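(* Let $Q$ be a quiver with a stability function $Z$ and let $l\subset\mathbb H_+$ be a ray such that $\langle\beta,\beta'\rangle=0$ whenever $\beta,\beta'\in\Gamma_+(Q)\setminus\{0\}$ satisfy $Z(\beta),Z(\beta')\in l$ and $f_Z(\beta),f_Z(\beta')\ne0$. Let $\alpha\in\Gamma_+(Q)\setminus\{0\}$ with $Z(\alpha)\in l$, and let $Z^{\mathrm{def}}$ be a deformation of $Z$ for the quiver $Q(\alpha)$, in the sense given in the context. Then the abelian quiver invariant $g_Z(\alpha)$ equals the virtual motive of the moduli space of $Z^{\mathrm{def}}$-stable abelian representations of $Q(\alpha)$: $$g_Z(\alpha)=[M_{Z^{\mathrm{def}}}(Q(\alpha))]_{\mathrm{vir}} .$$
   Context: $\mathbb N=\{0,1,2,\dots\}$. $K_0(\mathrm{Var}_{\mathbb C})$ is the Grothendieck ring of complex varieties, $\mathbb L=[\mathbb A^1]$ is also denoted $q$, and $\mathcal V=K_0(\mathrm{Var}_{\mathbb C})\otimes_{\mathbb Z[\mathbb L]}\mathbb Q(\mathbb L^{1/2})$. For a smooth connected variety $X$, $[X]_{\mathrm{vir}}=q^{-\frac12\dim X}[X]\in\mathcal V$ (and $[\emptyset]_{\mathrm{vir}}=0$). $Q$ has vertex set $Q_0$ (possibly infinite) and arrow set $Q_1$, with finitely many arrows between any two vertices. $\Gamma(Q)$ is the group of finitely supported maps $Q_0\to\mathbb Z$, $\Gamma_+(Q)$ the submonoid of maps to $\mathbb N$; $i\in Q_0$ also denotes the corresponding basis vector. $|\alpha|=\sum_i\alpha_i$,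 $\alpha!=\prod_i\alpha_i!$. Put $r(\alpha,\beta)=\sum_{(a:i\to j)\in Q_1}\alpha_i\beta_j$ and $\langle\alpha,\beta\rangle=r(\beta,\alpha)-r(\alpha,\beta)$. A stability function on a quiver $Q$ is a group homomorphism $Z:\Gamma(Q)\to\mathbb C$ with $Z(i)\in\mathbb H_+=\{re^{i\pi\varphi}:r>0,\,0<\varphi\le1\}$ for all $i\in Q_0$. Writing $Z=-d+\sqrt{-1}\,r_Z$ with real-valued $d,r_Z$, the slope is $\mu_Z(\alpha)=d(\alpha)/r_Z(\alpha)\in\mathbb R\cup\{\infty\}$ for nonzero $\alpha\in\Gamma_+(Q)$. A representation $M$ is $Z$-semistable (resp. $Z$-stable) if $\mu_Z(\underline{\dim}N)\le\mu_Z(\underline{\dim}M)$ (resp. $<$) for all proper nonzero subrepresentations $N$. Rays are sets $\mathbb R_{>0}v$, $v\in\mathbb H_+$. For $\alpha\in\Gamma_+(Q)$ the quiver $Q(\alpha)$ has vertices $i_k$ with $i\in Q_0$, $1\le k\le\alpha_i$, and the number of arrows from $i_k$ to $j_{k'}$ equals the number of arrows from $i$ to $j$ in $Q$. It carries the induced stability function $Z(i_k)=Z(i)$. Abelian representations of $Q(\alpha)$ are representations over $\mathbb C$ with dimension one at every vertex; they form the affine space $R(Q(\alpha))=\mathbb C^{Q(\alpha)_1}$, acted on by $G(Q(\alpha))=(\mathbb C^* )^{Q(\alpha)_0}$ by base change. For a stability function $Z'$ on $Q(\alpha)$, $R_{Z'}(Q(\alpha))$ is the locus of $Z'$-semistable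 points. Define $$f_Z(\alpha)=q^{\frac12(|\alpha|-r(\alpha,\alpha))}\frac{[R_Z(Q(\alpha))]}{(q-1)^{|\alpha|}}\in\mathcal V .$$ For a ray $l$ as in the claim, the abelian quiver invariants $g_Z(\alpha)$, $Z(\alpha)\in l$, are defined by $$1+\sum_{Z(\alpha)\in l}f_Z(\alpha)\frac{x^\alpha}{\alpha!}=\exp\Bigg(\frac{\sum_{Z(\alpha)\in l}g_Z(\alpha)\frac{x^\alpha}{\alpha!}}{q^{1/2}-q^{-1/2}}\Bigg)$$ in the ring of commutative formal power series in the $x_i$ (sums over nonzero $\alpha\in\Gamma_+(Q)$). Deformation: for a subset $I\subset Q(\alpha)_0$ write $\mu_{Z'}(I)=\mu_{Z'}(\sum_{v\in I}v)$. A deformation of $Z$ for $Q(\alpha)$ is a stability function $Z^{\mathrm{def}}$ on $Q(\alpha)$ such that: (1) $\mu_{Z^{\mathrm{def}}}(I)\ne\mu_{Z^{\mathrm{def}}}(J)$ for any non-empty subsets $I\ne J$ of $Q(\alpha)_0$; (2) $\mu_Z(I)<\mu_Z(J)$ implies $\mu_{Z^{\mathrm{def}}}(I)<\mu_{Z^{\mathrm{def}}}(J)$ for non-empty $I,J$; (3) an abelian representation is $Z^{\mathrm{def}}$-stable iff it is $Z^{\mathrm{def}}$-semistable; (4) $Z^{\mathrm{def}}$-stable abelian representations are $Z$-semistable; (5) $Z$-stable abelian representations are $Z^{\mathrm{def}}$-stable. The moduli space is the quotient $M_{Z^{\mathrm{def}}}(Q(\alpha))=R_{Z^{\mathrm{def}}}(Q(\alpha))/G(Q(\alpha))$,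 which is smooth, of dimension $|Q(\alpha)_1|-|Q(\alpha)_0|+1$ if non-empty. *)

theory Defs
  imports
    "HOL-Analysis.Analysis"
    "HOL-Library.Multiset"
    "HOL-Library.Poly_Mapping"
    "HOL-Computational_Algebra.Polynomial"
    "HOL-Computational_Algebra.Fraction_Field"
    "Graph_Theory.Digraph"
begin

section \<open>Complex varieties\<close>

text \<open>
  Varieties are treated in the classical language of spaces with functions (Serre, Milne,
  Springer): a topological space together with, for every open \<open>U\<close>, a set of regular functions
  \<open>U \<rightarrow> \<complex>\<close>. Over \<open>\<complex>\<close> this is equivalent to reduced separated schemes of finite type.
\<close>

record 'p fspace =
  zar :: "'p topology"
  regular :: "'p set \<Rightarrow> ('p \<Rightarrow> complex) \<Rightarrow> bool"

abbreviation points :: "('p, 'm) fspace_scheme \<Rightarrow> 'p set" where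
  "points X \<equiv> topspace (zar X)"

text \<open>The second condition says that regularity on \<open>U\<close> only depends on the values on \<open>U\<close>; the last
  two make the regular functions a sheaf.\<close>

definition space_with_functions :: "'p fspace \<Rightarrow> bool" where
  "space_with_functions X \<longleftrightarrow>
     (\<forall>U f. regular X U f \<longrightarrow> openin (zar X) U) \<and>
     (\<forall>U f g. regular X U f \<longrightarrow> (\<forall>x\<in>U. f x = g x) \<longrightarrow> regular X U g) \<and>
     (\<forall>U V f. regular X U f \<longrightarrow> openin (zar X) V \<longrightarrow> V \<subseteq> U \<longrightarrow> regular X V f) \<and>
     (\<forall>\<U> f. (\<forall>U\<in>\<U>. regular X U f) \<longrightarrow> regular X (\<Union>\<U>) f)"

definition morphism :: "'p fspace \<Rightarrow> 'r fspace \<Rightarrow> ('p \<Rightarrow> 'r) \<Rightarrow> bool" where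
  "morphism X Y \<phi> \<longleftrightarrow> continuous_map (zar X) (zar Y) \<phi> \<and>
     (\<forall>V f. regular Y V f \<longrightarrow> regular X {x \<in> points X. \<phi> x \<in> V} (\<lambda>x. f (\<phi> x)))"

definition isomorphic :: "'p fspace \<Rightarrow> 'r fspace \<Rightarrow> bool" where
  "isomorphic X Y \<longleftrightarrow> (\<exists>\<phi> \<psi>. morphism X Y \<phi> \<and> morphism Y X \<psi> \<and>
     (\<forall>x\<in>points X. \<psi> (\<phi> x) = x) \<and> (\<forall>y\<in>points Y. \<phi> (\<psi> y) = y))"

text \<open>Induced structure on a subset: regular functions are those that locally extend to regular
  functions on the ambient space. For an open subset this is the open subspace, for a closed one
  the reduced closed subvariety.\<close>

definition subspace_on :: "'p fspace \<Rightarrow> 'p set \<Rightarrow> 'p fspace" where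
  "subspace_on X S =
     \<lparr> zar = subtopology (zar X) S,
       regular = (\<lambda>V f. openin (subtopology (zar X) S) V \<and>
         (\<forall>x\<in>V. \<exists>U g. x \<in> U \<and> regular X U g \<and> U \<inter> S \<subseteq> V \<and> (\<forall>y\<in>U \<inter> S. f y = g y))) \<rparr>"

definition quotient_fspace :: "'p fspace \<Rightarrow> ('p \<Rightarrow> 'r) \<Rightarrow> 'r fspace" where
  "quotient_fspace X \<pi> =
     \<lparr> zar = topology (\<lambda>U. U \<subseteq> \<pi> ` points X \<and> openin (zar X) {x \<in> points X. \<pi> x \<in> U}),
       regular = (\<lambda>U f. U \<subseteq> \<pi> ` points X \<and> regular X {x \<in> points X. \<pi> x \<in> U} (\<lambda>x. f (\<pi> x))) \<rparr>"

lemma openin_quotient_fspace: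
  "openin (zar (quotient_fspace X \<pi>)) U \<longleftrightarrow>
     U \<subseteq> \<pi> ` points X \<and> openin (zar X) {x \<in> points X. \<pi> x \<in> U}"
proof -
  have "istopology (\<lambda>U. U \<subseteq> \<pi> ` points X \<and> openin (zar X) {x \<in> points X. \<pi> x \<in> U})"
    unfolding istopology_def
  proof (intro conjI allI impI)
    fix S T
    assume S: "S \<subseteq> \<pi> ` points X \<and> openin (zar X) {x \<in> points X. \<pi> x \<in> S}"
      and T: "T \<subseteq> \<pi> ` points X \<and> openin (zar X) {x \<in> points X. \<pi> x \<in> T}"
    show "S \<inter> T \<subseteq> \<pi> ` points X" using S by blast
    have "{x \<in> points X. \<pi> x \<in> S \<inter> T} = {x \<in> points X. \<pi> x \<in> S} \<inter> {x \<in> points X. \<pi> x \<in> T}"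
      by blast
    then show "openin (zar X) {x \<in> points X. \<pi> x \<in> S \<inter> T}" using S T by auto
  next
    fix \<K>
    assume K: "\<forall>K\<in>\<K>. K \<subseteq> \<pi> ` points X \<and> openin (zar X) {x \<in> points X. \<pi> x \<in> K}"
    show "\<Union>\<K> \<subseteq> \<pi> ` points X" using K by blast
    have "{x \<in> points X. \<pi> x \<in> \<Union>\<K>} = (\<Union>K\<in>\<K>. {x \<in> points X. \<pi> x \<in> K})" by blast
    then show "openin (zar X) {x \<in> points X. \<pi> x \<in> \<Union>\<K>}" using K by auto
  qed
  then show ?thesis by (simp add: quotient_fspace_def topology_inverse')
qed

text \<open>Affine space \<open>\<complex>\<^sup>I\<close> for a finite index set \<open>I\<close>, with its Zariski topology and locally rational
  functions.\<close>

abbreviation cspace :: "'i set \<Rightarrow> ('i \<Rightarrow> complex) set" where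
  "cspace I \<equiv> (\<Pi>\<^sub>E i\<in>I. UNIV)"

inductive_set poly_fun :: "'i set \<Rightarrow> (('i \<Rightarrow> complex) \<Rightarrow> complex) set" for I :: "'i set" where
  pf_const: "(\<lambda>x. c) \<in> poly_fun I"
| pf_coord: "i \<in> I \<Longrightarrow> (\<lambda>x. x i) \<in> poly_fun I"
| pf_add: "f \<in> poly_fun I \<Longrightarrow> g \<in> poly_fun I \<Longrightarrow> (\<lambda>x. f x + g x) \<in> poly_fun I"
| pf_mult: "f \<in> poly_fun I \<Longrightarrow> g \<in> poly_fun I \<Longrightarrow> (\<lambda>x. f x * g x) \<in> poly_fun I"

definition zero_locus :: "'i set \<Rightarrow> (('i \<Rightarrow> complex) \<Rightarrow> complex) set \<Rightarrow> ('i \<Rightarrow> complex) set" where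
  "zero_locus I F = {x \<in> cspace I. \<forall>f\<in>F. f x = 0}"

definition zariski :: "'i set \<Rightarrow> ('i \<Rightarrow> complex) topology" where
  "zariski I = topology (\<lambda>U. \<exists>F\<subseteq>poly_fun I. U = cspace I - zero_locus I F)"

lemma openin_zariski:
  "openin (zariski I) U \<longleftrightarrow> (\<exists>F\<subseteq>poly_fun I. U = cspace I - zero_locus I F)"
proof -
  have "istopology (\<lambda>U. \<exists>F\<subseteq>poly_fun I. U = cspace I - zero_locus I F)"
    unfolding istopology_def
  proof (intro conjI allI impI)
    fix S T
    assume "\<exists>F\<subseteq>poly_fun I. S = cspace I - zero_locus I F"
      and "\<exists>F\<subseteq>poly_fun I. T = cspace I - zero_locus I F"
    then obtain F G where F: "F \<subseteq> poly_fun I" "S = cspace I - zero_locus I F"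
      and G: "G \<subseteq> poly_fun I" "T = cspace I - zero_locus I G" by blast
    let ?H = "{(\<lambda>x. f x * g x) | f g. f \<in> F \<and> g \<in> G}"
    have "?H \<subseteq> poly_fun I" using F(1) G(1) by (auto intro!: pf_mult)
    moreover have "S \<inter> T = cspace I - zero_locus I ?H"
    proof (intro set_eqI iffI)
      fix x assume "x \<in> S \<inter> T"
      then obtain f g where fg: "x \<in> cspace I" "f \<in> F" "f x \<noteq> 0" "g \<in> G" "g x \<noteq> 0"
        unfolding F G zero_locus_def by blast
      have "(\<lambda>x. f x * g x) \<in> ?H" "f x * g x \<noteq> 0" using fg by auto
      then show "x \<in> cspace I - zero_locus I ?H" using fg(1) unfolding zero_locus_def by fastforce
    next
      fix x assume "x \<in> cspace I - zero_locus I ?H"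
      then obtain f g where "x \<in> cspace I" "f \<in> F" "g \<in> G" "f x * g x \<noteq> 0"
        unfolding zero_locus_def by auto
      then show "x \<in> S \<inter> T" unfolding F G zero_locus_def by auto
    qed
    ultimately show "\<exists>F\<subseteq>poly_fun I. S \<inter> T = cspace I - zero_locus I F" by blast
  next
    fix \<K> assume K: "\<forall>K\<in>\<K>. \<exists>F\<subseteq>poly_fun I. K = cspace I - zero_locus I F"
    then obtain F where F: "\<And>K. K \<in> \<K> \<Longrightarrow> F K \<subseteq> poly_fun I \<and> K = cspace I - zero_locus I (F K)"
      by metis
    have "\<Union>\<K> = cspace I - zero_locus I (\<Union>K\<in>\<K>. F K)"
    proof (intro set_eqI iffI)
      fix x assume "x \<in> \<Union>\<K>"
      then obtain K where "K \<in> \<K>" "x \<in> K" by blast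
      moreover from this have "x \<in> cspace I" "x \<notin> zero_locus I (F K)" using F[of K] by auto
      ultimately show "x \<in> cspace I - zero_locus I (\<Union>K\<in>\<K>. F K)"
        unfolding zero_locus_def by blast
    next
      fix x assume "x \<in> cspace I - zero_locus I (\<Union>K\<in>\<K>. F K)"
      then obtain K f where "x \<in> cspace I" "K \<in> \<K>" "f \<in> F K" "f x \<noteq> 0"
        unfolding zero_locus_def by blast
      then have "x \<in> cspace I - zero_locus I (F K)" unfolding zero_locus_def by blast
      then show "x \<in> \<Union>\<K>" using F[of K] \<open>K \<in> \<K>\<close> by blast
    qed
    moreover have "(\<Union>K\<in>\<K>. F K) \<subseteq> poly_fun I" using F by blast
    ultimately show "\<exists>F\<subseteq>poly_fun I. \<Union>\<K> = cspace I - zero_locus I F" by blast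
  qed
  then show ?thesis by (simp add: zariski_def topology_inverse')
qed

definition affine_space :: "'i set \<Rightarrow> ('i \<Rightarrow> complex) fspace" where
  "affine_space I =
     \<lparr> zar = zariski I,
       regular = (\<lambda>U f. openin (zariski I) U \<and>
         (\<forall>x\<in>U. \<exists>V p r. x \<in> V \<and> V \<subseteq> U \<and> openin (zariski I) V \<and> p \<in> poly_fun I \<and> r \<in> poly_fun I \<and>
            (\<forall>y\<in>V. r y \<noteq> 0 \<and> f y = p y / r y))) \<rparr>"

definition affine_variety :: "'p fspace \<Rightarrow> bool" where
  "affine_variety X \<longleftrightarrow> (\<exists>(n::nat) S. closedin (zariski {..<n}) S \<and>
     isomorphic X (subspace_on (affine_space {..<n}) S))"

definition separated :: "'p fspace \<Rightarrow> bool" where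
  "separated X \<longleftrightarrow> (\<forall>(n::nat) S \<phi> \<psi>.
     closedin (zariski {..<n}) S \<longrightarrow>
     morphism (subspace_on (affine_space {..<n}) S) X \<phi> \<longrightarrow>
     morphism (subspace_on (affine_space {..<n}) S) X \<psi> \<longrightarrow>
     closedin (zariski {..<n}) {z \<in> S. \<phi> z = \<psi> z})"

definition variety :: "'p fspace \<Rightarrow> bool" where
  "variety X \<longleftrightarrow> space_with_functions X \<and>
     (\<exists>\<U>. finite \<U> \<and> \<Union>\<U> = points X \<and>
        (\<forall>U\<in>\<U>. openin (zar X) U \<and> affine_variety (subspace_on X U))) \<and>
     separated X"

text \<open>Krull dimension. It is only used for nonempty varieties, where the lengths of chains of
  irreducible closed subsets are bounded.\<close>

definition irreducible_closed :: "'p fspace \<Rightarrow> 'p set \<Rightarrow> bool" where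
  "irreducible_closed X C \<longleftrightarrow> closedin (zar X) C \<and> C \<noteq> {} \<and>
     (\<forall>A B. closedin (zar X) A \<longrightarrow> closedin (zar X) B \<longrightarrow> C \<subseteq> A \<union> B \<longrightarrow> C \<subseteq> A \<or> C \<subseteq> B)"

definition variety_dim :: "'p fspace \<Rightarrow> nat" where
  "variety_dim X = Sup {n. \<exists>C. (\<forall>i\<le>n. irreducible_closed X (C i)) \<and> (\<forall>i<n. C i \<subset> C (Suc i))}"

definition is_product ::
  "'p fspace \<Rightarrow> 'p fspace \<Rightarrow> 'p fspace \<Rightarrow> bool" where
  "is_product X Y P \<longleftrightarrow> (\<exists>p\<^sub>1 p\<^sub>2. morphism P X p\<^sub>1 \<and> morphism P Y p\<^sub>2 \<and>
     (\<forall>(T :: 'p fspace) f g. variety T \<longrightarrow> morphism T X f \<longrightarrow> morphism T Y g \<longrightarrow>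
        (\<exists>h. morphism T P h \<and> (\<forall>t\<in>points T. p\<^sub>1 (h t) = f t \<and> p\<^sub>2 (h t) = g t) \<and>
           (\<forall>h'. morphism T P h' \<longrightarrow> (\<forall>t\<in>points T. p\<^sub>1 (h' t) = f t \<and> p\<^sub>2 (h' t) = g t) \<longrightarrow>
              (\<forall>t\<in>points T. h' t = h t)))))"

section \<open>The Grothendieck ring of varieties\<close>

text \<open>Every complex variety has at most continuum many points, hence is isomorphic to one whose
  points lie in the type \<^typ>\<open>nat \<Rightarrow> complex\<close>; the following type thus represents all
  isomorphism classes.\<close>

typedef cvariety = "{X :: (nat \<Rightarrow> complex) fspace. variety X}"
proof
  let ?X = "\<lparr>zar = discrete_topology {}, regular = (\<lambda>U f. U = {})\<rparr> :: (nat \<Rightarrow> complex) fspace"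
  have "space_with_functions ?X" unfolding space_with_functions_def by auto
  moreover have "separated ?X"
    unfolding separated_def
  proof (intro allI impI)
    fix n :: nat and S \<phi> \<psi>
    assume S: "closedin (zariski {..<n}) S"
      and m: "morphism (subspace_on (affine_space {..<n}) S) ?X \<phi>"
    have "points (subspace_on (affine_space {..<n}) S) = S"
      using closedin_subset[OF S] by (auto simp: subspace_on_def affine_space_def)
    then have "S = {}"
      using m unfolding morphism_def continuous_map_def by auto
    then show "closedin (zariski {..<n}) {z \<in> S. \<phi> z = \<psi> z}" by simp
  qed
  ultimately have "variety ?X" unfolding variety_def by (auto intro!: exI[of _ "{}"])
  then show "?X \<in> {X. variety X}" by simp
qed

text \<open>\<open>module.span (*)\<close> is the ideal generated by a set.\<close>

lemma module_mult: "module ((*) :: 'a \<Rightarrow> 'a \<Rightarrow> 'a::comm_ring_1)"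
  by (simp add: module.intro algebra_simps)

abbreviation ideal_generated :: "'a::comm_ring_1 set \<Rightarrow> 'a set" where
  "ideal_generated S \<equiv> module.span (*) S"

lemmas ideal_zero = module.span_zero[OF module_mult]
  and ideal_add = module.span_add[OF module_mult]
  and ideal_diff = module.span_diff[OF module_mult]
  and ideal_neg = module.span_neg[OF module_mult]
  and ideal_scale = module.span_scale[OF module_mult]
  and ideal_base = module.span_base[OF module_mult]

lemma ideal_cong_equivp: "equivp (\<lambda>x y. x - y \<in> ideal_generated S)"
proof (rule equivpI)
  show "reflp (\<lambda>x y. x - y \<in> ideal_generated S)" by (auto intro!: reflpI ideal_zero)
  show "symp (\<lambda>x y. x - y \<in> ideal_generated S)"
    by (rule sympI) (metis ideal_neg minus_diff_eq)
  show "transp (\<lambda>x y. x - y \<in> ideal_generated S)"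
    by (rule transpI) (metis ideal_add diff_add_cancel add_diff_eq)
qed

lemma ideal_cong_refl: "x = y \<Longrightarrow> x - y \<in> ideal_generated S"
  by (simp add: ideal_zero)

lemma ideal_cong_mult:
  assumes "a - b \<in> ideal_generated S" "c - d \<in> ideal_generated S"
  shows "a * c - b * d \<in> ideal_generated S"
proof -
  have "a * c - b * d = c * (a - b) + b * (c - d)" by (simp add: algebra_simps)
  then show ?thesis using assms by (simp add: ideal_add ideal_scale)
qed

lemma ideal_cong_add:
  assumes "a - b \<in> ideal_generated S" "c - d \<in> ideal_generated S"
  shows "(a + c) - (b + d) \<in> ideal_generated S"
  using ideal_add[OF assms] by (simp add: algebra_simps)

lemma ideal_cong_diff:
  assumes "a - b \<in> ideal_generated S" "c - d \<in> ideal_generated S"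
  shows "(a - c) - (b - d) \<in> ideal_generated S"
  using ideal_diff[OF assms] by (simp add: algebra_simps)

lemma ideal_cong_uminus:
  assumes "a - b \<in> ideal_generated S"
  shows "(- a) - (- b) \<in> ideal_generated S"
  using ideal_neg[OF assms] by (simp add: algebra_simps)

text \<open>The ring is presented as the free commutative ring on all varieties (the monoid ring of the
  free commutative monoid of multisets) modulo \<open>[X] = [Y]\<close> for \<open>X \<cong> Y\<close>, the scissor relations
  \<open>[X] = [C] + [X - C]\<close> for closed \<open>C\<close>, \<open>[X][Y] = [X \<times> Y]\<close> and \<open>[pt] = 1\<close>. Because of the last
  two, this is the free abelian group on isomorphism classes modulo the scissor relations, with
  multiplication induced by products.\<close>

definition free_var :: "cvariety \<Rightarrow> (cvariety multiset \<Rightarrow>\<^sub>0 int)" where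
  "free_var X = Poly_Mapping.single {#X#} 1"

definition K0_relations :: "(cvariety multiset \<Rightarrow>\<^sub>0 int) set" where
  "K0_relations =
     {free_var X - free_var Y | X Y. isomorphic (Rep_cvariety X) (Rep_cvariety Y)} \<union>
     {free_var X - (free_var Y + free_var W) | X Y W.
        \<exists>C. closedin (zar (Rep_cvariety X)) C \<and>
            Rep_cvariety Y = subspace_on (Rep_cvariety X) C \<and>
            Rep_cvariety W = subspace_on (Rep_cvariety X) (points (Rep_cvariety X) - C)} \<union>
     {free_var P - free_var X * free_var Y | P X Y.
        is_product (Rep_cvariety X) (Rep_cvariety Y) (Rep_cvariety P)} \<union>
     {free_var P - 1 | P. isomorphic (Rep_cvariety P) (affine_space ({} :: nat set))}"

quotient_type K0_Var = "cvariety multiset \<Rightarrow>\<^sub>0 int" /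
  "\<lambda>x y. x - y \<in> ideal_generated K0_relations"
  by (rule ideal_cong_equivp)

text \<open>The class \<^class>\<open>comm_ring_1\<close> includes \<open>0 \<noteq> 1\<close>, whose proof here would need a nontrivial
  motivic measure. Commutative rings with unit are therefore expressed by the pair of classes
  \<^class>\<open>comm_ring\<close>, \<^class>\<open>comm_monoid_mult\<close>.\<close>

instantiation K0_Var :: "{comm_ring, comm_monoid_mult}"
begin

lift_definition zero_K0_Var :: K0_Var is 0 .
lift_definition one_K0_Var :: K0_Var is 1 .
lift_definition plus_K0_Var :: "K0_Var \<Rightarrow> K0_Var \<Rightarrow> K0_Var" is "(+)" by (rule ideal_cong_add)
lift_definition minus_K0_Var :: "K0_Var \<Rightarrow> K0_Var \<Rightarrow> K0_Var" is "(-)" by (rule ideal_cong_diff)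
lift_definition uminus_K0_Var :: "K0_Var \<Rightarrow> K0_Var" is uminus by (rule ideal_cong_uminus)
lift_definition times_K0_Var :: "K0_Var \<Rightarrow> K0_Var \<Rightarrow> K0_Var" is "(*)" by (rule ideal_cong_mult)

instance
  by standard (transfer, rule ideal_cong_refl, simp add: algebra_simps)+

end

lift_definition K0_class :: "cvariety \<Rightarrow> K0_Var" is free_var .

definition motivic_class :: "'p fspace \<Rightarrow> K0_Var" where
  "motivic_class X = K0_class (SOME Y. isomorphic X (Rep_cvariety Y))"

definition Lefschetz :: K0_Var where
  "Lefschetz = motivic_class (affine_space {0::nat})"

section \<open>The coefficient ring\<close>

text \<open>\<^typ>\<open>rat poly fract\<close> plays the role of \<open>\<rat>(L\<^sup>1\<^sup>/\<^sup>2)\<close>, with variable \<open>L\<^sup>1\<^sup>/\<^sup>2 = q\<^sup>1\<^sup>/\<^sup>2\<close>.\<close>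

definition q_half :: "rat poly fract" where
  "q_half = Fract [:0, 1:] 1"

abbreviation q_var :: "rat poly fract" where
  "q_var \<equiv> q_half ^ 2"

text \<open>The ring structure on \<open>K \<otimes> F\<close> comes from that of the monoid ring over \<open>\<int>\<close> of the
  multiplicative monoid \<open>K \<times> F\<close> of pure tensors. Monoid rings in \<^theory>\<open>HOL-Library.Poly_Mapping\<close>
  use additive monoids, so \<open>+\<close> on pairs is the componentwise product.\<close>

datatype tensor_pair = Pure_Tensor K0_Var "rat poly fract"

instantiation tensor_pair :: comm_monoid_add
begin

definition "zero_tensor_pair = Pure_Tensor 1 1"

fun plus_tensor_pair :: "tensor_pair \<Rightarrow> tensor_pair \<Rightarrow> tensor_pair" where
  "plus_tensor_pair (Pure_Tensor k c) (Pure_Tensor k' c') = Pure_Tensor (k * k') (c * c')"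

instance
proof
  fix a b c :: tensor_pair
  show "a + b + c = a + (b + c)" by (cases a; cases b; cases c) (simp add: mult.assoc)
  show "a + b = b + a" by (cases a; cases b) (simp add: mult.commute)
  show "0 + a = a" by (cases a) (simp add: zero_tensor_pair_def)
qed

end

definition pure_tensor :: "K0_Var \<Rightarrow> rat poly fract \<Rightarrow> (tensor_pair \<Rightarrow>\<^sub>0 int)" where
  "pure_tensor k c = Poly_Mapping.single (Pure_Tensor k c) 1"

text \<open>Balancedness over \<open>\<int>[L]\<close> follows from biadditivity and balancedness for \<open>L\<close>. The relations
  are stable under multiplication by pure tensors, so the ideal they generate is the subgroup
  they generate.\<close>

definition tensor_relations :: "(tensor_pair \<Rightarrow>\<^sub>0 int) set" where
  "tensor_relations =
     {pure_tensor (k + k') c - (pure_tensor k c + pure_tensor k' c) | k k' c. True} \<union>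
     {pure_tensor k (c + c') - (pure_tensor k c + pure_tensor k c') | k c c'. True} \<union>
     {pure_tensor (Lefschetz * k) c - pure_tensor k (q_var * c) | k c. True}"

quotient_type motivic_ring = "tensor_pair \<Rightarrow>\<^sub>0 int" /
  "\<lambda>x y. x - y \<in> ideal_generated tensor_relations"
  by (rule ideal_cong_equivp)

instantiation motivic_ring :: "{comm_ring, comm_monoid_mult}"
begin

lift_definition zero_motivic_ring :: motivic_ring is 0 .
lift_definition one_motivic_ring :: motivic_ring is 1 .
lift_definition plus_motivic_ring :: "motivic_ring \<Rightarrow> motivic_ring \<Rightarrow> motivic_ring" is "(+)"
  by (rule ideal_cong_add)
lift_definition minus_motivic_ring :: "motivic_ring \<Rightarrow> motivic_ring \<Rightarrow> motivic_ring" is "(-)"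
  by (rule ideal_cong_diff)
lift_definition uminus_motivic_ring :: "motivic_ring \<Rightarrow> motivic_ring" is uminus
  by (rule ideal_cong_uminus)
lift_definition times_motivic_ring :: "motivic_ring \<Rightarrow> motivic_ring \<Rightarrow> motivic_ring" is "(*)"
  by (rule ideal_cong_mult)

instance
  by standard (transfer, rule ideal_cong_refl, simp add: algebra_simps)+

end

lift_definition tensor :: "K0_Var \<Rightarrow> rat poly fract \<Rightarrow> motivic_ring" (infixl "\<otimes>\<^sub>V" 70)
  is pure_tensor .

abbreviation scalar :: "rat poly fract \<Rightarrow> motivic_ring" where
  "scalar c \<equiv> 1 \<otimes>\<^sub>V c"

lemma tensor_add_right: "k \<otimes>\<^sub>V (c + c') = k \<otimes>\<^sub>V c + k \<otimes>\<^sub>V c'"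
  by transfer (rule ideal_base, unfold tensor_relations_def, blast)

lemma tensor_add_left: "(k + k') \<otimes>\<^sub>V c = k \<otimes>\<^sub>V c + k' \<otimes>\<^sub>V c"
  by transfer (rule ideal_base, unfold tensor_relations_def, blast)

lemma tensor_Lefschetz: "(Lefschetz * k) \<otimes>\<^sub>V c = k \<otimes>\<^sub>V (q_var * c)"
  by transfer (rule ideal_base, unfold tensor_relations_def, blast)

lemma tensor_mult: "(k \<otimes>\<^sub>V c) * (k' \<otimes>\<^sub>V c') = (k * k') \<otimes>\<^sub>V (c * c')"
  by transfer (rule ideal_cong_refl, simp add: pure_tensor_def mult_single)

lemma tensor_one: "1 \<otimes>\<^sub>V 1 = 1"
  by transfer (rule ideal_cong_refl, simp add: pure_tensor_def flip: zero_tensor_pair_def)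

text \<open>\<open>[X]\<^sub>v\<^sub>i\<^sub>r\<close> is meant for \<open>X\<close> empty or a smooth connected variety.\<close>

definition virtual_motive :: "'p fspace \<Rightarrow> motivic_ring" where
  "virtual_motive X =
     (if points X = {} then 0
      else motivic_class X \<otimes>\<^sub>V (q_half powi (- int (variety_dim X))))"

section \<open>Quivers and stability\<close>

text \<open>A quiver is a directed multigraph; an arrow \<open>a : i \<rightarrow> j\<close> has \<open>tail Q a = i\<close>, \<open>head Q a = j\<close>.\<close>

definition quiver :: "('v, 'a) pre_digraph \<Rightarrow> bool" where
  "quiver Q \<longleftrightarrow> wf_digraph Q \<and> (\<forall>i j. finite {a \<in> arcs Q. tail Q a = i \<and> head Q a = j})"

definition Gamma_group :: "('v, 'a) pre_digraph \<Rightarrow> ('v \<Rightarrow>\<^sub>0 int) set" where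
  "Gamma_group Q = {\<gamma>. Poly_Mapping.keys \<gamma> \<subseteq> verts Q}"

definition Gamma_plus :: "('v, 'a) pre_digraph \<Rightarrow> ('v \<Rightarrow>\<^sub>0 nat) set" where
  "Gamma_plus Q = {\<alpha>. Poly_Mapping.keys \<alpha> \<subseteq> verts Q}"

abbreviation int_vec :: "('v \<Rightarrow>\<^sub>0 nat) \<Rightarrow> ('v \<Rightarrow>\<^sub>0 int)" where
  "int_vec \<equiv> Poly_Mapping.map int"

definition size_vec :: "('v \<Rightarrow>\<^sub>0 nat) \<Rightarrow> nat" where
  "size_vec \<alpha> = (\<Sum>i\<in>Poly_Mapping.keys \<alpha>. Poly_Mapping.lookup \<alpha> i)"

definition fact_vec :: "('v \<Rightarrow>\<^sub>0 nat) \<Rightarrow> nat" where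
  "fact_vec \<alpha> = (\<Prod>i\<in>Poly_Mapping.keys \<alpha>. fact (Poly_Mapping.lookup \<alpha> i))"

text \<open>Only the finitely many arrows between the supports contribute to \<open>r(\<alpha>,\<beta>)\<close>; the arrow set
  itself may be infinite.\<close>

definition r_form :: "('v, 'a) pre_digraph \<Rightarrow> ('v \<Rightarrow>\<^sub>0 nat) \<Rightarrow> ('v \<Rightarrow>\<^sub>0 nat) \<Rightarrow> nat" where
  "r_form Q \<alpha> \<beta> =
     (\<Sum>a | a \<in> arcs Q \<and> tail Q a \<in> Poly_Mapping.keys \<alpha> \<and> head Q a \<in> Poly_Mapping.keys \<beta>.
        Poly_Mapping.lookup \<alpha> (tail Q a) * Poly_Mapping.lookup \<beta> (head Q a))"

definition skew_form :: "('v, 'a) pre_digraph \<Rightarrow> ('v \<Rightarrow>\<^sub>0 nat) \<Rightarrow> ('v \<Rightarrow>\<^sub>0 nat) \<Rightarrow> int" where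
  "skew_form Q \<alpha> \<beta> = int (r_form Q \<beta> \<alpha>) - int (r_form Q \<alpha> \<beta>)"

definition half_plane :: "complex set" where
  "half_plane = {complex_of_real r * exp (\<i> * complex_of_real (pi * \<phi>)) | r \<phi>. 0 < r \<and> 0 < \<phi> \<and> \<phi> \<le> 1}"

definition ray :: "complex set \<Rightarrow> bool" where
  "ray l \<longleftrightarrow> (\<exists>v\<in>half_plane. l = {complex_of_real t * v | t. t > 0})"

definition stability_function :: "('v, 'a) pre_digraph \<Rightarrow> (('v \<Rightarrow>\<^sub>0 int) \<Rightarrow> complex) \<Rightarrow> bool" where
  "stability_function Q Z \<longleftrightarrow>
     (\<forall>\<gamma>\<in>Gamma_group Q. \<forall>\<delta>\<in>Gamma_group Q. Z (\<gamma> + \<delta>) = Z \<gamma> + Z \<delta>) \<and>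
     (\<forall>i\<in>verts Q. Z (Poly_Mapping.single i 1) \<in> half_plane)"

definition slope :: "(('v \<Rightarrow>\<^sub>0 int) \<Rightarrow> complex) \<Rightarrow> ('v \<Rightarrow>\<^sub>0 int) \<Rightarrow> ereal" where
  "slope Z \<gamma> = (if Im (Z \<gamma>) = 0 then \<infinity> else ereal (- Re (Z \<gamma>) / Im (Z \<gamma>)))"

definition indicator_vec :: "'v set \<Rightarrow> ('v \<Rightarrow>\<^sub>0 int)" where
  "indicator_vec I = (\<Sum>v\<in>I. Poly_Mapping.single v 1)"

text \<open>An abelian representation of a finite quiver is given by a scalar \<open>m a\<close> for each arrow,
  acting between copies of \<open>\<complex>\<close>. A subrepresentation is a family of complex subspaces
  \<open>N v \<subseteq> \<complex>\<close>.\<close>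

definition subrepresentation ::
  "('v, 'a) pre_digraph \<Rightarrow> ('a \<Rightarrow> complex) \<Rightarrow> ('v \<Rightarrow> complex set) \<Rightarrow> bool" where
  "subrepresentation Q m N \<longleftrightarrow>
     (\<forall>v\<in>verts Q. module.subspace (*) (N v)) \<and>
     (\<forall>a\<in>arcs Q. \<forall>z\<in>N (tail Q a). m a * z \<in> N (head Q a))"

definition proper_nonzero_subrep ::
  "('v, 'a) pre_digraph \<Rightarrow> ('a \<Rightarrow> complex) \<Rightarrow> ('v \<Rightarrow> complex set) \<Rightarrow> bool" where
  "proper_nonzero_subrep Q m N \<longleftrightarrow> subrepresentation Q m N \<and>
     (\<exists>v\<in>verts Q. N v \<noteq> UNIV) \<and> (\<exists>v\<in>verts Q. N v \<noteq> {0})"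

definition dim_vec :: "('v, 'a) pre_digraph \<Rightarrow> ('v \<Rightarrow> complex set) \<Rightarrow> ('v \<Rightarrow>\<^sub>0 int)" where
  "dim_vec Q N = (\<Sum>v\<in>verts Q. Poly_Mapping.single v (int (vector_space.dim (*) (N v))))"

definition semistable ::
  "('v, 'a) pre_digraph \<Rightarrow> (('v \<Rightarrow>\<^sub>0 int) \<Rightarrow> complex) \<Rightarrow> ('a \<Rightarrow> complex) \<Rightarrow> bool" where
  "semistable Q Z m \<longleftrightarrow> (\<forall>N. proper_nonzero_subrep Q m N \<longrightarrow>
     slope Z (dim_vec Q N) \<le> slope Z (dim_vec Q (\<lambda>_. UNIV)))"

definition stable ::
  "('v, 'a) pre_digraph \<Rightarrow> (('v \<Rightarrow>\<^sub>0 int) \<Rightarrow> complex) \<Rightarrow> ('a \<Rightarrow> complex) \<Rightarrow> bool" where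
  "stable Q Z m \<longleftrightarrow> (\<forall>N. proper_nonzero_subrep Q m N \<longrightarrow>
     slope Z (dim_vec Q N) < slope Z (dim_vec Q (\<lambda>_. UNIV)))"

definition semistable_locus ::
  "('v, 'a) pre_digraph \<Rightarrow> (('v \<Rightarrow>\<^sub>0 int) \<Rightarrow> complex) \<Rightarrow> ('a \<Rightarrow> complex) fspace" where
  "semistable_locus Q Z =
     subspace_on (affine_space (arcs Q)) {m \<in> cspace (arcs Q). semistable Q Z m}"

definition torus_orbit ::
  "('v, 'a) pre_digraph \<Rightarrow> ('a \<Rightarrow> complex) \<Rightarrow> ('a \<Rightarrow> complex) set" where
  "torus_orbit Q m =
     {(\<lambda>a\<in>arcs Q. g (head Q a) * m a * inverse (g (tail Q a))) | g. \<forall>v\<in>verts Q. g v \<noteq> 0}"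

text \<open>The geometric quotient \<open>R\<^sub>Z(Q)/G(Q)\<close>: its points are the orbits, with the quotient topology
  and invariant regular functions.\<close>

definition moduli_space ::
  "('v, 'a) pre_digraph \<Rightarrow> (('v \<Rightarrow>\<^sub>0 int) \<Rightarrow> complex) \<Rightarrow> ('a \<Rightarrow> complex) set fspace" where
  "moduli_space Q Z = quotient_fspace (semistable_locus Q Z) (torus_orbit Q)"

definition blowup_quiver ::
  "('v, 'a) pre_digraph \<Rightarrow> ('v \<Rightarrow>\<^sub>0 nat) \<Rightarrow> ('v \<times> nat, 'a \<times> nat \<times> nat) pre_digraph" where
  "blowup_quiver Q \<alpha> =
     \<lparr> verts = {(i, k). i \<in> verts Q \<and> 1 \<le> k \<and> k \<le> Poly_Mapping.lookup \<alpha> i},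
       arcs = {(a, k, k'). a \<in> arcs Q \<and> 1 \<le> k \<and> k \<le> Poly_Mapping.lookup \<alpha> (tail Q a) \<and>
                 1 \<le> k' \<and> k' \<le> Poly_Mapping.lookup \<alpha> (head Q a)},
       tail = (\<lambda>(a, k, k'). (tail Q a, k)),
       head = (\<lambda>(a, k, k'). (head Q a, k')) \<rparr>"

text \<open>The additive extension of \<open>Z(i\<^sub>k) = Z(i)\<close>.\<close>

definition induced_stability ::
  "(('v \<Rightarrow>\<^sub>0 int) \<Rightarrow> complex) \<Rightarrow> ('v \<times> nat \<Rightarrow>\<^sub>0 int) \<Rightarrow> complex" where
  "induced_stability Z \<gamma> =
     Z (\<Sum>w\<in>Poly_Mapping.keys \<gamma>. Poly_Mapping.single (fst w) (Poly_Mapping.lookup \<gamma> w))"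

definition deformation ::
  "('v, 'a) pre_digraph \<Rightarrow> (('v \<Rightarrow>\<^sub>0 int) \<Rightarrow> complex) \<Rightarrow> ('v \<Rightarrow>\<^sub>0 nat) \<Rightarrow>
   (('v \<times> nat \<Rightarrow>\<^sub>0 int) \<Rightarrow> complex) \<Rightarrow> bool" where
  "deformation Q Z \<alpha> Z' \<longleftrightarrow>
     (let Q' = blowup_quiver Q \<alpha>; Z0 = induced_stability Z in
       stability_function Q' Z' \<and>
       (\<forall>I J. I \<subseteq> verts Q' \<longrightarrow> J \<subseteq> verts Q' \<longrightarrow> I \<noteq> {} \<longrightarrow> J \<noteq> {} \<longrightarrow> I \<noteq> J \<longrightarrow>
          slope Z' (indicator_vec I) \<noteq> slope Z' (indicator_vec J)) \<and>
       (\<forall>I J. I \<subseteq> verts Q' \<longrightarrow> J \<subseteq> verts Q' \<longrightarrow> I \<noteq> {} \<longrightarrow> J \<noteq> {} \<longrightarrow>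
          slope Z0 (indicator_vec I) < slope Z0 (indicator_vec J) \<longrightarrow>
          slope Z' (indicator_vec I) < slope Z' (indicator_vec J)) \<and>
       (\<forall>m \<in> cspace (arcs Q'). stable Q' Z' m \<longleftrightarrow> semistable Q' Z' m) \<and>
       (\<forall>m \<in> cspace (arcs Q'). stable Q' Z' m \<longrightarrow> semistable Q' Z0 m) \<and>
       (\<forall>m \<in> cspace (arcs Q'). stable Q' Z0 m \<longrightarrow> stable Q' Z' m))"

definition f_inv ::
  "('v, 'a) pre_digraph \<Rightarrow> (('v \<Rightarrow>\<^sub>0 int) \<Rightarrow> complex) \<Rightarrow> ('v \<Rightarrow>\<^sub>0 nat) \<Rightarrow> motivic_ring" where
  "f_inv Q Z \<alpha> =
     motivic_class (semistable_locus (blowup_quiver Q \<alpha>) (induced_stability Z)) \<otimes>\<^sub>V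
       (q_half powi (int (size_vec \<alpha>) - int (r_form Q \<alpha> \<alpha>)) / (q_var - 1) ^ size_vec \<alpha>)"

section \<open>Formal power series and the abelian quiver invariants\<close>

text \<open>A formal power series \<open>\<Sum>\<^sub>\<alpha> F(\<alpha>) x\<^sup>\<alpha>\<close> is represented by its coefficient function.\<close>

type_synonym 'v series = "('v \<Rightarrow>\<^sub>0 nat) \<Rightarrow> motivic_ring"

definition series_one :: "'v series" where
  "series_one = (\<lambda>\<alpha>. if \<alpha> = 0 then 1 else 0)"

definition series_mult :: "'v series \<Rightarrow> 'v series \<Rightarrow> 'v series" where
  "series_mult F G = (\<lambda>\<alpha>. \<Sum>(\<beta>, \<gamma>) | \<beta> + \<gamma> = \<alpha>. F \<beta> * G \<gamma>)"

primrec series_power :: "'v series \<Rightarrow> nat \<Rightarrow> 'v series" where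
  "series_power F 0 = series_one"
| "series_power F (Suc k) = series_mult F (series_power F k)"

text \<open>\<open>exp F = \<Sum>\<^sub>k F\<^sup>k/k!\<close> for \<open>F\<close> without constant term: then \<open>F\<^sup>k\<close> has no \<open>x\<^sup>\<alpha>\<close> term for
  \<open>k > |\<alpha>|\<close>.\<close>

definition series_exp :: "'v series \<Rightarrow> 'v series" where
  "series_exp F = (\<lambda>\<alpha>. \<Sum>k\<le>size_vec \<alpha>. scalar (1 / fact k) * series_power F k \<alpha>)"

definition ray_support ::
  "('v, 'a) pre_digraph \<Rightarrow> (('v \<Rightarrow>\<^sub>0 int) \<Rightarrow> complex) \<Rightarrow> complex set \<Rightarrow> ('v \<Rightarrow>\<^sub>0 nat) set" where
  "ray_support Q Z l = {\<alpha> \<in> Gamma_plus Q. \<alpha> \<noteq> 0 \<and> Z (int_vec \<alpha>) \<in> l}"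

definition exp_series_on :: "('v \<Rightarrow>\<^sub>0 nat) set \<Rightarrow> 'v series \<Rightarrow> 'v series" where
  "exp_series_on S h = (\<lambda>\<alpha>. if \<alpha> \<in> S then scalar (1 / of_nat (fact_vec \<alpha>)) * h \<alpha> else 0)"

definition abelian_quiver_invariants ::
  "('v, 'a) pre_digraph \<Rightarrow> (('v \<Rightarrow>\<^sub>0 int) \<Rightarrow> complex) \<Rightarrow> complex set \<Rightarrow>
   (('v \<Rightarrow>\<^sub>0 nat) \<Rightarrow> motivic_ring) \<Rightarrow> bool" where
  "abelian_quiver_invariants Q Z l g \<longleftrightarrow>
     (\<lambda>\<alpha>. series_one \<alpha> + exp_series_on (ray_support Q Z l) (f_inv Q Z) \<alpha>) =
     series_exp (\<lambda>\<alpha>. scalar (1 / (q_half - 1 / q_half)) * exp_series_on (ray_support Q Z l) g \<alpha>)"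

text \<open>The invariants exist, and are unique on the given ray, because the exponential of a series
  without constant term can be inverted degree by degree.\<close>

lemma size_vec_superset:
  assumes "finite A" "Poly_Mapping.keys \<alpha> \<subseteq> A"
  shows "size_vec \<alpha> = (\<Sum>i\<in>A. Poly_Mapping.lookup \<alpha> i)"
  unfolding size_vec_def
  by (rule sum.mono_neutral_left) (use assms in \<open>auto simp: in_keys_iff\<close>)

lemma size_vec_add: "size_vec (\<alpha> + \<beta>) = size_vec \<alpha> + size_vec \<beta>"
proof -
  let ?A = "Poly_Mapping.keys \<alpha> \<union> Poly_Mapping.keys \<beta>"
  have "size_vec (\<alpha> + \<beta>) = (\<Sum>i\<in>?A. Poly_Mapping.lookup (\<alpha> + \<beta>) i)"
    by (rule size_vec_superset) (auto simp: in_keys_iff lookup_add)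
  also have "\<dots> = (\<Sum>i\<in>?A. Poly_Mapping.lookup \<alpha> i) + (\<Sum>i\<in>?A. Poly_Mapping.lookup \<beta> i)"
    by (simp add: lookup_add sum.distrib)
  also have "\<dots> = size_vec \<alpha> + size_vec \<beta>"
    using size_vec_superset[of ?A \<alpha>] size_vec_superset[of ?A \<beta>] by simp
  finally show ?thesis .
qed

lemma size_vec_eq_0_iff [simp]: "size_vec \<alpha> = 0 \<longleftrightarrow> \<alpha> = 0"
proof
  assume "size_vec \<alpha> = 0"
  then have "\<forall>i\<in>Poly_Mapping.keys \<alpha>. Poly_Mapping.lookup \<alpha> i = 0"
    unfolding size_vec_def by simp
  then have "Poly_Mapping.keys \<alpha> = {}" by (meson all_not_in_conv in_keys_iff)
  then show "\<alpha> = 0" by (simp only: keys_eq_empty)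
qed (simp add: size_vec_def)

lemma size_vec_0 [simp]: "size_vec 0 = 0" by simp

lemma finite_decompositions: "finite {(\<beta> :: 'v \<Rightarrow>\<^sub>0 nat, \<gamma>). \<beta> + \<gamma> = \<alpha>}"
proof -
  let ?B = "{\<beta> :: 'v \<Rightarrow>\<^sub>0 nat. \<exists>\<gamma>. \<beta> + \<gamma> = \<alpha>}"
  let ?N = "Max (Poly_Mapping.lookup \<alpha> ` Poly_Mapping.keys \<alpha>)"
  have sub: "Poly_Mapping.lookup ` ?B \<subseteq>
     {f. \<forall>x. (x \<in> Poly_Mapping.keys \<alpha> \<longrightarrow> f x \<in> {..?N}) \<and> (x \<notin> Poly_Mapping.keys \<alpha> \<longrightarrow> f x = 0)}"
  proof clarify
    fix \<beta> \<gamma> :: "'v \<Rightarrow>\<^sub>0 nat" and x assume a: "\<alpha> = \<beta> + \<gamma>"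
    have le: "Poly_Mapping.lookup \<beta> x \<le> Poly_Mapping.lookup (\<beta> + \<gamma>) x" by (simp add: lookup_add)
    have "Poly_Mapping.lookup (\<beta> + \<gamma>) x
       \<le> Max (Poly_Mapping.lookup (\<beta> + \<gamma>) ` Poly_Mapping.keys (\<beta> + \<gamma>))"
      if "x \<in> Poly_Mapping.keys (\<beta> + \<gamma>)"
      using that by (intro Max_ge) auto
    then have "Poly_Mapping.lookup \<beta> x
         \<le> Max (Poly_Mapping.lookup (\<beta> + \<gamma>) ` Poly_Mapping.keys (\<beta> + \<gamma>))"
      if "x \<in> Poly_Mapping.keys (\<beta> + \<gamma>)"
      using that le by (meson le_trans)
    moreover have "Poly_Mapping.lookup \<beta> x = 0" if "x \<notin> Poly_Mapping.keys (\<beta> + \<gamma>)"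
      using that le by (simp add: in_keys_iff)
    ultimately show "(x \<in> Poly_Mapping.keys (\<beta> + \<gamma>) \<longrightarrow> Poly_Mapping.lookup \<beta> x \<in>
        {..Max (Poly_Mapping.lookup (\<beta> + \<gamma>) ` Poly_Mapping.keys (\<beta> + \<gamma>))}) \<and>
      (x \<notin> Poly_Mapping.keys (\<beta> + \<gamma>) \<longrightarrow> Poly_Mapping.lookup \<beta> x = 0)"
      by simp
  qed
  have "finite (Poly_Mapping.lookup ` ?B)"
    by (rule finite_subset[OF sub], rule finite_set_of_finite_funs) auto
  then have fin: "finite ?B"
    by (rule finite_imageD) (auto intro!: inj_onI poly_mapping_eqI)
  have "{(\<beta> :: 'v \<Rightarrow>\<^sub>0 nat, \<gamma>). \<beta> + \<gamma> = \<alpha>} \<subseteq> (\<lambda>\<beta>. (\<beta>, \<alpha> - \<beta>)) ` ?B" by force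
  then show ?thesis using fin finite_surj by blast
qed

lemma series_mult_one:
  fixes F :: "'v series"
  shows "series_mult F series_one = F"
proof
  fix \<alpha>
  have "series_mult F series_one \<alpha> = (\<Sum>(\<beta>, \<gamma>)\<in>{(\<alpha>, 0 :: 'v \<Rightarrow>\<^sub>0 nat)}. F \<beta> * series_one \<gamma>)"
    unfolding series_mult_def
  proof (rule sum.mono_neutral_right[OF finite_decompositions])
    show "{(\<alpha>, 0)} \<subseteq> {(\<beta>, \<gamma>). \<beta> + \<gamma> = \<alpha>}" by simp
    show "\<forall>p\<in>{(\<beta>, \<gamma>). \<beta> + \<gamma> = \<alpha>} - {(\<alpha>, 0)}. (case p of (\<beta>, \<gamma>) \<Rightarrow> F \<beta> * series_one \<gamma>) = 0"
    proof
      fix p :: "('v \<Rightarrow>\<^sub>0 nat) \<times> ('v \<Rightarrow>\<^sub>0 nat)"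
      assume p: "p \<in> {(\<beta>, \<gamma>). \<beta> + \<gamma> = \<alpha>} - {(\<alpha>, 0)}"
      obtain \<beta> \<gamma> where [simp]: "p = (\<beta>, \<gamma>)" by (cases p)
      have "\<gamma> \<noteq> 0" using p by auto
      then show "(case p of (\<beta>, \<gamma>) \<Rightarrow> F \<beta> * series_one \<gamma>) = 0" by (simp add: series_one_def)
    qed
  qed
  then show "series_mult F series_one \<alpha> = F \<alpha>" by (simp add: series_one_def)
qed

lemma series_power_agree:
  assumes "\<And>\<beta>. size_vec \<beta> < n \<Longrightarrow> F \<beta> = G \<beta>" "size_vec \<alpha> < n"
  shows "series_power F k \<alpha> = series_power G k \<alpha>"
  using assms(2)
proof (induction k arbitrary: \<alpha>)
  case (Suc k)
  have "(case p of (\<beta>, \<gamma>) \<Rightarrow> F \<beta> * series_power F k \<gamma>) =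
        (case p of (\<beta>, \<gamma>) \<Rightarrow> G \<beta> * series_power G k \<gamma>)" if "p \<in> {(\<beta>, \<gamma>). \<beta> + \<gamma> = \<alpha>}" for p
    using that Suc assms(1) by (auto simp: size_vec_add)
  then show ?case unfolding series_power.simps series_mult_def by (rule sum.cong[OF refl])
qed simp

lemma series_power_Suc_0:
  assumes "F 0 = 0"
  shows "series_power F (Suc k) 0 = 0"
proof -
  have "(case p of (\<beta>, \<gamma>) \<Rightarrow> F \<beta> * series_power F k \<gamma>) = 0"
    if p: "p \<in> {(\<beta>, \<gamma>). \<beta> + \<gamma> = 0}" for p :: "('a \<Rightarrow>\<^sub>0 nat) \<times> ('a \<Rightarrow>\<^sub>0 nat)"
  proof -
    have "size_vec (fst p + snd p) = 0" using p by (auto simp: case_prod_beta)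
    then have "fst p = 0" by (simp add: size_vec_add)
    then show ?thesis using assms by (simp add: case_prod_beta)
  qed
  then show ?thesis unfolding series_power.simps series_mult_def by (rule sum.neutral[OF ballI])
qed

lemma series_power_agree_top:
  assumes "\<And>\<beta>. size_vec \<beta> < n \<Longrightarrow> F \<beta> = G \<beta>" "F 0 = 0" "G 0 = 0" "size_vec \<alpha> \<le> n"
  shows "series_power F (Suc (Suc k)) \<alpha> = series_power G (Suc (Suc k)) \<alpha>"
proof -
  have "(case p of (\<beta>, \<gamma>) \<Rightarrow> F \<beta> * series_power F (Suc k) \<gamma>) =
        (case p of (\<beta>, \<gamma>) \<Rightarrow> G \<beta> * series_power G (Suc k) \<gamma>)"
    if p: "p \<in> {(\<beta>, \<gamma>). \<beta> + \<gamma> = \<alpha>}" for p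
  proof -
    obtain \<beta> \<gamma> where [simp]: "p = (\<beta>, \<gamma>)" by (cases p)
    have sz: "size_vec \<beta> + size_vec \<gamma> = size_vec \<alpha>" using p by (auto simp: size_vec_add)
    consider "\<beta> = 0" | "\<gamma> = 0" | "size_vec \<beta> < n" "size_vec \<gamma> < n"
      using sz assms(4) size_vec_eq_0_iff[of \<beta>] size_vec_eq_0_iff[of \<gamma>] by linarith
    then show ?thesis
    proof cases
      case 1 then show ?thesis using assms by simp
    next
      case 2
      then show ?thesis
        using series_power_Suc_0[of F k] series_power_Suc_0[of G k] assms
        by (simp del: series_power.simps)
    next
      case 3
      then show ?thesis
        using series_power_agree[of n F G \<gamma> "Suc k"] assms(1)
        by (simp del: series_power.simps)
    qed
  qed
  then show ?thesis
    unfolding series_power.simps(2)[of _ "Suc k"] series_mult_def[of _ "series_power _ (Suc k)"]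
    by (rule sum.cong[OF refl])
qed

lemma series_power_support:
  assumes "\<And>\<beta>. \<beta> \<notin> S \<Longrightarrow> F \<beta> = 0" "\<And>\<beta> \<gamma>. \<beta> \<in> S \<Longrightarrow> \<gamma> \<in> S \<Longrightarrow> \<beta> + \<gamma> \<in> S"
    "\<alpha> \<notin> S" "\<alpha> \<noteq> 0"
  shows "series_power F k \<alpha> = 0"
  using assms(3,4)
proof (induction k arbitrary: \<alpha>)
  case 0
  then show ?case by (simp add: series_one_def)
next
  case (Suc k)
  have "(case p of (\<beta>, \<gamma>) \<Rightarrow> F \<beta> * series_power F k \<gamma>) = 0"
    if p: "p \<in> {(\<beta>, \<gamma>). \<beta> + \<gamma> = \<alpha>}" for p
  proof -
    obtain \<beta> \<gamma> where [simp]: "p = (\<beta>, \<gamma>)" by (cases p)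
    show ?thesis
    proof (cases "\<beta> \<in> S")
      case True
      then have "\<gamma> \<notin> S" "\<gamma> \<noteq> 0" using p Suc.prems assms(2) by auto
      then show ?thesis using Suc.IH by simp
    qed (simp add: assms(1))
  qed
  then show ?case unfolding series_power.simps series_mult_def by (rule sum.neutral[OF ballI])
qed

definition series_exp_tail :: "'v series \<Rightarrow> 'v series" where
  "series_exp_tail F = (\<lambda>\<alpha>. \<Sum>k\<in>{2..size_vec \<alpha>}. scalar (1 / fact k) * series_power F k \<alpha>)"

lemma series_exp_0: "series_exp F 0 = 1"
  by (simp add: series_exp_def size_vec_def series_one_def tensor_one)

lemma series_exp_split:
  assumes "\<alpha> \<noteq> 0"
  shows "series_exp F \<alpha> = F \<alpha> + series_exp_tail F \<alpha>"
proof -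
  obtain n where "size_vec \<alpha> = Suc n"
    using assms size_vec_eq_0_iff[of \<alpha>] by (cases "size_vec \<alpha>") auto
  then have "{..size_vec \<alpha>} = insert 0 (insert 1 {2..size_vec \<alpha>})" by auto
  then show ?thesis
    using assms
    by (simp add: series_exp_def series_exp_tail_def series_mult_one tensor_one)
      (simp add: series_one_def)
qed

lemma series_exp_tail_agree:
  assumes "\<And>\<beta>. size_vec \<beta> < size_vec \<alpha> \<Longrightarrow> F \<beta> = G \<beta>" "F 0 = 0" "G 0 = 0"
  shows "series_exp_tail F \<alpha> = series_exp_tail G \<alpha>"
  unfolding series_exp_tail_def
proof (rule sum.cong[OF refl])
  fix k assume "k \<in> {2..size_vec \<alpha>}"
  then have "2 \<le> k" by simp
  then obtain j where "k = 2 + j" using le_Suc_ex by blast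
  then have "k = Suc (Suc j)" by simp
  then show "scalar (1 / fact k) * series_power F k \<alpha> = scalar (1 / fact k) * series_power G k \<alpha>"
    using series_power_agree_top[of "size_vec \<alpha>" F G \<alpha> j] assms by (simp del: series_power.simps)
qed

lemma series_exp_inj:
  assumes "F 0 = 0" "G 0 = 0" "series_exp F = series_exp G"
  shows "F = G"
proof
  fix \<alpha> show "F \<alpha> = G \<alpha>"
  proof (induction "size_vec \<alpha>" arbitrary: \<alpha> rule: less_induct)
    case less
    show ?case
    proof (cases "\<alpha> = 0")
      case False
      have "series_exp_tail F \<alpha> = series_exp_tail G \<alpha>"
        by (rule series_exp_tail_agree) (use less assms in auto)
      then show ?thesis using series_exp_split[OF False, of F] series_exp_split[OF False, of G] assms(3)
        by simp
    qed (simp add: assms)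
  qed
qed

primrec series_log_approx :: "'v series \<Rightarrow> nat \<Rightarrow> 'v series" where
  "series_log_approx A 0 = (\<lambda>_. 0)"
| "series_log_approx A (Suc n) = (\<lambda>\<alpha>. if size_vec \<alpha> = Suc n
     then A \<alpha> - series_exp_tail (series_log_approx A n) \<alpha> else series_log_approx A n \<alpha>)"

lemma series_exp_surj:
  assumes A0: "A 0 = 1"
    and AS: "\<And>\<alpha>. \<alpha> \<notin> S \<Longrightarrow> \<alpha> \<noteq> 0 \<Longrightarrow> A \<alpha> = 0"
    and S: "\<And>\<beta> \<gamma>. \<beta> \<in> S \<Longrightarrow> \<gamma> \<in> S \<Longrightarrow> \<beta> + \<gamma> \<in> S" "0 \<notin> S"
  shows "\<exists>G. series_exp G = A \<and> (\<forall>\<alpha>. \<alpha> \<notin> S \<longrightarrow> G \<alpha> = 0)"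
proof -
  define G where "G = (\<lambda>\<alpha>. series_log_approx A (size_vec \<alpha>) \<alpha>)"
  have approx: "series_log_approx A n \<alpha> = G \<alpha>" if "size_vec \<alpha> \<le> n" for n \<alpha>
    using that
  proof (induction n)
    case (Suc n)
    then show ?case by (cases "size_vec \<alpha> = Suc n") (simp_all add: G_def)
  qed (simp add: G_def)
  have G0: "G 0 = 0" by (simp add: G_def size_vec_def)
  have G: "G \<alpha> = A \<alpha> - series_exp_tail G \<alpha>" if nz: "\<alpha> \<noteq> 0" for \<alpha>
  proof -
    obtain n where n: "size_vec \<alpha> = Suc n" using nz size_vec_eq_0_iff[of \<alpha>] by (cases "size_vec \<alpha>") auto
    have "series_exp_tail (series_log_approx A n) \<alpha> = series_exp_tail G \<alpha>"
      by (rule series_exp_tail_agree) (auto simp: n approx G0 size_vec_def[of 0])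
    then show ?thesis by (simp add: G_def n)
  qed
  have "series_exp G \<alpha> = A \<alpha>" for \<alpha>
    by (cases "\<alpha> = 0") (auto simp: A0 series_exp_0 series_exp_split G)
  moreover have "G \<alpha> = 0" if "\<alpha> \<notin> S" for \<alpha>
    using that
  proof (induction "size_vec \<alpha>" arbitrary: \<alpha> rule: less_induct)
    case less
    show ?case
    proof (cases "\<alpha> = 0")
      case False
      let ?G = "\<lambda>\<beta>. if \<beta> \<in> S then G \<beta> else 0"
      have "series_exp_tail G \<alpha> = series_exp_tail ?G \<alpha>"
        by (rule series_exp_tail_agree) (use less G0 in auto)
      also have "\<dots> = 0"
        using series_power_support[of S ?G, OF _ S(1) less.prems False]
        by (simp add: series_exp_tail_def)
      finally show ?thesis using G[OF False] AS[OF less.prems False] by simp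
    qed (simp add: G0)
  qed
  ultimately show ?thesis by blast
qed

lemma q_half_nonzero: "q_half \<noteq> 0"
  by (simp add: q_half_def Zero_fract_def eq_fract)

lemma q_half_diff_nonzero: "q_half - 1 / q_half \<noteq> 0"
proof
  assume "q_half - 1 / q_half = 0"
  then have "q_half * q_half = 1" using q_half_nonzero by (simp add: field_simps)
  then show False
    by (simp add: q_half_def One_fract_def eq_fract one_pCons)
qed

lemma of_nat_rat_poly_fract: "(of_nat n :: rat poly fract) = Fract (of_nat n) 1"
  by (induction n) (simp_all add: Zero_fract_def One_fract_def)

lemma fact_vec_nonzero: "(of_nat (fact_vec \<alpha>) :: rat poly fract) \<noteq> 0"
  by (simp add: of_nat_rat_poly_fract Zero_fract_def eq_fract fact_vec_def)

lemma scalar_mult_scalar: "scalar c * (scalar d * v) = scalar (c * d) * v"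
  by (simp add: tensor_mult flip: mult.assoc)

lemma ray_support_add:
  assumes "stability_function Q Z" "ray l"
    and "\<alpha> \<in> ray_support Q Z l" "\<beta> \<in> ray_support Q Z l"
  shows "\<alpha> + \<beta> \<in> ray_support Q Z l"
proof -
  obtain v where l: "l = {complex_of_real t * v | t. t > 0}" using assms(2) unfolding ray_def by blast
  obtain s t where "Z (int_vec \<alpha>) = complex_of_real s * v" "s > 0"
    "Z (int_vec \<beta>) = complex_of_real t * v" "t > 0"
    using assms(3,4) unfolding ray_support_def l by blast
  moreover have "int_vec (\<alpha> + \<beta>) = int_vec \<alpha> + int_vec \<beta>"
    by (rule poly_mapping_eqI) (simp add: lookup_add map.rep_eq when_def)
  moreover have "int_vec \<alpha> \<in> Gamma_group Q" "int_vec \<beta> \<in> Gamma_group Q"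
    using assms(3,4) by (auto simp: ray_support_def Gamma_group_def Gamma_plus_def in_keys_iff map.rep_eq)
  ultimately have "Z (int_vec (\<alpha> + \<beta>)) = complex_of_real (s + t) * v" "s + t > 0"
    using assms(1) by (simp_all add: stability_function_def algebra_simps)
  then have "Z (int_vec (\<alpha> + \<beta>)) \<in> l" unfolding l by blast
  moreover have "\<alpha> + \<beta> \<noteq> 0"
    using assms(3) size_vec_add[of \<alpha> \<beta>] size_vec_eq_0_iff[of \<alpha>] size_vec_eq_0_iff[of "\<alpha> + \<beta>"]
    unfolding ray_support_def by force
  moreover have "\<alpha> + \<beta> \<in> Gamma_plus Q"
    using assms(3,4) keys_add[of \<alpha> \<beta>] by (auto simp: ray_support_def Gamma_plus_def)
  ultimately show ?thesis by (simp add: ray_support_def)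
qed

lemma abelian_quiver_invariants_exist:
  assumes "stability_function Q Z" "ray l"
  shows "\<exists>g. abelian_quiver_invariants Q Z l g"
proof -
  let ?S = "ray_support Q Z l"
  let ?A = "\<lambda>\<alpha>. series_one \<alpha> + exp_series_on ?S (f_inv Q Z) \<alpha>"
  have "\<exists>G. series_exp G = ?A \<and> (\<forall>\<alpha>. \<alpha> \<notin> ?S \<longrightarrow> G \<alpha> = 0)"
    by (rule series_exp_surj)
      (use ray_support_add[OF assms] in \<open>auto simp: series_one_def exp_series_on_def ray_support_def\<close>)
  then obtain G where G: "series_exp G = ?A" "\<And>\<alpha>. \<alpha> \<notin> ?S \<Longrightarrow> G \<alpha> = 0" by blast
  define g where "g = (\<lambda>\<alpha>. scalar ((q_half - 1 / q_half) * of_nat (fact_vec \<alpha>)) * G \<alpha>)"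
  have "scalar (1 / (q_half - 1 / q_half)) * exp_series_on ?S g \<alpha> = G \<alpha>" for \<alpha>
    using G(2)[of \<alpha>] q_half_diff_nonzero fact_vec_nonzero[of \<alpha>]
    by (simp add: exp_series_on_def g_def scalar_mult_scalar tensor_one)
  then have "abelian_quiver_invariants Q Z l g"
    using G(1) by (simp add: abelian_quiver_invariants_def)
  then show ?thesis by (rule exI[of _ g])
qed

lemma abelian_quiver_invariants_unique:
  assumes "abelian_quiver_invariants Q Z l g" "abelian_quiver_invariants Q Z l g'"
    and "\<alpha> \<in> ray_support Q Z l"
  shows "g \<alpha> = g' \<alpha>"
proof -
  let ?S = "ray_support Q Z l"
  let ?G = "\<lambda>g \<alpha>. scalar (1 / (q_half - 1 / q_half)) * exp_series_on ?S g \<alpha>"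
  have "?G g = ?G g'"
    by (rule series_exp_inj)
      (use assms(1,2) in \<open>auto simp: abelian_quiver_invariants_def exp_series_on_def ray_support_def\<close>)
  then have "scalar ((q_half - 1 / q_half) * of_nat (fact_vec \<alpha>)) * ?G g \<alpha> =
             scalar ((q_half - 1 / q_half) * of_nat (fact_vec \<alpha>)) * ?G g' \<alpha>" by metis
  then show ?thesis
    using assms(3) q_half_diff_nonzero fact_vec_nonzero[of \<alpha>]
    by (simp add: exp_series_on_def scalar_mult_scalar tensor_one)
qed

definition g_inv ::
  "('v, 'a) pre_digraph \<Rightarrow> (('v \<Rightarrow>\<^sub>0 int) \<Rightarrow> complex) \<Rightarrow> complex set \<Rightarrow>
   ('v \<Rightarrow>\<^sub>0 nat) \<Rightarrow> motivic_ring" where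
  "g_inv Q Z l = (SOME g. abelian_quiver_invariants Q Z l g)"

lemma g_inv:
  assumes "stability_function Q Z" "ray l"
  shows "abelian_quiver_invariants Q Z l (g_inv Q Z l)"
  unfolding g_inv_def using abelian_quiver_invariants_exist[OF assms] by (rule someI_ex)

end

theory Submission
  imports Defs "HOL-Library.Function_Algebras" "HOL-Library.Disjoint_Sets"
begin

text \<open>Semistability of an abelian representation depends only on its support, the set of arrows
  acting by a nonzero scalar. Cutting the semistable locus into strata of constant support
  gives \<open>[R\<^sub>Z] = \<Sum>\<^sub>S (L - 1)\<^sup>|\<^sup>S\<^sup>|\<close>, the sum over semistable supports \<open>S\<close>. For \<open>Z\<^sup>d\<^sup>e\<^sup>f\<close> every
  semistable support is connected, because distinct sets of vertices have distinct slopes.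
  Scaling the coordinates along a spanning tree to \<open>1\<close> provides charts of the quotient, which
  is smooth, separated and of class \<open>\<Sum>\<^sub>S (L - 1)\<^sup>|\<^sup>S\<^sup>|\<^sup>-\<^sup>|\<^sup>V\<^sup>|\<^sup>+\<^sup>1\<close>; its virtual motive is
  therefore \<open>q\<^sup>1\<^sup>/\<^sup>2 - q\<^sup>-\<^sup>1\<^sup>/\<^sup>2\<close> times the analogue of \<open>f\<^sub>Z(\<alpha>)\<close> for \<open>Z\<^sup>d\<^sup>e\<^sup>f\<close>.

  The Harder--Narasimhan filtration with respect to \<open>Z\<^sup>d\<^sup>e\<^sup>f\<close> cuts a \<open>Z\<close>-semistable support
  into a set partition of the vertices into blocks of the same \<open>Z\<close>-slope with
  \<open>Z\<^sup>d\<^sup>e\<^sup>f\<close>-semistable supports, the order of the blocks being determined by their distinct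
  slopes; arrows against the order are absent and those along it are free. Since the skew form
  vanishes, their contribution \<open>q\<^sup>r\<close> is exactly absorbed by the normalization of \<open>f\<^sub>Z\<close>. So
  \<open>f\<^sub>Z\<close> is a sum over set partitions of products of \<open>Z\<^sup>d\<^sup>e\<^sup>f\<close>-counts, which by the exponential
  formula for labelled structures is the relation defining \<open>g\<^sub>Z\<close>.\<close>

section \<open>Spaces with functions\<close>

text \<open>\<open>motivic_class X\<close> is a choice among varieties isomorphic to
  \<open>X\<close>, so it says nothing about the quotient until that is known to be a variety;
  charts and separatedness have to come first. What provides them is combinatorial: for semistable
  supports \<open>A\<close>, \<open>B\<close> no proper nonempty vertex set is closed under
  \<open>B\<close> with complement closed under \<open>A\<close>. For \<open>A = B\<close> this
  yields spanning trees and hence charts, for \<open>A \<noteq> B\<close> separatedness.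

  The skew form is only known to vanish where \<open>f\<close> does not, so exponents in the
  recursion can be rearranged only for blocks that carry semistable supports; the remaining terms
  are zero. Linking the two conditions requires that nonempty sums of powers of \<open>q - 1\<close>
  never vanish.

  The counts for the deformation are functions of a subset of the vertices of
  \<open>Q(\<alpha>)\<close>, whereas \<open>g\<close> depends on dimension vectors only. Both are
  compared as functions on subsets, through their sums over set partitions, which determine them by
  induction on size. Thus no deformation for a smaller quiver \<open>Q(\<beta>)\<close> has to be
  chosen.\<close>

lemma swf_open:
  assumes X: "space_with_functions X" and f: "regular X U f"
  shows "openin (zar X) U"
proof -
  have "\<forall>U f. regular X U f \<longrightarrow> openin (zar X) U"
    using X unfolding space_with_functions_def by (elim conjE)
  from this[rule_format, OF f] show ?thesis .
qed

lemma swf_cong: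
  assumes X: "space_with_functions X" and f: "regular X U f" and eq: "\<And>x. x \<in> U \<Longrightarrow> f x = g x"
  shows "regular X U g"
proof -
  have "\<forall>U f g. regular X U f \<longrightarrow> (\<forall>x\<in>U. f x = g x) \<longrightarrow> regular X U g"
    using X unfolding space_with_functions_def by (elim conjE)
  from this[rule_format, OF f eq] show ?thesis .
qed


lemma swf_restrict:
  assumes X: "space_with_functions X" and f: "regular X U f" and V: "openin (zar X) V" "V \<subseteq> U"
  shows "regular X V f"
proof -
  have "\<forall>U V f. regular X U f \<longrightarrow> openin (zar X) V \<longrightarrow> V \<subseteq> U \<longrightarrow> regular X V f"
    using X unfolding space_with_functions_def by (elim conjE)
  from this[rule_format, OF f V] show ?thesis .
qed


lemma swf_glue:
  assumes X: "space_with_functions X" and f: "\<And>U. U \<in> \<U> \<Longrightarrow> regular X U f"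
  shows "regular X (\<Union>\<U>) f"
proof -
  have "\<forall>\<U> f. (\<forall>U\<in>\<U>. regular X U f) \<longrightarrow> regular X (\<Union>\<U>) f"
    using X unfolding space_with_functions_def by (elim conjE)
  from this[rule_format, OF f] show ?thesis .
qed


lemma swf_subset: "space_with_functions X \<Longrightarrow> regular X U f \<Longrightarrow> U \<subseteq> points X"
  using swf_open openin_subset by blast

text \<open>The open subsets of \<open>U\<close> on which \<open>f\<close> is regular cover
  \<open>U\<close>, and the sheaf axiom glues them.\<close>

lemma swf_local:
  assumes X: "space_with_functions X" and U: "openin (zar X) U"
    and loc: "\<And>x. x \<in> U \<Longrightarrow> \<exists>V g. x \<in> V \<and> regular X V g \<and> (\<forall>y\<in>V \<inter> U. f y = g y)"
  shows "regular X U f"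
proof -
  let ?\<U> = "{V. V \<subseteq> U \<and> regular X V f}"
  have "x \<in> \<Union>?\<U>" if x: "x \<in> U" for x
  proof -
    obtain V g where V: "x \<in> V" "regular X V g" "\<forall>y\<in>V \<inter> U. f y = g y" using loc[OF x] by blast
    have "regular X (V \<inter> U) g"
      using swf_restrict[OF X V(2)] swf_open[OF X V(2)] U by (simp add: openin_Int)
    then have "regular X (V \<inter> U) f" by (rule swf_cong[OF X]) (use V(3) in auto)
    then show ?thesis using V(1) x by auto
  qed
  then have "\<Union>?\<U> = U" by auto
  then show ?thesis using swf_glue[OF X, of ?\<U> f] by simp
qed

text \<open>\<open>space_with_functions\<close> asks for a sheaf of sets of functions. This adds
  that they form \<complex>-algebras and that a function is invertible on the open set where it does
  not vanish, so that regular coordinates determine morphisms to affine space. Affine spaces have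
  the property; subspaces, quotients and varieties inherit it.\<close>

definition ringed_space :: "'p fspace \<Rightarrow> bool" where
  "ringed_space X \<longleftrightarrow> space_with_functions X \<and>
     (\<forall>U c. openin (zar X) U \<longrightarrow> regular X U (\<lambda>_. c)) \<and>
     (\<forall>U f g. regular X U f \<longrightarrow> regular X U g \<longrightarrow>
        regular X U (\<lambda>x. f x + g x) \<and> regular X U (\<lambda>x. f x * g x)) \<and>
     (\<forall>U f. regular X U f \<longrightarrow> openin (zar X) {x \<in> U. f x \<noteq> 0} \<and>
        regular X {x \<in> U. f x \<noteq> 0} (\<lambda>x. inverse (f x)))"

lemma ringed_swf: "ringed_space X \<Longrightarrow> space_with_functions X"
  by (simp add: ringed_space_def)

lemma ringed_const: "ringed_space X \<Longrightarrow> openin (zar X) U \<Longrightarrow> regular X U (\<lambda>_. c)"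
  by (simp add: ringed_space_def)

lemma ringed_add:
  "ringed_space X \<Longrightarrow> regular X U f \<Longrightarrow> regular X U g \<Longrightarrow> regular X U (\<lambda>x. f x + g x)"
  by (simp add: ringed_space_def)

lemma ringed_mult:
  "ringed_space X \<Longrightarrow> regular X U f \<Longrightarrow> regular X U g \<Longrightarrow> regular X U (\<lambda>x. f x * g x)"
  by (simp add: ringed_space_def)

lemma ringed_nonzero_open:
  "ringed_space X \<Longrightarrow> regular X U f \<Longrightarrow> openin (zar X) {x \<in> U. f x \<noteq> 0}"
  by (simp add: ringed_space_def)

lemma ringed_inverse:
  "ringed_space X \<Longrightarrow> regular X U f \<Longrightarrow> regular X {x \<in> U. f x \<noteq> 0} (\<lambda>x. inverse (f x))"
  by (simp add: ringed_space_def)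

lemma ringed_inverse_nonzero:
  assumes "ringed_space X" "regular X U f" "\<And>x. x \<in> U \<Longrightarrow> f x \<noteq> 0"
  shows "regular X U (\<lambda>x. inverse (f x))"
proof -
  have "{x \<in> U. f x \<noteq> 0} = U" using assms(3) by blast
  then show ?thesis using ringed_inverse[OF assms(1,2)] by simp
qed

section \<open>Induced structure on subsets\<close>

lemma points_subspace [simp]: "points (subspace_on X S) = points X \<inter> S"
  by (simp add: subspace_on_def)

lemma zar_subspace [simp]: "zar (subspace_on X S) = subtopology (zar X) S"
  by (simp add: subspace_on_def)

lemma regular_subspace:
  "regular (subspace_on X S) V f \<longleftrightarrow> openin (subtopology (zar X) S) V \<and>
     (\<forall>x\<in>V. \<exists>U g. x \<in> U \<and> regular X U g \<and> U \<inter> S \<subseteq> V \<and> (\<forall>y\<in>U \<inter> S. f y = g y))"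
  by (simp add: subspace_on_def)

lemma swf_subspace:
  assumes X: "space_with_functions X"
  shows "space_with_functions (subspace_on X S)"
  unfolding space_with_functions_def
proof (intro conjI allI impI)
  fix U f assume "regular (subspace_on X S) U f"
  then show "openin (zar (subspace_on X S)) U" by (simp add: regular_subspace)
next
  fix U and f g :: "'a \<Rightarrow> complex"
  assume "regular (subspace_on X S) U f" "\<forall>x\<in>U. f x = g x"
  then show "regular (subspace_on X S) U g" unfolding regular_subspace by (metis subset_eq)
next
  fix U V f
  assume U: "regular (subspace_on X S) U f" and V: "openin (zar (subspace_on X S)) V" "V \<subseteq> U"
  obtain O' where O': "openin (zar X) O'" "V = O' \<inter> S" using V by (auto simp: openin_subtopology)
  show "regular (subspace_on X S) V f"
    unfolding regular_subspace
  proof (intro conjI ballI)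
    fix x assume x: "x \<in> V"
    then obtain W g where W: "x \<in> W" "regular X W g" "W \<inter> S \<subseteq> U" "\<forall>y\<in>W \<inter> S. f y = g y"
      using U V(2) unfolding regular_subspace by blast
    have "regular X (W \<inter> O') g"
      using swf_restrict[OF X W(2)] swf_open[OF X W(2)] O'(1) by (simp add: openin_Int)
    then show "\<exists>U g. x \<in> U \<and> regular X U g \<and> U \<inter> S \<subseteq> V \<and> (\<forall>y\<in>U \<inter> S. f y = g y)"
      using W x O'(2) by (intro exI[of _ "W \<inter> O'"] exI[of _ g]) auto
  qed (use V in simp)
next
  fix \<U> f assume U: "\<forall>U\<in>\<U>. regular (subspace_on X S) U f"
  show "regular (subspace_on X S) (\<Union>\<U>) f"
    unfolding regular_subspace
  proof (intro conjI ballI)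
    show "openin (subtopology (zar X) S) (\<Union>\<U>)" using U by (auto simp: regular_subspace)
    fix x assume "x \<in> \<Union>\<U>"
    then obtain V where V: "V \<in> \<U>" "x \<in> V" by blast
    then have "regular (subspace_on X S) V f" using U by blast
    then obtain W g where "x \<in> W" "regular X W g" "W \<inter> S \<subseteq> V" "\<forall>y\<in>W \<inter> S. f y = g y"
      using V(2) unfolding regular_subspace by blast
    then show "\<exists>U g. x \<in> U \<and> regular X U g \<and> U \<inter> S \<subseteq> \<Union>\<U> \<and> (\<forall>y\<in>U \<inter> S. f y = g y)"
      using V(1) by blast
  qed
qed

lemma ringed_subspace:
  assumes R: "ringed_space X"
  shows "ringed_space (subspace_on X S)"
  unfolding ringed_space_def
proof (intro conjI allI impI)
  note X = ringed_swf[OF R]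
  show "space_with_functions (subspace_on X S)" by (rule swf_subspace[OF X])
  {
    fix U and c :: complex assume "openin (zar (subspace_on X S)) U"
    then obtain O' where "openin (zar X) O'" "U = O' \<inter> S" by (auto simp: openin_subtopology)
    then show "regular (subspace_on X S) U (\<lambda>_. c)"
      unfolding regular_subspace openin_subtopology using ringed_const[OF R, of O' c] by blast
  }
  {
    fix U f g assume f: "regular (subspace_on X S) U f" and g: "regular (subspace_on X S) U g"
    have ex: "\<exists>W f' g'. x \<in> W \<and> W \<inter> S \<subseteq> U \<and> regular X W f' \<and> regular X W g' \<and>
      (\<forall>y\<in>W \<inter> S. f y = f' y \<and> g y = g' y)" if x: "x \<in> U" for x
    proof -
      obtain V f' where V: "x \<in> V" "regular X V f'" "V \<inter> S \<subseteq> U" "\<forall>y\<in>V \<inter> S. f y = f' y"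
        using f x unfolding regular_subspace by blast
      obtain W g' where W: "x \<in> W" "regular X W g'" "W \<inter> S \<subseteq> U" "\<forall>y\<in>W \<inter> S. g y = g' y"
        using g x unfolding regular_subspace by blast
      have "regular X (V \<inter> W) f'" "regular X (V \<inter> W) g'"
        using swf_restrict[OF X V(2)] swf_restrict[OF X W(2)] swf_open[OF X V(2)]
          swf_open[OF X W(2)] by (simp_all add: openin_Int)
      then show ?thesis using V W by (intro exI[of _ "V \<inter> W"] exI[of _ f'] exI[of _ g']) auto
    qed
    have op: "openin (subtopology (zar X) S) U" using f by (simp add: regular_subspace)
    show "regular (subspace_on X S) U (\<lambda>x. f x + g x)"
      unfolding regular_subspace
    proof (intro conjI ballI op)
      fix x assume "x \<in> U"
      from ex[OF this] obtain W f' g' where "x \<in> W" "W \<inter> S \<subseteq> U" "regular X W f'" "regular X W g'"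
        "\<forall>y\<in>W \<inter> S. f y = f' y \<and> g y = g' y" by (elim exE conjE)
      then show "\<exists>V h. x \<in> V \<and> regular X V h \<and> V \<inter> S \<subseteq> U \<and> (\<forall>y\<in>V \<inter> S. f y + g y = h y)"
        using ringed_add[OF R, of W f' g']
        by (intro exI[of _ W] exI[of _ "\<lambda>x. f' x + g' x"]) auto
    qed
    show "regular (subspace_on X S) U (\<lambda>x. f x * g x)"
      unfolding regular_subspace
    proof (intro conjI ballI op)
      fix x assume "x \<in> U"
      from ex[OF this] obtain W f' g' where "x \<in> W" "W \<inter> S \<subseteq> U" "regular X W f'" "regular X W g'"
        "\<forall>y\<in>W \<inter> S. f y = f' y \<and> g y = g' y" by (elim exE conjE)
      then show "\<exists>V h. x \<in> V \<and> regular X V h \<and> V \<inter> S \<subseteq> U \<and> (\<forall>y\<in>V \<inter> S. f y * g y = h y)"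
        using ringed_mult[OF R, of W f' g']
        by (intro exI[of _ W] exI[of _ "\<lambda>x. f' x * g' x"]) auto
    qed
  }
  {
    fix U f assume f: "regular (subspace_on X S) U f"
    have ex: "\<exists>W g. x \<in> W \<and> W \<inter> S \<subseteq> {x \<in> U. f x \<noteq> 0} \<and> regular X W (\<lambda>x. inverse (g x)) \<and>
       (\<forall>y\<in>W \<inter> S. f y = g y)" if x: "x \<in> U" "f x \<noteq> 0" for x
    proof -
      obtain V g where V: "x \<in> V" "regular X V g" "V \<inter> S \<subseteq> U" "\<forall>y\<in>V \<inter> S. f y = g y"
        using f x unfolding regular_subspace by blast
      have "x \<in> S" using f x openin_subset unfolding regular_subspace by fastforce
      then show ?thesis
        using ringed_inverse[OF R V(2)] V x
        by (intro exI[of _ "{x \<in> V. g x \<noteq> 0}"] exI[of _ g]) auto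
    qed
    have "\<exists>T. openin (subtopology (zar X) S) T \<and> x \<in> T \<and> T \<subseteq> {x \<in> U. f x \<noteq> 0}"
      if x: "x \<in> {x \<in> U. f x \<noteq> 0}" for x
    proof -
      have "x \<in> U" "f x \<noteq> 0" using x by auto
      from ex[OF this] obtain W g where W: "x \<in> W" "W \<inter> S \<subseteq> {x \<in> U. f x \<noteq> 0}"
        "regular X W (\<lambda>x. inverse (g x))" by (elim exE conjE)
      have "x \<in> S" using f x openin_subset unfolding regular_subspace by fastforce
      moreover have "openin (subtopology (zar X) S) (W \<inter> S)"
        using swf_open[OF X W(3)] by (auto simp: openin_subtopology)
      ultimately show ?thesis using W(1,2) by blast
    qed
    then have op: "openin (subtopology (zar X) S) {x \<in> U. f x \<noteq> 0}"
      by (subst openin_subopen) blast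
    then show "openin (zar (subspace_on X S)) {x \<in> U. f x \<noteq> 0}" by simp
    show "regular (subspace_on X S) {x \<in> U. f x \<noteq> 0} (\<lambda>x. inverse (f x))"
      unfolding regular_subspace
    proof (intro conjI ballI op)
      fix x assume "x \<in> {x \<in> U. f x \<noteq> 0}"
      then have "x \<in> U" "f x \<noteq> 0" by auto
      from ex[OF this] obtain W g where "x \<in> W" "W \<inter> S \<subseteq> {x \<in> U. f x \<noteq> 0}"
        "regular X W (\<lambda>x. inverse (g x))" "\<forall>y\<in>W \<inter> S. f y = g y" by (elim exE conjE)
      then show "\<exists>V h. x \<in> V \<and> regular X V h \<and> V \<inter> S \<subseteq> {x \<in> U. f x \<noteq> 0} \<and>
          (\<forall>y\<in>V \<inter> S. inverse (f y) = h y)"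
        by (intro exI[of _ W] exI[of _ "\<lambda>x. inverse (g x)"]) auto
    qed
  }
qed

lemma regular_open_subspace:
  assumes X: "space_with_functions X" and U: "openin (zar X) U"
  shows "regular (subspace_on X U) V f \<longleftrightarrow> V \<subseteq> U \<and> regular X V f"
proof
  assume r: "regular (subspace_on X U) V f"
  then have V: "openin (zar X) V" "V \<subseteq> U"
    using openin_open_subtopology[OF U] by (auto simp: regular_subspace)
  have "regular X V f"
  proof (rule swf_local[OF X V(1)])
    fix x assume "x \<in> V"
    then obtain W g where "x \<in> W" "regular X W g" "\<forall>y\<in>W \<inter> U. f y = g y"
      using r unfolding regular_subspace by blast
    then show "\<exists>W g. x \<in> W \<and> regular X W g \<and> (\<forall>y\<in>W \<inter> V. f y = g y)" using V(2) by blast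
  qed
  then show "V \<subseteq> U \<and> regular X V f" using V by simp
next
  assume a: "V \<subseteq> U \<and> regular X V f"
  then show "regular (subspace_on X U) V f"
    unfolding regular_subspace openin_open_subtopology[OF U]
    using swf_open[OF X] by (metis inf_le1 swf_open)
qed

text \<open>An equality of records rather than an isomorphism, so that repeated cuts into strata can
  be rewritten.\<close>

lemma subspace_subspace:
  assumes X: "space_with_functions X"
  shows "subspace_on (subspace_on X A) B = subspace_on X (A \<inter> B)"
proof -
  have "regular (subspace_on (subspace_on X A) B) V f \<longleftrightarrow> regular (subspace_on X (A \<inter> B)) V f" for V f
  proof
    assume r: "regular (subspace_on (subspace_on X A) B) V f"
    show "regular (subspace_on X (A \<inter> B)) V f"
      unfolding regular_subspace
    proof (intro conjI ballI)
      show "openin (subtopology (zar X) (A \<inter> B)) V"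
        using r by (simp add: regular_subspace[of "subspace_on X A"] subtopology_subtopology)
      fix x assume "x \<in> V"
      then obtain U g where U: "x \<in> U" "regular (subspace_on X A) U g" "U \<inter> B \<subseteq> V"
        "\<forall>y\<in>U \<inter> B. f y = g y" using r unfolding regular_subspace[of "subspace_on X A"] by blast
      then obtain W h where "x \<in> W" "regular X W h" "W \<inter> A \<subseteq> U" "\<forall>y\<in>W \<inter> A. g y = h y"
        unfolding regular_subspace by blast
      then show "\<exists>U g. x \<in> U \<and> regular X U g \<and> U \<inter> (A \<inter> B) \<subseteq> V \<and> (\<forall>y\<in>U \<inter> (A \<inter> B). f y = g y)"
        using U by (intro exI[of _ W] exI[of _ h]) auto
    qed
  next
    assume r: "regular (subspace_on X (A \<inter> B)) V f"
    show "regular (subspace_on (subspace_on X A) B) V f"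
      unfolding regular_subspace[of "subspace_on X A"]
    proof (intro conjI ballI)
      show "openin (subtopology (zar (subspace_on X A)) B) V"
        using r by (simp add: regular_subspace subtopology_subtopology)
      fix x assume x: "x \<in> V"
      then obtain W h where W: "x \<in> W" "regular X W h" "W \<inter> (A \<inter> B) \<subseteq> V"
          "\<forall>y\<in>W \<inter> (A \<inter> B). f y = h y"
        using r unfolding regular_subspace by blast
      have "x \<in> A" using r x openin_subset unfolding regular_subspace by fastforce
      moreover have "regular (subspace_on X A) (W \<inter> A) h"
        unfolding regular_subspace openin_subtopology using W(2) swf_open[OF X W(2)] by blast
      ultimately show "\<exists>U g. x \<in> U \<and> regular (subspace_on X A) U g \<and> U \<inter> B \<subseteq> V \<and>
          (\<forall>y\<in>U \<inter> B. f y = g y)"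
        using W by (intro exI[of _ "W \<inter> A"] exI[of _ h]) auto
    qed
  qed
  then have "regular (subspace_on (subspace_on X A) B) = regular (subspace_on X (A \<inter> B))"
    by (intro ext)
  moreover have "zar (subspace_on (subspace_on X A) B) = zar (subspace_on X (A \<inter> B))"
    by (simp add: subtopology_subtopology)
  ultimately show ?thesis
    by (intro fspace.equality) (auto simp: subspace_on_def)
qed

section \<open>Morphisms and isomorphisms\<close>

lemma morphism_image: "morphism X Y \<phi> \<Longrightarrow> x \<in> points X \<Longrightarrow> \<phi> x \<in> points Y"
  by (auto simp: morphism_def continuous_map_def)

lemma morphism_continuous: "morphism X Y \<phi> \<Longrightarrow> continuous_map (zar X) (zar Y) \<phi>"
  by (simp add: morphism_def)

lemma morphism_regular:
  "morphism X Y \<phi> \<Longrightarrow> regular Y V f \<Longrightarrow> regular X {x \<in> points X. \<phi> x \<in> V} (\<lambda>x. f (\<phi> x))"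
  by (simp add: morphism_def)

lemma morphism_id: 
  assumes "space_with_functions X" shows "morphism X X (\<lambda>x. x)"
proof -
  have "{x \<in> points X. x \<in> V} = V" if "regular X V f" for V f
    using swf_subset[OF assms that] by blast
  then show ?thesis by (auto simp: morphism_def)
qed

lemma morphism_comp:
  assumes "morphism X Y \<phi>" "morphism Y W \<psi>"
  shows "morphism X W (\<lambda>x. \<psi> (\<phi> x))"
  unfolding morphism_def
proof (intro conjI allI impI)
  show "continuous_map (zar X) (zar W) (\<lambda>x. \<psi> (\<phi> x))"
    using continuous_map_compose[OF assms[THEN morphism_continuous]] by (simp add: o_def)
  fix V f assume "regular W V f"
  from morphism_regular[OF assms(1) morphism_regular[OF assms(2) this]]
  have "regular X {x \<in> points X. \<phi> x \<in> {x \<in> points Y. \<psi> x \<in> V}} (\<lambda>x. f (\<psi> (\<phi> x)))" .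
  moreover have "{x \<in> points X. \<phi> x \<in> {x \<in> points Y. \<psi> x \<in> V}} = {x \<in> points X. \<psi> (\<phi> x) \<in> V}"
    using morphism_image[OF assms(1)] by auto
  ultimately show "regular X {x \<in> points X. \<psi> (\<phi> x) \<in> V} (\<lambda>x. f (\<psi> (\<phi> x)))" by simp
qed

lemma morphism_cong:
  assumes X: "space_with_functions X" and \<phi>: "morphism X Y \<phi>"
    and eq: "\<And>x. x \<in> points X \<Longrightarrow> \<phi> x = \<psi> x"
  shows "morphism X Y \<psi>"
  unfolding morphism_def
proof (intro conjI allI impI)
  show "continuous_map (zar X) (zar Y) \<psi>"
    using continuous_map_eq[OF morphism_continuous[OF \<phi>]] eq by blast
  fix V f assume "regular Y V f"
  from morphism_regular[OF \<phi> this]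
  have "regular X {x \<in> points X. \<phi> x \<in> V} (\<lambda>x. f (\<phi> x))" .
  moreover have "{x \<in> points X. \<phi> x \<in> V} = {x \<in> points X. \<psi> x \<in> V}" using eq by auto
  ultimately have "regular X {x \<in> points X. \<psi> x \<in> V} (\<lambda>x. f (\<phi> x))" by simp
  then show "regular X {x \<in> points X. \<psi> x \<in> V} (\<lambda>x. f (\<psi> x))"
    by (rule swf_cong[OF X]) (use eq in auto)
qed

lemma morphism_inclusion:
  assumes X: "space_with_functions X"
  shows "morphism (subspace_on X S) X (\<lambda>x. x)"
  unfolding morphism_def
proof (intro conjI allI impI)
  show "continuous_map (zar (subspace_on X S)) (zar X) (\<lambda>x. x)"
    using continuous_map_from_subtopology[OF continuous_map_id, of "zar X" S] by (simp add: id_def)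
  fix V f assume V: "regular X V f"
  have "{x \<in> points (subspace_on X S). x \<in> V} = V \<inter> S" using swf_subset[OF X V] by auto
  moreover have "regular (subspace_on X S) (V \<inter> S) f"
    unfolding regular_subspace openin_subtopology using V swf_open[OF X V] by blast
  ultimately show "regular (subspace_on X S) {x \<in> points (subspace_on X S). x \<in> V} f" by simp
qed

lemma morphism_into_subspace:
  assumes X: "space_with_functions X" and \<phi>: "morphism X Y \<phi>"
    and S: "\<And>x. x \<in> points X \<Longrightarrow> \<phi> x \<in> S"
  shows "morphism X (subspace_on Y S) \<phi>"
  unfolding morphism_def
proof (intro conjI allI impI)
  show c: "continuous_map (zar X) (zar (subspace_on Y S)) \<phi>"
    using morphism_continuous[OF \<phi>] S by (auto simp: continuous_map_in_subtopology)
  fix V f assume V: "regular (subspace_on Y S) V f"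
  show "regular X {x \<in> points X. \<phi> x \<in> V} (\<lambda>x. f (\<phi> x))"
  proof (rule swf_local[OF X])
    show "openin (zar X) {x \<in> points X. \<phi> x \<in> V}"
      using c V by (auto simp: regular_subspace continuous_map_def)
    fix x assume "x \<in> {x \<in> points X. \<phi> x \<in> V}"
    then obtain U g where "x \<in> points X" "\<phi> x \<in> U" "regular Y U g" "\<forall>y\<in>U \<inter> S. f y = g y"
      using V unfolding regular_subspace by blast
    then show "\<exists>W g. x \<in> W \<and> regular X W g \<and> (\<forall>y\<in>W \<inter> {x \<in> points X. \<phi> x \<in> V}. f (\<phi> y) = g y)"
      using morphism_regular[OF \<phi>, of U g] S
      by (intro exI[of _ "{x \<in> points X. \<phi> x \<in> U}"] exI[of _ "\<lambda>x. g (\<phi> x)"]) auto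
  qed
qed

lemma morphism_subspaces:
  assumes "space_with_functions X" "morphism X Y \<phi>" "\<And>x. x \<in> points X \<Longrightarrow> x \<in> A \<Longrightarrow> \<phi> x \<in> B"
  shows "morphism (subspace_on X A) (subspace_on Y B) \<phi>"
  by (rule morphism_into_subspace[OF swf_subspace[OF assms(1)]])
    (use morphism_comp[OF morphism_inclusion[OF assms(1)] assms(2)] assms(3) in auto)

definition iso_pair :: "'p fspace \<Rightarrow> 'r fspace \<Rightarrow> ('p \<Rightarrow> 'r) \<Rightarrow> ('r \<Rightarrow> 'p) \<Rightarrow> bool" where
  "iso_pair X Y \<phi> \<psi> \<longleftrightarrow> morphism X Y \<phi> \<and> morphism Y X \<psi> \<and>
     (\<forall>x\<in>points X. \<psi> (\<phi> x) = x) \<and> (\<forall>y\<in>points Y. \<phi> (\<psi> y) = y)"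

lemma isomorphic_iff_iso_pair: "isomorphic X Y \<longleftrightarrow> (\<exists>\<phi> \<psi>. iso_pair X Y \<phi> \<psi>)"
  by (simp add: isomorphic_def iso_pair_def)

lemma iso_pairD:
  assumes "iso_pair X Y \<phi> \<psi>"
  shows "morphism X Y \<phi>" "morphism Y X \<psi>" "\<And>x. x \<in> points X \<Longrightarrow> \<psi> (\<phi> x) = x"
    "\<And>y. y \<in> points Y \<Longrightarrow> \<phi> (\<psi> y) = y"
    "\<And>x. x \<in> points X \<Longrightarrow> \<phi> x \<in> points Y" "\<And>y. y \<in> points Y \<Longrightarrow> \<psi> y \<in> points X"
proof -
  have m: "morphism X Y \<phi>" "morphism Y X \<psi>" and i: "\<forall>x\<in>points X. \<psi> (\<phi> x) = x"
    "\<forall>y\<in>points Y. \<phi> (\<psi> y) = y"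
    using assms by (simp_all add: iso_pair_def)
  show "morphism X Y \<phi>" "morphism Y X \<psi>" by (rule m)+
  show "\<psi> (\<phi> x) = x" if "x \<in> points X" for x using i that by simp
  show "\<phi> (\<psi> y) = y" if "y \<in> points Y" for y using i that by simp
  show "\<phi> x \<in> points Y" if "x \<in> points X" for x by (rule morphism_image[OF m(1) that])
  show "\<psi> y \<in> points X" if "y \<in> points Y" for y by (rule morphism_image[OF m(2) that])
qed

lemma iso_pair_sym: "iso_pair X Y \<phi> \<psi> \<Longrightarrow> iso_pair Y X \<psi> \<phi>"
  by (simp add: iso_pair_def)

lemma isomorphic_sym: "isomorphic X Y \<Longrightarrow> isomorphic Y X"
  unfolding isomorphic_iff_iso_pair using iso_pair_sym by blast

lemma isomorphic_refl: "space_with_functions X \<Longrightarrow> isomorphic X X"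
  unfolding isomorphic_def using morphism_id by blast

lemma isomorphic_trans:
  assumes "isomorphic X Y" "isomorphic Y W"
  shows "isomorphic X W"
proof -
  obtain \<phi> \<psi> where 1: "iso_pair X Y \<phi> \<psi>" using assms(1) isomorphic_iff_iso_pair by blast
  obtain \<phi>' \<psi>' where 2: "iso_pair Y W \<phi>' \<psi>'" using assms(2) isomorphic_iff_iso_pair by blast
  have "iso_pair X W (\<lambda>x. \<phi>' (\<phi> x)) (\<lambda>w. \<psi> (\<psi>' w))"
    unfolding iso_pair_def
    using morphism_comp[OF iso_pairD(1)[OF 1] iso_pairD(1)[OF 2]]
      morphism_comp[OF iso_pairD(2)[OF 2] iso_pairD(2)[OF 1]]
      iso_pairD(3-6)[OF 1] iso_pairD(3-6)[OF 2] by simp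
  then show ?thesis using isomorphic_iff_iso_pair by blast
qed

lemma iso_pair_image:
  assumes "iso_pair X Y \<phi> \<psi>" "A \<subseteq> points X"
  shows "\<phi> ` A = {y \<in> points Y. \<psi> y \<in> A}"
  using iso_pairD[OF assms(1)] assms(2) by (auto simp: image_iff) (metis subsetD)

lemma iso_pair_points: "iso_pair X Y \<phi> \<psi> \<Longrightarrow> \<phi> ` points X = points Y"
  using iso_pair_image[of X Y \<phi> \<psi> "points X"] iso_pairD(6)[of X Y \<phi> \<psi>] by auto

lemma iso_pair_openin:
  assumes "iso_pair X Y \<phi> \<psi>" "openin (zar X) A"
  shows "openin (zar Y) (\<phi> ` A)"
  using iso_pair_image[OF assms(1) openin_subset[OF assms(2)]]
    morphism_continuous[OF iso_pairD(2)[OF assms(1)]] assms(2)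
  by (simp add: continuous_map_def)

lemma iso_pair_closedin:
  assumes "iso_pair X Y \<phi> \<psi>" "closedin (zar X) A"
  shows "closedin (zar Y) (\<phi> ` A)"
  using iso_pair_image[OF assms(1) closedin_subset[OF assms(2)]]
    morphism_continuous[OF iso_pairD(2)[OF assms(1)]] assms(2)
  by (simp add: continuous_map_closedin)

lemma iso_pair_subspace:
  assumes "space_with_functions X" "space_with_functions Y" "iso_pair X Y \<phi> \<psi>" "A \<subseteq> points X"
  shows "iso_pair (subspace_on X A) (subspace_on Y (\<phi> ` A)) \<phi> \<psi>"
  unfolding iso_pair_def
proof (intro conjI ballI)
  note d = iso_pairD[OF assms(3)]
  show "morphism (subspace_on X A) (subspace_on Y (\<phi> ` A)) \<phi>"
    by (rule morphism_subspaces[OF assms(1) d(1)]) auto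
  show "morphism (subspace_on Y (\<phi> ` A)) (subspace_on X A) \<psi>"
    by (rule morphism_subspaces[OF assms(2) d(2)])
      (use iso_pair_image[OF assms(3,4)] in auto)
qed (use iso_pairD(3,4)[OF assms(3)] in auto)

lemma isomorphic_subspace_image:
  assumes "space_with_functions X" "space_with_functions Y" "iso_pair X Y \<phi> \<psi>" "A \<subseteq> points X"
  shows "isomorphic (subspace_on X A) (subspace_on Y (\<phi> ` A))"
  using iso_pair_subspace[OF assms] isomorphic_iff_iso_pair by blast

lemma ringed_iso:
  assumes "isomorphic X Y" and R: "ringed_space X" and Y: "space_with_functions Y"
  shows "ringed_space Y"
proof -
  obtain \<phi> \<psi> where i: "iso_pair X Y \<phi> \<psi>" using assms(1) isomorphic_iff_iso_pair by blast
  note d = iso_pairD[OF i]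
  have pull: "regular X {x \<in> points X. \<phi> x \<in> U} (\<lambda>x. f (\<phi> x))" if "regular Y U f" for U f
    using morphism_regular[OF d(1) that] .
  have push: "regular Y U h" if "regular X {x \<in> points X. \<phi> x \<in> U} h'" "U \<subseteq> points Y"
    "\<And>x. x \<in> points X \<Longrightarrow> \<phi> x \<in> U \<Longrightarrow> h' x = h (\<phi> x)" for U h h'
  proof -
    have "{y \<in> points Y. \<psi> y \<in> {x \<in> points X. \<phi> x \<in> U}} = U" using d that(2) by auto
    then have "regular Y U (\<lambda>y. h' (\<psi> y))" using morphism_regular[OF d(2) that(1)] by simp
    then show ?thesis
      by (rule swf_cong[OF Y]) (metis d(4) d(6) subsetD that(2) that(3))
  qed
  show ?thesis
    unfolding ringed_space_def
  proof (intro conjI allI impI Y)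
    fix U and c :: complex assume U: "openin (zar Y) U"
    then have "openin (zar X) {x \<in> points X. \<phi> x \<in> U}"
      using morphism_continuous[OF d(1)] by (simp add: continuous_map_def)
    then show "regular Y U (\<lambda>_. c)"
      by (intro push[OF ringed_const[OF R, of _ c]]) (use openin_subset[OF U] in auto)
  next
    fix U f g assume fg: "regular Y U f" "regular Y U g"
    show "regular Y U (\<lambda>x. f x + g x)"
      by (rule push[OF ringed_add[OF R pull[OF fg(1)] pull[OF fg(2)]]])
        (use swf_subset[OF Y fg(1)] in auto)
    show "regular Y U (\<lambda>x. f x * g x)"
      by (rule push[OF ringed_mult[OF R pull[OF fg(1)] pull[OF fg(2)]]])
        (use swf_subset[OF Y fg(1)] in auto)
  next
    fix U f assume f: "regular Y U f"
    have eq: "{x \<in> {x \<in> points X. \<phi> x \<in> U}. f (\<phi> x) \<noteq> 0} = {x \<in> points X. \<phi> x \<in> {x \<in> U. f x \<noteq> 0}}"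
      by auto
    have "regular X {x \<in> points X. \<phi> x \<in> {x \<in> U. f x \<noteq> 0}} (\<lambda>x. inverse (f (\<phi> x)))"
      using ringed_inverse[OF R pull[OF f]] eq by simp
    then show "regular Y {x \<in> U. f x \<noteq> 0} (\<lambda>x. inverse (f x))"
      by (rule push) (use swf_subset[OF Y f] in auto)
    then show "openin (zar Y) {x \<in> U. f x \<noteq> 0}" by (rule swf_open[OF Y])
  qed
qed

section \<open>Quotients\<close>

lemma topology_eq_openin: "(\<And>U. openin T U \<longleftrightarrow> openin T' U) \<Longrightarrow> T = T'"
  unfolding topology_eq by blast

lemma points_quotient [simp]: "points (quotient_fspace X \<pi>) = \<pi> ` points X"
proof -
  have "{x \<in> points X. \<pi> x \<in> \<pi> ` points X} = points X" by auto
  then have "openin (zar (quotient_fspace X \<pi>)) (\<pi> ` points X)"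
    by (simp add: openin_quotient_fspace)
  then have "\<pi> ` points X \<subseteq> points (quotient_fspace X \<pi>)" by (rule openin_subset)
  moreover have "points (quotient_fspace X \<pi>) \<subseteq> \<pi> ` points X"
    using openin_quotient_fspace[of X \<pi> "points (quotient_fspace X \<pi>)"] by simp
  ultimately show ?thesis by (rule equalityI[rotated])
qed

lemma regular_quotient:
  "regular (quotient_fspace X \<pi>) U f \<longleftrightarrow>
     U \<subseteq> \<pi> ` points X \<and> regular X {x \<in> points X. \<pi> x \<in> U} (\<lambda>x. f (\<pi> x))"
  by (simp add: quotient_fspace_def)

lemma swf_quotient:
  assumes X: "space_with_functions X"
  shows "space_with_functions (quotient_fspace X \<pi>)"
  unfolding space_with_functions_def
proof (intro conjI allI impI)
  fix U f assume "regular (quotient_fspace X \<pi>) U f"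
  then show "openin (zar (quotient_fspace X \<pi>)) U"
    using swf_open[OF X] by (auto simp: regular_quotient openin_quotient_fspace)
next
  fix U and f g :: "'b \<Rightarrow> complex"
  assume "regular (quotient_fspace X \<pi>) U f" "\<forall>x\<in>U. f x = g x"
  then show "regular (quotient_fspace X \<pi>) U g"
    by (auto simp: regular_quotient intro: swf_cong[OF X])
next
  fix U V f
  assume "regular (quotient_fspace X \<pi>) U f" "openin (zar (quotient_fspace X \<pi>)) V" "V \<subseteq> U"
  then show "regular (quotient_fspace X \<pi>) V f"
    by (auto simp: regular_quotient openin_quotient_fspace intro: swf_restrict[OF X])
next
  fix \<U> f assume U: "\<forall>U\<in>\<U>. regular (quotient_fspace X \<pi>) U f"
  have "{x \<in> points X. \<pi> x \<in> \<Union>\<U>} = \<Union>((\<lambda>U. {x \<in> points X. \<pi> x \<in> U}) ` \<U>)" by auto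
  moreover have "regular X (\<Union>((\<lambda>U. {x \<in> points X. \<pi> x \<in> U}) ` \<U>)) (\<lambda>x. f (\<pi> x))"
    by (rule swf_glue[OF X]) (use U in \<open>auto simp: regular_quotient\<close>)
  ultimately show "regular (quotient_fspace X \<pi>) (\<Union>\<U>) f"
    using U by (auto simp: regular_quotient)
qed

lemma ringed_quotient:
  assumes R: "ringed_space X"
  shows "ringed_space (quotient_fspace X \<pi>)"
  unfolding ringed_space_def
proof (intro conjI allI impI)
  note X = ringed_swf[OF R]
  show "space_with_functions (quotient_fspace X \<pi>)" by (rule swf_quotient[OF X])
  show "regular (quotient_fspace X \<pi>) U (\<lambda>_. c)"
    if "openin (zar (quotient_fspace X \<pi>)) U" for U and c :: complex
    using that ringed_const[OF R] by (auto simp: regular_quotient openin_quotient_fspace)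
  show "regular (quotient_fspace X \<pi>) U (\<lambda>x. f x + g x)"
    if "regular (quotient_fspace X \<pi>) U f" "regular (quotient_fspace X \<pi>) U g" for U f g
    using that ringed_add[OF R] by (auto simp: regular_quotient)
  show "regular (quotient_fspace X \<pi>) U (\<lambda>x. f x * g x)"
    if "regular (quotient_fspace X \<pi>) U f" "regular (quotient_fspace X \<pi>) U g" for U f g
    using that ringed_mult[OF R] by (auto simp: regular_quotient)
  fix U f assume f: "regular (quotient_fspace X \<pi>) U f"
  have eq: "{x \<in> {x \<in> points X. \<pi> x \<in> U}. f (\<pi> x) \<noteq> 0} = {x \<in> points X. \<pi> x \<in> {x \<in> U. f x \<noteq> 0}}"
    by auto
  show "openin (zar (quotient_fspace X \<pi>)) {x \<in> U. f x \<noteq> 0}"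
    using f ringed_nonzero_open[OF R, of "{x \<in> points X. \<pi> x \<in> U}" "\<lambda>x. f (\<pi> x)"] eq
    by (auto simp: regular_quotient openin_quotient_fspace)
  show "regular (quotient_fspace X \<pi>) {x \<in> U. f x \<noteq> 0} (\<lambda>x. inverse (f x))"
    using f ringed_inverse[OF R, of "{x \<in> points X. \<pi> x \<in> U}" "\<lambda>x. f (\<pi> x)"] eq
    by (auto simp: regular_quotient)
qed

lemma morphism_quotient: "morphism X (quotient_fspace X \<pi>) \<pi>"
  unfolding morphism_def continuous_map_def
  by (auto simp: regular_quotient openin_quotient_fspace)

lemma morphism_from_quotient:
  assumes X: "space_with_functions X" and m: "morphism X Y (\<lambda>x. f (\<pi> x))"
  shows "morphism (quotient_fspace X \<pi>) Y f"
proof -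
  have eq: "{x \<in> points X. \<pi> x \<in> {y \<in> \<pi> ` points X. f y \<in> V}} = {x \<in> points X. f (\<pi> x) \<in> V}" for V
    by auto
  show ?thesis
    unfolding morphism_def continuous_map_def
    using m eq unfolding morphism_def continuous_map_def
    by (auto simp: regular_quotient openin_quotient_fspace)
qed

text \<open>A slice criterion: \<open>\<sigma>\<close> includes the slice \<open>Y\<close>, and
  \<open>\<nu>\<close> moves each point within its fibre of \<open>\<pi>\<close> to the slice. Being
  constant on fibres, \<open>\<nu>\<close> descends to the quotient, with inverse
  \<open>\<pi>\<close> after \<open>\<sigma>\<close>.\<close>

lemma quotient_isomorphic_slice:
  assumes X: "space_with_functions X" and \<nu>: "morphism X Y \<nu>" and \<sigma>: "morphism Y X \<sigma>"
    and \<pi>: "\<And>x. x \<in> points X \<Longrightarrow> \<pi> (\<sigma> (\<nu> x)) = \<pi> x"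
    and inv: "\<And>x y. x \<in> points X \<Longrightarrow> y \<in> points X \<Longrightarrow> \<pi> x = \<pi> y \<Longrightarrow> \<nu> x = \<nu> y"
    and sec: "\<And>y. y \<in> points Y \<Longrightarrow> \<nu> (\<sigma> y) = y"
  obtains \<phi> where "iso_pair (quotient_fspace X \<pi>) Y \<phi> (\<lambda>y. \<pi> (\<sigma> y))"
    "\<forall>x\<in>points X. \<phi> (\<pi> x) = \<nu> x"
proof -
  \<comment> \<open>The choice of a representative is harmless because \<open>\<nu>\<close> takes
    the same value on all of them.\<close>
  define \<phi> where "\<phi> = (\<lambda>u. \<nu> (SOME x. x \<in> points X \<and> \<pi> x = u))"
  have \<phi>: "\<phi> (\<pi> x) = \<nu> x" if x: "x \<in> points X" for x
    unfolding \<phi>_def using someI[of "\<lambda>y. y \<in> points X \<and> \<pi> y = \<pi> x" x] inv x by blast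
  have 1: "morphism (quotient_fspace X \<pi>) Y \<phi>"
    by (rule morphism_from_quotient[OF X morphism_cong[OF X \<nu>]]) (simp add: \<phi>)
  have 2: "morphism Y (quotient_fspace X \<pi>) (\<lambda>y. \<pi> (\<sigma> y))"
    by (rule morphism_comp[OF \<sigma> morphism_quotient])
  have "iso_pair (quotient_fspace X \<pi>) Y \<phi> (\<lambda>y. \<pi> (\<sigma> y))"
    unfolding iso_pair_def using 1 2 \<phi> \<pi> sec morphism_image[OF \<sigma>] by auto
  then show ?thesis using that \<phi> by blast
qed

text \<open>Transport of structure along an injection: this moves a variety to the point type
  \<open>nat \<Rightarrow> complex\<close> of \<open>cvariety\<close>.\<close>

lemma quotient_inj_isomorphic:
  assumes X: "space_with_functions X" and j: "inj_on j (points X)"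
  shows "isomorphic X (quotient_fspace X j)"
proof -
  obtain \<phi> where "iso_pair (quotient_fspace X j) X \<phi> (\<lambda>x. j x)"
    by (rule quotient_isomorphic_slice[OF X morphism_id[OF X] morphism_id[OF X], of j])
      (use j in \<open>auto simp: inj_on_def\<close>)
  then show ?thesis using isomorphic_iff_iso_pair isomorphic_sym by blast
qed

text \<open>For an open union of fibres, restriction and quotient commute; hence the part of an
  orbit space over an open invariant locus is again an orbit space.\<close>

lemma subspace_quotient:
  assumes X: "space_with_functions X" and W: "openin (zar X) W"
    and sat: "\<And>x y. x \<in> points X \<Longrightarrow> y \<in> W \<Longrightarrow> \<pi> x = \<pi> y \<Longrightarrow> x \<in> W"
  shows "subspace_on (quotient_fspace X \<pi>) (\<pi> ` W) = quotient_fspace (subspace_on X W) \<pi>"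
proof -
  note Wp = openin_subset[OF W]
  have satW: "{x \<in> points X. \<pi> x \<in> \<pi> ` W} = W" using sat Wp by auto
  have W': "openin (zar (quotient_fspace X \<pi>)) (\<pi> ` W)"
    using satW W Wp by (auto simp: openin_quotient_fspace)
  have pre: "{x \<in> points X. \<pi> x \<in> V} = {x \<in> points (subspace_on X W). \<pi> x \<in> V}"
    if "V \<subseteq> \<pi> ` W" for V using that sat Wp by auto
  have pts: "\<pi> ` points (subspace_on X W) = \<pi> ` W" using Wp by (auto simp: Int_absorb1)
  have sub: "{x \<in> points X. \<pi> x \<in> V} \<subseteq> W" if "V \<subseteq> \<pi> ` W" for V
    using that satW by blast
  have VX: "V \<subseteq> \<pi> ` points X" if "V \<subseteq> \<pi> ` W" for V using that Wp by blast
  have 0: "openin (zar (subspace_on (quotient_fspace X \<pi>) (\<pi> ` W))) V \<longleftrightarrow>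
        openin (zar (quotient_fspace (subspace_on X W) \<pi>)) V" for V
  proof (cases "V \<subseteq> \<pi> ` W")
    case True
    have "openin (zar (subspace_on (quotient_fspace X \<pi>) (\<pi> ` W))) V \<longleftrightarrow>
       openin (zar X) {x \<in> points X. \<pi> x \<in> V}"
      using True VX[OF True] unfolding zar_subspace openin_open_subtopology[OF W'] openin_quotient_fspace
      by simp
    also have "\<dots> \<longleftrightarrow> openin (zar (quotient_fspace (subspace_on X W) \<pi>)) V"
      unfolding openin_quotient_fspace pts pre[OF True, symmetric]
      using True sub[OF True] openin_open_subtopology[OF W] by simp
    finally show ?thesis .
  next
    case False
    then show ?thesis
      unfolding openin_quotient_fspace[of "subspace_on X W"] pts zar_subspace
        openin_open_subtopology[OF W'] by auto
  qed
  then have 1: "zar (subspace_on (quotient_fspace X \<pi>) (\<pi> ` W)) =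
      zar (quotient_fspace (subspace_on X W) \<pi>)" by (rule topology_eq_openin)
  have "regular (subspace_on (quotient_fspace X \<pi>) (\<pi> ` W)) V f \<longleftrightarrow>
        regular (quotient_fspace (subspace_on X W) \<pi>) V f" for V f
  proof (cases "V \<subseteq> \<pi> ` W")
    case True
    then show ?thesis
      unfolding regular_open_subspace[OF swf_quotient[OF X] W'] regular_quotient pts
        pre[OF True, symmetric] regular_open_subspace[OF X W]
      using VX[OF True] sub[OF True] by simp
  next
    case False
    then show ?thesis
      unfolding regular_open_subspace[OF swf_quotient[OF X] W']
        regular_quotient[of "subspace_on X W"] pts by auto
  qed
  then have 2: "regular (subspace_on (quotient_fspace X \<pi>) (\<pi> ` W)) =
      regular (quotient_fspace (subspace_on X W) \<pi>)" by (intro ext)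
  show ?thesis
    by (rule fspace.equality[OF 1 2]) (simp add: subspace_on_def quotient_fspace_def)
qed

section \<open>Affine spaces and their locally closed subsets\<close>

lemma topspace_zariski [simp]: "topspace (zariski I) = cspace I"
proof
  show "topspace (zariski I) \<subseteq> cspace I"
    using openin_topspace[of "zariski I"] unfolding openin_zariski by blast
  have "openin (zariski I) (cspace I)"
    unfolding openin_zariski
    by (rule exI[of _ "{\<lambda>_. 1}"]) (auto simp: zero_locus_def intro: pf_const)
  then show "cspace I \<subseteq> topspace (zariski I)" by (rule openin_subset)
qed

lemma zar_affine [simp]: "zar (affine_space I) = zariski I"
  by (simp add: affine_space_def)

lemma regular_affine:
  "regular (affine_space I) U f \<longleftrightarrow> openin (zariski I) U \<and>
     (\<forall>x\<in>U. \<exists>V p r. x \<in> V \<and> V \<subseteq> U \<and> openin (zariski I) V \<and> p \<in> poly_fun I \<and> r \<in> poly_fun I \<and>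
        (\<forall>y\<in>V. r y \<noteq> 0 \<and> f y = p y / r y))"
  by (simp add: affine_space_def)

lemma regular_affineE:
  assumes "regular (affine_space I) U f" "x \<in> U"
  obtains V p r where "x \<in> V" "V \<subseteq> U" "openin (zariski I) V" "p \<in> poly_fun I" "r \<in> poly_fun I"
    "\<forall>y\<in>V. r y \<noteq> 0 \<and> f y = p y / r y"
proof -
  have "\<exists>V p r. x \<in> V \<and> V \<subseteq> U \<and> openin (zariski I) V \<and> p \<in> poly_fun I \<and> r \<in> poly_fun I \<and>
        (\<forall>y\<in>V. r y \<noteq> 0 \<and> f y = p y / r y)"
    using assms unfolding regular_affine by (elim conjE) (erule (1) bspec)
  then show ?thesis using that by (elim exE conjE)
qed

lemma poly_fun_prod:
  "finite A \<Longrightarrow> (\<And>a. a \<in> A \<Longrightarrow> p a \<in> poly_fun I) \<Longrightarrow> (\<lambda>x. \<Prod>a\<in>A. p a x) \<in> poly_fun I"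
  by (induction A rule: finite_induct) (auto intro: poly_fun.intros)

lemma poly_fun_cong:
  "p \<in> poly_fun I \<Longrightarrow> (\<And>i. i \<in> I \<Longrightarrow> x i = y i) \<Longrightarrow> p x = p y"
  by (induction rule: poly_fun.induct) auto

lemma poly_fun_subst:
  assumes "p \<in> poly_fun I" "\<And>i. i \<in> I \<Longrightarrow> (\<lambda>y. h y i) \<in> poly_fun J"
  shows "(\<lambda>y. p (h y)) \<in> poly_fun J"
  using assms by (induction rule: poly_fun.induct) (auto intro: poly_fun.intros)

lemma openin_zariski_nonzero:
  assumes "p \<in> poly_fun I"
  shows "openin (zariski I) {x \<in> cspace I. p x \<noteq> 0}"
  unfolding openin_zariski
  by (rule exI[of _ "{p}"]) (use assms in \<open>auto simp: zero_locus_def\<close>)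

lemma openin_zariskiE:
  assumes "openin (zariski I) U"
  obtains F where "F \<subseteq> poly_fun I" "U = cspace I - zero_locus I F"
  using assms unfolding openin_zariski by (elim exE conjE)

lemma closedin_zariski:
  "closedin (zariski I) C \<longleftrightarrow> (\<exists>F\<subseteq>poly_fun I. C = zero_locus I F)"
proof
  assume "closedin (zariski I) C"
  then have C: "C \<subseteq> cspace I" and "openin (zariski I) (cspace I - C)" by (auto simp: closedin_def)
  from this(2) obtain F where F: "F \<subseteq> poly_fun I" "cspace I - C = cspace I - zero_locus I F"
    by (rule openin_zariskiE)
  moreover have "zero_locus I F \<subseteq> cspace I" by (auto simp: zero_locus_def)
  ultimately have "C = zero_locus I F" using C by (metis double_diff order_refl)
  then show "\<exists>F\<subseteq>poly_fun I. C = zero_locus I F" using F by blast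
next
  assume "\<exists>F\<subseteq>poly_fun I. C = zero_locus I F"
  moreover have "zero_locus I F \<subseteq> cspace I" for F by (auto simp: zero_locus_def)
  ultimately show "closedin (zariski I) C" unfolding closedin_def openin_zariski by auto
qed

lemma swf_affine: "space_with_functions (affine_space I)"
  unfolding space_with_functions_def
proof (intro conjI allI impI)
  fix U f assume "regular (affine_space I) U f"
  then show "openin (zar (affine_space I)) U" by (simp add: regular_affine)
next
  fix U and f g :: "('a \<Rightarrow> complex) \<Rightarrow> complex"
  assume r: "regular (affine_space I) U f" "\<forall>x\<in>U. f x = g x"
  show "regular (affine_space I) U g"
    unfolding regular_affine
  proof (intro conjI ballI)
    show "openin (zariski I) U" using r by (simp add: regular_affine)
    fix x assume "x \<in> U"
    from regular_affineE[OF r(1) this] obtain V p q where "x \<in> V" "V \<subseteq> U" "openin (zariski I) V"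
      "p \<in> poly_fun I"
      "q \<in> poly_fun I" "\<forall>y\<in>V. q y \<noteq> 0 \<and> f y = p y / q y" .
    moreover from this have "\<forall>y\<in>V. q y \<noteq> 0 \<and> g y = p y / q y" using r(2) subsetD by metis
    ultimately show "\<exists>V p r. x \<in> V \<and> V \<subseteq> U \<and> openin (zariski I) V \<and> p \<in> poly_fun I \<and> r \<in> poly_fun I \<and>
        (\<forall>y\<in>V. r y \<noteq> 0 \<and> g y = p y / r y)"
      by (rule_tac exI[of _ V], rule_tac exI[of _ p], rule_tac exI[of _ q]) (intro conjI)
  qed
next
  fix U V f
  assume r: "regular (affine_space I) U f" and V: "openin (zar (affine_space I)) V" "V \<subseteq> U"
  show "regular (affine_space I) V f"
    unfolding regular_affine
  proof (intro conjI ballI)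
    show op: "openin (zariski I) V" using V by simp
    fix x assume x: "x \<in> V"
    then have "x \<in> U" using V by blast
    from regular_affineE[OF r(1) this] obtain W p q where "x \<in> W" "W \<subseteq> U" "openin (zariski I) W"
      "p \<in> poly_fun I"
      "q \<in> poly_fun I" "\<forall>y\<in>W. q y \<noteq> 0 \<and> f y = p y / q y" .
    then show "\<exists>W p r. x \<in> W \<and> W \<subseteq> V \<and> openin (zariski I) W \<and> p \<in> poly_fun I \<and> r \<in> poly_fun I \<and>
        (\<forall>y\<in>W. r y \<noteq> 0 \<and> f y = p y / r y)"
      using x op by (intro exI[of _ "W \<inter> V"] exI[of _ p] exI[of _ q]) (auto simp: openin_Int)
  qed
next
  fix \<U> f assume U: "\<forall>U\<in>\<U>. regular (affine_space I) U f"
  show "regular (affine_space I) (\<Union>\<U>) f"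
    unfolding regular_affine
  proof (intro conjI ballI)
    show "openin (zariski I) (\<Union>\<U>)" using U by (auto simp: regular_affine)
    fix x assume "x \<in> \<Union>\<U>"
    then obtain U where U': "U \<in> \<U>" "x \<in> U" by blast
    then have "regular (affine_space I) U f" using U by blast
    from regular_affineE[OF this U'(2)] obtain W p q where "x \<in> W" "W \<subseteq> U" "openin (zariski I) W"
      "p \<in> poly_fun I"
      "q \<in> poly_fun I" "\<forall>y\<in>W. q y \<noteq> 0 \<and> f y = p y / q y" .
    then show "\<exists>W p r. x \<in> W \<and> W \<subseteq> \<Union>\<U> \<and> openin (zariski I) W \<and> p \<in> poly_fun I \<and>
        r \<in> poly_fun I \<and> (\<forall>y\<in>W. r y \<noteq> 0 \<and> f y = p y / r y)"
      using U'(1) by (intro exI[of _ W] exI[of _ p] exI[of _ q]) auto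
  qed
qed

lemma ringed_affine: "ringed_space (affine_space I)"
  unfolding ringed_space_def
proof (intro conjI allI impI swf_affine)
  fix U and c :: complex assume U: "openin (zar (affine_space I)) U"
  show "regular (affine_space I) U (\<lambda>_. c)"
    unfolding regular_affine
  proof (intro conjI ballI)
    fix x assume "x \<in> U"
    then show "\<exists>V p r. x \<in> V \<and> V \<subseteq> U \<and> openin (zariski I) V \<and> p \<in> poly_fun I \<and> r \<in> poly_fun I \<and>
        (\<forall>y\<in>V. r y \<noteq> 0 \<and> c = p y / r y)"
      using U by (intro exI[of _ U] exI[of _ "\<lambda>_. c"] exI[of _ "\<lambda>_. 1"]) (auto intro: pf_const)
  qed (use U in simp)
next
  fix U f g assume f: "regular (affine_space I) U f" and g: "regular (affine_space I) U g"
  have ex: "\<exists>W p q p' q'. x \<in> W \<and> W \<subseteq> U \<and> openin (zariski I) W \<and> p \<in> poly_fun I \<and>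
      q \<in> poly_fun I \<and> p' \<in> poly_fun I \<and> q' \<in> poly_fun I \<and>
      (\<forall>y\<in>W. q y \<noteq> 0 \<and> q' y \<noteq> 0 \<and> f y = p y / q y \<and> g y = p' y / q' y)" if x: "x \<in> U" for x
  proof -
    obtain V p q where V: "x \<in> V" "V \<subseteq> U" "openin (zariski I) V" "p \<in> poly_fun I"
      "q \<in> poly_fun I" "\<forall>y\<in>V. q y \<noteq> 0 \<and> f y = p y / q y"
      using f x by (rule regular_affineE)
    obtain W p' q' where W: "x \<in> W" "W \<subseteq> U" "openin (zariski I) W" "p' \<in> poly_fun I"
      "q' \<in> poly_fun I" "\<forall>y\<in>W. q' y \<noteq> 0 \<and> g y = p' y / q' y"
      using g x by (rule regular_affineE)
    have "openin (zariski I) (V \<inter> W)" using V(3) W(3) by (rule openin_Int)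
    moreover have "\<forall>y\<in>V \<inter> W. q y \<noteq> 0 \<and> q' y \<noteq> 0 \<and> f y = p y / q y \<and> g y = p' y / q' y"
      using V(6) W(6) by blast
    moreover have "x \<in> V \<inter> W" "V \<inter> W \<subseteq> U" using V W by auto
    ultimately show ?thesis using V(4,5) W(4,5)
      by (rule_tac exI[of _ "V \<inter> W"], rule_tac exI[of _ p], rule_tac exI[of _ q],
          rule_tac exI[of _ p'], rule_tac exI[of _ q']) (intro conjI)
  qed
  have op: "openin (zariski I) U" using f by (simp add: regular_affine)
  show "regular (affine_space I) U (\<lambda>x. f x + g x)"
    unfolding regular_affine
  proof (intro conjI ballI op)
    fix x assume "x \<in> U"
    from ex[OF this] obtain W p q p' q' where "x \<in> W" "W \<subseteq> U" "openin (zariski I) W"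
      "p \<in> poly_fun I" "q \<in> poly_fun I" "p' \<in> poly_fun I" "q' \<in> poly_fun I"
      "\<forall>y\<in>W. q y \<noteq> 0 \<and> q' y \<noteq> 0 \<and> f y = p y / q y \<and> g y = p' y / q' y" by (elim exE conjE)
    then show "\<exists>V p r. x \<in> V \<and> V \<subseteq> U \<and> openin (zariski I) V \<and> p \<in> poly_fun I \<and> r \<in> poly_fun I \<and>
        (\<forall>y\<in>V. r y \<noteq> 0 \<and> f y + g y = p y / r y)"
      by (intro exI[of _ W] exI[of _ "\<lambda>x. p x * q' x + p' x * q x"] exI[of _ "\<lambda>x. q x * q' x"])
        (auto intro: poly_fun.intros simp: add_frac_eq)
  qed
  show "regular (affine_space I) U (\<lambda>x. f x * g x)"
    unfolding regular_affine
  proof (intro conjI ballI op)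
    fix x assume "x \<in> U"
    from ex[OF this] obtain W p q p' q' where "x \<in> W" "W \<subseteq> U" "openin (zariski I) W"
      "p \<in> poly_fun I" "q \<in> poly_fun I" "p' \<in> poly_fun I" "q' \<in> poly_fun I"
      "\<forall>y\<in>W. q y \<noteq> 0 \<and> q' y \<noteq> 0 \<and> f y = p y / q y \<and> g y = p' y / q' y" by (elim exE conjE)
    then show "\<exists>V p r. x \<in> V \<and> V \<subseteq> U \<and> openin (zariski I) V \<and> p \<in> poly_fun I \<and> r \<in> poly_fun I \<and>
        (\<forall>y\<in>V. r y \<noteq> 0 \<and> f y * g y = p y / r y)"
      by (intro exI[of _ W] exI[of _ "\<lambda>x. p x * p' x"] exI[of _ "\<lambda>x. q x * q' x"])
        (auto intro: poly_fun.intros)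
  qed
next
  fix U f assume f: "regular (affine_space I) U f"
  have ex: "\<exists>W p q. x \<in> W \<and> W \<subseteq> {x \<in> U. f x \<noteq> 0} \<and> openin (zariski I) W \<and> p \<in> poly_fun I \<and>
      q \<in> poly_fun I \<and> (\<forall>y\<in>W. p y \<noteq> 0 \<and> inverse (f y) = q y / p y)"
    if x: "x \<in> U" "f x \<noteq> 0" for x
  proof -
    obtain V p q where V: "x \<in> V" "V \<subseteq> U" "openin (zariski I) V" "p \<in> poly_fun I"
      "q \<in> poly_fun I" "\<forall>y\<in>V. q y \<noteq> 0 \<and> f y = p y / q y"
      using f x(1) by (rule regular_affineE)
    have sub: "V \<subseteq> cspace I" using openin_subset[OF V(3)] by simp
    have W: "openin (zariski I) (V \<inter> {x \<in> cspace I. p x \<noteq> 0})"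
      using V(3) openin_zariski_nonzero[OF V(4)] by (rule openin_Int)
    have 1: "x \<in> V \<inter> {x \<in> cspace I. p x \<noteq> 0}" using V(1,6) x sub by auto
    have 2: "V \<inter> {x \<in> cspace I. p x \<noteq> 0} \<subseteq> {x \<in> U. f x \<noteq> 0}" using V(2,6) by auto
    have 3: "\<forall>y\<in>V \<inter> {x \<in> cspace I. p x \<noteq> 0}. p y \<noteq> 0 \<and> inverse (f y) = q y / p y"
      using V(6) by (auto simp: field_simps)
    show ?thesis
      by (rule exI[of _ "V \<inter> {x \<in> cspace I. p x \<noteq> 0}"], rule exI[of _ p], rule exI[of _ q])
        (intro conjI 1 2 3 W V(4,5))
  qed
  have "\<exists>T. openin (zariski I) T \<and> x \<in> T \<and> T \<subseteq> {x \<in> U. f x \<noteq> 0}" if "x \<in> {x \<in> U. f x \<noteq> 0}" for x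
  proof -
    from that have "x \<in> U" "f x \<noteq> 0" by auto
    from ex[OF this] obtain W where "x \<in> W" "W \<subseteq> {x \<in> U. f x \<noteq> 0}" "openin (zariski I) W"
      by (elim exE conjE)
    then show ?thesis by blast
  qed
  then have op: "openin (zariski I) {x \<in> U. f x \<noteq> 0}" by (subst openin_subopen) blast
  then show "openin (zar (affine_space I)) {x \<in> U. f x \<noteq> 0}" by simp
  show "regular (affine_space I) {x \<in> U. f x \<noteq> 0} (\<lambda>x. inverse (f x))"
    unfolding regular_affine
  proof (intro conjI ballI op)
    fix x assume "x \<in> {x \<in> U. f x \<noteq> 0}"
    then have "x \<in> U" "f x \<noteq> 0" by auto
    from ex[OF this] obtain W p q where "x \<in> W" "W \<subseteq> {x \<in> U. f x \<noteq> 0}" "openin (zariski I) W"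
      "p \<in> poly_fun I" "q \<in> poly_fun I" "\<forall>y\<in>W. p y \<noteq> 0 \<and> inverse (f y) = q y / p y"
      by (elim exE conjE)
    then show "\<exists>V p r. x \<in> V \<and> V \<subseteq> {x \<in> U. f x \<noteq> 0} \<and> openin (zariski I) V \<and>
        p \<in> poly_fun I \<and> r \<in> poly_fun I \<and> (\<forall>y\<in>V. r y \<noteq> 0 \<and> inverse (f y) = p y / r y)"
      by (rule_tac exI[of _ W], rule_tac exI[of _ q], rule_tac exI[of _ p]) (intro conjI)
  qed
qed

lemma regular_affine_poly:
  assumes "p \<in> poly_fun I"
  shows "regular (affine_space I) (cspace I) p"
  unfolding regular_affine
proof (intro conjI ballI)
  show op: "openin (zariski I) (cspace I)" using openin_topspace[of "zariski I"] by simp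
  fix x assume "x \<in> cspace I"
  then show "\<exists>V q r. x \<in> V \<and> V \<subseteq> cspace I \<and> openin (zariski I) V \<and> q \<in> poly_fun I \<and>
      r \<in> poly_fun I \<and> (\<forall>y\<in>V. r y \<noteq> 0 \<and> p y = q y / r y)"
    using assms op
    by (intro exI[of _ "cspace I"] exI[of _ p] exI[of _ "\<lambda>_. 1"]) (auto intro: pf_const)
qed

lemma regular_poly_comp:
  assumes R: "ringed_space X" and c: "\<And>i. i \<in> I \<Longrightarrow> regular X (points X) (\<lambda>x. \<phi> x i)"
    and p: "p \<in> poly_fun I"
  shows "regular X (points X) (\<lambda>x. p (\<phi> x))"
  using p
proof (induction rule: poly_fun.induct)
  case (pf_const c)
  then show ?case using ringed_const[OF R, of "points X" c] by simp
qed (use c ringed_add[OF R] ringed_mult[OF R] in auto)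

text \<open>Polynomials in regular coordinates are regular, so nonvanishing loci have open
  preimages, and a local fraction \<open>p / q\<close> pulls back to a product with an
  inverse.\<close>

lemma morphism_affineI:
  assumes R: "ringed_space X" and im: "\<And>x. x \<in> points X \<Longrightarrow> \<phi> x \<in> cspace I"
    and c: "\<And>i. i \<in> I \<Longrightarrow> regular X (points X) (\<lambda>x. \<phi> x i)"
  shows "morphism X (affine_space I) \<phi>"
proof -
  note X = ringed_swf[OF R]
  have P: "regular X (points X) (\<lambda>x. p (\<phi> x))" if "p \<in> poly_fun I" for p
    by (rule regular_poly_comp[OF R _ that]) (rule c)
  have op: "openin (zar X) {x \<in> points X. \<phi> x \<in> U}" if U: "openin (zariski I) U" for U
  proof -
    obtain F where F: "F \<subseteq> poly_fun I" "U = cspace I - zero_locus I F"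
      using U by (rule openin_zariskiE)
    have "{x \<in> points X. \<phi> x \<in> U} = (\<Union>p\<in>F. {x \<in> points X. p (\<phi> x) \<noteq> 0})"
      using im unfolding F(2) zero_locus_def by auto
    moreover have "openin (zar X) {x \<in> points X. p (\<phi> x) \<noteq> 0}" if "p \<in> F" for p
      by (rule ringed_nonzero_open[OF R P]) (use that F(1) in auto)
    ultimately show ?thesis by auto
  qed
  show ?thesis
    unfolding morphism_def
  proof (intro conjI allI impI)
    show "continuous_map (zar X) (zar (affine_space I)) \<phi>"
      using im op by (auto simp: continuous_map_def)
    fix V f assume f: "regular (affine_space I) V f"
    show "regular X {x \<in> points X. \<phi> x \<in> V} (\<lambda>x. f (\<phi> x))"
    proof (rule swf_local[OF X])
      show "openin (zar X) {x \<in> points X. \<phi> x \<in> V}" using f op by (simp add: regular_affine)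
      fix x assume x: "x \<in> {x \<in> points X. \<phi> x \<in> V}"
      then have "\<phi> x \<in> V" by simp
      from regular_affineE[OF f this] obtain W p q where W: "\<phi> x \<in> W" "W \<subseteq> V"
        "openin (zariski I) W" "p \<in> poly_fun I" "q \<in> poly_fun I"
        "\<forall>y\<in>W. q y \<noteq> 0 \<and> f y = p y / q y" .
      let ?W = "{x \<in> points X. \<phi> x \<in> W}"
      have "regular X ?W (\<lambda>x. q (\<phi> x))" "regular X ?W (\<lambda>x. p (\<phi> x))"
        by (rule swf_restrict[OF X P[OF W(5)] op[OF W(3)]], simp,
            rule swf_restrict[OF X P[OF W(4)] op[OF W(3)]], simp)
      then have "regular X ?W (\<lambda>x. p (\<phi> x) * inverse (q (\<phi> x)))"
        using ringed_inverse_nonzero[OF R, of ?W "\<lambda>x. q (\<phi> x)"] W(6) ringed_mult[OF R] by simp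
      moreover have "\<forall>y\<in>?W \<inter> {x \<in> points X. \<phi> x \<in> V}. f (\<phi> y) = p (\<phi> y) * inverse (q (\<phi> y))"
        using W(6) by (auto simp: divide_inverse)
      ultimately show "\<exists>W g. x \<in> W \<and> regular X W g \<and>
          (\<forall>y\<in>W \<inter> {x \<in> points X. \<phi> x \<in> V}. f (\<phi> y) = g y)"
        using x W(1) by (intro exI[of _ ?W] exI[of _ "\<lambda>y. p (\<phi> y) * inverse (q (\<phi> y))"]) auto
    qed
  qed
qed

lemma morphism_affineD:
  assumes m: "morphism X (affine_space I) \<phi>" and i: "i \<in> I"
  shows "regular X (points X) (\<lambda>x. \<phi> x i)"
proof -
  have "{x \<in> points X. \<phi> x \<in> cspace I} = points X" using morphism_image[OF m] by auto
  then show ?thesis using morphism_regular[OF m regular_affine_poly[OF pf_coord[OF i]]] by simp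
qed

text \<open>A single fraction valid on all of \<open>A\<close>: more than regularity, but visibly
  stable under restriction, products and inverses. The coordinate changes below all have this
  form.\<close>

definition rational_on ::
  "'i set \<Rightarrow> ('i \<Rightarrow> complex) set \<Rightarrow> (('i \<Rightarrow> complex) \<Rightarrow> complex) \<Rightarrow> bool" where
  "rational_on I A f \<longleftrightarrow>
     (\<exists>p\<in>poly_fun I. \<exists>r\<in>poly_fun I. \<forall>x\<in>A. r x \<noteq> 0 \<and> f x = p x / r x)"

lemma rational_onE:
  assumes "rational_on I A f"
  obtains p r where "p \<in> poly_fun I" "r \<in> poly_fun I" "\<forall>x\<in>A. r x \<noteq> 0 \<and> f x = p x / r x"
  using assms unfolding rational_on_def by (elim bexE)

lemma rational_on_cong:
  assumes "rational_on I A f" "\<And>x. x \<in> A \<Longrightarrow> f x = g x"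
  shows "rational_on I A g"
proof -
  obtain p r where 1: "p \<in> poly_fun I" "r \<in> poly_fun I" "\<forall>x\<in>A. r x \<noteq> 0 \<and> f x = p x / r x"
    using assms(1) by (rule rational_onE)
  show ?thesis unfolding rational_on_def
    by (rule bexI[OF _ 1(1)], rule bexI[OF _ 1(2)]) (use 1(3) assms(2) in auto)
qed

lemma rational_on_poly: "p \<in> poly_fun I \<Longrightarrow> rational_on I A p"
  unfolding rational_on_def by (intro bexI[of _ p] bexI[of _ "\<lambda>_. 1"]) (auto intro: pf_const)

lemma rational_on_const: "rational_on I A (\<lambda>_. c)"
  by (intro rational_on_poly pf_const)

lemma rational_on_coord: "i \<in> I \<Longrightarrow> rational_on I A (\<lambda>x. x i)"
  by (intro rational_on_poly pf_coord)


lemma rational_on_mono: "rational_on I A f \<Longrightarrow> B \<subseteq> A \<Longrightarrow> rational_on I B f"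
  unfolding rational_on_def by (meson subsetD)

lemma rational_on_mult:
  assumes "rational_on I A f" "rational_on I A g"
  shows "rational_on I A (\<lambda>x. f x * g x)"
proof -
  obtain p r where 1: "p \<in> poly_fun I" "r \<in> poly_fun I" "\<forall>x\<in>A. r x \<noteq> 0 \<and> f x = p x / r x"
    using assms(1) by (rule rational_onE)
  obtain p' r' where 2: "p' \<in> poly_fun I" "r' \<in> poly_fun I" "\<forall>x\<in>A. r' x \<noteq> 0 \<and> g x = p' x / r' x"
    using assms(2) by (rule rational_onE)
  show ?thesis unfolding rational_on_def
    by (intro bexI[of _ "\<lambda>x. p x * p' x"] bexI[of _ "\<lambda>x. r x * r' x"])
      (use 1 2 in \<open>auto intro: poly_fun.intros\<close>)
qed

lemma rational_on_inverse:
  assumes "rational_on I A f" "\<And>x. x \<in> A \<Longrightarrow> f x \<noteq> 0"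
  shows "rational_on I A (\<lambda>x. inverse (f x))"
proof -
  obtain p r where 1: "p \<in> poly_fun I" "r \<in> poly_fun I" "\<forall>x\<in>A. r x \<noteq> 0 \<and> f x = p x / r x"
    using assms(1) by (rule rational_onE)
  show ?thesis unfolding rational_on_def
    by (rule bexI[OF _ 1(2)], rule bexI[OF _ 1(1)]) (use 1(3) assms(2) in auto)
qed

lemma regular_subspace_restrict:
  assumes X: "space_with_functions X" and f: "regular X U f"
  shows "regular (subspace_on X A) (U \<inter> A) f"
  unfolding regular_subspace openin_subtopology using f swf_open[OF X f] by blast

lemma regular_rational_on:
  assumes A: "A \<subseteq> cspace I" and f: "rational_on I A f"
  shows "regular (subspace_on (affine_space I) A) A f"
proof -
  let ?Y = "subspace_on (affine_space I) A"
  obtain p r where 1: "p \<in> poly_fun I" "r \<in> poly_fun I" "\<forall>x\<in>A. r x \<noteq> 0 \<and> f x = p x / r x"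
    using f by (rule rational_onE)
  have R: "ringed_space ?Y" by (rule ringed_subspace[OF ringed_affine])
  have "regular ?Y A p" "regular ?Y A r"
    using regular_subspace_restrict[OF swf_affine regular_affine_poly] 1(1,2) A
    by (metis inf.absorb2)+
  then have "regular ?Y A (\<lambda>x. p x * inverse (r x))"
    using ringed_inverse_nonzero[OF R] 1(3) ringed_mult[OF R] by blast
  then show ?thesis
    by (rule swf_cong[OF ringed_swf[OF R]]) (use 1(3) in \<open>auto simp: divide_inverse\<close>)
qed

lemma morphism_rational:
  assumes A: "A \<subseteq> cspace I" and im: "\<And>x. x \<in> A \<Longrightarrow> \<phi> x \<in> B" and B: "B \<subseteq> cspace J"
    and c: "\<And>j. j \<in> J \<Longrightarrow> rational_on I A (\<lambda>x. \<phi> x j)"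
  shows "morphism (subspace_on (affine_space I) A) (subspace_on (affine_space J) B) \<phi>"
proof -
  have p: "points (subspace_on (affine_space I) A) = A" using A by auto
  have "morphism (subspace_on (affine_space I) A) (affine_space J) \<phi>"
  proof (rule morphism_affineI[OF ringed_subspace[OF ringed_affine]])
    show "\<phi> x \<in> cspace J" if "x \<in> points (subspace_on (affine_space I) A)" for x
      using that im B unfolding p by blast
    show "regular (subspace_on (affine_space I) A) (points (subspace_on (affine_space I) A))
        (\<lambda>x. \<phi> x j)" if "j \<in> J" for j
      unfolding p by (rule regular_rational_on[OF A c[OF that]])
  qed
  then show ?thesis
    by (rule morphism_into_subspace[OF swf_subspace[OF swf_affine]]) (use im p in blast)
qed

lemma isomorphic_subspace_points:
  assumes X: "space_with_functions X"
  shows "isomorphic X (subspace_on X (points X))"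
  unfolding isomorphic_def
  using morphism_inclusion[OF X, of "points X"]
    morphism_into_subspace[OF X morphism_id[OF X], of "points X"]
  by (intro exI[of _ "\<lambda>x. x"]) auto

lemma iso_pair_reindex:
  assumes e: "bij_betw e J I"
  shows "iso_pair (affine_space I) (affine_space J) (\<lambda>x. \<lambda>j\<in>J. x (e j))
           (\<lambda>y. \<lambda>i\<in>I. y (inv_into J e i))"
proof -
  have inv: "inv_into J e i \<in> J" "e (inv_into J e i) = i" if "i \<in> I" for i
    using e that by (auto simp: bij_betw_def inv_into_into f_inv_into_f)
  have eI: "e j \<in> I" "inv_into J e (e j) = j" if "j \<in> J" for j
    using e that by (auto simp: bij_betw_def)
  have reg: "regular (affine_space K) (points (affine_space K)) (\<lambda>x. x k)"
    if "k \<in> K" for K and k :: 'k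
    using regular_affine_poly[OF pf_coord[OF that]] by simp
  have 1: "morphism (affine_space I) (affine_space J) (\<lambda>x. \<lambda>j\<in>J. x (e j))"
    by (rule morphism_affineI[OF ringed_affine], force) (use reg[OF eI(1)] in simp)
  have 2: "morphism (affine_space J) (affine_space I) (\<lambda>y. \<lambda>i\<in>I. y (inv_into J e i))"
    by (rule morphism_affineI[OF ringed_affine], force) (use reg[OF inv(1)] in simp)
  show ?thesis
    unfolding iso_pair_def
    using 1 2 eI inv by (auto simp: PiE_iff extensional_def restrict_def fun_eq_iff)
qed

section \<open>Affine varieties and separatedness\<close>

lemma affine_variety_iso: "isomorphic X Y \<Longrightarrow> affine_variety X \<Longrightarrow> affine_variety Y"
  unfolding affine_variety_def using isomorphic_sym isomorphic_trans by blast

lemma affine_variety_closed: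
  assumes I: "finite I" and C: "closedin (zariski I) C"
  shows "affine_variety (subspace_on (affine_space I) C)"
proof -
  obtain e where "bij_betw e {0..<card I} I" using ex_bij_betw_nat_finite[OF I] by blast
  then have e: "bij_betw e {..<card I} I" by (simp add: atLeast0LessThan)
  note i = iso_pair_reindex[OF e]
  show ?thesis
    unfolding affine_variety_def
    using isomorphic_subspace_image[OF swf_affine swf_affine i] iso_pair_closedin[OF i] C
      closedin_subset[OF C] by auto
qed

text \<open>Rabinowitsch's device: an extra coordinate \<open>None\<close> for the inverse of
  \<open>f\<close> turns the locus where \<open>f\<close> does not vanish into a closed set.\<close>

lemma affine_variety_principal:
  assumes I: "finite I" and C: "closedin (zariski I) C" and f: "f \<in> poly_fun I"
  shows "affine_variety (subspace_on (affine_space I) {x \<in> C. f x \<noteq> 0})"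
proof -
  define J where "J = insert None (Some ` I)"
  define \<phi> where "\<phi> = (\<lambda>x. \<lambda>j\<in>J. case j of Some i \<Rightarrow> x i | None \<Rightarrow> inverse (f x))"
  define \<psi> where "\<psi> = (\<lambda>y. \<lambda>i\<in>I. y (Some i) :: complex)"
  obtain F where F: "F \<subseteq> poly_fun I" "C = zero_locus I F" using C closedin_zariski by blast
  let ?A = "{x \<in> C. f x \<noteq> 0}"
  let ?G = "insert (\<lambda>y. y None * f (\<lambda>i. y (Some i)) + (- 1)) ((\<lambda>p y. p (\<lambda>i. y (Some i))) ` F)"
  let ?B = "zero_locus J ?G"
  have sub: "(\<lambda>y. p (\<lambda>i. y (Some i))) \<in> poly_fun J" if "p \<in> poly_fun I" for p
    using that by (rule poly_fun_subst) (auto simp: J_def intro: pf_coord)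
  have G: "?G \<subseteq> poly_fun J"
  proof (rule insert_subsetI)
    show "(\<lambda>y. y None * f (\<lambda>i. y (Some i)) + (- 1)) \<in> poly_fun J"
      by (intro pf_add pf_mult pf_const sub[OF f] pf_coord) (simp add: J_def)
    show "(\<lambda>p y. p (\<lambda>i. y (Some i))) ` F \<subseteq> poly_fun J" using sub F(1) by blast
  qed
  have p\<psi>: "p (\<psi> y) = p (\<lambda>i. y (Some i))" if "p \<in> poly_fun I" for p y
    using that by (rule poly_fun_cong) (simp add: \<psi>_def)
  have p\<phi>: "p (\<lambda>i. \<phi> x (Some i)) = p x" if "p \<in> poly_fun I" for p x
    using that by (rule poly_fun_cong) (simp add: \<phi>_def J_def)
  have A: "?A \<subseteq> cspace I" unfolding F zero_locus_def by auto
  have B: "?B \<subseteq> cspace J" unfolding zero_locus_def by auto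
  have im1: "\<phi> x \<in> ?B" if x: "x \<in> ?A" for x
  proof -
    have "\<phi> x \<in> cspace J" "\<phi> x None = inverse (f x)" by (auto simp: \<phi>_def J_def)
    moreover have "p (\<lambda>i. \<phi> x (Some i)) = 0" if "p \<in> F" for p
      using x that p\<phi>[of p x] F(1) unfolding F(2) zero_locus_def by auto
    ultimately show ?thesis using x p\<phi>[OF f, of x] unfolding zero_locus_def by auto
  qed
  have im2: "\<psi> y \<in> ?A" if y: "y \<in> ?B" for y
  proof -
    have "y None * f (\<psi> y) + (- 1) = 0" using y p\<psi>[OF f] unfolding zero_locus_def by auto
    then have "f (\<psi> y) \<noteq> 0" by auto
    moreover have "p (\<psi> y) = 0" if "p \<in> F" for p
      using y p\<psi>[of p] F(1) that unfolding zero_locus_def by auto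
    ultimately show ?thesis unfolding F(2) zero_locus_def by (auto simp: \<psi>_def)
  qed
  have "rational_on I ?A (\<lambda>x. \<phi> x j)" if j: "j \<in> J" for j
  proof (cases j)
    case None
    have "rational_on I ?A (\<lambda>x. inverse (f x))"
      by (rule rational_on_inverse[OF rational_on_poly[OF f]]) auto
    then show ?thesis using None j by (simp add: \<phi>_def)
  next
    case (Some i)
    then show ?thesis using j rational_on_coord[of i I ?A] by (auto simp: \<phi>_def J_def)
  qed
  from morphism_rational[OF A im1 B this]
  have 1: "morphism (subspace_on (affine_space I) ?A) (subspace_on (affine_space J) ?B) \<phi>" .
  have "rational_on J ?B (\<lambda>y. \<psi> y i)" if i: "i \<in> I" for i
    using i rational_on_coord[of "Some i" J ?B] by (auto simp: \<psi>_def J_def)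
  from morphism_rational[OF B im2 A this]
  have 2: "morphism (subspace_on (affine_space J) ?B) (subspace_on (affine_space I) ?A) \<psi>" .
  have 3: "\<psi> (\<phi> x) = x" if "x \<in> ?A" for x
  proof
    fix i show "\<psi> (\<phi> x) i = x i"
    proof (cases "i \<in> I")
      case False
      then show ?thesis using A that by (auto simp: \<psi>_def PiE_iff extensional_def)
    qed (simp add: \<psi>_def \<phi>_def J_def)
  qed
  have 4: "\<phi> (\<psi> y) = y" if y: "y \<in> ?B" for y
  proof
    fix j show "\<phi> (\<psi> y) j = y j"
    proof (cases "j \<in> J")
      case True
      have "y None * f (\<psi> y) + (- 1) = 0" using y p\<psi>[OF f] unfolding zero_locus_def by auto
      then have "f (\<psi> y) * y None = 1" by (simp add: add_eq_0_iff mult.commute)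
      then have "y None = inverse (f (\<psi> y))" by (rule inverse_unique[symmetric])
      then show ?thesis using True by (cases j) (auto simp: \<phi>_def \<psi>_def J_def)
    next
      case False
      then show ?thesis using B y by (auto simp: \<phi>_def PiE_iff extensional_def)
    qed
  qed
  have pts: "points (subspace_on (affine_space I) ?A) = ?A"
    "points (subspace_on (affine_space J) ?B) = ?B" using A B by auto
  have "isomorphic (subspace_on (affine_space J) ?B) (subspace_on (affine_space I) ?A)"
    unfolding isomorphic_def pts
    by (rule exI[of _ \<psi>], rule exI[of _ \<phi>], intro conjI ballI) (rule 1 2 3 4, assumption?)+
  moreover have "affine_variety (subspace_on (affine_space J) ?B)"
  proof (rule affine_variety_closed)
    show "finite J" using I by (simp add: J_def)
    show "closedin (zariski J) ?B"
      unfolding closedin_zariski by (rule exI[of _ ?G]) (intro conjI G refl)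
  qed
  ultimately show ?thesis by (rule affine_variety_iso)
qed

text \<open>If \<open>\<phi> z\<^sub>0 = x\<close> and \<open>\<psi> z\<^sub>0 = y\<close>, then \<open>f (\<phi> z) * g (\<psi> z)\<close> is different from \<open>1\<close> for \<open>z\<close>
  near \<open>z\<^sub>0\<close>, but it is \<open>1\<close> wherever \<open>\<phi>\<close> and \<open>\<psi>\<close> agree; so the coincidence locus is closed.\<close>

definition functions_separate :: "'p fspace \<Rightarrow> bool" where
  "functions_separate X \<longleftrightarrow> (\<forall>x\<in>points X. \<forall>y\<in>points X. x \<noteq> y \<longrightarrow>
     (\<exists>U V f g. x \<in> U \<and> y \<in> V \<and> regular X U f \<and> regular X V g \<and>
        (\<forall>z\<in>U \<inter> V. f z * g z = 1) \<and> f x * g y \<noteq> 1))"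

lemma separate_by_function:
  assumes R: "ringed_space X" and f: "regular X U f" and xy: "x \<in> U" "y \<in> U" "f x \<noteq> f y"
  shows "\<exists>U V f g. x \<in> U \<and> y \<in> V \<and> regular X U f \<and> regular X V g \<and>
        (\<forall>z\<in>U \<inter> V. f z * g z = 1) \<and> f x * g y \<noteq> 1"
proof -
  \<comment> \<open>Shifted to take the value 1 at \<open>y\<close>, so that its inverse is regular
    near \<open>y\<close> and the product of the values at \<open>x\<close> and \<open>y\<close> is
    \<open>1 + f x - f y\<close>, which is not 1.\<close>
  let ?f = "\<lambda>z. f z + (1 - f y)"
  have r: "regular X U ?f"
    using ringed_add[OF R f ringed_const[OF R swf_open[OF ringed_swf[OF R] f]]] .
  show ?thesis
    by (rule exI[of _ U], rule exI[of _ "{z \<in> U. ?f z \<noteq> 0}"], rule exI[of _ ?f],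
        rule exI[of _ "\<lambda>z. inverse (?f z)"])
      (use r ringed_inverse[OF R r] xy in auto)
qed

lemma separated_if_functions_separate:
  assumes X: "space_with_functions X" and s: "functions_separate X"
  shows "separated X"
  unfolding separated_def
proof (intro allI impI)
  fix n :: nat and S \<phi> \<psi>
  let ?Y = "subspace_on (affine_space {..<n}) S"
  assume S: "closedin (zariski {..<n}) S" and \<phi>: "morphism ?Y X \<phi>" and \<psi>: "morphism ?Y X \<psi>"
  have R: "ringed_space ?Y" by (rule ringed_subspace[OF ringed_affine])
  note Y = ringed_swf[OF R]
  have pts: "points ?Y = S" using closedin_subset[OF S] by auto
  let ?D = "{z \<in> S. \<phi> z \<noteq> \<psi> z}"
  have "\<exists>T. openin (zar ?Y) T \<and> z \<in> T \<and> T \<subseteq> ?D" if z: "z \<in> ?D" for z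
  proof -
    have "\<phi> z \<in> points X" "\<psi> z \<in> points X" "\<phi> z \<noteq> \<psi> z"
      using z pts morphism_image[OF \<phi>] morphism_image[OF \<psi>] by auto
    then obtain U V f g where U: "\<phi> z \<in> U" "\<psi> z \<in> V" "regular X U f" "regular X V g"
      "\<forall>z\<in>U \<inter> V. f z * g z = 1" "f (\<phi> z) * g (\<psi> z) \<noteq> 1"
      using s unfolding functions_separate_def by metis
    let ?W = "{z \<in> points ?Y. \<phi> z \<in> U} \<inter> {z \<in> points ?Y. \<psi> z \<in> V}"
    note f = morphism_regular[OF \<phi> U(3)] and g = morphism_regular[OF \<psi> U(4)]
    have W: "openin (zar ?Y) ?W" using swf_open[OF Y f] swf_open[OF Y g] by (rule openin_Int)
    have "regular ?Y ?W (\<lambda>z. f (\<phi> z))" "regular ?Y ?W (\<lambda>z. g (\<psi> z))"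
      using swf_restrict[OF Y f W] swf_restrict[OF Y g W] by auto
    then have "regular ?Y ?W (\<lambda>z. f (\<phi> z) * g (\<psi> z) + (- 1))"
      by (intro ringed_add[OF R] ringed_mult[OF R] ringed_const[OF R W])
    from ringed_nonzero_open[OF R this]
    have "openin (zar ?Y) {z \<in> ?W. f (\<phi> z) * g (\<psi> z) + (- 1) \<noteq> 0}" .
    moreover have "z \<in> {z \<in> ?W. f (\<phi> z) * g (\<psi> z) + (- 1) \<noteq> 0}" using z U pts by auto
    moreover have "{z \<in> ?W. f (\<phi> z) * g (\<psi> z) + (- 1) \<noteq> 0} \<subseteq> ?D" using U(5) pts by auto
    ultimately show ?thesis by meson
  qed
  then have "openin (zar ?Y) ?D" by (subst openin_subopen) blast
  then have "closedin (zar ?Y) (points ?Y - ?D)" by blast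
  moreover have "points ?Y - ?D = {z \<in> S. \<phi> z = \<psi> z}" using pts by auto
  ultimately show "closedin (zariski {..<n}) {z \<in> S. \<phi> z = \<psi> z}"
    using closedin_closed_subtopology[OF S] by auto
qed

lemma functions_separate_affine:
  assumes A: "A \<subseteq> cspace I"
  shows "functions_separate (subspace_on (affine_space I) A)"
  unfolding functions_separate_def
proof (intro ballI impI)
  fix x y assume xy: "x \<in> points (subspace_on (affine_space I) A)"
    "y \<in> points (subspace_on (affine_space I) A)" "x \<noteq> y"
  then have "x \<in> cspace I" "y \<in> cspace I" "x \<in> A" "y \<in> A" by auto
  then obtain i where i: "i \<in> I" "x i \<noteq> y i" using xy(3) PiE_ext by metis
  show "\<exists>U V f g. x \<in> U \<and> y \<in> V \<and> regular (subspace_on (affine_space I) A) U f \<and>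
      regular (subspace_on (affine_space I) A) V g \<and>
      (\<forall>z\<in>U \<inter> V. f z * g z = 1) \<and> f x * g y \<noteq> 1"
    by (rule separate_by_function[OF ringed_subspace[OF ringed_affine]
          regular_rational_on[OF A rational_on_coord[OF i(1)]]])
      (use i \<open>x \<in> A\<close> \<open>y \<in> A\<close> in auto)
qed

lemma varietyI:
  assumes "space_with_functions X" "functions_separate X" "finite \<U>" "\<Union>\<U> = points X"
    and "\<And>U. U \<in> \<U> \<Longrightarrow> openin (zar X) U" "\<And>U. U \<in> \<U> \<Longrightarrow> affine_variety (subspace_on X U)"
  shows "variety X"
  unfolding variety_def
  by (intro conjI assms(1) separated_if_functions_separate[OF assms(1,2)] exI[of _ \<U>])
    (use assms(3-6) in blast)+

text \<open>The principal open subsets of \<open>C\<close> given by the members of \<open>F\<close>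
  are affine charts, and coordinates separate points as in affine space.\<close>

lemma variety_quasi_affine:
  assumes I: "finite I" and C: "closedin (zariski I) C" and F: "finite F" "F \<subseteq> poly_fun I"
  shows "variety (subspace_on (affine_space I) {x \<in> C. \<exists>f\<in>F. f x \<noteq> 0})"
proof -
  let ?W = "{x \<in> C. \<exists>f\<in>F. f x \<noteq> 0}"
  have CI: "C \<subseteq> cspace I" using closedin_subset[OF C] by simp
  show ?thesis
  proof (rule varietyI[where \<U> = "(\<lambda>f. {x \<in> C. f x \<noteq> 0}) ` F"])
    show "functions_separate (subspace_on (affine_space I) ?W)"
      by (rule functions_separate_affine) (use CI in auto)
    fix U assume "U \<in> (\<lambda>f. {x \<in> C. f x \<noteq> 0}) ` F"
    then obtain f where f: "f \<in> F" "U = {x \<in> C. f x \<noteq> 0}" by blast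
    have "U = {x \<in> cspace I. f x \<noteq> 0} \<inter> ?W" using f CI by auto
    then show "openin (zar (subspace_on (affine_space I) ?W)) U"
      using openin_zariski_nonzero[of f I] f F by (auto simp: openin_subtopology)
    have "?W \<inter> U = U" using f by auto
    then show "affine_variety (subspace_on (subspace_on (affine_space I) ?W) U)"
      using affine_variety_principal[OF I C, of f] f F by (auto simp: subspace_subspace swf_affine)
  qed (use F CI in \<open>auto intro: swf_subspace swf_affine\<close>)
qed

lemma variety_iso:
  assumes i: "isomorphic X Y" and V: "variety X" and Y: "space_with_functions Y"
  shows "variety Y"
proof -
  obtain \<phi> \<psi> where p: "iso_pair X Y \<phi> \<psi>" using i isomorphic_iff_iso_pair by blast
  note d = iso_pairD[OF p]
  have X: "space_with_functions X" and sX: "separated X" using V by (auto simp: variety_def)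
  obtain \<U> where U: "finite \<U>" "\<Union>\<U> = points X" "\<forall>U\<in>\<U>. openin (zar X) U"
     "\<forall>U\<in>\<U>. affine_variety (subspace_on X U)" using V unfolding variety_def by blast
  have "separated Y"
    unfolding separated_def
  proof (intro allI impI)
    fix n :: nat and S f g
    let ?Z = "subspace_on (affine_space {..<n}) S"
    assume S: "closedin (zariski {..<n}) S" and f: "morphism ?Z Y f" and g: "morphism ?Z Y g"
    have "closedin (zariski {..<n}) {z \<in> S. \<psi> (f z) = \<psi> (g z)}"
      using sX S morphism_comp[OF f d(2)] morphism_comp[OF g d(2)] unfolding separated_def by blast
    moreover have "points ?Z = S" using closedin_subset[OF S] by auto
    then have "f z \<in> points Y" "g z \<in> points Y" if "z \<in> S" for z
      using that morphism_image[OF f] morphism_image[OF g] by auto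
    then have "{z \<in> S. \<psi> (f z) = \<psi> (g z)} = {z \<in> S. f z = g z}" using d(4) by auto metis
    ultimately show "closedin (zariski {..<n}) {z \<in> S. f z = g z}" by simp
  qed
  moreover have "affine_variety (subspace_on Y (\<phi> ` U))" if "U \<in> \<U>" for U
    by (rule affine_variety_iso[OF isomorphic_subspace_image[OF X Y p]])
      (use U that in blast)+
  moreover have "openin (zar Y) (\<phi> ` U)" if "U \<in> \<U>" for U
    using iso_pair_openin[OF p] U that by blast
  moreover have "\<Union>((`) \<phi> ` \<U>) = points Y"
    unfolding iso_pair_points[OF p, symmetric] U(2)[symmetric] by blast
  ultimately show ?thesis
    unfolding variety_def using U(1) Y by (intro conjI exI[of _ "(`) \<phi> ` \<U>"]) auto
qed

lemma variety_affine_space: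
  assumes "finite I" shows "variety (affine_space I)"
proof (rule variety_iso[OF isomorphic_sym[OF isomorphic_subspace_points[OF swf_affine]] _ swf_affine])
  have "closedin (zariski I) (cspace I)" using closedin_topspace[of "zariski I"] by simp
  from variety_quasi_affine[OF assms this, of "{\<lambda>_. 1}"]
  show "variety (subspace_on (affine_space I) (points (affine_space I)))"
    by (simp add: pf_const)
qed

text \<open>All the properties are local and hold on affine charts. They enter the universal
  property of products, which is tested on arbitrary varieties.\<close>

lemma ringed_variety:
  assumes "variety X" shows "ringed_space X"
proof -
  have X: "space_with_functions X" using assms by (simp add: variety_def)
  obtain \<U> where U: "\<Union>\<U> = points X" "\<forall>U\<in>\<U>. openin (zar X) U"
     "\<forall>U\<in>\<U>. affine_variety (subspace_on X U)" using assms unfolding variety_def by blast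
  have R: "ringed_space (subspace_on X U)" if "U \<in> \<U>" for U
  proof -
    from U(3)[THEN bspec, OF that]
    obtain n S where "isomorphic (subspace_on X U) (subspace_on (affine_space {..<n::nat}) S)"
      unfolding affine_variety_def by (elim exE conjE)
    from ringed_iso[OF isomorphic_sym[OF this] ringed_subspace[OF ringed_affine] swf_subspace[OF X]]
    show ?thesis .
  qed
  have loc: "regular (subspace_on X U) (W \<inter> U) f" if "U \<in> \<U>" "regular X W f" for U W f
    using regular_open_subspace[OF X] U(2) that swf_restrict[OF X that(2)] swf_open[OF X that(2)]
    by (simp add: openin_Int)
  have glue: "regular X W f" if "W \<subseteq> points X"
    "\<And>U. U \<in> \<U> \<Longrightarrow> regular (subspace_on X U) (W \<inter> U) f" for W f
  proof -
    have "regular X (\<Union>((\<lambda>U. W \<inter> U) ` \<U>)) f"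
      by (rule swf_glue[OF X]) (use that(2) U(2) regular_open_subspace[OF X] in auto)
    moreover have "\<Union>((\<lambda>U. W \<inter> U) ` \<U>) = W" using that(1) U(1) by auto
    ultimately show ?thesis by simp
  qed
  show ?thesis
    unfolding ringed_space_def
  proof (intro conjI allI impI X)
    fix W and c :: complex assume W: "openin (zar X) W"
    show "regular X W (\<lambda>_. c)"
      by (rule glue) (use W openin_subset[OF W] in \<open>auto intro!: ringed_const[OF R] simp: openin_subtopology\<close>)
  next
    fix W f g assume f: "regular X W f" and g: "regular X W g"
    show "regular X W (\<lambda>x. f x + g x)" "regular X W (\<lambda>x. f x * g x)"
      using loc[OF _ f] loc[OF _ g] swf_subset[OF X f]
      by (auto intro!: glue ringed_add[OF R] ringed_mult[OF R])
  next
    fix W f assume f: "regular X W f"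
    have eq: "{x \<in> W \<inter> U. f x \<noteq> 0} = {x \<in> W. f x \<noteq> 0} \<inter> U" for U by auto
    show "regular X {x \<in> W. f x \<noteq> 0} (\<lambda>x. inverse (f x))"
      by (rule glue)
        (use swf_subset[OF X f] ringed_inverse[OF R loc[OF _ f]] in \<open>auto simp only: eq\<close>)
    then show "openin (zar X) {x \<in> W. f x \<noteq> 0}" by (rule swf_open[OF X])
  qed
qed

section \<open>Classes in the Grothendieck ring\<close>

text \<open>Guarantees that the choice in \<open>motivic_class\<close> picks a variety isomorphic to
  \<open>X\<close>; otherwise it picks an arbitrary one.\<close>

definition realizable :: "'p fspace \<Rightarrow> bool" where
  "realizable X \<longleftrightarrow> (\<exists>Y. isomorphic X (Rep_cvariety Y))"

lemma variety_Rep_cvariety: "variety (Rep_cvariety Y)"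
  using Rep_cvariety[of Y] by simp

lemma swf_variety: "variety X \<Longrightarrow> space_with_functions X"
  by (simp add: variety_def)

lemma variety_realizable:
  fixes j :: "'p \<Rightarrow> nat \<Rightarrow> complex"
  assumes V: "variety X" and j: "inj_on j (points X)"
  shows "realizable X"
proof -
  note X = swf_variety[OF V]
  note i = quotient_inj_isomorphic[OF X j]
  have "variety (quotient_fspace X j)" by (rule variety_iso[OF i V swf_quotient[OF X]])
  then have "Rep_cvariety (Abs_cvariety (quotient_fspace X j)) = quotient_fspace X j"
    by (simp add: Abs_cvariety_inverse)
  then show ?thesis using i unfolding realizable_def by metis
qed

lemma inj_on_cspace_nat:
  assumes "finite I"
  obtains j :: "('i \<Rightarrow> complex) \<Rightarrow> nat \<Rightarrow> complex" where "inj_on j (cspace I)"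
proof -
  obtain e where e: "bij_betw e {0..<card I} I" using ex_bij_betw_nat_finite[OF assms] by blast
  have "inj_on (\<lambda>x k. x (e k)) (cspace I)"
  proof (rule inj_onI)
    fix x y :: "'i \<Rightarrow> complex"
    assume xy: "x \<in> cspace I" "y \<in> cspace I" and eq: "(\<lambda>k. x (e k)) = (\<lambda>k. y (e k))"
    show "x = y"
    proof (rule PiE_ext[OF xy])
      fix i assume "i \<in> I"
      then obtain k where "i = e k" using e unfolding bij_betw_def by blast
      then show "x i = y i" using fun_cong[OF eq, of k] by simp
    qed
  qed
  then show ?thesis by (rule that)
qed

lemma realizable_affine:
  assumes "finite I" "A \<subseteq> cspace I" "variety (subspace_on (affine_space I) A)"
  shows "realizable (subspace_on (affine_space I) A)"
proof -
  obtain j :: "('a \<Rightarrow> complex) \<Rightarrow> nat \<Rightarrow> complex" where j: "inj_on j (cspace I)"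
    using inj_on_cspace_nat[OF assms(1)] by blast
  show ?thesis
    by (rule variety_realizable[OF assms(3), of j]) (use inj_on_subset[OF j] assms(2) in auto)
qed

lemma K0_class_iso: "isomorphic (Rep_cvariety X) (Rep_cvariety Y) \<Longrightarrow> K0_class X = K0_class Y"
  by transfer (rule ideal_base, unfold K0_relations_def, blast)

lemma K0_class_point:
  "isomorphic (Rep_cvariety P) (affine_space ({} :: nat set)) \<Longrightarrow> K0_class P = 1"
  by transfer (rule ideal_base, unfold K0_relations_def, blast)

lemma K0_class_product:
  "is_product (Rep_cvariety X) (Rep_cvariety Y) (Rep_cvariety P) \<Longrightarrow>
     K0_class P = K0_class X * K0_class Y"
  by transfer (rule ideal_base, unfold K0_relations_def, blast)

lemma K0_class_scissor:
  "closedin (zar (Rep_cvariety X)) C \<Longrightarrow> Rep_cvariety Y = subspace_on (Rep_cvariety X) C \<Longrightarrow>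
     Rep_cvariety W = subspace_on (Rep_cvariety X) (points (Rep_cvariety X) - C) \<Longrightarrow>
     K0_class X = K0_class Y + K0_class W"
  by transfer (rule ideal_base, unfold K0_relations_def, blast)

lemma motivic_class_eq:
  assumes "isomorphic X (Rep_cvariety Y)"
  shows "motivic_class X = K0_class Y"
proof -
  have "isomorphic X (Rep_cvariety (SOME Y. isomorphic X (Rep_cvariety Y)))"
    using assms by (rule someI)
  from isomorphic_trans[OF isomorphic_sym[OF this] assms] show ?thesis
    unfolding motivic_class_def by (rule K0_class_iso)
qed

lemma motivic_class_iso:
  assumes "isomorphic X Y" "realizable Y"
  shows "motivic_class X = motivic_class Y"
proof -
  obtain W where W: "isomorphic Y (Rep_cvariety W)" using assms(2) realizable_def by blast
  show ?thesis
    using motivic_class_eq[OF W] motivic_class_eq[OF isomorphic_trans[OF assms(1) W]] by simp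
qed

text \<open>The relation defining the ring speaks of literal subspaces of a represented variety, so
  both pieces are transported along an isomorphism of \<open>X\<close> with such a variety.\<close>

lemma motivic_class_scissor:
  assumes rX: "realizable X" and X: "space_with_functions X" and C: "closedin (zar X) C"
    and V1: "variety (subspace_on X C)" and V2: "variety (subspace_on X (points X - C))"
  shows "motivic_class X =
    motivic_class (subspace_on X C) + motivic_class (subspace_on X (points X - C))"
proof -
  obtain Y where "isomorphic X (Rep_cvariety Y)" using rX realizable_def by blast
  then obtain \<phi> \<psi> where p: "iso_pair X (Rep_cvariety Y) \<phi> \<psi>" using isomorphic_iff_iso_pair by blast
  note Y = swf_variety[OF variety_Rep_cvariety[of Y]]
  have CX: "C \<subseteq> points X" using closedin_subset[OF C] .
  have "inj_on \<phi> (points X)" by (rule inj_on_inverseI[of _ \<psi>]) (rule iso_pairD(3)[OF p])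
  then have diff: "\<phi> ` (points X - C) = points (Rep_cvariety Y) - \<phi> ` C"
    using CX iso_pair_points[OF p] by (simp add: inj_on_image_set_diff[of \<phi> "points X"])
  have piece: "\<exists>Z. isomorphic (subspace_on X A) (Rep_cvariety Z) \<and>
      Rep_cvariety Z = subspace_on (Rep_cvariety Y) (\<phi> ` A)"
    if A: "A \<subseteq> points X" "variety (subspace_on X A)" for A
  proof -
    have i: "isomorphic (subspace_on X A) (subspace_on (Rep_cvariety Y) (\<phi> ` A))"
      by (rule isomorphic_subspace_image[OF X Y p A(1)])
    have "variety (subspace_on (Rep_cvariety Y) (\<phi> ` A))"
      by (rule variety_iso[OF i A(2) swf_subspace[OF Y]])
    then have "Rep_cvariety (Abs_cvariety (subspace_on (Rep_cvariety Y) (\<phi> ` A))) =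
        subspace_on (Rep_cvariety Y) (\<phi> ` A)" by (simp add: Abs_cvariety_inverse)
    then show ?thesis using i by metis
  qed
  obtain Z where Z: "isomorphic (subspace_on X C) (Rep_cvariety Z)"
    "Rep_cvariety Z = subspace_on (Rep_cvariety Y) (\<phi> ` C)" using piece[OF CX V1] by blast
  obtain W where W: "isomorphic (subspace_on X (points X - C)) (Rep_cvariety W)"
    "Rep_cvariety W = subspace_on (Rep_cvariety Y) (points (Rep_cvariety Y) - \<phi> ` C)"
    using piece[OF _ V2] diff by auto
  have "isomorphic X (Rep_cvariety Y)" using p isomorphic_iff_iso_pair by blast
  then show ?thesis
    using motivic_class_eq[OF Z(1)] motivic_class_eq[OF W(1)] motivic_class_eq[of X Y]
      K0_class_scissor[OF iso_pair_closedin[OF p C] Z(2) W(2)] by simp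
qed

text \<open>Cutting an empty space along its empty closed subset gives
  \<open>[X] = [X] + [X]\<close>.\<close>

lemma motivic_class_empty:
  assumes "realizable X" "space_with_functions X" "points X = {}" "variety X"
  shows "motivic_class X = 0"
proof -
  have v: "variety (subspace_on X {})"
    using variety_iso[OF isomorphic_subspace_points[OF assms(2)] assms(4) swf_subspace[OF assms(2)]]
      assms(3) by simp
  have "motivic_class X = motivic_class (subspace_on X {}) + motivic_class (subspace_on X {})"
    using motivic_class_scissor[OF assms(1,2), of "{}"] v assms(3) by simp
  moreover have "motivic_class (subspace_on X {}) = motivic_class X"
    using motivic_class_iso[OF isomorphic_sym assms(1), of "subspace_on X {}"]
      isomorphic_subspace_points[OF assms(2)] assms(3) by simp
  ultimately show ?thesis by simp
qed

lemma Rep_Abs_affine: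
  "finite (I :: nat set) \<Longrightarrow> Rep_cvariety (Abs_cvariety (affine_space I)) = affine_space I"
  by (simp add: Abs_cvariety_inverse variety_affine_space)

lemma realizable_affine_space:
  assumes "finite I" shows "realizable (affine_space I)"
proof -
  obtain j :: "('a \<Rightarrow> complex) \<Rightarrow> nat \<Rightarrow> complex" where "inj_on j (cspace I)"
    using inj_on_cspace_nat[OF assms] by blast
  then show ?thesis using variety_realizable[OF variety_affine_space[OF assms], of j] by simp
qed

lemma motivic_class_affine_nat:
  "finite (I :: nat set) \<Longrightarrow> motivic_class (affine_space I) = K0_class (Abs_cvariety (affine_space I))"
  by (rule motivic_class_eq) (simp add: Rep_Abs_affine isomorphic_refl swf_affine)

lemma is_product_affine:
  "is_product (affine_space {..<n}) (affine_space {0::nat}) (affine_space {..<Suc n})"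
proof -
  define p\<^sub>1 where "p\<^sub>1 = (\<lambda>x::nat \<Rightarrow> complex. \<lambda>i\<in>{..<n}. x i)"
  define p\<^sub>2 where "p\<^sub>2 = (\<lambda>x::nat \<Rightarrow> complex. \<lambda>i\<in>{0::nat}. x n)"
  have c: "regular (affine_space {..<Suc n}) (points (affine_space {..<Suc n})) (\<lambda>x. x i)"
    if "i < Suc n" for i
    using regular_affine_poly[OF pf_coord[of i "{..<Suc n}"]] that by simp
  have 1: "morphism (affine_space {..<Suc n}) (affine_space {..<n}) p\<^sub>1"
    by (rule morphism_affineI[OF ringed_affine]) (use c in \<open>auto simp: p\<^sub>1_def\<close>)
  have 2: "morphism (affine_space {..<Suc n}) (affine_space {0}) p\<^sub>2"
    by (rule morphism_affineI[OF ringed_affine]) (use c[of n] in \<open>auto simp: p\<^sub>2_def\<close>)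
  show ?thesis
    unfolding is_product_def
  proof (rule exI[of _ p\<^sub>1], rule exI[of _ p\<^sub>2], intro conjI 1 2 allI impI)
    fix T :: "(nat \<Rightarrow> complex) fspace" and f g :: "(nat \<Rightarrow> complex) \<Rightarrow> nat \<Rightarrow> complex"
    assume T: "variety T" and f: "morphism T (affine_space {..<n}) f"
      and g: "morphism T (affine_space {0}) g"
    \<comment> \<open>The last coordinate of the product has index \<open>n\<close>, the only
      coordinate of the second factor has index 0.\<close>
    define h where "h = (\<lambda>t. \<lambda>i\<in>{..<Suc n}. if i < n then f t i else g t 0)"
    have ft: "f t \<in> cspace {..<n}" and gt: "g t \<in> cspace {0}" if "t \<in> points T" for t
      using morphism_image[OF f that] morphism_image[OF g that] by auto
    have h: "morphism T (affine_space {..<Suc n}) h"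
    proof (rule morphism_affineI[OF ringed_variety[OF T]])
      show "h t \<in> cspace {..<Suc n}" for t by (simp add: h_def)
      fix i assume i: "i \<in> {..<Suc n}"
      show "regular T (points T) (\<lambda>t. h t i)"
      proof (cases "i < n")
        case True
        then show ?thesis using morphism_affineD[OF f, of i] by (simp add: h_def)
      next
        case False
        then show ?thesis using morphism_affineD[OF g, of 0] i by (simp add: h_def)
      qed
    qed
    have p1: "p\<^sub>1 (h t) = f t" if "t \<in> points T" for t
      by (rule PiE_ext[of _ "{..<n}" "\<lambda>_. UNIV"]) (use ft[OF that] in \<open>auto simp: p\<^sub>1_def h_def\<close>)
    have p2: "p\<^sub>2 (h t) = g t" if "t \<in> points T" for t
      by (rule PiE_ext[of _ "{0}" "\<lambda>_. UNIV"]) (use gt[OF that] in \<open>auto simp: p\<^sub>2_def h_def\<close>)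
    have un: "h' t = h t" if h': "morphism T (affine_space {..<Suc n}) h'"
      "\<forall>t\<in>points T. p\<^sub>1 (h' t) = f t \<and> p\<^sub>2 (h' t) = g t" and t: "t \<in> points T" for h' t
    proof (rule PiE_ext[of _ "{..<Suc n}" "\<lambda>_. UNIV"])
      show "h' t \<in> cspace {..<Suc n}" using morphism_image[OF h'(1) t] by simp
      show "h t \<in> cspace {..<Suc n}" by (simp add: h_def)
      fix i assume i: "i \<in> {..<Suc n}"
      have e: "p\<^sub>1 (h' t) = f t" "p\<^sub>2 (h' t) = g t" using h'(2) t by auto
      show "h' t i = h t i"
      proof (cases "i < n")
        case True
        then show ?thesis using fun_cong[OF e(1), of i] by (simp add: p\<^sub>1_def h_def)
      next
        case False
        then show ?thesis using fun_cong[OF e(2), of 0] i by (simp add: p\<^sub>2_def h_def less_Suc_eq)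
      qed
    qed
    show "\<exists>h. morphism T (affine_space {..<Suc n}) h \<and>
        (\<forall>t\<in>points T. p\<^sub>1 (h t) = f t \<and> p\<^sub>2 (h t) = g t) \<and>
        (\<forall>h'. morphism T (affine_space {..<Suc n}) h' \<longrightarrow>
           (\<forall>t\<in>points T. p\<^sub>1 (h' t) = f t \<and> p\<^sub>2 (h' t) = g t) \<longrightarrow> (\<forall>t\<in>points T. h' t = h t))"
      by (rule exI[of _ h]) (use h p1 p2 un in blast)
  qed
qed

lemma motivic_class_affine_space:
  assumes I: "finite I"
  shows "motivic_class (affine_space I) = Lefschetz ^ card I"
proof -
  have nat: "motivic_class (affine_space {..<n}) = Lefschetz ^ n" for n :: nat
  proof (induction n)
    case 0
    have "K0_class (Abs_cvariety (affine_space ({}::nat set))) = 1"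
      by (rule K0_class_point) (simp add: Rep_Abs_affine isomorphic_refl swf_affine)
    then show ?case using motivic_class_affine_nat[of "{}"] by simp
  next
    case (Suc n)
    have "K0_class (Abs_cvariety (affine_space {..<Suc n})) =
       K0_class (Abs_cvariety (affine_space {..<n})) * K0_class (Abs_cvariety (affine_space {0}))"
      by (rule K0_class_product) (simp add: Rep_Abs_affine is_product_affine)
    then show ?case
      using Suc motivic_class_affine_nat[of "{..<Suc n}"] motivic_class_affine_nat[of "{..<n}"]
        motivic_class_affine_nat[of "{0}"]
      by (simp add: Lefschetz_def mult.commute)
  qed
  obtain e where "bij_betw e {0..<card I} I" using ex_bij_betw_nat_finite[OF I] by blast
  then have "bij_betw e {..<card I} I" by (simp add: atLeast0LessThan)
  then have "isomorphic (affine_space I) (affine_space {..<card I})"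
    using iso_pair_reindex isomorphic_iff_iso_pair by blast
  from motivic_class_iso[OF this realizable_affine_space] nat show ?thesis by simp
qed

section \<open>Loci with prescribed nonzero coordinates\<close>

lemma variety_coordinates_nonzero:
  assumes I: "finite I" and C: "closedin (zariski I) C" and S: "S \<subseteq> I"
  shows "variety (subspace_on (affine_space I) {x \<in> C. \<forall>a\<in>S. x a \<noteq> 0})"
proof -
  have fS: "finite S" using S I by (rule finite_subset)
  have "(\<lambda>x. \<Prod>a\<in>S. x a) \<in> poly_fun I"
    by (rule poly_fun_prod[OF fS]) (use S in \<open>auto intro: pf_coord\<close>)
  then have "variety (subspace_on (affine_space I) {x \<in> C. \<exists>f\<in>{\<lambda>x. \<Prod>a\<in>S. x a}. f x \<noteq> 0})"
    by (intro variety_quasi_affine[OF I C]) auto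
  then show ?thesis using fS by simp
qed

lemma closedin_zariski_fixed:
  assumes "K \<subseteq> I"
  shows "closedin (zariski I) {x \<in> cspace I. \<forall>i\<in>K. x i = c i}"
  unfolding closedin_zariski
proof (intro exI conjI)
  show "(\<lambda>i x. x i + (- c i)) ` K \<subseteq> poly_fun I"
  proof (rule image_subsetI)
    fix i assume "i \<in> K"
    then show "(\<lambda>x. x i + (- c i)) \<in> poly_fun I"
      using assms by (intro pf_add pf_const pf_coord) auto
  qed
  show "{x \<in> cspace I. \<forall>i\<in>K. x i = c i} = zero_locus I ((\<lambda>i x. x i + (- c i)) ` K)"
    by (auto simp: zero_locus_def)
qed

lemma isomorphic_coordinate_slice:
  fixes c :: "'i \<Rightarrow> complex"
  assumes J: "J \<subseteq> I" and B: "B \<subseteq> cspace J"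
  shows "isomorphic (subspace_on (affine_space I)
      {x \<in> cspace I. (\<forall>i\<in>I - J. x i = c i) \<and> restrict x J \<in> B}) (subspace_on (affine_space J) B)"
proof -
  let ?A = "{x \<in> cspace I. (\<forall>i\<in>I - J. x i = c i) \<and> restrict x J \<in> B}"
  define \<phi> where "\<phi> = (\<lambda>x::'i \<Rightarrow> complex. restrict x J)"
  define \<psi> where "\<psi> = (\<lambda>y. \<lambda>i\<in>I. if i \<in> J then y i else c i)"
  have A: "?A \<subseteq> cspace I" by auto
  have rr: "restrict (\<psi> y) J = y" if "y \<in> B" for y
    by (rule PiE_ext[of _ J "\<lambda>_. UNIV"]) (use B J that in \<open>auto simp: \<psi>_def\<close>)
  have 1: "morphism (subspace_on (affine_space I) ?A) (subspace_on (affine_space J) B) \<phi>"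
  proof (rule morphism_rational[OF A _ B])
    show "\<phi> x \<in> B" if "x \<in> ?A" for x using that by (simp add: \<phi>_def)
    show "rational_on I ?A (\<lambda>x. \<phi> x j)" if "j \<in> J" for j
      using that J rational_on_coord[of j I ?A] by (auto simp: \<phi>_def)
  qed
  have im: "\<psi> y \<in> ?A" if "y \<in> B" for y
    using rr[OF that] that by (auto simp: \<psi>_def)
  have 2: "morphism (subspace_on (affine_space J) B) (subspace_on (affine_space I) ?A) \<psi>"
  proof (rule morphism_rational[OF B im A])
    show "rational_on J B (\<lambda>y. \<psi> y i)" if "i \<in> I" for i
      using that rational_on_coord[of i J B] rational_on_const[of J B "c i"]
      by (cases "i \<in> J") (auto simp: \<psi>_def)
  qed
  have 3: "\<psi> (\<phi> x) = x" if "x \<in> ?A" for x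
    by (rule PiE_ext[of _ I "\<lambda>_. UNIV"]) (use that in \<open>auto simp: \<psi>_def \<phi>_def\<close>)
  have pts: "points (subspace_on (affine_space I) ?A) = ?A"
    "points (subspace_on (affine_space J) B) = B" using A B by auto
  have 4: "\<phi> (\<psi> y) = y" if "y \<in> B" for y using rr[OF that] by (simp add: \<phi>_def)
  show ?thesis
    unfolding isomorphic_def pts
    by (rule exI[of _ \<phi>], rule exI[of _ \<psi>], intro conjI ballI) (rule 1 2 3 4, assumption?)+
qed

text \<open>Induction on \<open>S\<close>: removing the closed slice \<open>x b = 0\<close> from the
  locus for \<open>S\<close> leaves the locus for \<open>insert b S\<close>, and L^(k+1) (L-1)^s -
  L^k (L-1)^s = L^k (L-1)^(s+1).\<close>

lemma motivic_class_coordinates_nonzero: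
  assumes "finite I" "S \<subseteq> I"
  shows "motivic_class (subspace_on (affine_space I) {x \<in> cspace I. \<forall>a\<in>S. x a \<noteq> 0}) =
    Lefschetz ^ card (I - S) * (Lefschetz - 1) ^ card S"
proof -
  have "finite S" using assms finite_subset by blast
  then show ?thesis using assms
  proof (induction S arbitrary: I rule: finite_induct)
    case empty
    have "motivic_class (subspace_on (affine_space I) (cspace I)) = motivic_class (affine_space I)"
      using motivic_class_iso[OF isomorphic_sym[OF isomorphic_subspace_points[OF swf_affine]]
          realizable_affine_space[OF empty(1)]] by simp
    then show ?case using motivic_class_affine_space[OF empty(1)] by simp
  next
    case (insert b S)
    let ?D = "\<lambda>I S. {x \<in> cspace I. \<forall>a\<in>S. x a \<noteq> 0}"
    let ?X = "subspace_on (affine_space I) (?D I S)"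
    let ?C = "{x \<in> ?D I S. x b = 0}"
    have top: "closedin (zariski I) (cspace I)" for I :: "'a set"
      using closedin_topspace[of "zariski I"] by simp
    have pts: "points ?X = ?D I S" by auto
    have vX: "variety ?X" using insert by (intro variety_coordinates_nonzero top) auto
    have b: "closedin (zariski I) {x \<in> cspace I. \<forall>i\<in>{b}. x i = 0}"
      using insert by (intro closedin_zariski_fixed) auto
    have C: "closedin (zar ?X) ?C"
      using b by (auto simp: closedin_subtopology)
    have ssC: "subspace_on ?X ?C = subspace_on (affine_space I) ?C"
      unfolding subspace_subspace[OF swf_affine] by (intro arg_cong2[where f = subspace_on]) auto
    have eqD: "points ?X - ?C = ?D I (insert b S)" unfolding pts by auto
    have ssD: "subspace_on ?X (points ?X - ?C) = subspace_on (affine_space I) (?D I (insert b S))"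
      unfolding eqD subspace_subspace[OF swf_affine]
      by (intro arg_cong2[where f = subspace_on]) auto
    have "?C = {x \<in> {x \<in> cspace I. \<forall>i\<in>{b}. x i = 0}. \<forall>a\<in>S. x a \<noteq> 0}" by auto
    then have vC: "variety (subspace_on ?X ?C)"
      unfolding ssC using variety_coordinates_nonzero[OF _ b, of S] insert by auto
    have vD: "variety (subspace_on ?X (points ?X - ?C))"
      unfolding ssD using insert by (intro variety_coordinates_nonzero top) auto
    have rX: "realizable ?X" using insert by (intro realizable_affine vX) auto
    have sc: "motivic_class ?X = motivic_class (subspace_on ?X ?C) +
        motivic_class (subspace_on ?X (points ?X - ?C))"
      by (rule motivic_class_scissor[OF rX swf_subspace[OF swf_affine] C vC vD])
    let ?J = "I - {b}"
    have "?C = {x \<in> cspace I. (\<forall>i\<in>I - ?J. x i = 0) \<and> restrict x ?J \<in> ?D ?J S}"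
      using insert by auto
    then have "isomorphic (subspace_on ?X ?C) (subspace_on (affine_space ?J) (?D ?J S))"
      unfolding ssC using isomorphic_coordinate_slice[of ?J I "?D ?J S" "\<lambda>_. 0"] by auto
    moreover have "realizable (subspace_on (affine_space ?J) (?D ?J S))"
      using insert by (intro realizable_affine variety_coordinates_nonzero top) auto
    ultimately have "motivic_class (subspace_on ?X ?C) =
        motivic_class (subspace_on (affine_space ?J) (?D ?J S))" by (rule motivic_class_iso)
    also have "\<dots> = Lefschetz ^ card (?J - S) * (Lefschetz - 1) ^ card S"
      using insert by (intro insert.IH) auto
    finally have c: "motivic_class (subspace_on ?X ?C) =
        Lefschetz ^ card (I - insert b S) * (Lefschetz - 1) ^ card S"
      by (simp add: Diff_insert2[symmetric] Diff_insert[symmetric])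
    have x: "motivic_class ?X = Lefschetz ^ card (I - S) * (Lefschetz - 1) ^ card S"
      using insert by (intro insert.IH) auto
    have "I - S = insert b (I - insert b S)" using insert by auto
    then have "card (I - S) = Suc (card (I - insert b S))"
      using insert by (metis Diff_iff card_insert_disjoint finite_Diff insertI1)
    then have "motivic_class (subspace_on ?X (points ?X - ?C)) =
       Lefschetz ^ card (I - insert b S) * (Lefschetz - 1) ^ card (insert b S)"
      using sc c x insert by (simp add: algebra_simps)
    then show ?case unfolding ssD .
  qed
qed

lemma motivic_class_coordinate_torus:
  fixes c :: "'i \<Rightarrow> complex"
  assumes I: "finite I" and J: "J \<subseteq> I"
  shows "motivic_class (subspace_on (affine_space I)
      {x \<in> cspace I. (\<forall>i\<in>I - J. x i = c i) \<and> (\<forall>i\<in>J. x i \<noteq> 0)}) = (Lefschetz - 1) ^ card J"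
proof -
  let ?B = "{x \<in> cspace J. \<forall>i\<in>J. x i \<noteq> 0}"
  have fJ: "finite J" using J I by (rule finite_subset)
  have "{x \<in> cspace I. (\<forall>i\<in>I - J. x i = c i) \<and> (\<forall>i\<in>J. x i \<noteq> 0)} =
    {x \<in> cspace I. (\<forall>i\<in>I - J. x i = c i) \<and> restrict x J \<in> ?B}" by auto
  then have "isomorphic (subspace_on (affine_space I)
      {x \<in> cspace I. (\<forall>i\<in>I - J. x i = c i) \<and> (\<forall>i\<in>J. x i \<noteq> 0)}) (subspace_on (affine_space J) ?B)"
    using isomorphic_coordinate_slice[OF J, of ?B c] by auto
  moreover have "realizable (subspace_on (affine_space J) ?B)"
    using closedin_topspace[of "zariski J"]
    by (intro realizable_affine variety_coordinates_nonzero fJ) auto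
  ultimately have "motivic_class (subspace_on (affine_space I)
      {x \<in> cspace I. (\<forall>i\<in>I - J. x i = c i) \<and> (\<forall>i\<in>J. x i \<noteq> 0)}) =
    motivic_class (subspace_on (affine_space J) ?B)" by (rule motivic_class_iso)
  then show ?thesis using motivic_class_coordinates_nonzero[OF fJ order_refl] by simp
qed

section \<open>Strata of constant support\<close>

definition support_locus :: "'i set \<Rightarrow> 'i set set \<Rightarrow> ('i \<Rightarrow> complex) set" where
  "support_locus I F = {x \<in> cspace I. {i \<in> I. x i \<noteq> 0} \<in> F}"

text \<open>Arrows added to a support leave fewer closed vertex sets, so semistable supports form
  such a family. For an upset the locus is a union of nonvanishing loci, hence open.\<close>

definition upset :: "'i set \<Rightarrow> 'i set set \<Rightarrow> bool" where
  "upset I F \<longleftrightarrow> F \<subseteq> Pow I \<and> (\<forall>S\<in>F. \<forall>S'. S \<subseteq> S' \<longrightarrow> S' \<subseteq> I \<longrightarrow> S' \<in> F)"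

lemma upset_subset: "upset I F \<Longrightarrow> S \<in> F \<Longrightarrow> S \<subseteq> I"
  by (auto simp: upset_def)

lemma upset_superset: "upset I F \<Longrightarrow> S \<in> F \<Longrightarrow> S \<subseteq> S' \<Longrightarrow> S' \<subseteq> I \<Longrightarrow> S' \<in> F"
  by (simp add: upset_def)

lemma support_locus_cspace: "support_locus I F \<subseteq> cspace I"
  by (auto simp: support_locus_def)

lemma support_locus_upset:
  assumes "upset I F"
  shows "support_locus I F = {x \<in> cspace I. \<exists>S\<in>F. \<forall>i\<in>S. x i \<noteq> 0}"
proof -
  have "{i \<in> I. x i \<noteq> 0} \<in> F \<longleftrightarrow> (\<exists>S\<in>F. \<forall>i\<in>S. x i \<noteq> 0)" for x :: "'a \<Rightarrow> complex"
  proof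
    assume "\<exists>S\<in>F. \<forall>i\<in>S. x i \<noteq> 0"
    then obtain S where S: "S \<in> F" "\<forall>i\<in>S. x i \<noteq> 0" by blast
    then have "S \<subseteq> {i \<in> I. x i \<noteq> 0}" using upset_subset[OF assms] by auto
    from upset_superset[OF assms S(1) this] show "{i \<in> I. x i \<noteq> 0} \<in> F" by simp
  next
    assume "{i \<in> I. x i \<noteq> 0} \<in> F"
    then show "\<exists>S\<in>F. \<forall>i\<in>S. x i \<noteq> 0" by (rule bexI[rotated]) simp
  qed
  then show ?thesis by (simp add: support_locus_def)
qed

lemma support_locus_nonzero:
  assumes "finite I" "upset I F"
  shows "support_locus I F = {x \<in> cspace I. \<exists>f\<in>(\<lambda>S x. \<Prod>i\<in>S. x i) ` F. f x \<noteq> 0}"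
proof -
  have "finite S" if "S \<in> F" for S
    using finite_subset[OF upset_subset[OF assms(2) that] assms(1)] .
  then show ?thesis unfolding support_locus_upset[OF assms(2)] by auto
qed

lemma finite_upset: "finite I \<Longrightarrow> upset I F \<Longrightarrow> finite F"
  unfolding upset_def by (meson finite_Pow_iff finite_subset)

lemma poly_fun_support:
  assumes "finite I" "S \<subseteq> I"
  shows "(\<lambda>x. \<Prod>i\<in>S. x i) \<in> poly_fun I"
  by (rule poly_fun_prod) (use assms finite_subset in \<open>auto intro: pf_coord\<close>)

lemma variety_support_locus:
  assumes I: "finite I" and F: "upset I F"
  shows "variety (subspace_on (affine_space I) (support_locus I F))"
  unfolding support_locus_nonzero[OF I F]
proof (rule variety_quasi_affine[OF I])
  show "closedin (zariski I) (cspace I)" using closedin_topspace[of "zariski I"] by simp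
  show "finite ((\<lambda>S x. \<Prod>i\<in>S. x i) ` F)" using finite_upset[OF I F] by simp
  show "(\<lambda>S x. \<Prod>i\<in>S. x i) ` F \<subseteq> poly_fun I"
    using poly_fun_support[OF I] F by (auto simp: upset_def)
qed

lemma openin_support_locus:
  assumes I: "finite I" and F: "upset I F"
  shows "openin (zariski I) (support_locus I F)"
proof -
  have "support_locus I F = (\<Union>S\<in>F. {x \<in> cspace I. (\<Prod>i\<in>S. x i) \<noteq> 0})"
    unfolding support_locus_nonzero[OF I F] by auto
  moreover have "openin (zariski I) {x \<in> cspace I. (\<Prod>i\<in>S. x i) \<noteq> 0}" if "S \<in> F" for S
    by (rule openin_zariski_nonzero[OF poly_fun_support[OF I]]) (use F that in \<open>auto simp: upset_def\<close>)
  ultimately show ?thesis by auto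
qed

lemma upset_remove_minimal:
  assumes "upset I F" "\<And>S'. S' \<in> F \<Longrightarrow> \<not> S' \<subset> S"
  shows "upset I (F - {S})"
  unfolding upset_def
proof (intro conjI ballI allI impI)
  show "F - {S} \<subseteq> Pow I" using upset_subset[OF assms(1)] by auto
  fix T T' assume T: "T \<in> F - {S}" "T \<subseteq> T'" "T' \<subseteq> I"
  then have "T' \<in> F" using upset_superset[OF assms(1), of T T'] by simp
  moreover have "T' \<noteq> S" using T assms(2)[of T] by auto
  ultimately show "T' \<in> F - {S}" by simp
qed

text \<open>Removing a minimal member keeps the family an upset, and minimality is what makes the
  corresponding stratum closed.\<close>

lemma upset_induct [consumes 2, case_names empty remove]:
  assumes I: "finite I" and F: "upset I F"
    and e: "P {}"
    and r: "\<And>F S. upset I F \<Longrightarrow> S \<in> F \<Longrightarrow> (\<And>S'. S' \<in> F \<Longrightarrow> \<not> S' \<subset> S) \<Longrightarrow>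
      upset I (F - {S}) \<Longrightarrow> P (F - {S}) \<Longrightarrow> P F"
  shows "P F"
  using F
proof (induction "card F" arbitrary: F)
  case 0
  then show ?case using e finite_upset[OF I] by auto
next
  case (Suc n)
  then have fin: "finite F" "F \<noteq> {}" using finite_upset[OF I] by auto
  then obtain S where S: "S \<in> F" "\<And>S'. S' \<in> F \<Longrightarrow> \<not> S' \<subset> S"
    using finite_has_minimal[of F] by blast
  have u: "upset I (F - {S})" by (rule upset_remove_minimal[OF Suc(3) S(2)])
  have "P (F - {S})" by (rule Suc(1)[OF _ u]) (use Suc(2) S fin in simp)
  then show ?case using r[OF Suc(3) S(1) S(2) u] by blast
qed

theorem motivic_class_support_locus:
  assumes I: "finite I" and F: "upset I F"
  shows "motivic_class (subspace_on (affine_space I) (support_locus I F)) =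
    (\<Sum>S\<in>F. (Lefschetz - 1) ^ card S)"
  using I F
proof (induction rule: upset_induct)
  case empty
  have u: "upset I {}" by (simp add: upset_def)
  show ?case
    by (simp, rule motivic_class_empty)
      (use variety_support_locus[OF I u] swf_subspace[OF swf_affine]
        realizable_affine[OF I support_locus_cspace variety_support_locus[OF I u]]
        in \<open>auto simp: support_locus_def\<close>)
next
  case (remove F S)
  let ?X = "subspace_on (affine_space I) (support_locus I F)"
  let ?C = "{x \<in> cspace I. (\<forall>i\<in>I - S. x i = 0) \<and> (\<forall>i\<in>S. x i \<noteq> 0)}"
  have SI: "S \<subseteq> I" by (rule upset_subset[OF remove(1,2)])
  have pts: "points ?X = support_locus I F" using support_locus_cspace by auto
  have supp: "{i \<in> I. x i \<noteq> 0} = S \<longleftrightarrow> (\<forall>i\<in>I - S. x i = 0) \<and> (\<forall>i\<in>S. x i \<noteq> 0)"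
    for x :: "'a \<Rightarrow> complex" using SI by auto
  have CF: "?C \<subseteq> support_locus I F"
    using remove(2) supp unfolding support_locus_def by force
  \<comment> \<open>Vanishing outside \<open>S\<close> leaves a support inside \<open>S\<close>,
    which by minimality is \<open>S\<close> itself; so inside the locus the stratum is cut out by
    equations.\<close>
  have "?C = {x \<in> cspace I. \<forall>i\<in>I - S. x i = 0} \<inter> support_locus I F"
  proof -
    have "x \<in> ?C" if "x \<in> cspace I" "\<forall>i\<in>I - S. x i = 0" "x \<in> support_locus I F" for x
    proof -
      have "{i \<in> I. x i \<noteq> 0} \<subseteq> S" "{i \<in> I. x i \<noteq> 0} \<in> F"
        using that by (auto simp: support_locus_def)
      then have "{i \<in> I. x i \<noteq> 0} = S" using remove(3) by blast
      then show ?thesis using that(1) supp by simp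
    qed
    then show ?thesis using CF by auto
  qed
  then have C: "closedin (zar ?X) ?C"
    using closedin_zariski_fixed[of "I - S" I "\<lambda>_. 0"] unfolding zar_subspace zar_affine
      closedin_subtopology by blast
  have ssC: "subspace_on ?X ?C = subspace_on (affine_space I) ?C"
    unfolding subspace_subspace[OF swf_affine] using CF by (simp add: Int_absorb1)
  have eqD: "points ?X - ?C = support_locus I (F - {S})"
    unfolding pts using supp by (auto simp: support_locus_def)
  have "support_locus I F \<inter> support_locus I (F - {S}) = support_locus I (F - {S})"
    by (auto simp: support_locus_def)
  then have ssD: "subspace_on ?X (points ?X - ?C) =
      subspace_on (affine_space I) (support_locus I (F - {S}))"
    unfolding eqD subspace_subspace[OF swf_affine] by simp
  have "?C = {x \<in> {x \<in> cspace I. \<forall>i\<in>I - S. x i = 0}. \<forall>i\<in>S. x i \<noteq> 0}" by auto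
  then have vC: "variety (subspace_on ?X ?C)"
    unfolding ssC
    using variety_coordinates_nonzero[OF I closedin_zariski_fixed[of "I - S" I "\<lambda>_. 0"] SI] by auto
  have "motivic_class ?X = motivic_class (subspace_on ?X ?C) +
      motivic_class (subspace_on ?X (points ?X - ?C))"
    by (rule motivic_class_scissor[OF realizable_affine[OF I support_locus_cspace
            variety_support_locus[OF I remove(1)]] swf_subspace[OF swf_affine] C vC])
      (unfold ssD, rule variety_support_locus[OF I remove(4)])
  also have "\<dots> = (Lefschetz - 1) ^ card S + (\<Sum>S\<in>F - {S}. (Lefschetz - 1) ^ card S)"
    unfolding ssD remove(5) ssC motivic_class_coordinate_torus[OF I SI, of "\<lambda>_. 0"] ..
  also have "\<dots> = (\<Sum>S\<in>F. (Lefschetz - 1) ^ card S)"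
    by (rule sum.remove[symmetric, OF finite_upset[OF I remove(1)] remove(2)])
  finally show ?case .
qed

section \<open>From classes to scalars\<close>

lemma tensor_diff_left: "(k - k') \<otimes>\<^sub>V c = k \<otimes>\<^sub>V c - k' \<otimes>\<^sub>V c"
  using tensor_add_left[of "k - k'" k' c] by simp

lemma tensor_diff_right: "k \<otimes>\<^sub>V (c - c') = k \<otimes>\<^sub>V c - k \<otimes>\<^sub>V c'"
  using tensor_add_right[of k "c - c'" c'] by simp

lemma tensor_zero_left: "0 \<otimes>\<^sub>V c = 0"
  using tensor_diff_left[of 0 0 c] by simp

lemma tensor_zero_right: "k \<otimes>\<^sub>V 0 = 0"
  using tensor_diff_right[of k 0 0] by simp

lemma tensor_sum_left: "(\<Sum>x\<in>A. f x) \<otimes>\<^sub>V c = (\<Sum>x\<in>A. f x \<otimes>\<^sub>V c)"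
  by (induction A rule: infinite_finite_induct) (simp_all add: tensor_zero_left tensor_add_left)

lemma tensor_sum_right: "k \<otimes>\<^sub>V (\<Sum>x\<in>A. f x) = (\<Sum>x\<in>A. k \<otimes>\<^sub>V f x)"
  by (induction A rule: infinite_finite_induct) (simp_all add: tensor_zero_right tensor_add_right)

text \<open>Balancedness is imposed for \<open>Lefschetz\<close> only; biadditivity extends it to
  \<open>Lefschetz - 1\<close>, and induction to the powers.\<close>

lemma tensor_Lefschetz_minus_one:
  "((Lefschetz - 1) ^ n * k) \<otimes>\<^sub>V c = k \<otimes>\<^sub>V ((q_var - 1) ^ n * c)"
proof (induction n arbitrary: c)
  case (Suc n)
  have "((Lefschetz - 1) ^ Suc n * k) \<otimes>\<^sub>V c =
      (Lefschetz * ((Lefschetz - 1) ^ n * k) - (Lefschetz - 1) ^ n * k) \<otimes>\<^sub>V c"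
    by (simp add: algebra_simps)
  also have "\<dots> = ((Lefschetz - 1) ^ n * k) \<otimes>\<^sub>V (q_var * c - c)"
    by (simp only: tensor_diff_left tensor_Lefschetz tensor_diff_right)
  also have "\<dots> = k \<otimes>\<^sub>V ((q_var - 1) ^ n * (q_var * c - c))" by (rule Suc)
  also have "(q_var - 1) ^ n * (q_var * c - c) = (q_var - 1) ^ Suc n * c"
    by (simp add: algebra_simps)
  finally show ?case .
qed simp

lemma tensor_sum_Lefschetz_minus_one:
  "(\<Sum>x\<in>A. (Lefschetz - 1) ^ n x) \<otimes>\<^sub>V c = scalar ((\<Sum>x\<in>A. (q_var - 1) ^ n x) * c)"
  unfolding tensor_sum_left sum_distrib_right tensor_sum_right
  using tensor_Lefschetz_minus_one[of _ 1] by simp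

section \<open>Torus quotients of loci of abelian representations\<close>

definition torus_act :: "('v, 'a) pre_digraph \<Rightarrow> ('v \<Rightarrow> complex) \<Rightarrow> ('a \<Rightarrow> complex) \<Rightarrow> 'a \<Rightarrow> complex" where
  "torus_act G g m = (\<lambda>a\<in>arcs G. g (head G a) * m a * inverse (g (tail G a)))"

definition closed_under :: "('v, 'a) pre_digraph \<Rightarrow> 'a set \<Rightarrow> 'v set \<Rightarrow> bool" where
  "closed_under G S I \<longleftrightarrow> (\<forall>a\<in>S. tail G a \<in> I \<longrightarrow> head G a \<in> I)"

text \<open>For \<open>A = B\<close> the condition says that the support \<open>A\<close> is connected; for \<open>A \<noteq> B\<close> it provides
  an invariant Laurent monomial separating orbits with supports \<open>A\<close> and \<open>B\<close>.\<close>

definition unsplittable :: "('v, 'a) pre_digraph \<Rightarrow> 'a set set \<Rightarrow> bool" where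
  "unsplittable G F \<longleftrightarrow> (\<forall>A\<in>F. \<forall>B\<in>F. \<forall>I\<subseteq>verts G. I \<noteq> {} \<longrightarrow> I \<noteq> verts G \<longrightarrow>
     \<not> (closed_under G B I \<and> closed_under G A (verts G - I)))"

abbreviation nonzero_on :: "'a set \<Rightarrow> 'a set \<Rightarrow> ('a \<Rightarrow> complex) set" where
  "nonzero_on E S \<equiv> {x \<in> cspace E. \<forall>a\<in>S. x a \<noteq> 0}"

text \<open>An arbitrary family of supports in place of the semistable ones, since a family from
  which supports have been removed need not come from a stability function.\<close>

definition orbit_space :: "('v, 'a) pre_digraph \<Rightarrow> 'a set set \<Rightarrow> ('a \<Rightarrow> complex) set fspace" where
  "orbit_space G F =
     quotient_fspace (subspace_on (affine_space (arcs G)) (support_locus (arcs G) F)) (torus_orbit G)"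

lemma torus_orbit_act: "torus_orbit G m = {torus_act G g m | g. \<forall>v\<in>verts G. g v \<noteq> 0}"
  by (simp add: torus_orbit_def torus_act_def)

lemma torus_act_cspace: "torus_act G g m \<in> cspace (arcs G)"
  by (simp add: torus_act_def)

lemma torus_act_one: "m \<in> cspace (arcs G) \<Longrightarrow> torus_act G (\<lambda>_. 1) m = m"
  by (rule PiE_ext[of _ "arcs G" "\<lambda>_. UNIV"]) (auto simp: torus_act_def)

lemma torus_act_act:
  "torus_act G g (torus_act G h m) = torus_act G (\<lambda>v. g v * h v) m"
  by (auto simp: torus_act_def fun_eq_iff restrict_def)

section \<open>Torus orbits, spanning trees and normal forms\<close>

context fin_digraph
begin

lemma torus_act_nonzero:
  assumes "\<forall>v\<in>verts G. g v \<noteq> 0" "a \<in> arcs G"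
  shows "torus_act G g m a \<noteq> 0 \<longleftrightarrow> m a \<noteq> 0"
  using assms tail_in_verts[OF assms(2)] head_in_verts[OF assms(2)] by (simp add: torus_act_def)

lemma torus_orbit_refl:
  assumes "m \<in> cspace (arcs G)" shows "m \<in> torus_orbit G m"
  unfolding torus_orbit_act using torus_act_one[OF assms] by (auto intro!: exI[of _ "\<lambda>_. 1"])

lemma torus_orbit_eq_act:
  assumes g: "\<forall>v\<in>verts G. g v \<noteq> 0"
  shows "torus_orbit G (torus_act G g m) = torus_orbit G m"
proof
  show "torus_orbit G (torus_act G g m) \<subseteq> torus_orbit G m"
  proof
    fix y assume "y \<in> torus_orbit G (torus_act G g m)"
    then obtain h where h: "\<forall>v\<in>verts G. h v \<noteq> 0" "y = torus_act G h (torus_act G g m)"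
      unfolding torus_orbit_act by blast
    then show "y \<in> torus_orbit G m"
      unfolding torus_orbit_act torus_act_act using g by (auto intro!: exI[of _ "\<lambda>v. h v * g v"])
  qed
  show "torus_orbit G m \<subseteq> torus_orbit G (torus_act G g m)"
  proof
    fix y assume "y \<in> torus_orbit G m"
    then obtain h where h: "\<forall>v\<in>verts G. h v \<noteq> 0" "y = torus_act G h m"
      unfolding torus_orbit_act by blast
    have "torus_act G (\<lambda>v. (h v * inverse (g v)) * g v) m = torus_act G h m"
      using g tail_in_verts head_in_verts by (auto simp: torus_act_def fun_eq_iff restrict_def)
    then show "y \<in> torus_orbit G (torus_act G g m)"
      unfolding torus_orbit_act torus_act_act
      using g h by (auto intro!: exI[of _ "\<lambda>v. h v * inverse (g v)"])
  qed
qed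

lemma torus_orbit_eqE:
  assumes "torus_orbit G x = torus_orbit G y" "y \<in> cspace (arcs G)"
  obtains g where "\<forall>v\<in>verts G. g v \<noteq> 0" "y = torus_act G g x"
proof -
  have "y \<in> torus_orbit G x" using torus_orbit_refl[OF assms(2)] assms(1) by simp
  then obtain g where "\<forall>v\<in>verts G. g v \<noteq> 0" "y = torus_act G g x"
    unfolding torus_orbit_act by blast
  then show ?thesis by (rule that)
qed

lemma torus_orbit_support:
  assumes "torus_orbit G x = torus_orbit G y" "y \<in> cspace (arcs G)" "a \<in> arcs G"
  shows "x a \<noteq> 0 \<longleftrightarrow> y a \<noteq> 0"
proof -
  obtain g where "\<forall>v\<in>verts G. g v \<noteq> 0" "y = torus_act G g x"
    using torus_orbit_eqE[OF assms(1,2)] .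
  then show ?thesis using torus_act_nonzero assms(3) by simp
qed

lemma support_locus_saturated:
  assumes "x \<in> cspace (arcs G)" "y \<in> support_locus (arcs G) F" "torus_orbit G x = torus_orbit G y"
  shows "x \<in> support_locus (arcs G) F"
proof -
  have "y \<in> cspace (arcs G)" using assms(2) by (simp add: support_locus_def)
  then have "{a \<in> arcs G. x a \<noteq> 0} = {a \<in> arcs G. y a \<noteq> 0}"
    using torus_orbit_support[OF assms(3)] by blast
  then show ?thesis using assms(1,2) by (simp add: support_locus_def)
qed

lemma support_locus_principal:
  assumes "S \<subseteq> arcs G"
  shows "support_locus (arcs G) {S'. S \<subseteq> S' \<and> S' \<subseteq> arcs G} = nonzero_on (arcs G) S"
  using assms by (auto simp: support_locus_def)

lemma upset_principal: "S \<subseteq> E \<Longrightarrow> upset E {S'. S \<subseteq> S' \<and> S' \<subseteq> E}"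
  by (auto simp: upset_def)

lemma points_orbit_space [simp]:
  "points (orbit_space G F) = torus_orbit G ` support_locus (arcs G) F"
  unfolding orbit_space_def using support_locus_cspace[of "arcs G" F] by (simp add: Int_absorb1)

lemma ringed_orbit_space: "ringed_space (orbit_space G F)"
  unfolding orbit_space_def by (intro ringed_quotient ringed_subspace ringed_affine)

lemma openin_support_sublocus:
  assumes F': "upset (arcs G) F'" and sub: "F' \<subseteq> F"
  shows "openin (zar (subspace_on (affine_space (arcs G)) (support_locus (arcs G) F)))
    (support_locus (arcs G) F')"
proof -
  have "support_locus (arcs G) F' = support_locus (arcs G) F' \<inter> support_locus (arcs G) F"
    using sub by (auto simp: support_locus_def)
  then show ?thesis
    using openin_support_locus[OF finite_arcs F']
    unfolding zar_subspace zar_affine openin_subtopology by blast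
qed

lemma orbit_space_open:
  assumes F': "upset (arcs G) F'" and sub: "F' \<subseteq> F"
  shows "openin (zar (orbit_space G F)) (torus_orbit G ` support_locus (arcs G) F')"
    and "subspace_on (orbit_space G F) (torus_orbit G ` support_locus (arcs G) F') = orbit_space G F'"
proof -
  let ?X = "subspace_on (affine_space (arcs G)) (support_locus (arcs G) F)"
  let ?W = "support_locus (arcs G) F'"
  have W: "?W \<subseteq> support_locus (arcs G) F" using sub by (auto simp: support_locus_def)
  have pts: "points ?X = support_locus (arcs G) F" using support_locus_cspace by auto
  have sat: "x \<in> ?W" if "x \<in> points ?X" "y \<in> ?W" "torus_orbit G x = torus_orbit G y" for x y
    using support_locus_saturated[OF _ that(2,3)] that(1) by simp
  have "subspace_on ?X ?W = subspace_on (affine_space (arcs G)) ?W"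
    unfolding subspace_subspace[OF swf_affine] using W by (simp add: Int_absorb1)
  moreover have "subspace_on (quotient_fspace ?X (torus_orbit G)) (torus_orbit G ` ?W) =
      quotient_fspace (subspace_on ?X ?W) (torus_orbit G)"
    by (rule subspace_quotient[OF swf_subspace[OF swf_affine] openin_support_sublocus[OF F' sub] sat])
  ultimately show "subspace_on (orbit_space G F) (torus_orbit G ` ?W) = orbit_space G F'"
    by (simp add: orbit_space_def)
  have eq: "{x \<in> points ?X. torus_orbit G x \<in> torus_orbit G ` ?W} = ?W"
    using sat W unfolding pts by blast
  show "openin (zar (orbit_space G F)) (torus_orbit G ` ?W)"
    unfolding orbit_space_def openin_quotient_fspace eq
    using openin_support_sublocus[OF F' sub] W pts by auto
qed

text \<open>\<open>\<gamma> v\<close> is the monomial in the arrows of the tree along the path from the root \<open>r\<close> to \<open>v\<close>.\<close>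

definition tree_gauge :: "'b set \<Rightarrow> 'a set \<Rightarrow> ('a \<Rightarrow> ('b \<Rightarrow> complex) \<Rightarrow> complex) \<Rightarrow> 'a \<Rightarrow> bool" where
  "tree_gauge T B \<gamma> r \<longleftrightarrow> r \<in> B \<and> B \<subseteq> verts G \<and> T \<subseteq> arcs G \<and> Suc (card T) = card B \<and>
     (\<forall>a\<in>T. tail G a \<in> B \<and> head G a \<in> B) \<and>
     (\<forall>v\<in>B. rational_on (arcs G) (nonzero_on (arcs G) T) (\<gamma> v)) \<and>
     (\<forall>v\<in>B. \<forall>x. (\<forall>a\<in>T. x a \<noteq> 0) \<longrightarrow> \<gamma> v x \<noteq> 0) \<and>
     (\<forall>a\<in>T. \<forall>x. (\<forall>a\<in>T. x a \<noteq> 0) \<longrightarrow> \<gamma> (head G a) x = \<gamma> (tail G a) x * x a) \<and>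
     (\<forall>v\<in>B. \<forall>x. (\<forall>a\<in>T. x a = 1) \<longrightarrow> \<gamma> v x = 1) \<and>
     (\<forall>v\<in>B. \<forall>x g. (\<forall>v\<in>verts G. g v \<noteq> 0) \<longrightarrow> (\<forall>a\<in>T. x a \<noteq> 0) \<longrightarrow>
        \<gamma> v (torus_act G g x) = g v * \<gamma> v x * inverse (g r))"

lemma tree_gaugeD:
  assumes "tree_gauge T B \<gamma> r"
  shows "r \<in> B" "B \<subseteq> verts G" "T \<subseteq> arcs G" "Suc (card T) = card B"
    "\<And>a. a \<in> T \<Longrightarrow> tail G a \<in> B" "\<And>a. a \<in> T \<Longrightarrow> head G a \<in> B"
    "\<And>v. v \<in> B \<Longrightarrow> rational_on (arcs G) (nonzero_on (arcs G) T) (\<gamma> v)"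
    "\<And>v x. v \<in> B \<Longrightarrow> \<forall>a\<in>T. x a \<noteq> 0 \<Longrightarrow> \<gamma> v x \<noteq> 0"
    "\<And>a x. a \<in> T \<Longrightarrow> \<forall>a\<in>T. x a \<noteq> 0 \<Longrightarrow> \<gamma> (head G a) x = \<gamma> (tail G a) x * x a"
    "\<And>v x. v \<in> B \<Longrightarrow> \<forall>a\<in>T. x a = 1 \<Longrightarrow> \<gamma> v x = 1"
    "\<And>v x g. v \<in> B \<Longrightarrow> \<forall>v\<in>verts G. g v \<noteq> 0 \<Longrightarrow> \<forall>a\<in>T. x a \<noteq> 0 \<Longrightarrow>
        \<gamma> v (torus_act G g x) = g v * \<gamma> v x * inverse (g r)"
  using assms unfolding tree_gauge_def by simp_all

lemma tree_gauge_extend: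
  assumes t: "tree_gauge T B \<gamma> r" and a: "a \<in> arcs G"
    and uw: "u \<in> B" "w \<in> verts G" "w \<notin> B"
    and ends: "tail G a = u \<and> head G a = w \<or> tail G a = w \<and> head G a = u"
  shows "\<exists>\<gamma>'. tree_gauge (insert a T) (insert w B) \<gamma>' r"
proof -
  note d = tree_gaugeD[OF t]
  \<comment> \<open>The path from the root traverses \<open>a\<close> forwards if \<open>a\<close>
    ends at the new vertex, and backwards otherwise.\<close>
  define e where "e = (\<lambda>x::'b \<Rightarrow> complex. if head G a = w then x a else inverse (x a))"
  define \<gamma>' where "\<gamma>' = \<gamma>(w := \<lambda>x. \<gamma> u x * e x)"
  have aT: "a \<notin> T" using d(5,6) ends uw by metis
  have finT: "finite T" using d(3) finite_arcs finite_subset by blast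
  have finB: "finite B" using d(2) finite_verts finite_subset by blast
  have sub: "nonzero_on (arcs G) (insert a T) \<subseteq> nonzero_on (arcs G) T" by auto
  have ra: "rational_on (arcs G) (nonzero_on (arcs G) (insert a T)) (\<lambda>x. x a)"
    by (rule rational_on_coord[OF a])
  have re: "rational_on (arcs G) (nonzero_on (arcs G) (insert a T)) e"
  proof (cases "head G a = w")
    case False
    have "rational_on (arcs G) (nonzero_on (arcs G) (insert a T)) (\<lambda>x. inverse (x a))"
      by (rule rational_on_inverse[OF ra]) simp
    then show ?thesis using False by (simp add: e_def)
  next
    case True
    then have "e = (\<lambda>x. x a)" by (simp add: e_def)
    then show ?thesis using ra by simp
  qed
  have old: "\<gamma>' v = \<gamma> v" if "v \<in> B" for v using that uw by (auto simp: \<gamma>'_def)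
  have new: "\<gamma>' w x = \<gamma> u x * e x" for x by (simp add: \<gamma>'_def)
  have "tree_gauge (insert a T) (insert w B) \<gamma>' r"
    unfolding tree_gauge_def
  proof (intro conjI ballI allI impI)
    show "r \<in> insert w B" "insert w B \<subseteq> verts G" "insert a T \<subseteq> arcs G" using d(1-3) uw a by auto
    show "Suc (card (insert a T)) = card (insert w B)"
      using d(4) aT finT finB uw(3) by simp
    show "tail G b \<in> insert w B" "head G b \<in> insert w B" if "b \<in> insert a T" for b
      using that d(5,6) ends uw by auto
    show "rational_on (arcs G) (nonzero_on (arcs G) (insert a T)) (\<gamma>' v)" if "v \<in> insert w B" for v
    proof (cases "v = w")
      case True
      then show ?thesis
        using rational_on_mult[OF rational_on_mono[OF d(7)[OF uw(1)] sub] re]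
        by (simp add: \<gamma>'_def)
    next
      case False
      then show ?thesis using that old rational_on_mono[OF d(7) sub] by simp
    qed
    show "\<gamma>' v x \<noteq> 0" if "v \<in> insert w B" "\<forall>a\<in>insert a T. x a \<noteq> 0" for v x
    proof (cases "v = w")
      case True
      then show ?thesis using d(8)[OF uw(1), of x] that new by (simp add: e_def)
    next
      case False
      then show ?thesis using d(8)[of v x] that old by simp
    qed
    show "\<gamma>' (head G b) x = \<gamma>' (tail G b) x * x b" if b: "b \<in> insert a T"
      and x: "\<forall>a\<in>insert a T. x a \<noteq> 0" for b x
    proof (cases "b = a")
      case True
      have "\<gamma> u x \<noteq> 0" "x a \<noteq> 0" using d(8)[OF uw(1), of x] x by auto
      then show ?thesis using ends True uw old[OF uw(1)] new by (auto simp: e_def)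
    next
      case False
      then have "b \<in> T" using b by simp
      then show ?thesis using d(9)[of b x] d(5,6) old x by simp
    qed
    show "\<gamma>' v x = 1" if "v \<in> insert w B" "\<forall>a\<in>insert a T. x a = 1" for v x
    proof (cases "v = w")
      case True
      then show ?thesis using d(10)[OF uw(1), of x] that new by (simp add: e_def)
    next
      case False
      then show ?thesis using d(10)[of v x] that old by simp
    qed
    show "\<gamma>' v (torus_act G g x) = g v * \<gamma>' v x * inverse (g r)"
      if v: "v \<in> insert w B" and g: "\<forall>v\<in>verts G. g v \<noteq> 0" and x: "\<forall>a\<in>insert a T. x a \<noteq> 0" for v x g
    proof (cases "v = w")
      case True
      have nz: "g u \<noteq> 0" "g w \<noteq> 0" using g uw d(2) by auto
      have "e (torus_act G g x) = g w * e x * inverse (g u)"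
        using ends uw a nz by (auto simp: e_def torus_act_def)
      then show ?thesis using True new d(11)[OF uw(1) g, of x] x nz by simp
    next
      case False
      then show ?thesis using d(11)[of v g x] that old by simp
    qed
  qed
  then show ?thesis by blast
qed

text \<open>The tree grows one vertex at a time: if no arrow of \<open>S\<close> crossed the
  boundary of the part \<open>B\<close> already reached, both \<open>B\<close> and its complement
  would be closed under \<open>S\<close>.\<close>

lemma spanning_tree_exists:
  assumes S: "S \<subseteq> arcs G" and ne: "verts G \<noteq> {}"
    and conn: "\<And>I. I \<subseteq> verts G \<Longrightarrow> I \<noteq> {} \<Longrightarrow> I \<noteq> verts G \<Longrightarrow>
      \<not> (closed_under G S I \<and> closed_under G S (verts G - I))"
  obtains T \<gamma> r where "T \<subseteq> S" "tree_gauge T (verts G) \<gamma> r"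
proof -
  obtain r where r: "r \<in> verts G" using ne by blast
  have "\<exists>T B \<gamma>. T \<subseteq> S \<and> card B = k \<and> tree_gauge T B \<gamma> r" if "1 \<le> k" "k \<le> card (verts G)" for k
    using that
  proof (induction k)
    case (Suc k)
    show ?case
    proof (cases "k = 0")
      case True
      have "tree_gauge {} {r} (\<lambda>_ _. 1) r"
        unfolding tree_gauge_def using r by (auto intro: rational_on_const)
      then show ?thesis using True by (intro exI[of _ "{}"] exI[of _ "{r}"] exI) auto
    next
      case False
      then obtain T B \<gamma> where T: "T \<subseteq> S" "card B = k" "tree_gauge T B \<gamma> r"
        using Suc by auto
      note d = tree_gaugeD[OF T(3)]
      have "B \<noteq> verts G" using T(2) Suc(3) by auto
      moreover have "B \<noteq> {}" using d(1) by blast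
      ultimately have "\<not> (closed_under G S B \<and> closed_under G S (verts G - B))"
        using conn[OF d(2)] by blast
      then obtain a where a: "a \<in> S" "tail G a \<in> B \<and> head G a \<notin> B \<or> tail G a \<notin> B \<and> head G a \<in> B"
        unfolding closed_under_def using S head_in_verts tail_in_verts by blast
      have aG: "a \<in> arcs G" using a S by blast
      obtain u w where uw: "u \<in> B" "w \<in> verts G" "w \<notin> B"
        "tail G a = u \<and> head G a = w \<or> tail G a = w \<and> head G a = u"
        using a(2) head_in_verts[OF aG] tail_in_verts[OF aG] by blast
      from tree_gauge_extend[OF T(3) aG uw] obtain \<gamma>' where
        g: "tree_gauge (insert a T) (insert w B) \<gamma>' r" by blast
      have "finite B" using d(2) finite_verts finite_subset by blast
      then have "card (insert w B) = Suc k" using T(2) uw(3) by simp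
      then show ?thesis using g a(1) T(1)
        by (intro exI[of _ "insert a T"] exI[of _ "insert w B"] exI) auto
    qed
  qed simp
  from this[of "card (verts G)"] obtain T B \<gamma> where
    T: "T \<subseteq> S" "card B = card (verts G)" "tree_gauge T B \<gamma> r"
    using r finite_verts card_gt_0_iff[of "verts G"] by (auto simp: Suc_le_eq)
  have "B = verts G" using card_subset_eq[OF finite_verts tree_gaugeD(2)[OF T(3)]] T(2) by simp
  then show ?thesis using that T by blast
qed

text \<open>Gauge fixing: the path monomials at the two ends of a tree arrow \<open>a\<close> differ
  by the factor \<open>x a\<close>, so acting by their inverses turns all tree coordinates into
  1.\<close>

definition normal_form :: "('a \<Rightarrow> ('b \<Rightarrow> complex) \<Rightarrow> complex) \<Rightarrow> ('b \<Rightarrow> complex) \<Rightarrow> 'b \<Rightarrow> complex" where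
  "normal_form \<gamma> x = torus_act G (\<lambda>v. inverse (\<gamma> v x)) x"

lemma normal_form_cspace: "normal_form \<gamma> x \<in> cspace (arcs G)"
  unfolding normal_form_def by (rule torus_act_cspace)

lemma normal_form:
  assumes t: "tree_gauge T (verts G) \<gamma> r" and x: "x \<in> nonzero_on (arcs G) T"
  shows "torus_orbit G (normal_form \<gamma> x) = torus_orbit G x"
    and "\<And>a. a \<in> T \<Longrightarrow> normal_form \<gamma> x a = 1"
    and "\<And>a. a \<in> arcs G \<Longrightarrow> normal_form \<gamma> x a \<noteq> 0 \<longleftrightarrow> x a \<noteq> 0"
    and "\<And>y. y \<in> nonzero_on (arcs G) T \<Longrightarrow> torus_orbit G x = torus_orbit G y \<Longrightarrow>
      normal_form \<gamma> x = normal_form \<gamma> y"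
    and "\<forall>a\<in>T. x a = 1 \<Longrightarrow> normal_form \<gamma> x = x"
proof -
  note d = tree_gaugeD[OF t]
  have nz: "\<forall>v\<in>verts G. inverse (\<gamma> v x) \<noteq> 0" using d(8) x by simp
  show "torus_orbit G (normal_form \<gamma> x) = torus_orbit G x"
    unfolding normal_form_def by (rule torus_orbit_eq_act[OF nz])
  show "normal_form \<gamma> x a \<noteq> 0 \<longleftrightarrow> x a \<noteq> 0" if "a \<in> arcs G" for a
    unfolding normal_form_def by (rule torus_act_nonzero[OF nz that])
  show "normal_form \<gamma> x a = 1" if a: "a \<in> T" for a
  proof -
    have "\<gamma> (head G a) x = \<gamma> (tail G a) x * x a" "\<gamma> (head G a) x \<noteq> 0" "a \<in> arcs G"
      using d(9)[OF a, of x] d(8)[OF d(6)[OF a], of x] x d(3) a by auto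
    then show ?thesis unfolding normal_form_def torus_act_def by (simp add: field_simps)
  qed
  show "normal_form \<gamma> x = x" if 1: "\<forall>a\<in>T. x a = 1"
  proof (rule PiE_ext[OF normal_form_cspace])
    show "x \<in> cspace (arcs G)" using x by blast
    fix a assume a: "a \<in> arcs G"
    then have "\<gamma> (head G a) x = 1" "\<gamma> (tail G a) x = 1" using d(10)[OF _ 1] by auto
    then show "normal_form \<gamma> x a = x a" using a by (simp add: normal_form_def torus_act_def)
  qed
  show "normal_form \<gamma> x = normal_form \<gamma> y"
    if y: "y \<in> nonzero_on (arcs G) T" and eq: "torus_orbit G x = torus_orbit G y" for y
  proof -
    obtain g where g: "\<forall>v\<in>verts G. g v \<noteq> 0" "y = torus_act G g x"
      using torus_orbit_eqE[OF eq] y by blast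
    have gr: "g r \<noteq> 0" using g(1) d(1) by blast
    show ?thesis
    proof (rule PiE_ext[OF normal_form_cspace normal_form_cspace])
      fix a assume a: "a \<in> arcs G"
      have h: "head G a \<in> verts G" "tail G a \<in> verts G" using a by auto
      \<comment> \<open>The factor coming from the root is the same at both ends of an arrow and
        cancels in the normal form.\<close>
      have *: "\<gamma> v y = g v * \<gamma> v x * inverse (g r)" if "v \<in> verts G" for v
        using d(11)[OF that g(1), of x] x g(2) by simp
      have nz: "g (head G a) \<noteq> 0" "g (tail G a) \<noteq> 0" "\<gamma> (head G a) x \<noteq> 0" "\<gamma> (tail G a) x \<noteq> 0"
        using g(1) h d(8) x by auto
      have "y a = g (head G a) * x a * inverse (g (tail G a))" using a g(2)
        by (simp add: torus_act_def)
      then show "normal_form \<gamma> x a = normal_form \<gamma> y a"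
        using a nz gr
        by (simp add: normal_form_def torus_act_def *[OF h(1)] *[OF h(2)] nonzero_inverse_mult_distrib)
          (simp add: field_simps)
    qed
  qed
qed

lemma rational_normal_form:
  assumes t: "tree_gauge T (verts G) \<gamma> r" and a: "a \<in> arcs G"
  shows "rational_on (arcs G) (nonzero_on (arcs G) T) (\<lambda>x. normal_form \<gamma> x a)"
proof -
  note d = tree_gaugeD[OF t]
  have h: "head G a \<in> verts G" "tail G a \<in> verts G" using a by auto
  have "rational_on (arcs G) (nonzero_on (arcs G) T)
      (\<lambda>x. inverse (\<gamma> (head G a) x) * x a * \<gamma> (tail G a) x)"
    by (intro rational_on_mult rational_on_inverse rational_on_coord d(7) h a) (use d(8) h in auto)
  then show ?thesis
    by (rule rational_on_cong) (use a in \<open>auto simp: normal_form_def torus_act_def\<close>)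
qed

text \<open>The points whose tree coordinates are 1 form a slice that meets each orbit of the chart
  once, and the normal form is the projection to it.\<close>

lemma orbit_space_chart:
  assumes S: "S \<subseteq> arcs G" and TS: "T \<subseteq> S" and t: "tree_gauge T (verts G) \<gamma> r"
  obtains \<phi> where
    "iso_pair (orbit_space G {S'. S \<subseteq> S' \<and> S' \<subseteq> arcs G})
       (subspace_on (affine_space (arcs G)) {x \<in> nonzero_on (arcs G) S. \<forall>a\<in>T. x a = 1})
       \<phi> (torus_orbit G)"
    "\<forall>x\<in>nonzero_on (arcs G) S. \<phi> (torus_orbit G x) = normal_form \<gamma> x"
proof -
  let ?W = "nonzero_on (arcs G) S" and ?A = "affine_space (arcs G)"
  let ?Y = "{x \<in> ?W. \<forall>a\<in>T. x a = 1}"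
  have WT: "?W \<subseteq> nonzero_on (arcs G) T" using TS by auto
  have W: "?W \<subseteq> cspace (arcs G)" and Y: "?Y \<subseteq> cspace (arcs G)" by auto
  have pts: "points (subspace_on ?A ?W) = ?W" "points (subspace_on ?A ?Y) = ?Y" using W Y by auto
  have im: "normal_form \<gamma> x \<in> ?Y" if x: "x \<in> ?W" for x
  proof -
    have xT: "x \<in> nonzero_on (arcs G) T" using x WT by blast
    have "normal_form \<gamma> x a \<noteq> 0" if "a \<in> S" for a
      using normal_form(3)[OF t xT, of a] that S x by auto
    then show ?thesis using normal_form_cspace normal_form(2)[OF t xT] by auto
  qed
  have \<nu>: "morphism (subspace_on ?A ?W) (subspace_on ?A ?Y) (normal_form \<gamma>)"
    by (rule morphism_rational[OF W im Y rational_on_mono[OF rational_normal_form[OF t] WT]])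
  have \<sigma>: "morphism (subspace_on ?A ?Y) (subspace_on ?A ?W) (\<lambda>x. x)"
    by (rule morphism_rational[OF Y _ W]) (auto intro: rational_on_coord)
  have 1: "torus_orbit G (normal_form \<gamma> x) = torus_orbit G x"
    if "x \<in> points (subspace_on ?A ?W)" for x
  proof -
    have "x \<in> nonzero_on (arcs G) T" using that WT unfolding pts by blast
    then show ?thesis by (rule normal_form(1)[OF t])
  qed
  have 2: "normal_form \<gamma> x = normal_form \<gamma> y" if "x \<in> points (subspace_on ?A ?W)"
    "y \<in> points (subspace_on ?A ?W)" "torus_orbit G x = torus_orbit G y" for x y
  proof -
    have "x \<in> nonzero_on (arcs G) T" "y \<in> nonzero_on (arcs G) T"
      using that(1,2) WT unfolding pts by blast+
    then show ?thesis using that(3) by (rule normal_form(4)[OF t])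
  qed
  have 3: "normal_form \<gamma> y = y" if "y \<in> points (subspace_on ?A ?Y)" for y
  proof -
    have "y \<in> nonzero_on (arcs G) T" "\<forall>a\<in>T. y a = 1" using that WT unfolding pts by blast+
    then show ?thesis by (rule normal_form(5)[OF t])
  qed
  obtain \<phi> where \<phi>: "iso_pair (quotient_fspace (subspace_on ?A ?W) (torus_orbit G))
        (subspace_on ?A ?Y) \<phi> (\<lambda>y. torus_orbit G y)"
      "\<forall>x\<in>points (subspace_on ?A ?W). \<phi> (torus_orbit G x) = normal_form \<gamma> x"
    using quotient_isomorphic_slice[where \<pi> = "torus_orbit G" and \<sigma> = "\<lambda>x. x" and
        \<nu> = "normal_form \<gamma>", OF swf_subspace[OF swf_affine] \<nu> \<sigma> 1 2 3] .
  show ?thesis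
    by (rule that[of \<phi>]) (use \<phi> in \<open>unfold orbit_space_def support_locus_principal[OF S] pts(1)\<close>)
qed

text \<open>An invariant function has a well-defined value on each orbit, and regularity on the
  quotient means regularity of the pullback.\<close>

lemma orbit_space_rational:
  assumes F: "upset (arcs G) F" and S: "S \<in> F"
    and f: "rational_on (arcs G) (nonzero_on (arcs G) S) f"
    and inv: "\<And>x g. x \<in> nonzero_on (arcs G) S \<Longrightarrow> \<forall>v\<in>verts G. g v \<noteq> 0 \<Longrightarrow> f (torus_act G g x) = f x"
  obtains f' where "regular (orbit_space G F) (torus_orbit G ` nonzero_on (arcs G) S) f'"
    "\<forall>x\<in>nonzero_on (arcs G) S. f' (torus_orbit G x) = f x"
proof -
  let ?A = "affine_space (arcs G)" and ?W = "nonzero_on (arcs G) S"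
  let ?X = "subspace_on ?A (support_locus (arcs G) F)"
  have SG: "S \<subseteq> arcs G" by (rule upset_subset[OF F S])
  note sp = support_locus_principal[OF SG]
  have sub: "{S'. S \<subseteq> S' \<and> S' \<subseteq> arcs G} \<subseteq> F" using upset_superset[OF F S] by blast
  define f' where "f' = (\<lambda>u. f (SOME x. x \<in> ?W \<and> torus_orbit G x = u))"
  have f': "f' (torus_orbit G x) = f x" if x: "x \<in> ?W" for x
  proof -
    let ?y = "SOME y. y \<in> ?W \<and> torus_orbit G y = torus_orbit G x"
    have y: "?y \<in> ?W \<and> torus_orbit G ?y = torus_orbit G x"
      using someI[of "\<lambda>y. y \<in> ?W \<and> torus_orbit G y = torus_orbit G x" x] x by blast
    then obtain g where "\<forall>v\<in>verts G. g v \<noteq> 0" "x = torus_act G g ?y"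
      using torus_orbit_eqE[of ?y x] x by blast
    then have "f x = f ?y" using inv[of ?y g] y by simp
    then show ?thesis by (simp add: f'_def)
  qed
  have op: "openin (zar ?X) ?W"
    using openin_support_sublocus[OF upset_principal[OF SG] sub] unfolding sp .
  have WF: "?W \<subseteq> support_locus (arcs G) F"
    using sub unfolding sp[symmetric] by (auto simp: support_locus_def)
  have "regular (subspace_on ?A ?W) ?W f" by (rule regular_rational_on[OF _ f]) auto
  moreover have "subspace_on ?X ?W = subspace_on ?A ?W"
    unfolding subspace_subspace[OF swf_affine] using WF by (simp add: Int_absorb1)
  ultimately have "regular ?X ?W f"
    using regular_open_subspace[OF swf_subspace[OF swf_affine] op] by simp
  then have r: "regular ?X ?W (\<lambda>x. f' (torus_orbit G x))"
    by (rule swf_cong[OF swf_subspace[OF swf_affine]]) (simp add: f')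
  have sat: "x \<in> ?W" if "x \<in> cspace (arcs G)" "y \<in> ?W" "torus_orbit G x = torus_orbit G y" for x y
    using support_locus_saturated[OF that(1) _ that(3), of "{S'. S \<subseteq> S' \<and> S' \<subseteq> arcs G}"] that(2)
    unfolding sp by blast
  have pts: "points ?X = support_locus (arcs G) F" using support_locus_cspace by auto
  have "{x \<in> points ?X. torus_orbit G x \<in> torus_orbit G ` ?W} = ?W"
    using sat WF support_locus_cspace unfolding pts by blast
  then have "regular (orbit_space G F) (torus_orbit G ` ?W) f'"
    unfolding orbit_space_def regular_quotient pts using r WF by (simp add: image_mono)
  then show ?thesis using that f' by blast
qed

text \<open>The monomial is collected along a walk that follows arrows of \<open>B\<close> forwards and arrows of
  \<open>A\<close> backwards.\<close>

lemma separating_monomial_path: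
  assumes A: "A \<subseteq> arcs G" and B: "B \<subseteq> arcs G"
    and path: "(w, v) \<in> {(v, v'). (\<exists>a\<in>B. tail G a = v \<and> head G a = v') \<or>
       (\<exists>a\<in>A. head G a = v \<and> tail G a = v')}\<^sup>*"
    and w: "w \<in> verts G"
  shows "\<exists>f f'. v \<in> verts G \<and> rational_on (arcs G) (nonzero_on (arcs G) A) f \<and>
    rational_on (arcs G) (nonzero_on (arcs G) B) f' \<and>
    (\<forall>x. (\<forall>a\<in>A \<union> B. x a \<noteq> 0) \<longrightarrow> f x * f' x = 1) \<and>
    (\<forall>x g. (\<forall>v\<in>verts G. g v \<noteq> 0) \<longrightarrow> f (torus_act G g x) = g v * f x * inverse (g w) \<and>
       f' (torus_act G g x) = g w * f' x * inverse (g v))"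
  using path
proof (induction rule: rtrancl_induct)
  case base
  show ?case
    by (rule exI[of _ "\<lambda>_. 1"], rule exI[of _ "\<lambda>_. 1"]) (use w in \<open>auto intro: rational_on_const\<close>)
next
  case (step v v')
  from step(3) obtain f f' where v: "v \<in> verts G"
    and f: "rational_on (arcs G) (nonzero_on (arcs G) A) f"
    and f': "rational_on (arcs G) (nonzero_on (arcs G) B) f'"
    and one: "\<forall>x. (\<forall>a\<in>A \<union> B. x a \<noteq> 0) \<longrightarrow> f x * f' x = 1"
    and eq: "\<forall>x g. (\<forall>v\<in>verts G. g v \<noteq> 0) \<longrightarrow> f (torus_act G g x) = g v * f x * inverse (g w) \<and>
       f' (torus_act G g x) = g w * f' x * inverse (g v)" by (elim exE conjE)
  from step(2) consider a where "a \<in> B" "tail G a = v" "head G a = v'"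
    | a where "a \<in> A" "head G a = v" "tail G a = v'" by blast
  then show ?case
  proof cases
    case 1
    have aG: "a \<in> arcs G" using 1 B by blast
    have "rational_on (arcs G) (nonzero_on (arcs G) A) (\<lambda>x. f x * x a)"
      by (intro rational_on_mult f rational_on_coord aG)
    moreover have "rational_on (arcs G) (nonzero_on (arcs G) B) (\<lambda>x. f' x * inverse (x a))"
      by (intro rational_on_mult f' rational_on_inverse rational_on_coord aG) (use 1 in auto)
    moreover have "\<forall>x. (\<forall>a\<in>A \<union> B. x a \<noteq> 0) \<longrightarrow> (f x * x a) * (f' x * inverse (x a)) = 1"
    proof (intro allI impI)
      fix x :: "'b \<Rightarrow> complex" assume "\<forall>a\<in>A \<union> B. x a \<noteq> 0"
      then have "f x * f' x = 1" "x a \<noteq> 0" using one 1(1) by auto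
      then show "(f x * x a) * (f' x * inverse (x a)) = 1" by (simp add: field_simps)
    qed
    moreover have "f (torus_act G g x) * torus_act G g x a = g v' * (f x * x a) * inverse (g w) \<and>
       f' (torus_act G g x) * inverse (torus_act G g x a) = g w * (f' x * inverse (x a)) * inverse (g v')"
      if g: "\<forall>v\<in>verts G. g v \<noteq> 0" for x g
    proof -
      have "g v \<noteq> 0" "g v' \<noteq> 0" using g v 1 aG by auto
      moreover have "torus_act G g x a = g v' * x a * inverse (g v)"
        using aG 1 by (simp add: torus_act_def)
      ultimately show ?thesis using eq[THEN spec[of _ x], THEN spec[of _ g], THEN mp, OF g] by simp
    qed
    moreover have "v' \<in> verts G" using aG 1 by auto
    ultimately show ?thesis
      by (rule_tac exI[of _ "\<lambda>x. f x * x a"], rule_tac exI[of _ "\<lambda>x. f' x * inverse (x a)"]) simp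
  next
    case 2
    have aG: "a \<in> arcs G" using 2 A by blast
    have "rational_on (arcs G) (nonzero_on (arcs G) A) (\<lambda>x. f x * inverse (x a))"
      by (intro rational_on_mult f rational_on_inverse rational_on_coord aG) (use 2 in auto)
    moreover have "rational_on (arcs G) (nonzero_on (arcs G) B) (\<lambda>x. f' x * x a)"
      by (intro rational_on_mult f' rational_on_coord aG)
    moreover have "\<forall>x. (\<forall>a\<in>A \<union> B. x a \<noteq> 0) \<longrightarrow> (f x * inverse (x a)) * (f' x * x a) = 1"
    proof (intro allI impI)
      fix x :: "'b \<Rightarrow> complex" assume "\<forall>a\<in>A \<union> B. x a \<noteq> 0"
      then have "f x * f' x = 1" "x a \<noteq> 0" using one 2(1) by auto
      then show "(f x * inverse (x a)) * (f' x * x a) = 1" by (simp add: field_simps)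
    qed
    moreover have "f (torus_act G g x) * inverse (torus_act G g x a) =
        g v' * (f x * inverse (x a)) * inverse (g w) \<and>
       f' (torus_act G g x) * torus_act G g x a = g w * (f' x * x a) * inverse (g v')"
      if g: "\<forall>v\<in>verts G. g v \<noteq> 0" for x g
    proof -
      have "g v \<noteq> 0" "g v' \<noteq> 0" using g v 2 aG by auto
      moreover have "torus_act G g x a = g v * x a * inverse (g v')"
        using aG 2 by (simp add: torus_act_def)
      ultimately show ?thesis using eq[THEN spec[of _ x], THEN spec[of _ g], THEN mp, OF g] by simp
    qed
    moreover have "v' \<in> verts G" using aG 2 by auto
    ultimately show ?thesis
      by (rule_tac exI[of _ "\<lambda>x. f x * inverse (x a)"], rule_tac exI[of _ "\<lambda>x. f' x * x a"]) simp
  qed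
qed

text \<open>Walks following \<open>B\<close> forwards and \<open>A\<close> backwards reach every
  vertex, since the set reached is closed under \<open>B\<close> and its complement under
  \<open>A\<close>. A walk joining the ends of an arrow that lies in only one of \<open>A\<close>,
  \<open>B\<close> is closed up by that arrow to an invariant monomial, and the arrow makes
  \<open>f x\<close> or \<open>f' y\<close> zero.\<close>

lemma separating_monomial:
  assumes A: "A \<subseteq> arcs G" and B: "B \<subseteq> arcs G" and ne: "A \<noteq> B"
    and split: "\<forall>I\<subseteq>verts G. I \<noteq> {} \<longrightarrow> I \<noteq> verts G \<longrightarrow>
      \<not> (closed_under G B I \<and> closed_under G A (verts G - I))"
  shows "\<exists>f f'. rational_on (arcs G) (nonzero_on (arcs G) A) f \<and>
    rational_on (arcs G) (nonzero_on (arcs G) B) f' \<and>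
    (\<forall>x. (\<forall>a\<in>A \<union> B. x a \<noteq> 0) \<longrightarrow> f x * f' x = 1) \<and>
    (\<forall>x g. (\<forall>v\<in>verts G. g v \<noteq> 0) \<longrightarrow> f (torus_act G g x) = f x \<and> f' (torus_act G g x) = f' x) \<and>
    (\<forall>x y. {a \<in> arcs G. x a \<noteq> 0} = A \<longrightarrow> {a \<in> arcs G. y a \<noteq> 0} = B \<longrightarrow> f x * f' y = 0)"
proof -
  let ?D = "{(v, v'). (\<exists>a\<in>B. tail G a = v \<and> head G a = v') \<or> (\<exists>a\<in>A. head G a = v \<and> tail G a = v')}"
  have reach: "(w, u) \<in> ?D\<^sup>*" if uw: "u \<in> verts G" "w \<in> verts G" for u w
  proof (rule ccontr)
    assume n: "(w, u) \<notin> ?D\<^sup>*"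
    let ?I = "{v \<in> verts G. (w, v) \<in> ?D\<^sup>*}"
    have "?I \<noteq> {}" "?I \<noteq> verts G" using uw n by auto
    moreover have "closed_under G B ?I"
      unfolding closed_under_def
    proof (intro ballI impI)
      fix a assume a: "a \<in> B" "tail G a \<in> ?I"
      then have "(tail G a, head G a) \<in> ?D" by blast
      then have "(w, head G a) \<in> ?D\<^sup>*" using a(2) by (auto intro: rtrancl_into_rtrancl)
      then show "head G a \<in> ?I" using a(1) B by auto
    qed
    moreover have "closed_under G A (verts G - ?I)"
      unfolding closed_under_def
    proof (intro ballI impI)
      fix a assume a: "a \<in> A" "tail G a \<in> verts G - ?I"
      have "(head G a, tail G a) \<in> ?D" using a(1) by blast
      then have "(w, head G a) \<notin> ?D\<^sup>*" using a(2) by (auto dest: rtrancl_into_rtrancl)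
      then show "head G a \<in> verts G - ?I" using a(1) A by auto
    qed
    moreover have "?I \<subseteq> verts G" by blast
    ultimately show False using split[rule_format, of ?I] by blast
  qed
  from ne consider a where "a \<in> B" "a \<notin> A" | a where "a \<in> A" "a \<notin> B" by blast
  then show ?thesis
  proof cases
    case 1
    have aG: "a \<in> arcs G" using 1 B by blast
    have hv: "tail G a \<in> verts G" "head G a \<in> verts G" using aG by auto
    from separating_monomial_path[OF A B reach[OF hv] hv(2)]
    obtain f f' where "tail G a \<in> verts G" and f: "rational_on (arcs G) (nonzero_on (arcs G) A) f"
      and f': "rational_on (arcs G) (nonzero_on (arcs G) B) f'"
      and one: "\<forall>x. (\<forall>a\<in>A \<union> B. x a \<noteq> 0) \<longrightarrow> f x * f' x = 1"
      and eq: "\<forall>x g. (\<forall>v\<in>verts G. g v \<noteq> 0) \<longrightarrow>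
        f (torus_act G g x) = g (tail G a) * f x * inverse (g (head G a)) \<and>
        f' (torus_act G g x) = g (head G a) * f' x * inverse (g (tail G a))"
      by (elim exE conjE)
    have "rational_on (arcs G) (nonzero_on (arcs G) A) (\<lambda>x. f x * x a)"
      by (intro rational_on_mult f rational_on_coord aG)
    moreover have "rational_on (arcs G) (nonzero_on (arcs G) B) (\<lambda>x. f' x * inverse (x a))"
      by (intro rational_on_mult f' rational_on_inverse rational_on_coord aG) (use 1 in auto)
    moreover have "\<forall>x. (\<forall>a\<in>A \<union> B. x a \<noteq> 0) \<longrightarrow> (f x * x a) * (f' x * inverse (x a)) = 1"
    proof (intro allI impI)
      fix x :: "'b \<Rightarrow> complex" assume "\<forall>a\<in>A \<union> B. x a \<noteq> 0"
      then have "f x * f' x = 1" "x a \<noteq> 0" using one 1(1) by auto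
      then show "(f x * x a) * (f' x * inverse (x a)) = 1" by (simp add: field_simps)
    qed
    moreover have "f (torus_act G g x) * torus_act G g x a = f x * x a \<and>
       f' (torus_act G g x) * inverse (torus_act G g x a) = f' x * inverse (x a)"
      if g: "\<forall>v\<in>verts G. g v \<noteq> 0" for x g
    proof -
      have "g (head G a) \<noteq> 0" "g (tail G a) \<noteq> 0" using g aG by auto
      then show ?thesis using eq[THEN spec[of _ x], THEN spec[of _ g], THEN mp, OF g] aG
        by (simp add: torus_act_def) (simp add: field_simps)
    qed
    moreover have "(f x * x a) * (f' y * inverse (y a)) = 0" if "{a \<in> arcs G. x a \<noteq> 0} = A" for x y
      using that 1 aG by auto
    ultimately show ?thesis
      by (rule_tac exI[of _ "\<lambda>x. f x * x a"], rule_tac exI[of _ "\<lambda>x. f' x * inverse (x a)"]) simp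
  next
    case 2
    have aG: "a \<in> arcs G" using 2 A by blast
    have hv: "head G a \<in> verts G" "tail G a \<in> verts G" using aG by auto
    from separating_monomial_path[OF A B reach[OF hv] hv(2)]
    obtain f f' where "head G a \<in> verts G" and f: "rational_on (arcs G) (nonzero_on (arcs G) A) f"
      and f': "rational_on (arcs G) (nonzero_on (arcs G) B) f'"
      and one: "\<forall>x. (\<forall>a\<in>A \<union> B. x a \<noteq> 0) \<longrightarrow> f x * f' x = 1"
      and eq: "\<forall>x g. (\<forall>v\<in>verts G. g v \<noteq> 0) \<longrightarrow>
        f (torus_act G g x) = g (head G a) * f x * inverse (g (tail G a)) \<and>
        f' (torus_act G g x) = g (tail G a) * f' x * inverse (g (head G a))"
      by (elim exE conjE)
    have "rational_on (arcs G) (nonzero_on (arcs G) A) (\<lambda>x. f x * inverse (x a))"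
      by (intro rational_on_mult f rational_on_inverse rational_on_coord aG) (use 2 in auto)
    moreover have "rational_on (arcs G) (nonzero_on (arcs G) B) (\<lambda>x. f' x * x a)"
      by (intro rational_on_mult f' rational_on_coord aG)
    moreover have "\<forall>x. (\<forall>a\<in>A \<union> B. x a \<noteq> 0) \<longrightarrow> (f x * inverse (x a)) * (f' x * x a) = 1"
    proof (intro allI impI)
      fix x :: "'b \<Rightarrow> complex" assume "\<forall>a\<in>A \<union> B. x a \<noteq> 0"
      then have "f x * f' x = 1" "x a \<noteq> 0" using one 2(1) by auto
      then show "(f x * inverse (x a)) * (f' x * x a) = 1" by (simp add: field_simps)
    qed
    moreover have "f (torus_act G g x) * inverse (torus_act G g x a) = f x * inverse (x a) \<and>
       f' (torus_act G g x) * torus_act G g x a = f' x * x a"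
      if g: "\<forall>v\<in>verts G. g v \<noteq> 0" for x g
    proof -
      have "g (head G a) \<noteq> 0" "g (tail G a) \<noteq> 0" using g aG by auto
      then show ?thesis using eq[THEN spec[of _ x], THEN spec[of _ g], THEN mp, OF g] aG
        by (simp add: torus_act_def) (simp add: field_simps)
    qed
    moreover have "(f x * inverse (x a)) * (f' y * y a) = 0" if "{a \<in> arcs G. y a \<noteq> 0} = B" for x y
      using that 2 aG by auto
    ultimately show ?thesis
      by (rule_tac exI[of _ "\<lambda>x. f x * inverse (x a)"], rule_tac exI[of _ "\<lambda>x. f' x * x a"]) simp
  qed
qed

section \<open>Orbit spaces as varieties\<close>

lemma unsplittable_tree:
  assumes F: "upset (arcs G) F" and u: "unsplittable G F" and ne: "verts G \<noteq> {}" and S: "S \<in> F"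
  obtains T \<gamma> r where "T \<subseteq> S" "tree_gauge T (verts G) \<gamma> r"
  by (rule spanning_tree_exists[OF upset_subset[OF F S] ne])
    (use u S in \<open>auto simp: unsplittable_def\<close>)

text \<open>Orbits with equal support lie in one chart and differ in a coordinate of the normal
  form. Orbits with different supports need not share a chart; for them the reciprocal pair of
  monomials is used.\<close>

lemma functions_separate_orbit_space:
  assumes F: "upset (arcs G) F" and u: "unsplittable G F" and ne: "verts G \<noteq> {}"
  shows "functions_separate (orbit_space G F)"
  unfolding functions_separate_def points_orbit_space
proof (intro ballI impI)
  fix o1 o2 assume o: "o1 \<in> torus_orbit G ` support_locus (arcs G) F"
    "o2 \<in> torus_orbit G ` support_locus (arcs G) F" "o1 \<noteq> o2"
  obtain x y where x: "x \<in> support_locus (arcs G) F" "o1 = torus_orbit G x"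
    and y: "y \<in> support_locus (arcs G) F" "o2 = torus_orbit G y" using o by blast
  define A where "A = {a \<in> arcs G. x a \<noteq> 0}"
  define B where "B = {a \<in> arcs G. y a \<noteq> 0}"
  have AF: "A \<in> F" and xc: "x \<in> cspace (arcs G)" and BF: "B \<in> F" and yc: "y \<in> cspace (arcs G)"
    using x y by (auto simp: A_def B_def support_locus_def)
  have xA: "x \<in> nonzero_on (arcs G) A" and yB: "y \<in> nonzero_on (arcs G) B"
    using xc yc by (auto simp: A_def B_def)
  show "\<exists>U V f g. o1 \<in> U \<and> o2 \<in> V \<and> regular (orbit_space G F) U f \<and> regular (orbit_space G F) V g \<and>
      (\<forall>z\<in>U \<inter> V. f z * g z = 1) \<and> f o1 * g o2 \<noteq> 1"
  proof (cases "A = B")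
    case True
    obtain T \<gamma> r where T: "T \<subseteq> A" "tree_gauge T (verts G) \<gamma> r"
      using unsplittable_tree[OF F u ne AF] .
    have sub: "nonzero_on (arcs G) A \<subseteq> nonzero_on (arcs G) T" using T by auto
    have xT: "x \<in> nonzero_on (arcs G) T" and yT: "y \<in> nonzero_on (arcs G) T"
      using xA yB True sub by auto
    have "normal_form \<gamma> x \<noteq> normal_form \<gamma> y"
      using normal_form(1)[OF T(2) xT] normal_form(1)[OF T(2) yT] o(3) x(2) y(2) by metis
    then obtain a where a: "a \<in> arcs G" "normal_form \<gamma> x a \<noteq> normal_form \<gamma> y a"
      using PiE_ext[of _ "arcs G" "\<lambda>_. UNIV"] torus_act_cspace unfolding normal_form_def by metis
    have inv: "normal_form \<gamma> (torus_act G g z) a = normal_form \<gamma> z a"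
      if z: "z \<in> nonzero_on (arcs G) A" and g: "\<forall>v\<in>verts G. g v \<noteq> 0" for z g
    proof -
      have zT: "z \<in> nonzero_on (arcs G) T" using z sub by blast
      have "torus_act G g z b \<noteq> 0" if b: "b \<in> T" for b
        using zT torus_act_nonzero[OF g, of b z] b tree_gaugeD(3)[OF T(2)] by blast
      then have "torus_act G g z \<in> nonzero_on (arcs G) T" using torus_act_cspace[of G g z] by blast
      from normal_form(4)[OF T(2) zT this] show ?thesis using torus_orbit_eq_act[OF g, of z] by simp
    qed
    obtain f' where f': "regular (orbit_space G F) (torus_orbit G ` nonzero_on (arcs G) A) f'"
      "\<forall>x\<in>nonzero_on (arcs G) A. f' (torus_orbit G x) = normal_form \<gamma> x a"
      using orbit_space_rational[OF F AF
            rational_on_mono[OF rational_normal_form[OF T(2) a(1)] sub] inv] .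
    show ?thesis
      by (rule separate_by_function[OF ringed_orbit_space f'(1)])
        (use x(2) y(2) xA yB True f'(2) a(2) in auto)
  next
    case False
    have "\<forall>I\<subseteq>verts G. I \<noteq> {} \<longrightarrow> I \<noteq> verts G \<longrightarrow>
      \<not> (closed_under G B I \<and> closed_under G A (verts G - I))"
      using u AF BF unfolding unsplittable_def by blast
    from separating_monomial[OF upset_subset[OF F AF] upset_subset[OF F BF] False this]
    obtain f f' where f: "rational_on (arcs G) (nonzero_on (arcs G) A) f"
      and f': "rational_on (arcs G) (nonzero_on (arcs G) B) f'"
      and one: "\<forall>x. (\<forall>a\<in>A \<union> B. x a \<noteq> 0) \<longrightarrow> f x * f' x = 1"
      and inv: "\<forall>x g. (\<forall>v\<in>verts G. g v \<noteq> 0) \<longrightarrow>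
         f (torus_act G g x) = f x \<and> f' (torus_act G g x) = f' x"
      and z: "\<forall>x y. {a \<in> arcs G. x a \<noteq> 0} = A \<longrightarrow> {a \<in> arcs G. y a \<noteq> 0} = B \<longrightarrow> f x * f' y = 0"
      by (elim exE conjE)
    obtain h where h: "regular (orbit_space G F) (torus_orbit G ` nonzero_on (arcs G) A) h"
      "\<forall>x\<in>nonzero_on (arcs G) A. h (torus_orbit G x) = f x"
      by (rule orbit_space_rational[OF F AF f]) (use inv in auto)
    obtain h' where h': "regular (orbit_space G F) (torus_orbit G ` nonzero_on (arcs G) B) h'"
      "\<forall>x\<in>nonzero_on (arcs G) B. h' (torus_orbit G x) = f' x"
      by (rule orbit_space_rational[OF F BF f']) (use inv in auto)
    have 1: "h w * h' w = 1"
      if w: "w \<in> torus_orbit G ` nonzero_on (arcs G) A \<inter> torus_orbit G ` nonzero_on (arcs G) B" for w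
    proof -
      obtain p p' where p: "p \<in> nonzero_on (arcs G) A" "w = torus_orbit G p"
        "p' \<in> nonzero_on (arcs G) B" "w = torus_orbit G p'" using w by blast
      have "p' a \<noteq> 0" if "a \<in> A" for a
        using torus_orbit_support[of p p' a] p that by (auto simp: A_def)
      then have "p' \<in> nonzero_on (arcs G) A" "\<forall>a\<in>A \<union> B. p' a \<noteq> 0" using p(3) by auto
      then show ?thesis using h(2)[THEN bspec, of p'] h'(2)[THEN bspec, of p'] p(3,4) one by simp
    qed
    have "f x * f' y = 0" using z[rule_format, of x y] by (simp only: A_def B_def simp_thms)
    then have 2: "h o1 * h' o2 \<noteq> 1" using h(2)[THEN bspec, OF xA] h'(2)[THEN bspec, OF yB] x(2) y(2)
      by auto
    show ?thesis
      by (rule exI[of _ "torus_orbit G ` nonzero_on (arcs G) A"],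
          rule exI[of _ "torus_orbit G ` nonzero_on (arcs G) B"], rule exI[of _ h], rule exI[of _ h'])
        (use 1 2 h(1) h'(1) xA yB x(2) y(2) in blast)
  qed
qed

lemma variety_orbit_space:
  assumes F: "upset (arcs G) F" and u: "unsplittable G F" and ne: "verts G \<noteq> {}"
  shows "variety (orbit_space G F)"
proof (rule varietyI[where \<U> = "(\<lambda>S. torus_orbit G ` nonzero_on (arcs G) S) ` F"])
  show "space_with_functions (orbit_space G F)" by (rule ringed_swf[OF ringed_orbit_space])
  show "functions_separate (orbit_space G F)" by (rule functions_separate_orbit_space[OF F u ne])
  show "finite ((\<lambda>S. torus_orbit G ` nonzero_on (arcs G) S) ` F)"
    using finite_upset[OF finite_arcs F] by simp
  show "\<Union>((\<lambda>S. torus_orbit G ` nonzero_on (arcs G) S) ` F) = points (orbit_space G F)"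
    unfolding points_orbit_space support_locus_upset[OF F] by blast
  fix U assume "U \<in> (\<lambda>S. torus_orbit G ` nonzero_on (arcs G) S) ` F"
  then obtain S where S: "S \<in> F" "U = torus_orbit G ` nonzero_on (arcs G) S" by blast
  have SG: "S \<subseteq> arcs G" by (rule upset_subset[OF F S(1)])
  have sub: "{S'. S \<subseteq> S' \<and> S' \<subseteq> arcs G} \<subseteq> F" using upset_superset[OF F S(1)] by blast
  note op = orbit_space_open[OF upset_principal[OF SG] sub, unfolded support_locus_principal[OF SG]]
  show "openin (zar (orbit_space G F)) U" using op(1) S(2) by simp
  obtain T \<gamma> r where T: "T \<subseteq> S" "tree_gauge T (verts G) \<gamma> r"
    using unsplittable_tree[OF F u ne S(1)] .
  have TG: "T \<subseteq> arcs G" using T SG by blast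
  let ?Y = "{x \<in> nonzero_on (arcs G) S. \<forall>a\<in>T. x a = 1}"
  have finS: "finite S" using SG finite_arcs finite_subset by blast
  have "?Y = {x \<in> {x \<in> cspace (arcs G). \<forall>a\<in>T. x a = 1}. (\<Prod>a\<in>S. x a) \<noteq> 0}" using finS by auto
  then have "affine_variety (subspace_on (affine_space (arcs G)) ?Y)"
    using affine_variety_principal[OF finite_arcs closedin_zariski_fixed[OF TG]
        poly_fun_support[OF finite_arcs SG], of "\<lambda>_. 1"] by simp
  moreover have "isomorphic (subspace_on (affine_space (arcs G)) ?Y)
      (orbit_space G {S'. S \<subseteq> S' \<and> S' \<subseteq> arcs G})"
  proof -
    obtain \<phi> where "iso_pair (orbit_space G {S'. S \<subseteq> S' \<and> S' \<subseteq> arcs G})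
        (subspace_on (affine_space (arcs G)) ?Y) \<phi> (torus_orbit G)"
      using orbit_space_chart[OF SG T] .
    from iso_pair_sym[OF this] show ?thesis unfolding isomorphic_iff_iso_pair by blast
  qed
  ultimately show "affine_variety (subspace_on (orbit_space G F) U)"
    unfolding S(2) op(2) by (rule affine_variety_iso[rotated])
qed

text \<open>Points of the quotient are orbits, that is, sets; representatives embed them into affine
  space and from there into \<open>nat \<Rightarrow> complex\<close>.\<close>

lemma realizable_orbit_space:
  assumes F: "upset (arcs G) F" and u: "unsplittable G F" and ne: "verts G \<noteq> {}"
  shows "realizable (orbit_space G F)"
proof -
  obtain j :: "('b \<Rightarrow> complex) \<Rightarrow> nat \<Rightarrow> complex" where j: "inj_on j (cspace (arcs G))"
    using inj_on_cspace_nat[OF finite_arcs] by blast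
  let ?W = "support_locus (arcs G) F"
  let ?r = "inv_into ?W (torus_orbit G)"
  have "inj_on (\<lambda>u. j (?r u)) (torus_orbit G ` ?W)"
  proof (rule inj_onI)
    fix u v assume uv: "u \<in> torus_orbit G ` ?W" "v \<in> torus_orbit G ` ?W" "j (?r u) = j (?r v)"
    have "?r u \<in> ?W" "?r v \<in> ?W" using uv inv_into_into by metis+
    then have "?r u \<in> cspace (arcs G)" "?r v \<in> cspace (arcs G)" using support_locus_cspace by blast+
    then have "?r u = ?r v" by (rule inj_onD[OF j, OF uv(3)])
    then show "u = v" using uv(1,2) by (metis f_inv_into_f)
  qed
  then show ?thesis
    by (intro variety_realizable[OF variety_orbit_space[OF F u ne]]) simp
qed

lemma unsplittable_mono: "unsplittable G F \<Longrightarrow> F' \<subseteq> F \<Longrightarrow> unsplittable G F'"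
  unfolding unsplittable_def by blast

text \<open>Removing a minimal support \<open>S\<close> from \<open>F\<close> removes a closed stratum, a torus of dimension
  \<open>|S| - |Q\<^sub>0| + 1\<close>.\<close>

theorem motivic_class_orbit_space:
  assumes F: "upset (arcs G) F" and u: "unsplittable G F" and ne: "verts G \<noteq> {}"
  shows "motivic_class (orbit_space G F) =
    (\<Sum>S\<in>F. (Lefschetz - 1) ^ (Suc (card S) - card (verts G)))"
  using finite_arcs F u
proof (induction rule: upset_induct)
  case empty
  have u: "upset (arcs G) {}" by (simp add: upset_def)
  show ?case
    by (simp, rule motivic_class_empty)
      (use variety_orbit_space[OF u empty ne] ringed_swf[OF ringed_orbit_space]
        realizable_orbit_space[OF u empty ne] in \<open>auto simp: support_locus_def\<close>)
next
  case (remove F S)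
  let ?X = "orbit_space G F"
  let ?C = "torus_orbit G ` support_locus (arcs G) {S}"
  let ?D = "torus_orbit G ` support_locus (arcs G) (F - {S})"
  note X = ringed_swf[OF ringed_orbit_space[of F]]
  have SG: "S \<subseteq> arcs G" by (rule upset_subset[OF remove(1,2)])
  have uF': "unsplittable G (F - {S})" using unsplittable_mono[OF remove(6)] by blast
  note op = orbit_space_open[OF remove(4), of F, OF Diff_subset]
  have diff: "points ?X - ?C = ?D"
  proof
    show "points ?X - ?C \<subseteq> ?D" by (auto simp: support_locus_def)
    have "torus_orbit G x \<notin> ?C" if x: "x \<in> support_locus (arcs G) (F - {S})" for x
    proof
      assume "torus_orbit G x \<in> ?C"
      then obtain y where "y \<in> support_locus (arcs G) {S}" "torus_orbit G x = torus_orbit G y"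
        by blast
      then have "x \<in> support_locus (arcs G) {S}"
        using support_locus_saturated[of x y "{S}"] x support_locus_cspace by blast
      then show False using x by (auto simp: support_locus_def)
    qed
    then show "?D \<subseteq> points ?X - ?C" by (auto simp: support_locus_def)
  qed
  have CX: "?C \<subseteq> points ?X" using remove(2) by (auto simp: support_locus_def)
  have C: "closedin (zar ?X) ?C"
    unfolding closedin_def using CX diff op(1) by simp
  obtain T \<gamma> r where T: "T \<subseteq> S" "tree_gauge T (verts G) \<gamma> r"
    using unsplittable_tree[OF remove(1,6) ne remove(2)] .
  have TG: "T \<subseteq> arcs G" using T SG by blast
  let ?U = "{S'. S \<subseteq> S' \<and> S' \<subseteq> arcs G}"
  have sub: "?U \<subseteq> F" using upset_superset[OF remove(1,2)] by blast
  note op2 = orbit_space_open[OF upset_principal[OF SG] sub]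
  have CU: "?C \<subseteq> torus_orbit G ` support_locus (arcs G) ?U"
    using SG by (auto simp: support_locus_def)
  have ssC: "subspace_on ?X ?C = subspace_on (orbit_space G ?U) ?C"
    unfolding op2(2)[symmetric] subspace_subspace[OF X] using CU by (simp add: Int_absorb1)
  let ?Y = "{x \<in> nonzero_on (arcs G) S. \<forall>a\<in>T. x a = 1}"
  obtain \<phi> where \<phi>: "iso_pair (orbit_space G ?U) (subspace_on (affine_space (arcs G)) ?Y) \<phi> (torus_orbit G)"
    "\<forall>x\<in>nonzero_on (arcs G) S. \<phi> (torus_orbit G x) = normal_form \<gamma> x"
    using orbit_space_chart[OF SG T] .
  \<comment> \<open>In the chart the closed stratum is the torus with coordinates 1 on the tree, 0
    outside \<open>S\<close> and arbitrary nonzero on \<open>S - T\<close>.\<close>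
  define c where "c = (\<lambda>a. if a \<in> T then 1 else 0 :: complex)"
  let ?Z = "{x \<in> cspace (arcs G). (\<forall>a\<in>arcs G - (S - T). x a = c a) \<and> (\<forall>a\<in>S - T. x a \<noteq> 0)}"
  have S1: "support_locus (arcs G) {S} \<subseteq> nonzero_on (arcs G) S" by (auto simp: support_locus_def)
  have ZS: "?Z \<subseteq> support_locus (arcs G) {S}"
    using SG T(1) TG by (auto simp: support_locus_def c_def split: if_splits)
  have Z1: "\<forall>a\<in>T. x a = 1" if "x \<in> ?Z" for x using that TG by (auto simp: c_def)
  have im: "\<phi> ` ?C = ?Z"
  proof
    show "\<phi> ` ?C \<subseteq> ?Z"
    proof
      fix z assume "z \<in> \<phi> ` ?C"
      then obtain x where x: "x \<in> support_locus (arcs G) {S}" "z = normal_form \<gamma> x"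
      proof -
        from \<open>z \<in> \<phi> ` ?C\<close> obtain x where x: "x \<in> support_locus (arcs G) {S}"
          "z = \<phi> (torus_orbit G x)" by blast
        moreover have "x \<in> nonzero_on (arcs G) S" using x(1) S1 by blast
        ultimately show thesis using that[of x] \<phi>(2)[THEN bspec, of x] by simp
      qed
      have xT: "x \<in> nonzero_on (arcs G) T" using x(1) S1 T(1) by auto
      have "z a \<noteq> 0 \<longleftrightarrow> a \<in> S" if "a \<in> arcs G" for a
        using normal_form(3)[OF T(2) xT that] x that by (auto simp: support_locus_def)
      moreover have "z \<in> cspace (arcs G)" using x(2) torus_act_cspace by (simp add: normal_form_def)
      moreover have "z a = 1" if "a \<in> T" for a using normal_form(2)[OF T(2) xT that] x(2) by simp
      ultimately show "z \<in> ?Z" using SG by (auto simp: c_def)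
    qed
    show "?Z \<subseteq> \<phi> ` ?C"
    proof
      fix z assume z: "z \<in> ?Z"
      have zS: "z \<in> nonzero_on (arcs G) S" using subsetD[OF S1 subsetD[OF ZS z]] .
      have zT: "z \<in> nonzero_on (arcs G) T" using zS T(1) by blast
      have "\<phi> (torus_orbit G z) = z"
        using normal_form(5)[OF T(2) zT Z1[OF z]] \<phi>(2)[THEN bspec, OF zS] by simp
      moreover have "torus_orbit G z \<in> ?C" using subsetD[OF ZS z] by (rule imageI)
      ultimately show "z \<in> \<phi> ` ?C" by (rule image_eqI[OF sym])
    qed
  qed
  have ZY: "?Z \<subseteq> ?Y" using ZS S1 Z1 by blast
  have "isomorphic (subspace_on ?X ?C) (subspace_on (subspace_on (affine_space (arcs G)) ?Y) (\<phi> ` ?C))"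
    unfolding ssC
    by (rule isomorphic_subspace_image[OF ringed_swf[OF ringed_orbit_space]
          swf_subspace[OF swf_affine] \<phi>(1)]) (use CU in simp)
  then have iso: "isomorphic (subspace_on ?X ?C) (subspace_on (affine_space (arcs G)) ?Z)"
    unfolding im subspace_subspace[OF swf_affine] using ZY by (simp add: Int_absorb1)
  have "?Z = {x \<in> {x \<in> cspace (arcs G). \<forall>a\<in>arcs G - (S - T). x a = c a}. \<forall>a\<in>S - T. x a \<noteq> 0}" by auto
  then have vZ: "variety (subspace_on (affine_space (arcs G)) ?Z)"
    using variety_coordinates_nonzero[OF finite_arcs
        closedin_zariski_fixed[of "arcs G - (S - T)" "arcs G" c], of "S - T"] SG by auto
  have vC: "variety (subspace_on ?X ?C)"
    by (rule variety_iso[OF isomorphic_sym[OF iso] vZ swf_subspace[OF X]])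
  have "motivic_class (subspace_on ?X ?C) = motivic_class (subspace_on (affine_space (arcs G)) ?Z)"
    by (rule motivic_class_iso[OF iso realizable_affine[OF finite_arcs _ vZ]]) auto
  also have "\<dots> = (Lefschetz - 1) ^ card (S - T)"
    by (rule motivic_class_coordinate_torus[OF finite_arcs]) (use SG in auto)
  \<comment> \<open>A spanning tree has one arrow less than there are vertices; as
    \<open>T \<subseteq> S\<close>, the truncated difference is exact.\<close>
  also have "card (S - T) = Suc (card S) - card (verts G)"
    using tree_gaugeD(4)[OF T(2)] card_Diff_subset[OF finite_subset[OF TG finite_arcs] T(1)] by simp
  finally have cC: "motivic_class (subspace_on ?X ?C) = (Lefschetz - 1) ^ (Suc (card S) - card (verts G))" .
  have "motivic_class ?X = motivic_class (subspace_on ?X ?C) +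
      motivic_class (subspace_on ?X (points ?X - ?C))"
    by (rule motivic_class_scissor[OF realizable_orbit_space[OF remove(1,6) ne] X C vC])
      (unfold diff op(2), rule variety_orbit_space[OF remove(4) uF' ne])
  also have "\<dots> = (Lefschetz - 1) ^ (Suc (card S) - card (verts G)) +
      (\<Sum>S\<in>F - {S}. (Lefschetz - 1) ^ (Suc (card S) - card (verts G)))"
    unfolding diff op(2) cC remove(5)[OF uF'] ..
  also have "\<dots> = (\<Sum>S\<in>F. (Lefschetz - 1) ^ (Suc (card S) - card (verts G)))"
    by (rule sum.remove[symmetric, OF finite_upset[OF finite_arcs remove(1)] remove(2)])
  finally show ?case .
qed

end

section \<open>Krull dimension\<close>

text \<open>Stated for topologies instead of spaces with functions, so that it applies to
  subtopologies.\<close>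

definition irreducible_in :: "'p topology \<Rightarrow> 'p set \<Rightarrow> bool" where
  "irreducible_in T C \<longleftrightarrow> closedin T C \<and> C \<noteq> {} \<and>
     (\<forall>A B. closedin T A \<longrightarrow> closedin T B \<longrightarrow> C \<subseteq> A \<union> B \<longrightarrow> C \<subseteq> A \<or> C \<subseteq> B)"

definition irreducible_chain :: "'p topology \<Rightarrow> nat \<Rightarrow> (nat \<Rightarrow> 'p set) \<Rightarrow> bool" where
  "irreducible_chain T n C \<longleftrightarrow> (\<forall>i\<le>n. irreducible_in T (C i)) \<and> (\<forall>i<n. C i \<subset> C (Suc i))"

lemma variety_dim_eq: "variety_dim X = Sup {n. \<exists>C. irreducible_chain (zar X) n C}"
  by (simp add: variety_dim_def irreducible_chain_def irreducible_in_def irreducible_closed_def)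

lemma irreducible_inD:
  "irreducible_in T C \<Longrightarrow> closedin T A \<Longrightarrow> closedin T B \<Longrightarrow> C \<subseteq> A \<union> B \<Longrightarrow> C \<subseteq> A \<or> C \<subseteq> B"
  by (simp add: irreducible_in_def)

lemma irreducible_in_open_restrict:
  assumes U: "openin T U" and C: "irreducible_in T C" and ne: "C \<inter> U \<noteq> {}"
  shows "irreducible_in (subtopology T U) (C \<inter> U)"
  unfolding irreducible_in_def
proof (intro conjI allI impI ne)
  show "closedin (subtopology T U) (C \<inter> U)"
    using C by (auto simp: closedin_subtopology irreducible_in_def)
  fix A B assume A: "closedin (subtopology T U) A" and B: "closedin (subtopology T U) B"
    and sub: "C \<inter> U \<subseteq> A \<union> B"
  obtain A' B' where A': "closedin T A'" "A = A' \<inter> U" and B': "closedin T B'" "B = B' \<inter> U"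
    using A B by (auto simp: closedin_subtopology)
  have c: "closedin T (topspace T - U)" using U by blast
  have "C \<subseteq> topspace T" using C closedin_subset by (auto simp: irreducible_in_def)
  then have "C \<subseteq> (A' \<union> (topspace T - U)) \<union> (B' \<union> (topspace T - U))" using sub A' B' by blast
  from irreducible_inD[OF C closedin_Un[OF A'(1) c] closedin_Un[OF B'(1) c] this]
  show "C \<inter> U \<subseteq> A \<or> C \<inter> U \<subseteq> B" using A'(2) B'(2) by blast
qed

text \<open>An irreducible closed set that meets \<open>U\<close> is not covered by a smaller closed
  set together with the complement of \<open>U\<close>; so traces on \<open>U\<close> stay
  distinct.\<close>

lemma irreducible_chain_open_restrict:
  assumes U: "openin T U" and C: "irreducible_chain T n C" and ne: "C 0 \<inter> U \<noteq> {}"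
  shows "irreducible_chain (subtopology T U) n (\<lambda>i. C i \<inter> U)"
proof -
  have mono: "C 0 \<subseteq> C i" if "i \<le> n" for i
    using that
  proof (induction i)
    case (Suc i)
    then have "C i \<subset> C (Suc i)" using C by (simp add: irreducible_chain_def)
    then show ?case using Suc by simp
  qed simp
  have nei: "C i \<inter> U \<noteq> {}" if "i \<le> n" for i using mono[OF that] ne by blast
  have "C i \<inter> U \<subset> C (Suc i) \<inter> U" if i: "i < n" for i
  proof -
    have s: "C i \<subset> C (Suc i)" and irr: "irreducible_in T (C (Suc i))" and cl: "closedin T (C i)"
      using C i by (auto simp: irreducible_chain_def irreducible_in_def)
    have "C i \<inter> U \<noteq> C (Suc i) \<inter> U"
    proof
      assume eq: "C i \<inter> U = C (Suc i) \<inter> U"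
      have "C (Suc i) \<subseteq> topspace T" using irr closedin_subset by (auto simp: irreducible_in_def)
      then have "C (Suc i) \<subseteq> C i \<union> (topspace T - U)" using eq by blast
      moreover have "closedin T (topspace T - U)" using U by blast
      ultimately have "C (Suc i) \<subseteq> C i \<or> C (Suc i) \<subseteq> topspace T - U"
        by (rule irreducible_inD[OF irr cl, rotated])
      then show False using s nei[OF Suc_leI[OF i]] by blast
    qed
    then show ?thesis using s by blast
  qed
  then show ?thesis
    using C nei irreducible_in_open_restrict[OF U] by (simp add: irreducible_chain_def)
qed

text \<open>The trace on \<open>U\<close> of the closure of \<open>C i\<close> is \<open>C i\<close>
  again, so strict inclusions persist; irreducibility passes to closures.\<close>

lemma irreducible_chain_closure:
  assumes C: "irreducible_chain (subtopology T U) n C"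
  shows "irreducible_chain T n (\<lambda>i. T closure_of (C i))"
proof -
  have CT: "C i \<subseteq> topspace T \<inter> U" and inter: "T closure_of (C i) \<inter> U = C i"
    and irr: "irreducible_in T (T closure_of (C i))" if i: "i \<le> n" for i
  proof -
    have ir: "irreducible_in (subtopology T U) (C i)" using C i by (simp add: irreducible_chain_def)
    then obtain K where K: "closedin T K" "C i = K \<inter> U"
      by (auto simp: irreducible_in_def closedin_subtopology)
    show sub: "C i \<subseteq> topspace T \<inter> U" using K closedin_subset by blast
    have "T closure_of (C i) \<subseteq> K" by (rule closure_of_minimal) (use K in auto)
    moreover have "C i \<subseteq> T closure_of (C i)" by (rule closure_of_subset) (use sub in blast)
    ultimately show int: "T closure_of (C i) \<inter> U = C i" using K(2) by blast
    show "irreducible_in T (T closure_of (C i))"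
      unfolding irreducible_in_def
    proof (intro conjI allI impI closedin_closure_of)
      show "T closure_of (C i) \<noteq> {}"
        using ir int by (auto simp: irreducible_in_def)
      fix A B assume A: "closedin T A" and B: "closedin T B" and s: "T closure_of (C i) \<subseteq> A \<union> B"
      have "C i \<subseteq> (A \<inter> U) \<union> (B \<inter> U)" using s int by blast
      moreover have "closedin (subtopology T U) (A \<inter> U)" "closedin (subtopology T U) (B \<inter> U)"
        using A B by (auto simp: closedin_subtopology)
      ultimately have "C i \<subseteq> A \<inter> U \<or> C i \<subseteq> B \<inter> U"
        using irreducible_inD[OF ir, of "A \<inter> U" "B \<inter> U"] by blast
      then show "T closure_of (C i) \<subseteq> A \<or> T closure_of (C i) \<subseteq> B"
        using closure_of_minimal[OF _ A] closure_of_minimal[OF _ B] by blast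
    qed
  qed
  have "T closure_of (C i) \<subset> T closure_of (C (Suc i))" if i: "i < n" for i
  proof -
    have s: "C i \<subset> C (Suc i)" using C i by (simp add: irreducible_chain_def)
    then have "T closure_of (C i) \<subseteq> T closure_of (C (Suc i))" by (intro closure_of_mono) auto
    moreover have "T closure_of (C i) \<noteq> T closure_of (C (Suc i))"
      using s inter[of i] inter[of "Suc i"] i by auto
    ultimately show ?thesis by blast
  qed
  then show ?thesis using irr by (simp add: irreducible_chain_def)
qed

lemma irreducible_chain_iso:
  assumes i: "iso_pair X Y \<phi> \<psi>" and C: "irreducible_chain (zar X) n C"
  shows "irreducible_chain (zar Y) n (\<lambda>i. \<phi> ` C i)"
proof -
  have sub: "C k \<subseteq> points X" if "k \<le> n" for k
    using C that closedin_subset by (auto simp: irreducible_chain_def irreducible_in_def)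
  have inj: "inj_on \<phi> (points X)" by (rule inj_on_inverseI[of _ \<psi>]) (rule iso_pairD(3)[OF i])
  have "irreducible_in (zar Y) (\<phi> ` C k)" if k: "k \<le> n" for k
  proof -
    have ir: "irreducible_in (zar X) (C k)" using C k by (simp add: irreducible_chain_def)
    show ?thesis
      unfolding irreducible_in_def
    proof (intro conjI allI impI)
      show "closedin (zar Y) (\<phi> ` C k)"
        using iso_pair_closedin[OF i] ir by (simp add: irreducible_in_def)
      show "\<phi> ` C k \<noteq> {}" using ir by (simp add: irreducible_in_def)
      fix A B assume A: "closedin (zar Y) A" and B: "closedin (zar Y) B" and s: "\<phi> ` C k \<subseteq> A \<union> B"
      let ?p = "\<lambda>A. {x \<in> points X. \<phi> x \<in> A}"
      have "closedin (zar X) (?p A)" "closedin (zar X) (?p B)"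
        using morphism_continuous[OF iso_pairD(1)[OF i]] A B by (auto simp: continuous_map_closedin)
      moreover have "C k \<subseteq> ?p A \<union> ?p B" using s sub[OF k] by blast
      ultimately have "C k \<subseteq> ?p A \<or> C k \<subseteq> ?p B" by (rule irreducible_inD[OF ir])
      then show "\<phi> ` C k \<subseteq> A \<or> \<phi> ` C k \<subseteq> B" by blast
    qed
  qed
  moreover have "\<phi> ` C k \<subset> \<phi> ` C (Suc k)" if k: "k < n" for k
  proof -
    have "C k \<subset> C (Suc k)" using C k by (simp add: irreducible_chain_def)
    then show ?thesis
      using inj_on_image_eq_iff[OF inj sub[of k] sub[of "Suc k"]] k by auto
  qed
  ultimately show ?thesis by (simp add: irreducible_chain_def)
qed

text \<open>A chain in \<open>X\<close> restricts, without getting shorter, to a chart that meets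
  its smallest member, and a chain in a chart extends to \<open>X\<close> by closures.\<close>

lemma variety_dim_cover:
  assumes cover: "\<Union>\<U> = points X" and op: "\<And>U. U \<in> \<U> \<Longrightarrow> openin (zar X) U"
    and iso: "\<And>U. U \<in> \<U> \<Longrightarrow> \<exists>A \<phi> \<psi>. iso_pair (subspace_on X U) A \<phi> \<psi> \<and>
       (\<forall>n C. irreducible_chain (zar A) n C \<longrightarrow> n \<le> N) \<and> (\<exists>C. irreducible_chain (zar (A :: 'r fspace)) N C)"
    and ne: "\<U> \<noteq> {}"
  shows "variety_dim X = N"
proof -
  have le: "n \<le> N" if C: "irreducible_chain (zar X) n C" for n C
  proof -
    have "irreducible_in (zar X) (C 0)" using C by (simp add: irreducible_chain_def)
    then have "C 0 \<subseteq> points X" "C 0 \<noteq> {}" using closedin_subset by (auto simp: irreducible_in_def)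
    then obtain U where U: "U \<in> \<U>" "C 0 \<inter> U \<noteq> {}" using cover by blast
    obtain A \<phi> \<psi> where A: "iso_pair (subspace_on X U) (A :: 'r fspace) \<phi> \<psi>"
       "\<forall>n C. irreducible_chain (zar A) n C \<longrightarrow> n \<le> N" using iso[OF U(1)] by blast
    have "irreducible_chain (zar (subspace_on X U)) n (\<lambda>i. C i \<inter> U)"
      using irreducible_chain_open_restrict[OF op[OF U(1)] C U(2)] by simp
    from irreducible_chain_iso[OF A(1) this] A(2) show ?thesis by blast
  qed
  obtain U where U: "U \<in> \<U>" using ne by blast
  obtain A \<phi> \<psi> C where A: "iso_pair (subspace_on X U) (A :: 'r fspace) \<phi> \<psi>"
     "irreducible_chain (zar A) N C" using iso[OF U] by blast
  have "irreducible_chain (subtopology (zar X) U) N (\<lambda>i. \<psi> ` C i)"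
    using irreducible_chain_iso[OF iso_pair_sym[OF A(1)] A(2)] by simp
  from irreducible_chain_closure[OF this]
  have "\<exists>C. irreducible_chain (zar X) N C" by blast
  then show ?thesis
    unfolding variety_dim_eq by (intro cSup_eq_maximum) (use le in auto)
qed

section \<open>Algebraic dependence of polynomials\<close>

lemma vector_space_functions:
  "vector_space (\<lambda>(a::complex) (f::'x \<Rightarrow> complex) x. a * f x)"
  by unfold_locales (auto simp: fun_eq_iff algebra_simps)

text \<open>The degree is bounded in each variable separately, which makes the count
  \<open>Suc d ^ card J\<close> immediate.\<close>

definition monomials :: "'i set \<Rightarrow> nat \<Rightarrow> (('i \<Rightarrow> complex) \<Rightarrow> complex) set" where
  "monomials J d = (\<lambda>e x. \<Prod>i\<in>J. x i ^ e i) ` (\<Pi>\<^sub>E i\<in>J. {..d})"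

abbreviation fspan :: "('x \<Rightarrow> complex) set \<Rightarrow> ('x \<Rightarrow> complex) set" where
  "fspan \<equiv> module.span (\<lambda>(a::complex) (f::'x \<Rightarrow> complex) x. a * f x)"

lemma finite_monomials: "finite J \<Longrightarrow> finite (monomials J d)"
  by (simp add: monomials_def finite_PiE)

lemma card_monomials: "finite J \<Longrightarrow> card (monomials J d) \<le> Suc d ^ card J"
  unfolding monomials_def
  by (rule order.trans[OF card_image_le]) (simp_all add: finite_PiE card_PiE)

lemma monomials_mono: "d \<le> d' \<Longrightarrow> monomials J d \<subseteq> monomials J d'"
  unfolding monomials_def by (intro image_mono PiE_mono) auto

lemma monomials_mult:
  assumes "finite J" "f \<in> monomials J d" "g \<in> monomials J d'"
  shows "(\<lambda>x. f x * g x) \<in> monomials J (d + d')"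
proof -
  obtain e e' where e: "e \<in> (\<Pi>\<^sub>E i\<in>J. {..d})" "f = (\<lambda>x. \<Prod>i\<in>J. x i ^ e i)"
    "e' \<in> (\<Pi>\<^sub>E i\<in>J. {..d'})" "g = (\<lambda>x. \<Prod>i\<in>J. x i ^ e' i)"
    using assms(2,3) unfolding monomials_def by blast
  have "(\<lambda>x. f x * g x) = (\<lambda>x. \<Prod>i\<in>J. x i ^ (\<lambda>i\<in>J. e i + e' i) i)"
    using e by (simp add: fun_eq_iff power_add prod.distrib)
  moreover have "(\<lambda>i\<in>J. e i + e' i) \<in> (\<Pi>\<^sub>E i\<in>J. {..d + d'})"
    using e by (auto simp: PiE_iff intro: add_mono)
  ultimately show ?thesis unfolding monomials_def by blast
qed

lemma fspan_monomials_mult: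
  assumes J: "finite J" and f: "f \<in> fspan (monomials J d)" and g: "g \<in> fspan (monomials J d')"
  shows "(\<lambda>x. f x * g x) \<in> fspan (monomials J (d + d'))"
proof -
  interpret VS: vector_space "\<lambda>(a::complex) (f::('a \<Rightarrow> complex) \<Rightarrow> complex) x. a * f x"
    by (rule vector_space_functions)
  let ?S = "fspan (monomials J (d + d'))"
  have 1: "(\<lambda>x. f x * g x) \<in> ?S" if f: "f \<in> monomials J d"
    and g: "g \<in> fspan (monomials J d')" for f g
  proof -
    have "VS.subspace {g. (\<lambda>x. f x * g x) \<in> ?S}"
    proof (rule VS.subspaceI; clarsimp)
      show "(\<lambda>x. 0) \<in> ?S" using VS.span_zero by (simp add: zero_fun_def)
      show "(\<lambda>x. f x * (u x + v x)) \<in> ?S" if "(\<lambda>x. f x * u x) \<in> ?S" "(\<lambda>x. f x * v x) \<in> ?S" for u v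
        using VS.span_add[OF that] by (simp add: plus_fun_def distrib_left)
      show "(\<lambda>x. f x * (c * u x)) \<in> ?S" if "(\<lambda>x. f x * u x) \<in> ?S" for c u
        using VS.span_scale[OF that, of c] by (simp add: mult.left_commute)
    qed
    moreover have "monomials J d' \<subseteq> {g. (\<lambda>x. f x * g x) \<in> ?S}"
      using monomials_mult[OF J f] VS.span_base by blast
    ultimately show ?thesis using VS.span_minimal g by blast
  qed
  have "VS.subspace {f. (\<lambda>x. f x * g x) \<in> ?S}"
  proof (rule VS.subspaceI; clarsimp)
    show "(\<lambda>x. 0) \<in> ?S" using VS.span_zero by (simp add: zero_fun_def)
    show "(\<lambda>x. (u x + v x) * g x) \<in> ?S" if "(\<lambda>x. u x * g x) \<in> ?S" "(\<lambda>x. v x * g x) \<in> ?S" for u v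
      using VS.span_add[OF that] by (simp add: plus_fun_def distrib_right)
    show "(\<lambda>x. c * u x * g x) \<in> ?S" if "(\<lambda>x. u x * g x) \<in> ?S" for c u
      using VS.span_scale[OF that, of c] by (simp add: mult.assoc)
  qed
  moreover have "monomials J d \<subseteq> {f. (\<lambda>x. f x * g x) \<in> ?S}" using 1[OF _ g] by blast
  ultimately show ?thesis using VS.span_minimal f by blast
qed

lemma fspan_monomials_mono:
  assumes "d \<le> d'" "f \<in> fspan (monomials J d)"
  shows "f \<in> fspan (monomials J d')"
proof -
  interpret VS: vector_space "\<lambda>(a::complex) (f::('a \<Rightarrow> complex) \<Rightarrow> complex) x. a * f x"
    by (rule vector_space_functions)
  show ?thesis using VS.span_mono[OF monomials_mono[OF assms(1)]] assms(2) by blast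
qed

lemma fspan_monomials_const: 
  assumes J: "finite J" shows "(\<lambda>_. c) \<in> fspan (monomials J d)"
proof -
  interpret VS: vector_space "\<lambda>(a::complex) (f::('a \<Rightarrow> complex) \<Rightarrow> complex) x. a * f x"
    by (rule vector_space_functions)
  have "(\<lambda>_. 1) \<in> monomials J d"
    unfolding monomials_def by (rule image_eqI[of _ _ "\<lambda>i\<in>J. 0"]) auto
  from VS.span_scale[OF VS.span_base[OF this], of c] show ?thesis by simp
qed

lemma poly_fun_fspan:
  assumes J: "finite J" and f: "f \<in> poly_fun J"
  shows "\<exists>d. f \<in> fspan (monomials J d)"
  using f
proof (induction rule: poly_fun.induct)
  case (pf_const c)
  then show ?case using fspan_monomials_const[OF J] by blast
next
  case (pf_coord i)
  interpret VS: vector_space "\<lambda>(a::complex) (f::('a \<Rightarrow> complex) \<Rightarrow> complex) x. a * f x"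
    by (rule vector_space_functions)
  have "(\<lambda>x :: 'a \<Rightarrow> complex. x i) \<in> monomials J 1"
    unfolding monomials_def
  proof (rule image_eqI[of _ _ "\<lambda>j\<in>J. if j = i then 1 else 0"])
    have *: "(\<Prod>j\<in>J. x j ^ (\<lambda>j\<in>J. if j = i then 1 else 0) j) = x i" for x :: "'a \<Rightarrow> complex"
    proof -
      have "(\<Prod>j\<in>J. x j ^ (\<lambda>j\<in>J. if j = i then 1 else 0) j) = (\<Prod>j\<in>J. if j = i then x j else 1)"
        by (rule prod.cong) auto
      then show ?thesis using J pf_coord by simp
    qed
    show "(\<lambda>x :: 'a \<Rightarrow> complex. x i) = (\<lambda>x. \<Prod>j\<in>J. x j ^ (\<lambda>j\<in>J. if j = i then 1 else 0) j)"
      by (rule ext) (rule *[symmetric])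
  qed auto
  then show ?case using VS.span_base by blast
next
  case (pf_add f g)
  interpret VS: vector_space "\<lambda>(a::complex) (f::('a \<Rightarrow> complex) \<Rightarrow> complex) x. a * f x"
    by (rule vector_space_functions)
  obtain d d' where "f \<in> fspan (monomials J d)" "g \<in> fspan (monomials J d')" using pf_add by blast
  then have "f \<in> fspan (monomials J (d + d'))" "g \<in> fspan (monomials J (d + d'))"
    using fspan_monomials_mono[of d "d + d'" f J] fspan_monomials_mono[of d' "d + d'" g J] by auto
  from VS.span_add[OF this] show ?case by (auto simp: plus_fun_def)
next
  case (pf_mult f g)
  then show ?case using fspan_monomials_mult[OF J] by blast
qed

lemma fspan_monomials_power:
  assumes J: "finite J" and f: "f \<in> fspan (monomials J d)"
  shows "(\<lambda>x. f x ^ k) \<in> fspan (monomials J (d * k))"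
proof (induction k)
  case 0
  then show ?case using fspan_monomials_const[OF J, of 1] by simp
next
  case (Suc k)
  from fspan_monomials_mult[OF J f this] show ?case by simp
qed

lemma fspan_monomials_prod:
  assumes J: "finite J" and A: "finite A" and f: "\<And>a. a \<in> A \<Longrightarrow> f a \<in> fspan (monomials J (d a))"
  shows "(\<lambda>x. \<Prod>a\<in>A. f a x) \<in> fspan (monomials J (\<Sum>a\<in>A. d a))"
  using A f
proof (induction A rule: finite_induct)
  case empty
  then show ?case using fspan_monomials_const[OF J, of 1] by simp
next
  case (insert a A)
  then show ?case using fspan_monomials_mult[OF J, of "f a" "d a"] by simp
qed

text \<open>Counting, with \<open>N = card J\<close>: the products of powers of the
  \<open>F i\<close> with exponents up to \<open>D\<close> have \<open>(D + 1) ^ (N + 1)\<close>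
  exponent vectors, but lie in the span of at most \<open>(K D + 1) ^ N\<close> monomials.\<close>

lemma poly_fun_algebraically_dependent:
  assumes J: "finite J" and F: "\<forall>i\<le>card J. F i \<in> poly_fun J"
  shows "\<exists>E c. finite E \<and> E \<subseteq> (\<Pi>\<^sub>E i\<in>{..<Suc (card J)}. UNIV :: nat set) \<and> (\<exists>e\<in>E. c e \<noteq> (0::complex)) \<and>
    (\<forall>x. (\<Sum>e\<in>E. c e * (\<Prod>i<Suc (card J). F i x ^ e i)) = 0)"
proof -
  interpret VS: vector_space "\<lambda>(a::complex) (f::('a \<Rightarrow> complex) \<Rightarrow> complex) x. a * f x"
    by (rule vector_space_functions)
  let ?N = "card J"
  have "\<forall>i. \<exists>d. i \<le> ?N \<longrightarrow> F i \<in> fspan (monomials J d)"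
    using poly_fun_fspan[OF J] F by blast
  then obtain d where d: "\<And>i. i \<le> ?N \<Longrightarrow> F i \<in> fspan (monomials J (d i))" by metis
  define K where "K = (\<Sum>i<Suc ?N. d i)"
  \<comment> \<open>With this value \<open>(K D + 1) ^ N\<close> is at most
    \<open>(K + 1) ^ N (D + 1) ^ N = D (D + 1) ^ N\<close>, which is less than the number of
    exponent vectors.\<close>
  define D where "D = Suc K ^ ?N"
  define E where "E = (\<Pi>\<^sub>E i\<in>{..<Suc ?N}. {..D})"
  define \<phi> where "\<phi> = (\<lambda>e x. \<Prod>i<Suc ?N. F i x ^ e i)"
  have finE: "finite E" by (simp add: E_def finite_PiE)
  have cardE: "card E = Suc D ^ Suc ?N" by (simp add: E_def card_PiE)
  have in_span: "\<phi> e \<in> fspan (monomials J (K * D))" if e: "e \<in> E" for e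
  proof -
    have "\<phi> e \<in> fspan (monomials J (\<Sum>i<Suc ?N. d i * e i))"
      unfolding \<phi>_def by (rule fspan_monomials_prod[OF J], simp, rule fspan_monomials_power[OF J d]) simp
    moreover have "(\<Sum>i<Suc ?N. d i * e i) \<le> K * D"
      unfolding K_def sum_distrib_right
      by (rule sum_mono) (use e in \<open>auto simp: E_def PiE_iff\<close>)
    ultimately show ?thesis by (rule fspan_monomials_mono[rotated])
  qed
  have "card (monomials J (K * D)) \<le> Suc (K * D) ^ ?N" by (rule card_monomials[OF J])
  also have "\<dots> \<le> (Suc K * Suc D) ^ ?N" by (rule power_mono) auto
  also have "\<dots> = D * Suc D ^ ?N" unfolding power_mult_distrib D_def[symmetric] ..
  also have "\<dots> < Suc D ^ Suc ?N" by simp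
  finally have card: "card (monomials J (K * D)) < card E" using cardE by simp
  have rel: "\<exists>c. (\<exists>e\<in>E. c e \<noteq> (0::complex)) \<and> (\<forall>x. (\<Sum>e\<in>E. c e * \<phi> e x) = 0)"
  proof (cases "inj_on \<phi> E")
    case True
    have "VS.dependent (\<phi> ` E)"
    proof (rule ccontr)
      assume "VS.independent (\<phi> ` E)"
      then have "card (\<phi> ` E) \<le> card (monomials J (K * D))"
        using VS.independent_span_bound[OF finite_monomials[OF J]] in_span by blast
      then show False using card card_image[OF True] by simp
    qed
    then obtain u where u: "\<exists>v\<in>\<phi> ` E. u v \<noteq> 0" "(\<Sum>v\<in>\<phi> ` E. (\<lambda>x. u v * v x)) = 0"
      using VS.dependent_finite[of "\<phi> ` E"] finE by auto
    have "(\<Sum>e\<in>E. u (\<phi> e) * \<phi> e x) = 0" for x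
    proof -
      have "(\<Sum>v\<in>\<phi> ` E. (\<lambda>x. u v * v x)) = (\<Sum>e\<in>E. (\<lambda>x. u (\<phi> e) * \<phi> e x))"
        by (simp add: sum.reindex[OF True])
      moreover have "(\<Sum>e\<in>E. (\<lambda>x. u (\<phi> e) * \<phi> e x)) x = (\<Sum>e\<in>E. u (\<phi> e) * \<phi> e x)"
        using finE by (induction E rule: finite_induct) auto
      ultimately show ?thesis using u(2) by simp
    qed
    then show ?thesis using u(1) by (intro exI[of _ "\<lambda>e. u (\<phi> e)"]) auto
  next
    case False
    then obtain e e' where e: "e \<in> E" "e' \<in> E" "e \<noteq> e'" "\<phi> e = \<phi> e'" by (auto simp: inj_on_def)
    \<comment> \<open>Two equal products already form a relation.\<close>
    define c where "c = (\<lambda>a. if a = e then 1 else if a = e' then -1 else (0::complex))"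
    have "(\<Sum>a\<in>E. c a * \<phi> a x) = 0" for x
    proof -
      have "(\<Sum>a\<in>E. c a * \<phi> a x) = (\<Sum>a\<in>{e, e'}. c a * \<phi> a x)"
        by (rule sum.mono_neutral_right[OF finE]) (use e in \<open>auto simp: c_def\<close>)
      then show ?thesis using e by (simp add: c_def)
    qed
    then show ?thesis using e(1) by (intro exI[of _ c]) (auto simp: c_def)
  qed
  have "E \<subseteq> (\<Pi>\<^sub>E i\<in>{..<Suc ?N}. UNIV)" by (auto simp: E_def)
  then show ?thesis using rel finE unfolding \<phi>_def by blast
qed

section \<open>Chains in slices of affine space\<close>

lemma closedin_zariski_poly:
  assumes "f \<in> poly_fun I"
  shows "closedin (subtopology (zariski I) A) {x \<in> cspace I \<inter> A. f x = 0}"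
proof -
  have "{x \<in> cspace I \<inter> A. f x = 0} = zero_locus I {f} \<inter> A" by (auto simp: zero_locus_def)
  moreover have "closedin (zariski I) (zero_locus I {f})"
    unfolding closedin_zariski by (rule exI[of _ "{f}"]) (simp add: assms)
  ultimately show ?thesis unfolding closedin_subtopology by blast
qed

lemma closedin_zariski_separate:
  assumes C: "closedin (subtopology (zariski I) A) C" and x: "x \<in> cspace I \<inter> A" "x \<notin> C"
  shows "\<exists>f\<in>poly_fun I. (\<forall>y\<in>C. f y = 0) \<and> f x \<noteq> 0"
proof -
  obtain K where "closedin (zariski I) K" "C = K \<inter> A" using C by (auto simp: closedin_subtopology)
  then obtain F where F: "F \<subseteq> poly_fun I" "C = zero_locus I F \<inter> A" by (auto simp: closedin_zariski)
  then have "x \<notin> zero_locus I F" using x by blast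
  then show ?thesis using F x by (auto simp: zero_locus_def)
qed

text \<open>Take polynomials \<open>f\<^sub>i\<close> vanishing on \<open>C\<^sub>i\<close> but not on \<open>C\<^sub>i\<^sub>+\<^sub>1\<close>; a relation between them
  descends along the chain to a nonzero constant vanishing on \<open>C\<^sub>0\<close>.\<close>

lemma no_relation_on_chain:
  assumes C: "irreducible_chain (subtopology (zariski I) A) n C"
    and f: "\<And>i. i < n \<Longrightarrow> f i \<in> poly_fun I"
    and f0: "\<And>i y. i < n \<Longrightarrow> y \<in> C i \<Longrightarrow> f i y = 0"
    and f1: "\<And>i. i < n \<Longrightarrow> \<exists>y\<in>C (Suc i). f i y \<noteq> 0"
    and m: "m \<le> n" and E: "finite E" "E \<subseteq> (\<Pi>\<^sub>E i\<in>{..<m}. UNIV :: nat set)" "e \<in> E" "c e \<noteq> 0"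
  shows "\<exists>x\<in>C m. (\<Sum>e\<in>E. c e * (\<Prod>i<m. f i x ^ e i)) \<noteq> 0"
  using m E
proof (induction m arbitrary: E c e)
  case 0
  have "E = {e}" using 0 by auto
  moreover have "C 0 \<noteq> {}" using C by (simp add: irreducible_chain_def irreducible_in_def)
  ultimately show ?case using 0 by auto
next
  case (Suc m)
  have irr: "irreducible_in (subtopology (zariski I) A) (C (Suc m))" and "C m \<subset> C (Suc m)"
    using C Suc.prems(1) by (simp_all add: irreducible_chain_def)
  then have sub: "C m \<subseteq> C (Suc m)" by blast
  have CA: "C (Suc m) \<subseteq> cspace I \<inter> A"
    using irr closedin_subset[of "subtopology (zariski I) A"] by (auto simp: irreducible_in_def)
  define E1 where "E1 = {e \<in> E. c e \<noteq> 0}"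
  have E1: "finite E1" "e \<in> E1" using Suc.prems by (auto simp: E1_def)
  \<comment> \<open>Dividing the relation by \<open>f m ^ k\<close> leaves \<open>g\<close>. Since
    \<open>f m\<close> vanishes on \<open>C m\<close>, only the terms of \<open>g\<close> with
    exponent exactly \<open>k\<close> survive there, and they involve the smaller indices
    only.\<close>
  define k where "k = Min ((\<lambda>e. e m) ` E1)"
  have k: "k \<le> e m" if "e \<in> E1" for e unfolding k_def using E1(1) that by (intro Min_le) auto
  have "k \<in> (\<lambda>e. e m) ` E1" unfolding k_def using E1 by (intro Min_in) auto
  then obtain e0 where e0: "e0 \<in> E1" "e0 m = k" by blast
  define E2 where "E2 = {e \<in> E1. e m = k}"
  define g where "g = (\<lambda>x. \<Sum>e\<in>E1. c e * (f m x ^ (e m - k) * (\<Prod>i<m. f i x ^ e i)))"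
  have fm: "f m \<in> poly_fun I" using f Suc.prems(1) by simp
  have pow: "(\<lambda>x. p x ^ j) \<in> poly_fun I" if "p \<in> poly_fun I" for p j
    by (induction j) (auto intro: pf_const pf_mult that)
  have "(\<lambda>x. \<Sum>e\<in>E'. c e * (f m x ^ (e m - k) * (\<Prod>i<m. f i x ^ e i))) \<in> poly_fun I"
    if "finite E'" for E'
    using that
  proof (induction E' rule: finite_induct)
    case (insert a E')
    have "(\<lambda>x. \<Prod>i<m. f i x ^ a i) \<in> poly_fun I"
      using f Suc.prems(1) by (intro poly_fun_prod pow) auto
    then show ?case using insert by (simp, intro pf_add pf_mult pf_const pow fm) auto
  qed (simp add: pf_const)
  then have g: "g \<in> poly_fun I" using E1(1) by (simp add: g_def)
  \<comment> \<open>Exponent functions on \<open>{..<m}\<close> must be \<open>undefined\<close> at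
    \<open>m\<close>; no information is lost, since on \<open>E2\<close> the value there is the
    constant \<open>k\<close>.\<close>
  define E3 where "E3 = (\<lambda>e. e(m := undefined)) ` E2"
  have inj: "inj_on (\<lambda>e. e(m := undefined)) E2"
  proof (rule inj_onI)
    fix a b assume ab: "a \<in> E2" "b \<in> E2" "a(m := undefined) = b(m := undefined)"
    show "a = b"
    proof
      fix i show "a i = b i"
        using ab(1,2) fun_cong[OF ab(3), of i] by (cases "i = m") (auto simp: E2_def)
    qed
  qed
  have "\<exists>x\<in>C m. (\<Sum>e\<in>E3. c (e(m := k)) * (\<Prod>i<m. f i x ^ e i)) \<noteq> 0"
  proof (rule Suc.IH)
    show "m \<le> n" using Suc.prems by simp
    show "finite E3" using E1 by (simp add: E3_def E2_def)
    show "E3 \<subseteq> (\<Pi>\<^sub>E i\<in>{..<m}. UNIV)"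
    proof
      fix a assume "a \<in> E3"
      then obtain b where b: "b \<in> E" "a = b(m := undefined)" by (auto simp: E3_def E2_def E1_def)
      have "b \<in> (\<Pi>\<^sub>E i\<in>{..<Suc m}. UNIV)" using b(1) Suc.prems(3) by blast
      then show "a \<in> (\<Pi>\<^sub>E i\<in>{..<m}. UNIV)" unfolding b(2) by (auto simp: PiE_iff extensional_def)
    qed
    show "e0(m := undefined) \<in> E3" using e0 by (auto simp: E3_def E2_def)
    show "c ((e0(m := undefined))(m := k)) \<noteq> 0" using e0 by (auto simp: E1_def)
  qed
  then obtain x where x: "x \<in> C m" "(\<Sum>e\<in>E3. c (e(m := k)) * (\<Prod>i<m. f i x ^ e i)) \<noteq> 0" by blast
  have "g x \<noteq> 0"
  proof -
    have "f m x = 0" using f0[of m x] x(1) Suc.prems(1) by simp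
    moreover have "e m - k \<noteq> 0" if "e \<in> E1 - E2" for e using that k[of e] by (auto simp: E2_def)
    ultimately have "g x = (\<Sum>e\<in>E2. c e * (\<Prod>i<m. f i x ^ e i))"
      unfolding g_def
      by (intro sum.mono_neutral_cong_right E1(1)) (auto simp: E2_def power_0_left)
    also have "\<dots> = (\<Sum>e\<in>E3. c (e(m := k)) * (\<Prod>i<m. f i x ^ e i))"
      unfolding E3_def sum.reindex[OF inj] o_def
      by (intro sum.cong refl arg_cong2[where f = "(*)"] arg_cong[where f = c] prod.cong)
        (auto simp: E2_def)
    finally show ?thesis using x(2) by simp
  qed
  then have n1: "\<not> C (Suc m) \<subseteq> {x \<in> cspace I \<inter> A. g x = 0}" using x(1) sub by blast
  have n2: "\<not> C (Suc m) \<subseteq> {x \<in> cspace I \<inter> A. f m x = 0}" using f1[of m] Suc.prems(1) by auto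
  \<comment> \<open>By irreducibility \<open>f m\<close> and \<open>g\<close> are nonzero at a
    common point, and there the relation takes the value \<open>f m y ^ k * g y\<close>.\<close>
  have "\<not> C (Suc m) \<subseteq> {x \<in> cspace I \<inter> A. f m x = 0} \<union> {x \<in> cspace I \<inter> A. g x = 0}"
    using irreducible_inD[OF irr closedin_zariski_poly[OF fm] closedin_zariski_poly[OF g]] n1 n2
      by blast
  then obtain y where y: "y \<in> C (Suc m)" "f m y \<noteq> 0" "g y \<noteq> 0" using CA by auto
  have "(\<Sum>e\<in>E. c e * (\<Prod>i<Suc m. f i y ^ e i)) = (\<Sum>e\<in>E1. c e * (\<Prod>i<Suc m. f i y ^ e i))"
    by (rule sum.mono_neutral_right) (use Suc.prems in \<open>auto simp: E1_def\<close>)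
  also have "\<dots> = (\<Sum>e\<in>E1. f m y ^ k * (c e * (f m y ^ (e m - k) * (\<Prod>i<m. f i y ^ e i))))"
  proof (rule sum.cong[OF refl])
    fix e assume "e \<in> E1"
    then have "f m y ^ e m = f m y ^ k * f m y ^ (e m - k)" using k by (simp flip: power_add)
    then show "c e * (\<Prod>i<Suc m. f i y ^ e i) =
        f m y ^ k * (c e * (f m y ^ (e m - k) * (\<Prod>i<m. f i y ^ e i)))" by simp
  qed
  also have "\<dots> = f m y ^ k * g y" by (simp add: g_def sum_distrib_left)
  finally show ?case using y by (intro bexI[of _ y]) auto
qed

text \<open>A longer chain would give \<open>card J + 1\<close> polynomials admitting no relation on
  it. With the coordinates outside \<open>J\<close> replaced by constants they are polynomials in
  \<open>card J\<close> variables, hence dependent.\<close>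

lemma irreducible_chain_length:
  assumes J: "finite J" "J \<subseteq> I" and A: "A \<subseteq> {x \<in> cspace I. \<forall>i\<in>I - J. x i = c i}"
    and C: "irreducible_chain (subtopology (zariski I) A) n C"
  shows "n \<le> card J"
proof (rule ccontr)
  assume "\<not> n \<le> card J"
  then have n: "Suc (card J) \<le> n" by simp
  have cl: "closedin (subtopology (zariski I) A) (C i)" if "i \<le> n" for i
    using C that by (simp add: irreducible_chain_def irreducible_in_def)
  have sub: "C i \<subseteq> cspace I \<inter> A" if "i \<le> n" for i using closedin_subset[OF cl[OF that]] by simp
  have "\<exists>f. f \<in> poly_fun I \<and> (\<forall>y\<in>C i. f y = 0) \<and> (\<exists>y\<in>C (Suc i). f y \<noteq> 0)" if i: "i < n" for i
  proof -
    have "C i \<subset> C (Suc i)" using C i by (simp add: irreducible_chain_def)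
    then obtain x where x: "x \<in> C (Suc i)" "x \<notin> C i" by blast
    have "x \<in> cspace I \<inter> A" using sub[of "Suc i"] i x(1) by auto
    from closedin_zariski_separate[OF cl this x(2)] i x(1) show ?thesis by auto
  qed
  then obtain f where f: "\<And>i. i < n \<Longrightarrow> f i \<in> poly_fun I" "\<And>i y. i < n \<Longrightarrow> y \<in> C i \<Longrightarrow> f i y = 0"
    "\<And>i. i < n \<Longrightarrow> \<exists>y\<in>C (Suc i). f i y \<noteq> 0" by metis
  define \<sigma> where "\<sigma> = (\<lambda>y i. if i \<in> J then y i else c i)"
  have "\<forall>i\<le>card J. (\<lambda>y. f i (\<sigma> y)) \<in> poly_fun J"
  proof (intro allI impI)
    fix i assume "i \<le> card J"
    then have "f i \<in> poly_fun I" using f(1)[of i] n by simp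
    moreover have "(\<lambda>y. \<sigma> y j) \<in> poly_fun J" for j
      by (cases "j \<in> J") (auto simp: \<sigma>_def intro: pf_const pf_coord)
    ultimately show "(\<lambda>y. f i (\<sigma> y)) \<in> poly_fun J" by (rule poly_fun_subst)
  qed
  from poly_fun_algebraically_dependent[OF J(1), of "\<lambda>i y. f i (\<sigma> y)", OF this]
  obtain E b where E: "finite E" "E \<subseteq> (\<Pi>\<^sub>E i\<in>{..<Suc (card J)}. UNIV :: nat set)"
    "\<exists>e\<in>E. b e \<noteq> (0::complex)"
    and rel: "\<forall>y. (\<Sum>e\<in>E. b e * (\<Prod>i<Suc (card J). f i (\<sigma> y) ^ e i)) = 0"
    by (elim exE conjE)
  obtain e where e: "e \<in> E" "b e \<noteq> 0" using E(3) by blast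
  have "\<exists>x\<in>C (Suc (card J)). (\<Sum>e\<in>E. b e * (\<Prod>i<Suc (card J). f i x ^ e i)) \<noteq> 0"
    by (rule no_relation_on_chain[where f = f and c = b and e = e, OF C _ _ _ n E(1,2) e])
      (rule f; assumption)+
  then obtain x where x: "x \<in> C (Suc (card J))"
    "(\<Sum>e\<in>E. b e * (\<Prod>i<Suc (card J). f i x ^ e i)) \<noteq> 0" by blast
  have "x \<in> A" using x(1) sub[OF n] by blast
  then have "f i (\<sigma> x) = f i x" if "i < Suc (card J)" for i
    using A by (intro poly_fun_cong[OF f(1)]) (use that n in \<open>auto simp: \<sigma>_def\<close>)
  then have "(\<Sum>e\<in>E. b e * (\<Prod>i<Suc (card J). f i (\<sigma> x) ^ e i)) \<noteq> 0" using x(2) by simp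
  then show False using rel by blast
qed

lemma poly_fun_on_line:
  assumes "f \<in> poly_fun I"
  shows "\<exists>P. \<forall>t. f (\<lambda>i\<in>I. x i + t * (y i - x i)) = poly P t"
  using assms
proof (induction rule: poly_fun.induct)
  case (pf_const c)
  then show ?case by (intro exI[of _ "[:c:]"]) simp
next
  case (pf_coord i)
  then show ?case by (intro exI[of _ "[:x i, y i - x i:]"]) simp
next
  case (pf_add f g)
  then obtain P Q where "\<forall>t. f (\<lambda>i\<in>I. x i + t * (y i - x i)) = poly P t"
    "\<forall>t. g (\<lambda>i\<in>I. x i + t * (y i - x i)) = poly Q t" by blast
  then show ?case by (intro exI[of _ "P + Q"]) (simp only: poly_add simp_thms)
next
  case (pf_mult f g)
  then obtain P Q where "\<forall>t. f (\<lambda>i\<in>I. x i + t * (y i - x i)) = poly P t"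
    "\<forall>t. g (\<lambda>i\<in>I. x i + t * (y i - x i)) = poly Q t" by blast
  then show ?case by (intro exI[of _ "P * Q"]) (simp only: poly_mult simp_thms)
qed

lemma exists_nonroot: "P \<noteq> 0 \<Longrightarrow> \<exists>t. poly P t \<noteq> (0::complex)"
  by (metis poly_all_0_iff_0)

text \<open>A flag of coordinate subspaces through \<open>p\<close>, cut down to
  \<open>h \<noteq> 0\<close>. Its members are irreducible: on the line joining two points the
  polynomials that exclude them become nonzero polynomials in one variable, and these, together with
  \<open>h\<close>, have a common nonroot.\<close>

lemma irreducible_chain_exists:
  assumes J: "finite J" "J \<subseteq> I" and h: "h \<in> poly_fun I"
    and p: "p \<in> cspace I" "\<forall>i\<in>I - J. p i = c i" "h p \<noteq> 0"
  shows "\<exists>C. irreducible_chain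
    (subtopology (zariski I) {x \<in> cspace I. (\<forall>i\<in>I - J. x i = c i) \<and> h x \<noteq> 0}) (card J) C"
proof -
  let ?A = "{x \<in> cspace I. (\<forall>i\<in>I - J. x i = c i) \<and> h x \<noteq> 0}"
  obtain e where "bij_betw e {0..<card J} J" using ex_bij_betw_nat_finite[OF J(1)] by blast
  then have e: "e ` {..<card J} = J" "inj_on e {..<card J}"
    by (auto simp: bij_betw_def atLeast0LessThan)
  define L where "L = (\<lambda>k. {x \<in> ?A. \<forall>i\<in>I - e ` {..<k}. x i = p i})"
  have pL: "p \<in> L k" for k using p by (auto simp: L_def)
  have irr: "irreducible_in (subtopology (zariski I) ?A) (L k)" if k: "k \<le> card J" for k
    unfolding irreducible_in_def
  proof (intro conjI allI impI)
    have "L k = {x \<in> cspace I. \<forall>i\<in>I - e ` {..<k}. x i = p i} \<inter> ?A" by (auto simp: L_def)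
    then show "closedin (subtopology (zariski I) ?A) (L k)"
      using closedin_zariski_fixed[of "I - e ` {..<k}" I p] by (auto simp: closedin_subtopology)
    show "L k \<noteq> {}" using pL by blast
    fix A B assume A: "closedin (subtopology (zariski I) ?A) A"
      and B: "closedin (subtopology (zariski I) ?A) B" and s: "L k \<subseteq> A \<union> B"
    show "L k \<subseteq> A \<or> L k \<subseteq> B"
    proof (rule ccontr)
      assume "\<not> (L k \<subseteq> A \<or> L k \<subseteq> B)"
      then obtain x y where x: "x \<in> L k" "x \<notin> A" and y: "y \<in> L k" "y \<notin> B" by blast
      obtain f where f: "f \<in> poly_fun I" "\<forall>z\<in>A. f z = 0" "f x \<noteq> 0"
        using closedin_zariski_separate[OF A, of x] x by (auto simp: L_def)
      obtain g where g: "g \<in> poly_fun I" "\<forall>z\<in>B. g z = 0" "g y \<noteq> 0"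
        using closedin_zariski_separate[OF B, of y] y by (auto simp: L_def)
      let ?z = "\<lambda>t. \<lambda>i\<in>I. x i + t * (y i - x i)"
      obtain P where P: "\<forall>t. f (?z t) = poly P t" using poly_fun_on_line[OF f(1)] by blast
      obtain Q where Q: "\<forall>t. g (?z t) = poly Q t" using poly_fun_on_line[OF g(1)] by blast
      obtain R where R: "\<forall>t. h (?z t) = poly R t" using poly_fun_on_line[OF h] by blast
      have xy: "x \<in> cspace I" "y \<in> cspace I" "h x \<noteq> 0" using x y by (auto simp: L_def)
      have z0: "?z 0 = x" by (rule PiE_ext[of _ I "\<lambda>_. UNIV"]) (use xy in auto)
      have z1: "?z 1 = y" by (rule PiE_ext[of _ I "\<lambda>_. UNIV"]) (use xy in auto)
      have "P \<noteq> 0" using P[rule_format, of 0] f(3) z0 by auto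
      moreover have "Q \<noteq> 0" using Q[rule_format, of 1] g(3) z1 by auto
      moreover have "R \<noteq> 0" using R[rule_format, of 0] xy(3) z0 by auto
      ultimately have "P * Q * R \<noteq> 0" by simp
      then obtain t where t: "poly (P * Q * R) t \<noteq> 0" using exists_nonroot by blast
      then have nz: "f (?z t) \<noteq> 0" "g (?z t) \<noteq> 0" "h (?z t) \<noteq> 0" using P Q R by auto
      have zp: "?z t i = p i" if "i \<in> I - e ` {..<k}" for i
      proof -
        have "x i = p i" "y i = p i" using x(1) y(1) that by (auto simp: L_def)
        then show ?thesis using that by simp
      qed
      moreover have "?z t i = c i" if i: "i \<in> I - J" for i
      proof -
        have "i \<in> I - e ` {..<k}" using i k e(1) by auto
        from zp[OF this] show ?thesis using p(2) i by simp
      qed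
      moreover have "?z t \<in> cspace I" by simp
      ultimately have "?z t \<in> L k" unfolding L_def using nz(3) by blast
      then show False using s nz f(2) g(2) by blast
    qed
  qed
  have strict: "L k \<subset> L (Suc k)" if k: "k < card J" for k
  proof -
    have sub: "L k \<subseteq> L (Suc k)" by (auto simp: L_def lessThan_Suc)
    have ek: "e k \<in> J" "e k \<notin> e ` {..<k}"
      using e k by (auto simp: inj_on_def) (metis lessThan_iff less_irrefl less_trans)
    define y where "y = p(e k := p (e k) + 1)"
    let ?z = "\<lambda>t. \<lambda>i\<in>I. p i + t * (y i - p i)"
    obtain R where R: "\<forall>t. h (?z t) = poly R t" using poly_fun_on_line[OF h] by blast
    have z0: "?z 0 = p" by (rule PiE_ext[of _ I "\<lambda>_. UNIV"]) (use p in auto)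
    have "R \<noteq> 0" using R[rule_format, of 0] p(3) z0 by auto
    \<comment> \<open>The extra factor excludes the parameter 0, that is, the point \<open>p\<close>
      itself.\<close>
    then have "R * [:0, 1:] \<noteq> 0" by simp
    then obtain t where "poly (R * [:0, 1:]) t \<noteq> 0" using exists_nonroot by blast
    then have t: "t \<noteq> 0" "h (?z t) \<noteq> 0" using R by auto
    have ekI: "e k \<in> I" using ek J by blast
    have zi: "?z t i = p i" if "i \<in> I" "i \<noteq> e k" for i using that by (simp add: y_def)
    have zk: "?z t (e k) = p (e k) + t" using ekI by (simp add: y_def)
    have "?z t \<in> L (Suc k)"
      using t(2) zi p(2) ek(1) by (auto simp: L_def lessThan_Suc y_def)
    moreover have "?z t \<notin> L k"
      using zk t(1) ekI ek(2) by (auto simp: L_def)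
    ultimately show ?thesis using sub by blast
  qed
  show ?thesis
    by (rule exI[of _ L]) (use irr strict in \<open>simp add: irreducible_chain_def\<close>)
qed

text \<open>Every chart is a nonempty principal open subset of an affine space whose coordinates are
  the arrows off a spanning tree.\<close>

theorem (in fin_digraph) variety_dim_orbit_space:
  assumes F: "upset (arcs G) F" and u: "unsplittable G F" and ne: "verts G \<noteq> {}" "F \<noteq> {}"
  shows "variety_dim (orbit_space G F) = Suc (card (arcs G)) - card (verts G)"
proof (rule variety_dim_cover[where \<U> = "(\<lambda>S. torus_orbit G ` nonzero_on (arcs G) S) ` F"
      and ?'r = "'b \<Rightarrow> complex"])
  let ?A = "affine_space (arcs G)"
  show "\<Union>((\<lambda>S. torus_orbit G ` nonzero_on (arcs G) S) ` F) = points (orbit_space G F)"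
    unfolding points_orbit_space support_locus_upset[OF F] by blast
  show "(\<lambda>S. torus_orbit G ` nonzero_on (arcs G) S) ` F \<noteq> {}" using ne by simp
  fix U assume "U \<in> (\<lambda>S. torus_orbit G ` nonzero_on (arcs G) S) ` F"
  then obtain S where S: "S \<in> F" "U = torus_orbit G ` nonzero_on (arcs G) S" by blast
  have SG: "S \<subseteq> arcs G" by (rule upset_subset[OF F S(1)])
  have sub: "{S'. S \<subseteq> S' \<and> S' \<subseteq> arcs G} \<subseteq> F" using upset_superset[OF F S(1)] by blast
  note op = orbit_space_open[OF upset_principal[OF SG] sub, unfolded support_locus_principal[OF SG]]
  show "openin (zar (orbit_space G F)) U" using op(1) S(2) by simp
  obtain T \<gamma> r where T: "T \<subseteq> S" "tree_gauge T (verts G) \<gamma> r"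
    using unsplittable_tree[OF F u ne(1) S(1)] .
  have TG: "T \<subseteq> arcs G" using T SG by blast
  let ?Y = "{x \<in> nonzero_on (arcs G) S. \<forall>a\<in>T. x a = 1}"
  let ?J = "arcs G - T"
  have finS: "finite S" using SG finite_arcs finite_subset by blast
  have finT: "finite T" using TG finite_arcs finite_subset by blast
  have IJ: "arcs G - ?J = T" using TG by blast
  have Y: "?Y = {x \<in> cspace (arcs G). (\<forall>a\<in>arcs G - ?J. x a = 1) \<and> (\<Prod>a\<in>S. x a) \<noteq> 0}"
    unfolding IJ using finS by auto
  have cJ: "card ?J = Suc (card (arcs G)) - card (verts G)"
    using tree_gaugeD(4)[OF T(2)] card_Diff_subset[OF finT TG] by simp
  have zY: "zar (subspace_on ?A ?Y) = subtopology (zariski (arcs G)) ?Y" by simp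
  obtain \<phi> where "iso_pair (orbit_space G {S'. S \<subseteq> S' \<and> S' \<subseteq> arcs G}) (subspace_on ?A ?Y) \<phi> (torus_orbit G)"
    using orbit_space_chart[OF SG T] .
  then have i: "iso_pair (subspace_on (orbit_space G F) U) (subspace_on ?A ?Y) \<phi> (torus_orbit G)"
    unfolding S(2) op(2) .
  have "n \<le> card ?J" if "irreducible_chain (zar (subspace_on ?A ?Y)) n C" for n C
    by (rule irreducible_chain_length[OF _ _ _ that[unfolded zY], of _ "\<lambda>_. 1"])
      (use finite_arcs IJ in auto)
  moreover have "\<exists>C. irreducible_chain (zar (subspace_on ?A ?Y)) (card ?J) C"
    unfolding zY unfolding Y
    by (rule irreducible_chain_exists[where p = "\<lambda>a\<in>arcs G. 1"])
      (use finite_arcs SG poly_fun_support[OF finite_arcs SG] in \<open>auto simp: prod.neutral subset_eq\<close>)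
  ultimately show "\<exists>A \<phi> \<psi>. iso_pair (subspace_on (orbit_space G F) U) A \<phi> \<psi> \<and>
       (\<forall>n C. irreducible_chain (zar A) n C \<longrightarrow> n \<le> Suc (card (arcs G)) - card (verts G)) \<and>
       (\<exists>C. irreducible_chain (zar (A :: ('b \<Rightarrow> complex) fspace)) (Suc (card (arcs G)) - card (verts G)) C)"
    using i unfolding cJ by blast
qed

section \<open>Harder--Narasimhan recursion for supports\<close>

text \<open>The values lie in any linear order, so that the recursion uses only this property and
  comparisons of slopes. Nothing is prescribed on the empty set.\<close>

definition seesaw :: "'v set \<Rightarrow> ('v set \<Rightarrow> 'o::linorder) \<Rightarrow> bool" where
  "seesaw W s \<longleftrightarrow> (\<forall>A B. A \<subseteq> W \<longrightarrow> B \<subseteq> W \<longrightarrow> A \<noteq> {} \<longrightarrow> B \<noteq> {} \<longrightarrow> A \<inter> B = {} \<longrightarrow>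
     (s A \<le> s (A \<union> B) \<longleftrightarrow> s A \<le> s B) \<and> (s (A \<union> B) \<le> s B \<longleftrightarrow> s A \<le> s B))"

lemma seesawD:
  assumes "seesaw W s" "A \<subseteq> W" "B \<subseteq> W" "A \<noteq> {}" "B \<noteq> {}" "A \<inter> B = {}"
  shows "s A \<le> s (A \<union> B) \<longleftrightarrow> s A \<le> s B" "s (A \<union> B) \<le> s B \<longleftrightarrow> s A \<le> s B"
    "s B \<le> s (A \<union> B) \<longleftrightarrow> s B \<le> s A" "s (A \<union> B) \<le> s A \<longleftrightarrow> s B \<le> s A"
proof -
  have *: "(s A \<le> s (A \<union> B) \<longleftrightarrow> s A \<le> s B) \<and> (s (A \<union> B) \<le> s B \<longleftrightarrow> s A \<le> s B)"
    if "A \<subseteq> W" "B \<subseteq> W" "A \<noteq> {}" "B \<noteq> {}" "A \<inter> B = {}" for A B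
    using assms(1) that unfolding seesaw_def by blast
  show "s A \<le> s (A \<union> B) \<longleftrightarrow> s A \<le> s B" "s (A \<union> B) \<le> s B \<longleftrightarrow> s A \<le> s B"
    using *[OF assms(2-6)] by auto
  have "B \<inter> A = {}" "A \<union> B = B \<union> A" using assms(6) by auto
  then show "s B \<le> s (A \<union> B) \<longleftrightarrow> s B \<le> s A" "s (A \<union> B) \<le> s A \<longleftrightarrow> s B \<le> s A"
    using *[OF assms(3,2,5,4)] by auto
qed

lemma seesaw_le:
  assumes s: "seesaw W s" and "A \<subseteq> W" "B \<subseteq> W" "A \<inter> B = {}" "A \<union> B \<noteq> {}"
    and "A \<noteq> {} \<Longrightarrow> s A \<le> m" "B \<noteq> {} \<Longrightarrow> s B \<le> m"
  shows "s (A \<union> B) \<le> m"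
proof -
  consider "A = {}" | "B = {}" | "A \<noteq> {}" "B \<noteq> {}" by blast
  then show ?thesis
  proof cases
    case 3
    note d = seesawD[OF s assms(2,3) 3 assms(4)]
    show ?thesis using d(2,4) assms(6)[OF 3(1)] assms(7)[OF 3(2)] by (meson le_cases order_trans)
  qed (use assms in auto)
qed

lemma seesaw_eq:
  assumes s: "seesaw W s" and "A \<subseteq> W" "B \<subseteq> W" "A \<noteq> {}" "B \<noteq> {}" "A \<inter> B = {}"
    and "s A \<le> m" "s B \<le> m" "s (A \<union> B) = m"
  shows "s A = m" "s B = m"
proof -
  note d = seesawD[OF assms(1-6)]
  show "s A = m" "s B = m" using d assms(7-9) by (metis antisym linear)+
qed

lemma partition_on_remove1:
  assumes "partition_on V P" "I \<in> P"
  shows "partition_on (V - I) (P - {I})"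
  using assms unfolding partition_on_def disjoint_def by (auto 0 4)

lemma partition_on_insert1:
  assumes "partition_on (V - I) P" "I \<subseteq> V" "I \<noteq> {}"
  shows "partition_on V (insert I P)" "I \<notin> P"
proof -
  have U: "\<Union>P = V - I" and D: "disjoint P" and E: "{} \<notin> P" using assms(1)
    by (auto simp: partition_on_def)
  show "I \<notin> P" using U assms(3) by blast
  have "disjoint (insert I P)"
    unfolding disjoint_def
  proof (intro ballI impI)
    fix A C assume "A \<in> insert I P" "C \<in> insert I P" "A \<noteq> C"
    then show "A \<inter> C = {}" using U D unfolding disjoint_def by blast
  qed
  then show "partition_on V (insert I P)" using U E assms(2,3) by (auto simp: partition_on_def)
qed

text \<open>With \<open>t = q - 1\<close>, each free arrow contributes \<open>1 + t = q\<close>,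
  from its zero and its nonzero values.\<close>

lemma sum_power_card_Pow:
  assumes "finite A"
  shows "(\<Sum>S\<in>Pow A. t ^ card S) = (1 + t :: 'k::comm_semiring_1) ^ card A"
  using assms
proof (induction A rule: finite_induct)
  case (insert a A)
  have "(\<Sum>S\<in>insert a ` Pow A. t ^ card S) = (\<Sum>S\<in>Pow A. t ^ card (insert a S))"
    by (rule sum.reindex_cong[OF _ refl refl]) (use insert in \<open>auto simp: inj_on_def\<close>)
  also have "\<dots> = (\<Sum>S\<in>Pow A. t * t ^ card S)"
  proof (rule sum.cong[OF refl])
    fix S assume "S \<in> Pow A"
    then have "finite S" "a \<notin> S" using insert finite_subset by auto
    then show "t ^ card (insert a S) = t * t ^ card S" by simp
  qed
  also have "\<dots> = t * (1 + t) ^ card A" using insert by (simp flip: sum_distrib_left)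
  finally have "(\<Sum>S\<in>insert a ` Pow A. t ^ card S) = t * (1 + t) ^ card A" .
  moreover have "(\<Sum>S\<in>Pow (insert a A). t ^ card S) =
      (\<Sum>S\<in>Pow A. t ^ card S) + (\<Sum>S\<in>insert a ` Pow A. t ^ card S)"
    unfolding Pow_insert by (rule sum.union_disjoint) (use insert in auto)
  ultimately show ?case using insert by (simp add: distrib_right)
qed simp

context fin_digraph
begin

definition arcs_between :: "'a set \<Rightarrow> 'a set \<Rightarrow> 'b set" where
  "arcs_between I J = {a \<in> arcs G. tail G a \<in> I \<and> head G a \<in> J}"

text \<open>Defined for every subset \<open>I\<close>, with the arrows inside \<open>I\<close> only,
  because the steps of a filtration live on subsets.\<close>

definition semistable_supports :: "('a set \<Rightarrow> 'o::linorder) \<Rightarrow> 'a set \<Rightarrow> 'b set set" where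
  "semistable_supports s I = {S. S \<subseteq> arcs_between I I \<and>
     (\<forall>J\<subseteq>I. J \<noteq> {} \<longrightarrow> closed_under G S J \<longrightarrow> s J \<le> s I)}"

text \<open>Supports that are semistable of slope \<open>m\<close> for \<open>s\<close> and whose Harder--Narasimhan slopes for
  \<open>s'\<close> all lie in \<open>B\<close>.\<close>

definition bounded_supports ::
  "('a set \<Rightarrow> 'o::linorder) \<Rightarrow> ('a set \<Rightarrow> 'o) \<Rightarrow> 'o \<Rightarrow> 'o set \<Rightarrow> 'a set \<Rightarrow> 'b set set" where
  "bounded_supports s s' m B V = {S. S \<subseteq> arcs_between V V \<and>
     (\<forall>J\<subseteq>V. J \<noteq> {} \<longrightarrow> closed_under G S J \<longrightarrow> s J \<le> m \<and> (s J = m \<longrightarrow> s' J \<in> B))}"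

lemma finite_arcs_between: "finite (arcs_between I J)"
  unfolding arcs_between_def using finite_arcs by simp

lemma finite_bounded_supports: "finite (bounded_supports s s' m B V)"
  by (rule finite_subset[of _ "Pow (arcs_between V V)"])
    (auto simp: bounded_supports_def finite_arcs_between)

lemma finite_semistable_supports: "finite (semistable_supports s V)"
  by (rule finite_subset[of _ "Pow (arcs_between V V)"])
    (auto simp: semistable_supports_def finite_arcs_between)

text \<open>With \<open>h = q\<^sup>1\<^sup>/\<^sup>2\<close> and \<open>t = q - 1\<close> this is the normalization of \<open>f\<^sub>Z\<close>, applied to the
  class of the locus of representations with support in \<open>F\<close>.\<close>

definition weight :: "'k::field \<Rightarrow> 'k \<Rightarrow> 'a set \<Rightarrow> 'b set set \<Rightarrow> 'k" where
  "weight h t V F = h powi (int (card V) - int (card (arcs_between V V))) *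
     (\<Sum>S\<in>F. t ^ card S) / t ^ card V"

lemma card_arcs_between_Un:
  assumes "I \<inter> J = {}"
  shows "card (arcs_between (I \<union> J) (I \<union> J)) = card (arcs_between I I) + card (arcs_between J J) +
    (card (arcs_between I J) + card (arcs_between J I))"
proof -
  have "arcs_between (I \<union> J) (I \<union> J) =
      (arcs_between I I \<union> arcs_between J J) \<union> (arcs_between I J \<union> arcs_between J I)"
    by (auto simp: arcs_between_def)
  moreover have "arcs_between I I \<inter> arcs_between J J = {}"
    "arcs_between I J \<inter> arcs_between J I = {}"
    "(arcs_between I I \<union> arcs_between J J) \<inter> (arcs_between I J \<union> arcs_between J I) = {}"
    using assms by (auto simp: arcs_between_def)
  ultimately show ?thesis by (simp add: card_Un_disjoint finite_arcs_between)
qed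

end

text \<open>The combinatorial content of a deformation: \<open>s\<close> and \<open>s'\<close> stand
  for the slopes of \<open>Z\<close> and of its deformation, \<open>m\<close> for the slope of the
  ray.\<close>

locale deformed_slopes = fin_digraph G for G :: "('a, 'b) pre_digraph" +
  fixes s s' :: "'a set \<Rightarrow> 'o::linorder" and m :: 'o
  assumes seesaw_s: "seesaw (verts G) s" and seesaw_s': "seesaw (verts G) s'"
    and s'_inj: "\<And>I J. I \<subseteq> verts G \<Longrightarrow> J \<subseteq> verts G \<Longrightarrow> I \<noteq> {} \<Longrightarrow> J \<noteq> {} \<Longrightarrow>
       s' I = s' J \<Longrightarrow> I = J"
    and s'_refines: "\<And>I J. I \<subseteq> verts G \<Longrightarrow> J \<subseteq> verts G \<Longrightarrow> I \<noteq> {} \<Longrightarrow> J \<noteq> {} \<Longrightarrow>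
       s I < s J \<Longrightarrow> s' I < s' J"
begin

abbreviation "X \<equiv> bounded_supports s s' m"

text \<open>The first step of the Harder--Narasimhan filtration for \<open>s'\<close>. As
  \<open>s'\<close> separates nonempty sets, maximal slope alone determines it. Only sets with
  \<open>s J = m\<close> compete: for a support semistable of slope \<open>m\<close>, the others
  have smaller \<open>s'\<close> by refinement.\<close>

definition max_destabilizing :: "'a set \<Rightarrow> 'b set \<Rightarrow> 'a set \<Rightarrow> bool" where
  "max_destabilizing V S I \<longleftrightarrow> I \<subseteq> V \<and> I \<noteq> {} \<and> closed_under G S I \<and> s I = m \<and>
     (\<forall>J\<subseteq>V. J \<noteq> {} \<longrightarrow> closed_under G S J \<longrightarrow> s J = m \<longrightarrow> s' J \<le> s' I)"

lemma max_destabilizing_exists: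
  assumes V: "V \<subseteq> verts G" "V \<noteq> {}" "s V = m" and S: "S \<subseteq> arcs_between V V"
  shows "\<exists>I. max_destabilizing V S I"
proof -
  let ?C = "{J. J \<subseteq> V \<and> J \<noteq> {} \<and> closed_under G S J \<and> s J = m}"
  have fin: "finite (s' ` ?C)"
    using finite_subset[OF V(1) finite_verts] by (intro finite_imageI) simp
  have "closed_under G S V" using S by (auto simp: closed_under_def arcs_between_def)
  then have ne: "s' ` ?C \<noteq> {}" using V by auto
  obtain I where I: "I \<in> ?C" "Max (s' ` ?C) = s' I"
    using Max_in[OF fin ne] by (elim imageE)
  have "s' J \<le> s' I" if "J \<in> ?C" for J using Max_ge[OF fin, of "s' J"] that I(2) by auto
  then show ?thesis using I(1) unfolding max_destabilizing_def by blast
qed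

lemma max_destabilizing_unique:
  assumes V: "V \<subseteq> verts G" and "max_destabilizing V S I" "max_destabilizing V S I'"
  shows "I = I'"
proof -
  have "s' I = s' I'" using assms(2,3) unfolding max_destabilizing_def by (simp add: antisym)
  then show ?thesis
    using s'_inj[of I I'] assms unfolding max_destabilizing_def by blast
qed

text \<open>A subset closed inside \<open>I\<close> is closed in \<open>V\<close>, and so is the
  union of \<open>I\<close> with a subset closed in the quotient. Maximality of \<open>I\<close>
  bounds the slopes of both, the second one through the see-saw property.\<close>

lemma hn_split:
  assumes V: "V \<subseteq> verts G" "s V = m" and S: "S \<in> X B V" and I: "max_destabilizing V S I"
  shows "s' I \<in> B" "S \<inter> arcs_between I I \<in> semistable_supports s' I"
    "S \<inter> arcs_between (V - I) (V - I) \<in> X {..<s' I} (V - I)"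
    "S = (S \<inter> arcs_between I I) \<union> (S \<inter> arcs_between (V - I) (V - I)) \<union> (S \<inter> arcs_between (V - I) I)"
proof -
  have SV: "S \<subseteq> arcs_between V V"
    and SB: "\<And>J. J \<subseteq> V \<Longrightarrow> J \<noteq> {} \<Longrightarrow> closed_under G S J \<Longrightarrow> s J \<le> m \<and> (s J = m \<longrightarrow> s' J \<in> B)"
    using S by (auto simp: bounded_supports_def)
  have I': "I \<subseteq> V" "I \<noteq> {}" "closed_under G S I" "s I = m"
    "\<And>J. J \<subseteq> V \<Longrightarrow> J \<noteq> {} \<Longrightarrow> closed_under G S J \<Longrightarrow> s J = m \<Longrightarrow> s' J \<le> s' I"
    using I by (auto simp: max_destabilizing_def)
  show "s' I \<in> B" using SB[OF I'(1-3)] I'(4) by blast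
  show "S \<inter> arcs_between I I \<in> semistable_supports s' I"
    unfolding semistable_supports_def
  proof (intro CollectI conjI allI impI)
    fix J assume J: "J \<subseteq> I" "J \<noteq> {}" and cl: "closed_under G (S \<inter> arcs_between I I) J"
    have c: "closed_under G S J"
      unfolding closed_under_def
    proof (intro ballI impI)
      fix a assume a: "a \<in> S" "tail G a \<in> J"
      then have "head G a \<in> I" using I'(3) J by (auto simp: closed_under_def)
      then have "a \<in> arcs_between I I" using a J SV by (auto simp: arcs_between_def)
      then show "head G a \<in> J" using cl a by (auto simp: closed_under_def)
    qed
    have JV: "J \<subseteq> V" using J I' by blast
    show "s' J \<le> s' I"
    proof (cases "s J = m")
      case True
      then show ?thesis using I'(5)[OF JV J(2) c] by simp
    next
      case False
      then have "s J < s I" using SB[OF JV J(2) c] I'(4) by auto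
      then show ?thesis using s'_refines[of J I] JV V I' J(2) by (auto intro: less_imp_le)
    qed
  qed simp
  show "S \<inter> arcs_between (V - I) (V - I) \<in> X {..<s' I} (V - I)"
    unfolding bounded_supports_def
  proof (rule CollectI, intro conjI allI impI)
    fix J assume J: "J \<subseteq> V - I" "J \<noteq> {}"
      and cl: "closed_under G (S \<inter> arcs_between (V - I) (V - I)) J"
    have c: "closed_under G S (I \<union> J)"
      unfolding closed_under_def
    proof (intro ballI impI)
      fix a assume a: "a \<in> S" "tail G a \<in> I \<union> J"
      show "head G a \<in> I \<union> J"
      proof (cases "tail G a \<in> I \<or> head G a \<in> I")
        case True
        then show ?thesis using I'(3) a(1) by (auto simp: closed_under_def)
      next
        case False
        then have "a \<in> arcs_between (V - I) (V - I)" using a SV by (auto simp: arcs_between_def)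
        then show ?thesis using cl a False by (auto simp: closed_under_def)
      qed
    qed
    have IJ: "I \<union> J \<subseteq> V" "I \<union> J \<noteq> {}" using I' J by auto
    have disj: "I \<inter> J = {}" "I \<subseteq> verts G" "J \<subseteq> verts G" using J I' V by auto
    note d = seesawD[OF seesaw_s disj(2,3) I'(2) J(2) disj(1)]
      and d' = seesawD[OF seesaw_s' disj(2,3) I'(2) J(2) disj(1)]
    show "s J \<le> m" using SB[OF IJ c] d(4) I'(4) by simp
    assume "s J = m"
    then have "s (I \<union> J) = m" using d(1,4) I'(4) by (simp add: antisym)
    then have "s' (I \<union> J) \<le> s' I" using I'(5)[OF IJ c] by simp
    \<comment> \<open>Distinct nonempty sets never have equal slopes, so the remaining slopes are
      strictly below \<open>s' I\<close>.\<close>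
    moreover have "s' (I \<union> J) \<noteq> s' I" 
    proof
      have "I \<union> J \<noteq> I" "I \<union> J \<subseteq> verts G" using disj J(2) by auto
      moreover assume "s' (I \<union> J) = s' I"
      ultimately show False using s'_inj[of "I \<union> J" I] IJ(2) I'(2) disj(2) by simp
    qed
    ultimately have "s' J < s' I" using d'(1) by (simp add: not_le[symmetric])
    then show "s' J \<in> {..<s' I}" by simp
  qed simp
  show "S = (S \<inter> arcs_between I I) \<union> (S \<inter> arcs_between (V - I) (V - I)) \<union> (S \<inter> arcs_between (V - I) I)"
    using SV I'(3) by (auto simp: arcs_between_def closed_under_def)
qed

text \<open>A closed \<open>J\<close> splits into \<open>J \<inter> I\<close>, closed in
  \<open>I\<close>, and \<open>J - I\<close>, closed in the quotient, and the see-saw property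
  combines their bounds. The arrows of \<open>S3\<close> run from the quotient into \<open>I\<close>
  and may be arbitrary.\<close>

lemma hn_glue:
  assumes V: "V \<subseteq> verts G" and B: "\<forall>y\<in>B. \<forall>x\<le>y. x \<in> B"
    and I: "I \<subseteq> V" "I \<noteq> {}" "s I = m" "s' I \<in> B"
    and S1: "S1 \<in> semistable_supports s' I" and S2: "S2 \<in> X {..<s' I} (V - I)"
    and S3: "S3 \<subseteq> arcs_between (V - I) I"
  shows "S1 \<union> S2 \<union> S3 \<in> X B V" "max_destabilizing V (S1 \<union> S2 \<union> S3) I"
proof -
  let ?S = "S1 \<union> S2 \<union> S3"
  have S1': "S1 \<subseteq> arcs_between I I" "\<And>J. J \<subseteq> I \<Longrightarrow> J \<noteq> {} \<Longrightarrow> closed_under G S1 J \<Longrightarrow> s' J \<le> s' I"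
    using S1 by (auto simp: semistable_supports_def)
  have S2': "S2 \<subseteq> arcs_between (V - I) (V - I)"
    "\<And>J. J \<subseteq> V - I \<Longrightarrow> J \<noteq> {} \<Longrightarrow> closed_under G S2 J \<Longrightarrow> s J \<le> m \<and> (s J = m \<longrightarrow> s' J < s' I)"
    using S2 by (auto simp: bounded_supports_def)
  have *: "s J \<le> m \<and> (s J = m \<longrightarrow> s' J \<le> s' I)"
    if J: "J \<subseteq> V" "J \<noteq> {}" and c: "closed_under G ?S J" for J
  proof -
    let ?K = "J \<inter> I" and ?L = "J - I"
    have KL: "J = ?K \<union> ?L" "?K \<inter> ?L = {}" "?K \<subseteq> verts G" "?L \<subseteq> verts G" using J V by auto
    have "closed_under G S1 ?K" using c S1'(1) by (auto simp: closed_under_def arcs_between_def)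
    then have K: "s' ?K \<le> s' I" if "?K \<noteq> {}" using S1'(2)[of ?K] that by blast
    \<comment> \<open>A larger \<open>s\<close> would by refinement give \<open>?K\<close> a larger
      \<open>s'\<close> than \<open>I\<close> has.\<close>
    have Km: "s ?K \<le> m" if "?K \<noteq> {}"
    proof (rule ccontr)
      assume "\<not> s ?K \<le> m"
      then have "s' I < s' ?K"
        using s'_refines[OF _ KL(3) I(2) that] order.trans[OF I(1) V] I(3) by (simp add: not_le)
      then show False using K[OF that] by simp
    qed
    have "closed_under G S2 ?L" using c S2'(1) by (auto simp: closed_under_def arcs_between_def)
    then have L: "s ?L \<le> m \<and> (s ?L = m \<longrightarrow> s' ?L < s' I)" if "?L \<noteq> {}"
      using S2'(2)[of ?L] that J by blast
    have le: "s J \<le> m"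
      using seesaw_le[OF seesaw_s KL(3,4,2), of m] Km L J(2) KL(1) by auto
    moreover have "s' J \<le> s' I" if eq: "s J = m"
    proof -
      have "s' ?L \<le> s' I" if ne: "?L \<noteq> {}"
      proof (cases "?K = {}")
        case True
        then have "?L = J" by blast
        then show ?thesis using L[OF ne] eq by auto
      next
        case False
        have "s (?K \<union> ?L) = m" using eq KL(1) by simp
        from seesaw_eq(2)[OF seesaw_s KL(3,4) False ne KL(2) _ _ this] Km[OF False] L[OF ne]
        show ?thesis by auto
      qed
      then show ?thesis
        using seesaw_le[OF seesaw_s' KL(3,4,2), of "s' I"] K J(2) KL(1) by auto
    qed
    ultimately show ?thesis by blast
  qed
  have sub: "?S \<subseteq> arcs_between V V" using S1'(1) S2'(1) S3 I(1) by (auto simp: arcs_between_def)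
  show "?S \<in> X B V"
    unfolding bounded_supports_def using * sub B I(4) by blast
  have "closed_under G ?S I" using S1'(1) S2'(1) S3
    by (auto simp: closed_under_def arcs_between_def)
  then show "max_destabilizing V ?S I"
    unfolding max_destabilizing_def using * I by blast
qed

text \<open>\<open>B\<close> is a lower segment of slopes: everything at the start, and
  \<open>{..<s' I}\<close> once \<open>I\<close> has been split off. This builds the decreasing
  order of the slopes into the recursion.\<close>

lemma hn_bij:
  assumes V: "V \<subseteq> verts G" "V \<noteq> {}" "s V = m" and B: "\<forall>y\<in>B. \<forall>x\<le>y. x \<in> B"
  shows "bij_betw (\<lambda>(I, S1, S2, S3). S1 \<union> S2 \<union> S3)
     (SIGMA I:{I. I \<subseteq> V \<and> I \<noteq> {} \<and> s I = m \<and> s' I \<in> B}.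
        semistable_supports s' I \<times> X {..<s' I} (V - I) \<times> Pow (arcs_between (V - I) I)) (X B V)"
    (is "bij_betw ?f ?D _")
proof -
  define g where "g = (\<lambda>S. let I = (THE I. max_destabilizing V S I) in
    (I, S \<inter> arcs_between I I, S \<inter> arcs_between (V - I) (V - I), S \<inter> arcs_between (V - I) I))"
  have the: "(THE I. max_destabilizing V S I) = I" if "max_destabilizing V S I" for S I
    by (rule the_equality[where P = "max_destabilizing V S"], rule that,
        rule max_destabilizing_unique[OF V(1) _ that])
  show ?thesis
  proof (rule bij_betw_byWitness[where f' = g])
    show "\<forall>d\<in>?D. g (?f d) = d"
    proof clarsimp
      fix I S1 S2 S3
      assume I: "I \<subseteq> V" "I \<noteq> {}" "m = s I" "s' I \<in> B" and S1: "S1 \<in> semistable_supports s' I"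
        and S2: "S2 \<in> bounded_supports s s' (s I) {..<s' I} (V - I)"
        and S3: "S3 \<subseteq> arcs_between (V - I) I"
      have I': "max_destabilizing V (S1 \<union> S2 \<union> S3) I"
        using hn_glue(2)[OF V(1) B I(1,2) _ I(4) S1 _ S3] S2 I(3) by simp
      have "S1 \<subseteq> arcs_between I I" "S2 \<subseteq> arcs_between (V - I) (V - I)"
        using S1 S2 by (auto simp: semistable_supports_def bounded_supports_def)
      then have "(S1 \<union> S2 \<union> S3) \<inter> arcs_between I I = S1"
        "(S1 \<union> S2 \<union> S3) \<inter> arcs_between (V - I) (V - I) = S2"
        "(S1 \<union> S2 \<union> S3) \<inter> arcs_between (V - I) I = S3"
        using S3 by (auto simp: arcs_between_def)
      then show "g (S1 \<union> S2 \<union> S3) = (I, S1, S2, S3)" by (simp add: g_def the[OF I'])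
    qed
    have gS: "?f (g S) = S \<and> g S \<in> ?D" if S: "S \<in> X B V" for S
    proof -
      have "S \<subseteq> arcs_between V V" using S by (auto simp: bounded_supports_def)
      then obtain I where I: "max_destabilizing V S I" using max_destabilizing_exists[OF V] by blast
      note h = hn_split[OF V(1,3) S I]
      have "I \<subseteq> V" "I \<noteq> {}" "s I = m" using I by (auto simp: max_destabilizing_def)
      then show ?thesis using h by (auto simp: g_def the[OF I])
    qed
    show "\<forall>S\<in>X B V. ?f (g S) = S" by (intro ballI, rule gS[THEN conjunct1])
    show "g ` X B V \<subseteq> ?D" by (rule image_subsetI, rule gS[THEN conjunct2])
    show "?f ` ?D \<subseteq> X B V"
    proof (rule image_subsetI)
      fix d assume dD: "d \<in> ?D"
      obtain I S1 S2 S3 where d: "d = (I, S1, S2, S3)" by (metis surj_pair)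
      have I: "I \<subseteq> V" "I \<noteq> {}" "s I = m" "s' I \<in> B"
        and S: "S1 \<in> semistable_supports s' I" "S2 \<in> X {..<s' I} (V - I)"
          "S3 \<subseteq> arcs_between (V - I) I" using dD unfolding d by auto
      show "?f d \<in> X B V" using hn_glue(1)[OF V(1) B I S] d by simp
    qed
  qed
qed

lemma hn_sum:
  fixes t :: "'k::field"
  assumes V: "V \<subseteq> verts G" "V \<noteq> {}" "s V = m" and B: "\<forall>y\<in>B. \<forall>x\<le>y. x \<in> B"
  shows "(\<Sum>S\<in>X B V. t ^ card S) =
    (\<Sum>I | I \<subseteq> V \<and> I \<noteq> {} \<and> s I = m \<and> s' I \<in> B.
      (\<Sum>S\<in>semistable_supports s' I. t ^ card S) * (\<Sum>S\<in>X {..<s' I} (V - I). t ^ card S) *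
      (1 + t) ^ card (arcs_between (V - I) I))"
proof -
  let ?Idx = "{I. I \<subseteq> V \<and> I \<noteq> {} \<and> s I = m \<and> s' I \<in> B}"
  let ?P = "\<lambda>I. semistable_supports s' I \<times> X {..<s' I} (V - I) \<times> Pow (arcs_between (V - I) I)"
  have finI: "finite ?Idx" using finite_subset[OF V(1) finite_verts] by simp
  have finP: "finite (?P I)" for I
    by (simp add: finite_semistable_supports finite_bounded_supports finite_arcs_between)
  have "(\<Sum>S\<in>X B V. t ^ card S) = (\<Sum>d\<in>Sigma ?Idx ?P. t ^ card ((\<lambda>(I, S1, S2, S3). S1 \<union> S2 \<union> S3) d))"
    by (rule sum.reindex_bij_betw[OF hn_bij[OF V B], symmetric])
  also have "\<dots> = (\<Sum>d\<in>Sigma ?Idx ?P. (\<lambda>(I, S1, S2, S3). t ^ card S1 * t ^ card S2 * t ^ card S3) d)"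
  proof (rule sum.cong[OF refl])
    fix d assume "d \<in> Sigma ?Idx ?P"
    then obtain I S1 S2 S3 where d: "d = (I, S1, S2, S3)" and I: "I \<subseteq> V"
      and S: "S1 \<subseteq> arcs_between I I" "S2 \<subseteq> arcs_between (V - I) (V - I)"
          "S3 \<subseteq> arcs_between (V - I) I"
      by (auto simp: semistable_supports_def bounded_supports_def)
    have fin: "finite S1" "finite S2" "finite S3"
      using S finite_arcs_between finite_subset by blast+
    have "S1 \<inter> S2 = {}" "(S1 \<union> S2) \<inter> S3 = {}" using S by (auto simp: arcs_between_def)
    then have "card (S1 \<union> S2 \<union> S3) = card S1 + card S2 + card S3"
      using fin by (simp add: card_Un_disjoint)
    then show "t ^ card ((\<lambda>(I, S1, S2, S3). S1 \<union> S2 \<union> S3) d) =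
        (\<lambda>(I, S1, S2, S3). t ^ card S1 * t ^ card S2 * t ^ card S3) d"
      by (simp add: d power_add)
  qed
  also have "\<dots> = (\<Sum>I\<in>?Idx. \<Sum>(S1, S2, S3)\<in>?P I. t ^ card S1 * t ^ card S2 * t ^ card S3)"
    using finI finP by (subst sum.Sigma) auto
  also have "\<dots> = (\<Sum>I\<in>?Idx. (\<Sum>S\<in>semistable_supports s' I. t ^ card S) *
      (\<Sum>S\<in>X {..<s' I} (V - I). t ^ card S) * (1 + t) ^ card (arcs_between (V - I) I))"
  proof (rule sum.cong[OF refl])
    fix I
    have "(\<Sum>(S1, S2, S3)\<in>?P I. t ^ card S1 * t ^ card S2 * t ^ card S3) =
      (\<Sum>S1\<in>semistable_supports s' I. \<Sum>S2\<in>X {..<s' I} (V - I).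
         \<Sum>S3\<in>Pow (arcs_between (V - I) I). t ^ card S1 * t ^ card S2 * t ^ card S3)"
      by (simp add: sum.cartesian_product case_prod_unfold)
    also have "\<dots> = (\<Sum>S1\<in>semistable_supports s' I. t ^ card S1 * (\<Sum>S2\<in>X {..<s' I} (V - I).
         t ^ card S2 * (\<Sum>S3\<in>Pow (arcs_between (V - I) I). t ^ card S3)))"
      by (simp add: sum_distrib_left mult.assoc)
    also have "\<dots> = (\<Sum>S\<in>semistable_supports s' I. t ^ card S) *
      (\<Sum>S\<in>X {..<s' I} (V - I). t ^ card S) * (\<Sum>S\<in>Pow (arcs_between (V - I) I). t ^ card S)"
      by (simp add: mult.assoc flip: sum_distrib_right)
    finally show "(\<Sum>(S1, S2, S3)\<in>?P I. t ^ card S1 * t ^ card S2 * t ^ card S3) =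
      (\<Sum>S\<in>semistable_supports s' I. t ^ card S) *
      (\<Sum>S\<in>X {..<s' I} (V - I). t ^ card S) * (1 + t) ^ card (arcs_between (V - I) I)"
      by (simp only: sum_power_card_Pow[OF finite_arcs_between])
  qed
  finally show ?thesis .
qed

text \<open>Makes the vanishing of the skew form, known where \<open>s\<close>-semistable supports
  exist, available for blocks that are semistable for \<open>s'\<close>.\<close>

lemma semistable_supports_refine:
  assumes "I \<subseteq> verts G"
  shows "semistable_supports s' I \<subseteq> semistable_supports s I"
proof
  fix S assume S: "S \<in> semistable_supports s' I"
  show "S \<in> semistable_supports s I"
    unfolding semistable_supports_def
  proof (intro CollectI conjI allI impI)
    show "S \<subseteq> arcs_between I I" using S by (simp add: semistable_supports_def)
    fix J assume J: "J \<subseteq> I" "J \<noteq> {}" "closed_under G S J"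
    then have "s' J \<le> s' I" using S by (simp add: semistable_supports_def)
    then show "s J \<le> s I" using s'_refines[of I J] assms J by (force simp: not_less[symmetric])
  qed
qed

text \<open>The vanishing of the skew form on the ray, expressed by arrow counts between disjoint
  vertex sets; a nonempty family of supports stands for a nonzero \<open>f\<close>.\<close>

definition commuting :: bool where
  "commuting \<longleftrightarrow> (\<forall>I J. I \<subseteq> verts G \<longrightarrow> J \<subseteq> verts G \<longrightarrow> I \<noteq> {} \<longrightarrow> J \<noteq> {} \<longrightarrow> I \<inter> J = {} \<longrightarrow>
     s I = m \<longrightarrow> s J = m \<longrightarrow> semistable_supports s I \<noteq> {} \<longrightarrow> semistable_supports s J \<noteq> {} \<longrightarrow>
     card (arcs_between I J) = card (arcs_between J I))"

lemma slope_complement: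
  assumes "V \<subseteq> verts G" "s V = m" "I \<subseteq> V" "I \<noteq> {}" "s I = m" "V - I \<noteq> {}"
  shows "s (V - I) = m"
proof -
  have eq: "I \<union> (V - I) = V" and sub: "I \<subseteq> verts G" "V - I \<subseteq> verts G" using assms by auto
  show ?thesis
    using seesawD(1,4)[OF seesaw_s sub assms(4,6) Diff_disjoint] assms(2,5) unfolding eq by simp
qed

text \<open>The exponent of \<open>h\<close> for \<open>V\<close> falls short of the sum of those
  for \<open>I\<close> and \<open>V - I\<close> by the number of arrows between the two, which is
  twice the number of arrows from \<open>V - I\<close> to \<open>I\<close>. Each of the latter
  contributes a factor \<open>1 + t\<close>, which is \<open>h ^ 2\<close>.\<close>

lemma weight_hn:
  fixes h t :: "'k::field"
  assumes ht: "h \<noteq> 0" "t \<noteq> 0" "h ^ 2 = 1 + t" and comm: commuting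
    and V: "V \<subseteq> verts G" "V \<noteq> {}" "s V = m" and B: "\<forall>y\<in>B. \<forall>x\<le>y. x \<in> B"
  shows "weight h t V (X B V) = (\<Sum>I | I \<subseteq> V \<and> I \<noteq> {} \<and> s I = m \<and> s' I \<in> B.
     weight h t I (semistable_supports s' I) * weight h t (V - I) (X {..<s' I} (V - I)))"
proof -
  let ?Idx = "{I. I \<subseteq> V \<and> I \<noteq> {} \<and> s I = m \<and> s' I \<in> B}"
  have "weight h t V (X B V) = h powi (int (card V) - int (card (arcs_between V V))) *
    (\<Sum>I\<in>?Idx. (\<Sum>S\<in>semistable_supports s' I. t ^ card S) * (\<Sum>S\<in>X {..<s' I} (V - I). t ^ card S) *
      (1 + t) ^ card (arcs_between (V - I) I)) / t ^ card V"
    by (simp only: weight_def hn_sum[OF V B])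
  also have "\<dots> = (\<Sum>I\<in>?Idx. h powi (int (card V) - int (card (arcs_between V V))) *
    ((\<Sum>S\<in>semistable_supports s' I. t ^ card S) * (\<Sum>S\<in>X {..<s' I} (V - I). t ^ card S) *
      (1 + t) ^ card (arcs_between (V - I) I)) / t ^ card V)"
    by (subst sum_distrib_left, subst sum_divide_distrib, rule refl)
  also have "\<dots> = (\<Sum>I\<in>?Idx. weight h t I (semistable_supports s' I) *
      weight h t (V - I) (X {..<s' I} (V - I)))"
  proof (rule sum.cong[OF refl])
    fix I assume "I \<in> ?Idx"
    then have I: "I \<subseteq> V" "I \<noteq> {}" "s I = m" by auto
    let ?J = "V - I"
    let ?e = "\<lambda>A B. card (arcs_between A B)"
    let ?x = "\<Sum>S\<in>semistable_supports s' I. t ^ card S" and ?y = "\<Sum>S\<in>X {..<s' I} ?J. t ^ card S"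
    have VIJ: "I \<union> ?J = V" "I \<inter> ?J = {}" using I by auto
    have finV: "finite V" using finite_subset[OF V(1) finite_verts] .
    have cV: "card V = card I + card ?J"
      using card_Un_disjoint[OF finite_subset[OF I(1) finV] finite_Diff[OF finV] VIJ(2)] VIJ(1)
        by simp
    have eV: "?e V V = ?e I I + ?e ?J ?J + (?e I ?J + ?e ?J I)"
      using card_arcs_between_Un[OF VIJ(2)] VIJ(1) by simp
    show "h powi (int (card V) - int (?e V V)) * (?x * ?y * (1 + t) ^ ?e ?J I) / t ^ card V =
      weight h t I (semistable_supports s' I) * weight h t ?J (X {..<s' I} ?J)"
    \<comment> \<open>Where one of the families is empty the arrow counts need not balance, but both
      sides are zero.\<close>
    proof (cases "semistable_supports s' I = {} \<or> X {..<s' I} ?J = {}")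
      case True
      then show ?thesis by (auto simp: weight_def)
    next
      case False
      have eq: "?e I ?J = ?e ?J I"
      proof (cases "?J = {}")
        case True
        show ?thesis unfolding True by (simp add: arcs_between_def)
      next
        case ne: False
        have sJ: "s ?J = m" by (rule slope_complement[OF V(1,3) I ne])
        have "semistable_supports s I \<noteq> {}" using False semistable_supports_refine[of I] I V
          by blast
        moreover have "X {..<s' I} ?J \<subseteq> semistable_supports s ?J"
          using sJ by (auto simp: bounded_supports_def semistable_supports_def)
        ultimately show ?thesis
          using comm[unfolded commuting_def, rule_format, of I ?J] False I ne sJ V by blast
      qed
      have "(1 + t) ^ ?e ?J I = h powi (2 * int (?e ?J I))"
        unfolding ht(3)[symmetric]
          by (simp add: power_int_def flip: power_mult) (simp add: nat_mult_distrib)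
      then have "h powi (int (card V) - int (?e V V)) * (1 + t) ^ ?e ?J I =
          h powi ((int (card V) - int (?e V V)) + 2 * int (?e ?J I))"
        using ht(1) by (simp add: power_int_add)
      also have "(int (card V) - int (?e V V)) + 2 * int (?e ?J I) =
          (int (card I) - int (?e I I)) + (int (card ?J) - int (?e ?J ?J))"
        unfolding cV eV using eq by simp
      also have "h powi \<dots> = h powi (int (card I) - int (?e I I)) * h powi (int (card ?J) - int (?e ?J ?J))"
        using ht(1) by (simp add: power_int_add)
      finally have p: "h powi (int (card V) - int (?e V V)) * (1 + t) ^ ?e ?J I =
          h powi (int (card I) - int (?e I I)) * h powi (int (card ?J) - int (?e ?J ?J))" .
      have "h powi (int (card V) - int (?e V V)) * (?x * ?y * (1 + t) ^ ?e ?J I) / t ^ card V =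
        (h powi (int (card V) - int (?e V V)) * (1 + t) ^ ?e ?J I) * ?x * ?y / t ^ card V"
        by (simp add: ac_simps)
      also have "\<dots> = weight h t I (semistable_supports s' I) * weight h t ?J (X {..<s' I} ?J)"
        by (simp only: p) (simp add: cV weight_def power_add)
      finally show ?thesis .
    qed
  qed
  finally show ?thesis .
qed

section \<open>Sums over set partitions\<close>

definition slope_partitions :: "'o set \<Rightarrow> 'a set \<Rightarrow> 'a set set set" where
  "slope_partitions B V = {P. partition_on V P \<and> (\<forall>I\<in>P. s I = m \<and> s' I \<in> B)}"

text \<open>A partition is its block of largest \<open>s'\<close>, unique as slopes are distinct,
  together with a partition of the rest into blocks of smaller slope. This is the shape of the
  recursion in \<open>weight_hn\<close>.\<close>

lemma slope_partitions_bij: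
  assumes V: "V \<subseteq> verts G" "V \<noteq> {}" and B: "\<forall>y\<in>B. \<forall>x\<le>y. x \<in> B"
  shows "bij_betw (\<lambda>(I, P). insert I P)
    (SIGMA I:{I. I \<subseteq> V \<and> I \<noteq> {} \<and> s I = m \<and> s' I \<in> B}. slope_partitions {..<s' I} (V - I))
    (slope_partitions B V)" (is "bij_betw ?f ?D _")
proof -
  have finV: "finite V" using finite_subset[OF V(1) finite_verts] .
  have inj: "I = I'" if "I \<in> insert I' P'" "I' \<in> insert I P" "\<forall>K\<in>P. s' K < s' I"
    "\<forall>K\<in>P'. s' K < s' I'"
    for I I' P P' using that by (metis insertE less_asym)
  show ?thesis
    unfolding bij_betw_def
  proof
    show "inj_on ?f ?D"
    proof (rule inj_onI)
      fix d d' assume "d \<in> ?D" "d' \<in> ?D" and eq: "?f d = ?f d'"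
      then obtain I P I' P' where d: "d = (I, P)" "d' = (I', P')"
        and I: "I \<subseteq> V" "I \<noteq> {}" and P: "P \<in> slope_partitions {..<s' I} (V - I)"
        and I': "I' \<subseteq> V" "I' \<noteq> {}" and P': "P' \<in> slope_partitions {..<s' I'} (V - I')" by blast
      have eq': "insert I P = insert I' P'" using eq d by simp
      have "I = I'" using inj[of I I' P' P] eq' P P' by (auto simp: slope_partitions_def)
      moreover have "I \<notin> P" "I' \<notin> P'"
        using partition_on_insert1(2)[OF _ I, of P] partition_on_insert1(2)[OF _ I', of P'] P P'
        by (auto simp: slope_partitions_def)
      ultimately have "P = P'" using eq' by (metis insert_ident)
      then show "d = d'" using \<open>I = I'\<close> d by simp
    qed
    show "?f ` ?D = slope_partitions B V"
    proof
      show "?f ` ?D \<subseteq> slope_partitions B V"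
      proof (rule image_subsetI)
        fix d assume "d \<in> ?D"
        then obtain I P where d: "d = (I, P)" and I: "I \<subseteq> V" "I \<noteq> {}" "s I = m" "s' I \<in> B"
          and P: "P \<in> slope_partitions {..<s' I} (V - I)" by blast
        have part: "partition_on (V - I) P" and K: "\<forall>K\<in>P. s K = m \<and> s' K < s' I"
          using P by (auto simp: slope_partitions_def)
        have "\<forall>K\<in>insert I P. s K = m \<and> s' K \<in> B" using K B I(3,4) by auto
        then show "?f d \<in> slope_partitions B V"
          using partition_on_insert1(1)[OF part I(1,2)] d by (simp add: slope_partitions_def)
      qed
      show "slope_partitions B V \<subseteq> ?f ` ?D"
      proof
        fix P assume P: "P \<in> slope_partitions B V"
        then have part: "partition_on V P" by (simp add: slope_partitions_def)
        have fin: "finite (s' ` P)" using finite_elements[OF finV part] by simp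
        have ne: "s' ` P \<noteq> {}" using part V(2) by (auto simp: partition_on_def)
        obtain I where I: "I \<in> P" "s' I = Max (s' ` P)" using Max_in[OF fin ne] by auto
        have sub: "K \<subseteq> V" "K \<noteq> {}" if "K \<in> P" for K using part that by (auto simp: partition_on_def)
        have "s' K < s' I" if K: "K \<in> P - {I}" for K
        proof -
          have "s' K \<le> s' I" using Max_ge[OF fin, of "s' K"] K I(2) by auto
          moreover have "s' K \<noteq> s' I" using s'_inj[of K I] sub[of K] sub[OF I(1)] K V by auto
          ultimately show ?thesis by simp
        qed
        then have "P - {I} \<in> slope_partitions {..<s' I} (V - I)"
          using partition_on_remove1[OF part I(1)] P by (auto simp: slope_partitions_def)
        moreover have "I \<in> {I. I \<subseteq> V \<and> I \<noteq> {} \<and> s I = m \<and> s' I \<in> B}"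
          using sub[OF I(1)] P I(1) by (auto simp: slope_partitions_def)
        moreover have "P = ?f (I, P - {I})" using I(1) by auto
        ultimately show "P \<in> ?f ` ?D" by blast
      qed
    qed
  qed
qed

text \<open>Both sides satisfy the same recursion, by \<open>weight_hn\<close> and
  \<open>slope_partitions_bij\<close>.\<close>

lemma weight_bounded_partitions:
  fixes h t :: "'k::field"
  assumes ht: "h \<noteq> 0" "t \<noteq> 0" "h ^ 2 = 1 + t" and comm: commuting
    and V: "V \<subseteq> verts G" "V \<noteq> {} \<longrightarrow> s V = m" and B: "\<forall>y\<in>B. \<forall>x\<le>y. x \<in> B"
  shows "weight h t V (X B V) =
    (\<Sum>P\<in>slope_partitions B V. \<Prod>I\<in>P. weight h t I (semistable_supports s' I))"
  using V B
proof (induction "card V" arbitrary: V B rule: less_induct)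
  case less
  let ?w = "\<lambda>I. weight h t I (semistable_supports s' I)"
  have finV: "finite V" using finite_subset[OF less.prems(1) finite_verts] .
  have finP: "finite (slope_partitions B V)" if "finite V" for B V
    by (rule finite_subset[OF _ finitely_many_partition_on[OF that]]) (auto simp: slope_partitions_def)
  show ?case
  proof (cases "V = {}")
    case True
    \<comment> \<open>The base: one empty support of weight 1, and one empty partition with product
      1.\<close>
    have "X B {} = {{}}" by (auto simp: bounded_supports_def arcs_between_def)
    moreover have "slope_partitions B {} = {{}}"
      by (auto simp: slope_partitions_def partition_on_def disjoint_def)
    ultimately show ?thesis using True by (simp add: weight_def arcs_between_def)
  next
    case False
    then have sV: "s V = m" using less.prems(2) by blast
    let ?Idx = "{I. I \<subseteq> V \<and> I \<noteq> {} \<and> s I = m \<and> s' I \<in> B}"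
    have "weight h t V (X B V) = (\<Sum>I\<in>?Idx. ?w I * weight h t (V - I) (X {..<s' I} (V - I)))"
      by (rule weight_hn[OF ht comm less.prems(1) False sV less.prems(3)])
    also have "\<dots> = (\<Sum>I\<in>?Idx. ?w I * (\<Sum>P\<in>slope_partitions {..<s' I} (V - I). \<Prod>K\<in>P. ?w K))"
    proof (rule sum.cong[OF refl])
      fix I assume "I \<in> ?Idx"
      then have I: "I \<subseteq> V" "I \<noteq> {}" "s I = m" by auto
      have "V - I \<subset> V" using I by blast
      then have "card (V - I) < card V" by (rule psubset_card_mono[OF finV])
      moreover have "V - I \<noteq> {} \<longrightarrow> s (V - I) = m"
        using slope_complement[OF less.prems(1) sV I] by blast
      ultimately have "weight h t (V - I) (X {..<s' I} (V - I)) =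
          (\<Sum>P\<in>slope_partitions {..<s' I} (V - I). \<Prod>K\<in>P. ?w K)"
        using less.prems(1) by (intro less.hyps) auto
      then show "?w I * weight h t (V - I) (X {..<s' I} (V - I)) =
        ?w I * (\<Sum>P\<in>slope_partitions {..<s' I} (V - I). \<Prod>K\<in>P. ?w K)" by simp
    qed
    also have "\<dots> = (\<Sum>(I, P)\<in>(SIGMA I:?Idx. slope_partitions {..<s' I} (V - I)). \<Prod>K\<in>insert I P. ?w K)"
    proof -
      have "?w I * (\<Sum>P\<in>slope_partitions {..<s' I} (V - I). \<Prod>K\<in>P. ?w K) =
          (\<Sum>P\<in>slope_partitions {..<s' I} (V - I). \<Prod>K\<in>insert I P. ?w K)" if I: "I \<in> ?Idx" for I
        unfolding sum_distrib_left
      proof (rule sum.cong[OF refl])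
        fix P assume "P \<in> slope_partitions {..<s' I} (V - I)"
        then have part: "partition_on (V - I) P" by (simp add: slope_partitions_def)
        then show "?w I * (\<Prod>K\<in>P. ?w K) = (\<Prod>K\<in>insert I P. ?w K)"
          using partition_on_insert1(2)[OF part] finite_elements[OF _ part] finV I by simp
      qed
      then show ?thesis using finV finP by (simp add: sum.Sigma)
    qed
    also have "\<dots> = (\<Sum>P\<in>slope_partitions B V. \<Prod>K\<in>P. ?w K)"
      using sum.reindex_bij_betw[OF slope_partitions_bij[OF less.prems(1) False less.prems(3)],
          of "\<lambda>P. \<Prod>K\<in>P. ?w K"] by (simp add: case_prod_unfold)
    finally show ?thesis .
  qed
qed

theorem weight_semistable_partitions:
  fixes h t :: "'k::field"
  assumes ht: "h \<noteq> 0" "t \<noteq> 0" "h ^ 2 = 1 + t" and comm: commuting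
    and V: "V \<subseteq> verts G" "s V = m"
  shows "weight h t V (semistable_supports s V) =
    (\<Sum>P | partition_on V P \<and> (\<forall>I\<in>P. s I = m). \<Prod>I\<in>P. weight h t I (semistable_supports s' I))"
proof -
  have "X UNIV V = semistable_supports s V"
    using V(2) by (auto simp: bounded_supports_def semistable_supports_def)
  moreover have "slope_partitions UNIV V = {P. partition_on V P \<and> (\<forall>I\<in>P. s I = m)}"
    by (auto simp: slope_partitions_def)
  ultimately show ?thesis using weight_bounded_partitions[OF ht comm V(1), of UNIV] V(2) by simp
qed

end

section \<open>The exponential formula\<close>

definition dim_of :: "('w \<Rightarrow> 'v) \<Rightarrow> 'w set \<Rightarrow> ('v \<Rightarrow>\<^sub>0 nat)" where
  "dim_of c I = (\<Sum>w\<in>I. Poly_Mapping.single (c w) 1)"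

lemma dim_of_empty [simp]: "dim_of c {} = 0"
  by (simp add: dim_of_def)

lemma dim_of_insert: "finite I \<Longrightarrow> w \<notin> I \<Longrightarrow> dim_of c (insert w I) = Poly_Mapping.single (c w) 1 + dim_of c I"
  by (simp add: dim_of_def)

lemma dim_of_diff: "finite I \<Longrightarrow> J \<subseteq> I \<Longrightarrow> dim_of c J + dim_of c (I - J) = dim_of c I"
  unfolding dim_of_def by (metis add.commute sum.subset_diff)

lemma size_vec_single: "size_vec (Poly_Mapping.single i n) = n"
  by (simp add: size_vec_def)

lemma size_vec_dim_of: "finite I \<Longrightarrow> size_vec (dim_of c I) = card I"
  by (induction I rule: finite_induct) (simp_all add: dim_of_insert size_vec_add size_vec_single)

lemma dim_of_eq_0_iff: "finite I \<Longrightarrow> dim_of c I = 0 \<longleftrightarrow> I = {}"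
  using size_vec_dim_of[of I c] size_vec_eq_0_iff[of "dim_of c I"] by auto

lemma lookup_dim_of: "finite I \<Longrightarrow> Poly_Mapping.lookup (dim_of c I) i = card {w \<in> I. c w = i}"
proof (induction I rule: finite_induct)
  case (insert w I)
  have "{x \<in> insert w I. c x = i} = (if c w = i then insert w {x \<in> I. c x = i} else {x \<in> I. c x = i})"
    by auto
  then show ?case using insert by (simp add: dim_of_insert lookup_add lookup_single when_def)
qed simp

lemma fact_vec_superset:
  assumes "finite A" "Poly_Mapping.keys \<alpha> \<subseteq> A"
  shows "fact_vec \<alpha> = (\<Prod>i\<in>A. fact (Poly_Mapping.lookup \<alpha> i))"
  unfolding fact_vec_def
  by (rule prod.mono_neutral_left) (use assms in \<open>auto simp: in_keys_iff\<close>)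

lemma fact_vec_add_single:
  "fact_vec (Poly_Mapping.single i 1 + \<alpha>) = Suc (Poly_Mapping.lookup \<alpha> i) * fact_vec \<alpha>"
proof -
  let ?A = "insert i (Poly_Mapping.keys \<alpha>)"
  let ?B = "?A - {i}"
  have "Poly_Mapping.keys (Poly_Mapping.single i 1 + \<alpha>) \<subseteq> ?A"
    using keys_add[of "Poly_Mapping.single i 1" \<alpha>] by auto
  then have "fact_vec (Poly_Mapping.single i 1 + \<alpha>) =
      (\<Prod>j\<in>?A. fact (Poly_Mapping.lookup (Poly_Mapping.single i 1 + \<alpha>) j))"
    by (intro fact_vec_superset) auto
  also have "\<dots> = fact (Suc (Poly_Mapping.lookup \<alpha> i)) *
      (\<Prod>j\<in>?B. fact (Poly_Mapping.lookup (Poly_Mapping.single i 1 + \<alpha>) j))"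
    by (subst prod.remove[of ?A i]) (simp_all add: lookup_add)
  also have "(\<Prod>j\<in>?B. fact (Poly_Mapping.lookup (Poly_Mapping.single i 1 + \<alpha>) j)) =
      (\<Prod>j\<in>?B. fact (Poly_Mapping.lookup \<alpha> j))"
    by (rule prod.cong) (auto simp: lookup_add lookup_single when_def)
  also have "fact (Suc (Poly_Mapping.lookup \<alpha> i)) * \<dots> = Suc (Poly_Mapping.lookup \<alpha> i) *
      (fact (Poly_Mapping.lookup \<alpha> i) * (\<Prod>j\<in>?B. fact (Poly_Mapping.lookup \<alpha> j)))"
    by (simp add: algebra_simps)
  also have "fact (Poly_Mapping.lookup \<alpha> i) * (\<Prod>j\<in>?B. fact (Poly_Mapping.lookup \<alpha> j)) = fact_vec \<alpha>"
  proof -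
    have "fact_vec \<alpha> = (\<Prod>j\<in>?A. fact (Poly_Mapping.lookup \<alpha> j))"
      by (rule fact_vec_superset) auto
    then show ?thesis by (subst (asm) prod.remove[of ?A i]) auto
  qed
  finally show ?thesis .
qed

text \<open>The number of subsets with dimension vector \<open>\<beta>\<close> is a product of
  binomial coefficients. In the induction, subsets avoiding \<open>w\<close> account for the share
  \<open>\<gamma>(c w)\<close> and those containing it for the share \<open>\<beta>(c w)\<close> of
  the total \<open>\<beta>(c w) + \<gamma>(c w)\<close>.\<close>

lemma card_subsets_dim_of:
  assumes "finite I" "\<beta> + \<gamma> = dim_of c I"
  shows "card {J. J \<subseteq> I \<and> dim_of c J = \<beta>} * (fact_vec \<beta> * fact_vec \<gamma>) = fact_vec (dim_of c I)"
  using assms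
proof (induction I arbitrary: \<beta> \<gamma> rule: finite_induct)
  case empty
  have "size_vec \<beta> + size_vec \<gamma> = 0" using size_vec_add[of \<beta> \<gamma>] empty by simp
  then have "\<beta> = 0" "\<gamma> = 0" by simp_all
  moreover have "{J. J = {} \<and> dim_of c J = 0} = {{}}" by auto
  ultimately show ?case by (simp add: fact_vec_def)
next
  case (insert w I)
  let ?e = "Poly_Mapping.single (c w) (1::nat)"
  let ?d = "dim_of c I"
  let ?l = "\<lambda>\<alpha>. Poly_Mapping.lookup \<alpha> (c w)"
  have sum: "\<beta> + \<gamma> = ?e + ?d" using insert by (simp add: dim_of_insert)
  have suml: "?l \<beta> + ?l \<gamma> = Suc (?l ?d)"
    using arg_cong[OF sum, of ?l] by (simp add: lookup_add)
  let ?A = "{J. J \<subseteq> I \<and> dim_of c J = \<beta>}" and ?B = "{J. J \<subseteq> I \<and> ?e + dim_of c J = \<beta>}"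
  have finAB: "finite ?A" "finite ?B" using insert(1) by auto
  have le: "?l (dim_of c J) \<le> ?l ?d" if "J \<subseteq> I" for J
    using that insert(1) finite_subset[OF that insert(1)]
    by (simp add: lookup_dim_of) (rule card_mono, auto)
  have dec: "\<exists>\<delta>. \<alpha> = ?e + \<delta>" if "?l \<alpha> \<noteq> 0" for \<alpha>
  proof
    show "\<alpha> = ?e + (\<alpha> - ?e)"
      by (rule poly_mapping_eqI) (use that in \<open>auto simp: lookup_add lookup_minus lookup_single when_def\<close>)
  qed
  have "{J. J \<subseteq> insert w I \<and> dim_of c J = \<beta>} = ?A \<union> insert w ` ?B"
  proof (intro set_eqI iffI)
    fix J assume J: "J \<in> {J. J \<subseteq> insert w I \<and> dim_of c J = \<beta>}"
    show "J \<in> ?A \<union> insert w ` ?B"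
    proof (cases "w \<in> J")
      case True
      then have K: "J = insert w (J - {w})" "J - {w} \<subseteq> I" using J by auto
      then have "dim_of c J = ?e + dim_of c (J - {w})"
        using dim_of_insert[of "J - {w}" w c] finite_subset[OF K(2) insert(1)] by simp
      then have "J - {w} \<in> ?B" using J K(2) by simp
      then show ?thesis using K(1) by blast
    qed (use J in auto)
  next
    fix J assume "J \<in> ?A \<union> insert w ` ?B"
    then consider "J \<in> ?A" | K where "J = insert w K" "K \<in> ?B" by blast
    then show "J \<in> {J. J \<subseteq> insert w I \<and> dim_of c J = \<beta>}"
    proof cases
      case 2
      then have "finite K" "w \<notin> K" using finite_subset[OF _ insert(1)] insert(2) by auto
      then show ?thesis using 2 by (auto simp: dim_of_insert)
    qed auto
  qed
  moreover have "?A \<inter> insert w ` ?B = {}" using insert(2) by auto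
  moreover have "inj_on (insert w) ?B" using insert(2) by (auto simp: inj_on_def)
  ultimately have card: "card {J. J \<subseteq> insert w I \<and> dim_of c J = \<beta>} = card ?A + card ?B"
    using finAB by (simp add: card_Un_disjoint card_image)
  have 1: "card ?A * (fact_vec \<beta> * fact_vec \<gamma>) = ?l \<gamma> * fact_vec ?d"
  proof (cases "?l \<gamma> = 0")
    case True
    have "?A = {}"
    proof (rule equals0I)
      fix J assume "J \<in> ?A"
      then show False using le[of J] suml True by auto
    qed
    then show ?thesis by (simp only: True card.empty mult_zero_left)
  next
    case False
    then obtain \<delta> where \<delta>: "\<gamma> = ?e + \<delta>" using dec by blast
    then have "?e + (\<beta> + \<delta>) = ?e + ?d" using sum by (simp add: ac_simps)
    then have "\<beta> + \<delta> = ?d" by simp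
    from insert.IH[OF this]
    show ?thesis
      using \<delta> fact_vec_add_single[of "c w" \<delta>] by (simp add: lookup_add algebra_simps)
  qed
  have 2: "card ?B * (fact_vec \<beta> * fact_vec \<gamma>) = ?l \<beta> * fact_vec ?d"
  proof (cases "?l \<beta> = 0")
    case True
    have "?B = {}"
    proof (rule equals0I)
      fix J assume "J \<in> ?B"
      then have "?e + dim_of c J = \<beta>" by blast
      then have "?l (?e + dim_of c J) = 0" using True by simp
      then show False by (simp add: lookup_add)
    qed
    then show ?thesis by (simp only: True card.empty mult_zero_left)
  next
    case False
    then obtain \<delta> where \<delta>: "\<beta> = ?e + \<delta>" using dec by blast
    then have "?e + (\<delta> + \<gamma>) = ?e + ?d" using sum by (simp add: ac_simps)
    then have "\<delta> + \<gamma> = ?d" by simp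
    from insert.IH[OF this] have IH: "card {J. J \<subseteq> I \<and> dim_of c J = \<delta>} * (fact_vec \<delta> * fact_vec \<gamma>) = fact_vec ?d" .
    have "?B = {J. J \<subseteq> I \<and> dim_of c J = \<delta>}" using \<delta> by auto
    then show ?thesis
      using IH \<delta> fact_vec_add_single[of "c w" \<delta>] by (simp add: lookup_add algebra_simps)
  qed
  have "fact_vec (dim_of c (insert w I)) = Suc (?l ?d) * fact_vec ?d"
    by (simp only: dim_of_insert[OF insert(1,2)] fact_vec_add_single)
  also have "\<dots> = (?l \<beta> + ?l \<gamma>) * fact_vec ?d" using suml by simp
  finally show ?case using 1 2 card by (simp add: algebra_simps)
qed

lemma scalar_add: "scalar (a + b) = scalar a + scalar b"
  by (rule tensor_add_right)

lemma scalar_mult: "scalar (a * b) = scalar a * scalar b"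
  by (simp add: tensor_mult)

lemma scalar_zero: "scalar 0 = 0"
  by (rule tensor_zero_right)

lemma scalar_sum: "scalar (\<Sum>x\<in>A. f x) = (\<Sum>x\<in>A. scalar (f x))"
  by (rule tensor_sum_right)

lemma scalar_prod: "scalar (\<Prod>x\<in>A. f x) = (\<Prod>x\<in>A. scalar (f x))"
  by (induction A rule: infinite_finite_induct) (simp_all add: tensor_one scalar_mult)

lemma sum_constant_scalar: "finite A \<Longrightarrow> (\<Sum>x\<in>A. v) = scalar (of_nat (card A)) * v"
  by (induction A rule: finite_induct) (simp_all add: scalar_zero scalar_add tensor_one distrib_right)

text \<open>A series \<open>\<Sum>\<^sub>\<beta> a(\<beta>) x\<^sup>\<beta>/\<beta>!\<close> becomes the function \<open>I \<mapsto> a(dim I)\<close> on finite sets labelled by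
  vertices, and the product of series becomes convolution over subsets.\<close>

definition labelled :: "('w \<Rightarrow> 'v) \<Rightarrow> 'v series \<Rightarrow> 'w set \<Rightarrow> motivic_ring" where
  "labelled c F I = scalar (of_nat (fact_vec (dim_of c I))) * F (dim_of c I)"

lemma labelled_series_mult:
  assumes I: "finite I"
  shows "labelled c (series_mult F G) I = (\<Sum>J\<in>Pow I. labelled c F J * labelled c G (I - J))"
proof -
  let ?D = "{(\<beta>, \<gamma>). \<beta> + \<gamma> = dim_of c I}"
  let ?d = "\<lambda>J. (dim_of c J, dim_of c (I - J))"
  let ?h = "\<lambda>(\<beta>, \<gamma>). scalar (of_nat (fact_vec \<beta> * fact_vec \<gamma>)) * (F \<beta> * G \<gamma>)"
  have "(\<Sum>J\<in>Pow I. labelled c F J * labelled c G (I - J)) = (\<Sum>J\<in>Pow I. ?h (?d J))"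
    by (rule sum.cong) (simp_all add: labelled_def scalar_mult ac_simps)
  \<comment> \<open>Subsets are grouped by the dimension vectors of themselves and of their
    complements; \<open>card_subsets_dim_of\<close> gives the size of each group.\<close>
  also have "\<dots> = (\<Sum>p\<in>?D. \<Sum>J\<in>{J \<in> Pow I. ?d J = p}. ?h (?d J))"
    by (rule sum.group[symmetric]) (use I finite_decompositions dim_of_diff[OF I] in auto)
  also have "\<dots> = (\<Sum>p\<in>?D. scalar (of_nat (fact_vec (dim_of c I))) * (case p of (\<beta>, \<gamma>) \<Rightarrow> F \<beta> * G \<gamma>))"
  proof (rule sum.cong[OF refl])
    fix p assume "p \<in> ?D"
    then obtain \<beta> \<gamma> where p: "p = (\<beta>, \<gamma>)" "\<beta> + \<gamma> = dim_of c I" by blast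
    have "{J \<in> Pow I. ?d J = p} = {J. J \<subseteq> I \<and> dim_of c J = \<beta>}"
    proof -
      have "dim_of c (I - J) = \<gamma>" if "J \<subseteq> I" "dim_of c J = \<beta>" for J
        using dim_of_diff[OF I that(1), of c] p(2) that(2) by (metis add_left_cancel)
      then show ?thesis unfolding p(1) by blast
    qed
    moreover have "(\<Sum>J\<in>{J \<in> Pow I. ?d J = p}. ?h (?d J)) = (\<Sum>J\<in>{J \<in> Pow I. ?d J = p}. ?h p)"
      by (rule sum.cong) auto
    moreover have "finite {J \<in> Pow I. ?d J = p}" using I by simp
    ultimately have "(\<Sum>J\<in>{J \<in> Pow I. ?d J = p}. ?h (?d J)) =
        scalar (of_nat (card {J. J \<subseteq> I \<and> dim_of c J = \<beta>})) * ?h p"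
      using sum_constant_scalar[of "{J \<in> Pow I. ?d J = p}"] by simp
    also have "\<dots> = scalar (of_nat (card {J. J \<subseteq> I \<and> dim_of c J = \<beta>} * (fact_vec \<beta> * fact_vec \<gamma>))) * (F \<beta> * G \<gamma>)"
      by (simp add: p scalar_mult mult.assoc)
    also have "\<dots> = scalar (of_nat (fact_vec (dim_of c I))) * (case p of (\<beta>, \<gamma>) \<Rightarrow> F \<beta> * G \<gamma>)"
      unfolding card_subsets_dim_of[OF I p(2)] by (simp add: p)
    finally show "(\<Sum>J\<in>{J \<in> Pow I. ?d J = p}. ?h (?d J)) =
      scalar (of_nat (fact_vec (dim_of c I))) * (case p of (\<beta>, \<gamma>) \<Rightarrow> F \<beta> * G \<gamma>)" .
  qed
  also have "\<dots> = labelled c (series_mult F G) I"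
    by (simp add: labelled_def series_mult_def sum_distrib_left)
  finally show ?thesis by simp
qed

text \<open>Both sides sum over partitions with a marked block. The terms of the inner sum do not
  depend on \<open>J\<close>, so it is multiplication by \<open>Suc k\<close>, written without
  integers in the ring.\<close>

lemma sum_partitions_choose_block:
  fixes w :: "'w set \<Rightarrow> 'r::{comm_ring, comm_monoid_mult}"
  assumes V: "finite V"
  shows "(\<Sum>J | J \<subseteq> V \<and> J \<noteq> {}. w J * (\<Sum>P | partition_on (V - J) P \<and> card P = k. \<Prod>K\<in>P. w K)) =
    (\<Sum>P | partition_on V P \<and> card P = Suc k. \<Sum>J\<in>P. \<Prod>K\<in>P. w K)"
proof -
  let ?Q = "\<lambda>J. {P. partition_on (V - J) P \<and> card P = k}"
  let ?R = "{P. partition_on V P \<and> card P = Suc k}"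
  have finQ: "finite (?Q J)" for J
    by (rule finite_subset[OF _ finitely_many_partition_on[of "V - J"]]) (use V in auto)
  have finR: "finite ?R"
    by (rule finite_subset[OF _ finitely_many_partition_on[OF V]]) auto
  have finP: "finite P" if "partition_on V P" for P using finite_elements[OF V that] .
  have "(\<Sum>J | J \<subseteq> V \<and> J \<noteq> {}. w J * (\<Sum>P\<in>?Q J. \<Prod>K\<in>P. w K)) =
      (\<Sum>(J, P)\<in>Sigma {J. J \<subseteq> V \<and> J \<noteq> {}} ?Q. w J * (\<Prod>K\<in>P. w K))"
    unfolding sum_distrib_left by (rule sum.Sigma) (use V finQ in auto)
  also have "\<dots> = (\<Sum>(P, J)\<in>Sigma ?R (\<lambda>P. P). \<Prod>K\<in>P. w K)"
  proof (rule sum.reindex_bij_witness[where i = "\<lambda>(P, J). (J, P - {J})"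
    and j = "\<lambda>(J, P). (insert J P, J)"])
    fix d assume "d \<in> Sigma {J. J \<subseteq> V \<and> J \<noteq> {}} ?Q"
    then obtain J P where d: "d = (J, P)" and J: "J \<subseteq> V" "J \<noteq> {}" and P: "partition_on (V - J) P"
      "card P = k"
      by blast
    have i: "partition_on V (insert J P)" "J \<notin> P" using partition_on_insert1[OF P(1) J] by auto
    have fP: "finite P" using finite_elements[OF _ P(1)] V by simp
    show "(case case d of (J, P) \<Rightarrow> (insert J P, J) of (P, J) \<Rightarrow> (J, P - {J})) = d"
      using i(2) by (simp add: d)
    show "(case d of (J, P) \<Rightarrow> (insert J P, J)) \<in> Sigma ?R (\<lambda>P. P)"
      using i P fP by (simp add: d)
    show "(case case d of (J, P) \<Rightarrow> (insert J P, J) of (P, J) \<Rightarrow> \<Prod>K\<in>P. w K) =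
        (case d of (J, P) \<Rightarrow> w J * (\<Prod>K\<in>P. w K))"
      using i(2) fP by (simp add: d)
  next
    fix d assume "d \<in> Sigma ?R (\<lambda>P. P)"
    then obtain P J where d: "d = (P, J)" and P: "partition_on V P" "card P = Suc k" and J: "J \<in> P"
      by blast
    show "(case case d of (P, J) \<Rightarrow> (J, P - {J}) of (J, P) \<Rightarrow> (insert J P, J)) = d"
      using J by (auto simp: d)
    have "J \<subseteq> V" "J \<noteq> {}" using P(1) J by (auto simp: partition_on_def)
    then show "(case d of (P, J) \<Rightarrow> (J, P - {J})) \<in> Sigma {J. J \<subseteq> V \<and> J \<noteq> {}} ?Q"
      using partition_on_remove1[OF P(1) J] P(2) J finP[OF P(1)] by (simp add: d)
  qed
  also have "\<dots> = (\<Sum>P\<in>?R. \<Sum>J\<in>P. \<Prod>K\<in>P. w K)"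
    by (rule sum.Sigma[symmetric]) (use finR finP in auto)
  finally show ?thesis .
qed

text \<open>An additional factor of \<open>F\<close> marks one block of a partition into
  \<open>Suc k\<close> blocks; forgetting the mark yields the new factor of the factorial. The
  vanishing of \<open>F 0\<close> excludes empty blocks.\<close>

lemma labelled_series_power:
  assumes F0: "F 0 = 0" and V: "finite V"
  shows "labelled c (series_power F k) V =
    scalar (fact k) * (\<Sum>P | partition_on V P \<and> card P = k. \<Prod>J\<in>P. labelled c F J)"
  using V
proof (induction k arbitrary: V)
  case 0
  have fin: "finite P" if "partition_on V P" for P using finite_elements[OF 0 that] .
  have eq: "{P. partition_on V P \<and> card P = 0} = (if V = {} then {{}} else {})"
  proof -
    have "P = {}" if "partition_on V P" "card P = 0" for P using fin[OF that(1)] that(2) by simp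
    then have "{P. partition_on V P \<and> card P = 0} = {P. P = {} \<and> partition_on V P}" by auto
    moreover have "partition_on V {} \<longleftrightarrow> V = {}" by (auto simp: partition_on_def)
    ultimately show ?thesis by auto
  qed
  show ?case
    unfolding eq using dim_of_eq_0_iff[OF 0, of c]
    by (auto simp: labelled_def series_one_def tensor_one fact_vec_def)
next
  case (Suc k)
  let ?Q = "\<lambda>J. {P. partition_on (V - J) P \<and> card P = k}"
  let ?R = "{P. partition_on V P \<and> card P = Suc k}"
  let ?w = "labelled c F"
  have w0: "?w {} = 0" using F0 by (simp add: labelled_def)
  have "labelled c (series_power F (Suc k)) V =
      (\<Sum>J\<in>Pow V. ?w J * labelled c (series_power F k) (V - J))"
    using labelled_series_mult[OF Suc(2)] by simp
  also have "\<dots> = (\<Sum>J | J \<subseteq> V \<and> J \<noteq> {}. ?w J * labelled c (series_power F k) (V - J))"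
    by (rule sum.mono_neutral_right) (use Suc(2) w0 in auto)
  also have "\<dots> = (\<Sum>J | J \<subseteq> V \<and> J \<noteq> {}. scalar (fact k) * (?w J * (\<Sum>P\<in>?Q J. \<Prod>K\<in>P. ?w K)))"
    by (rule sum.cong[OF refl]) (use Suc in \<open>simp add: mult.left_commute\<close>)
  also have "\<dots> = scalar (fact k) * (\<Sum>P\<in>?R. \<Sum>J\<in>P. \<Prod>K\<in>P. ?w K)"
    by (subst sum_distrib_left[symmetric], subst sum_partitions_choose_block[OF Suc(2)], rule refl)
  also have "(\<Sum>P\<in>?R. \<Sum>J\<in>P. \<Prod>K\<in>P. ?w K) = (\<Sum>P\<in>?R. scalar (of_nat (Suc k)) * (\<Prod>K\<in>P. ?w K))"
  proof (rule sum.cong[OF refl])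
    fix P assume "P \<in> ?R"
    then have "finite P" "card P = Suc k" using finite_elements[OF Suc(2)] by auto
    then show "(\<Sum>J\<in>P. \<Prod>K\<in>P. ?w K) = scalar (of_nat (Suc k)) * (\<Prod>K\<in>P. ?w K)"
      using sum_constant_scalar by metis
  qed
  also have "scalar (fact k) * \<dots> = scalar (fact k * of_nat (Suc k)) * (\<Sum>P\<in>?R. \<Prod>K\<in>P. ?w K)"
    by (simp only: scalar_mult sum_distrib_left[symmetric] mult.assoc)
  also have "fact k * of_nat (Suc k) = (fact (Suc k) :: rat poly fract)" by (simp add: mult.commute)
  finally show ?case .
qed

text \<open>Ensures that every partition is counted before \<open>series_exp\<close> is cut off, at
  \<open>k = card V\<close>.\<close>

lemma card_partition_le:
  assumes V: "finite V" and P: "partition_on V P"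
  shows "card P \<le> card V"
proof -
  have "\<forall>I\<in>P. \<exists>v. v \<in> I" using partition_onD3[OF P] by (metis all_not_in_conv)
  then obtain f where f: "\<forall>I\<in>P. f I \<in> I" by metis
  have "inj_on f P"
  proof (rule inj_onI)
    fix I J assume "I \<in> P" "J \<in> P" "f I = f J"
    then show "I = J" using f P unfolding partition_on_def disjoint_def by (metis disjoint_iff)
  qed
  moreover have "f ` P \<subseteq> V" using f P by (auto simp: partition_on_def)
  ultimately show ?thesis using V card_inj_on_le by blast
qed

theorem labelled_series_exp:
  assumes F0: "F 0 = 0" and V: "finite V"
  shows "labelled c (series_exp F) V = (\<Sum>P | partition_on V P. \<Prod>J\<in>P. labelled c F J)"
proof -
  let ?R = "{P. partition_on V P}"
  have "labelled c (series_exp F) V =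
      (\<Sum>k\<le>card V. scalar (1 / fact k) * labelled c (series_power F k) V)"
    by (simp add: labelled_def series_exp_def size_vec_dim_of[OF V] sum_distrib_left mult.left_commute)
  also have "\<dots> = (\<Sum>k\<le>card V. \<Sum>P\<in>{P \<in> ?R. card P = k}. \<Prod>J\<in>P. labelled c F J)"
  proof (rule sum.cong[OF refl])
    fix k
    have "scalar (1 / fact k) * labelled c (series_power F k) V =
      scalar (1 / fact k * fact k) * (\<Sum>P\<in>{P \<in> ?R. card P = k}. \<Prod>J\<in>P. labelled c F J)"
      by (simp only: labelled_series_power[where F = F, OF F0 V] scalar_mult mult.assoc mem_Collect_eq)
    then show "scalar (1 / fact k) * labelled c (series_power F k) V =
      (\<Sum>P\<in>{P \<in> ?R. card P = k}. \<Prod>J\<in>P. labelled c F J)" by (simp add: tensor_one)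
  qed
  also have "\<dots> = (\<Sum>P\<in>?R. \<Prod>J\<in>P. labelled c F J)"
    by (rule sum.group) (use finitely_many_partition_on[OF V] card_partition_le[OF V] in auto)
  finally show ?thesis .
qed

text \<open>The one-block partition contributes \<open>a I\<close>, all others involve smaller
  blocks only, so the system is triangular. This takes the place of a logarithm.\<close>

lemma partition_sum_inj:
  fixes a b :: "'w set \<Rightarrow> 'r::{comm_ring, comm_monoid_mult}"
  assumes V: "finite V"
    and eq: "\<And>I. I \<subseteq> V \<Longrightarrow> I \<noteq> {} \<Longrightarrow>
      (\<Sum>P | partition_on I P. \<Prod>J\<in>P. a J) = (\<Sum>P | partition_on I P. \<Prod>J\<in>P. b J)"
    and I: "I \<subseteq> V" "I \<noteq> {}"
  shows "a I = b I"
  using I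
proof (induction "card I" arbitrary: I rule: less_induct)
  case less
  have fI: "finite I" using finite_subset[OF less(2) V] .
  let ?R = "{P. partition_on I P}"
  have finR: "finite ?R" using finitely_many_partition_on[OF fI] .
  have one: "{I} \<in> ?R" using less(3) by (simp add: partition_on_space)
  have split: "(\<Sum>P\<in>?R. \<Prod>J\<in>P. f J) = f I + (\<Sum>P\<in>?R - {{I}}. \<Prod>J\<in>P. f J)"
    for f :: "'w set \<Rightarrow> 'r" using sum.remove[OF finR one, of "\<lambda>P. \<Prod>J\<in>P. f J"] by simp
  have "(\<Sum>P\<in>?R - {{I}}. \<Prod>J\<in>P. a J) = (\<Sum>P\<in>?R - {{I}}. \<Prod>J\<in>P. b J)"
  proof (intro sum.cong refl prod.cong)
    fix P J assume P: "P \<in> ?R - {{I}}" and J: "J \<in> P"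
    have part: "partition_on I P" using P by blast
    have "J \<subseteq> I" "J \<noteq> {}" using part J by (auto simp: partition_on_def)
    moreover have "J \<noteq> I"
    proof
      assume "J = I"
      have "K = I" if K: "K \<in> P" for K
      proof (rule ccontr)
        assume "K \<noteq> I"
        then have "K \<inter> I = {}"
          using disjointD[OF partition_onD2[OF part] K, of I] J \<open>J = I\<close> by simp
        moreover have "K \<subseteq> I" "K \<noteq> {}" using part K by (auto simp: partition_on_def)
        ultimately show False by blast
      qed
      then show False using P J \<open>J = I\<close> by blast
    qed
    ultimately have "J \<subset> I" "J \<subseteq> V" "J \<noteq> {}" using less(2) by auto
    then show "a J = b J" using less(1)[of J] psubset_card_mono[OF fI] by blast
  qed
  then show ?case using eq[OF less(2,3)] split[of a] split[of b] by simp
qed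

section \<open>Slopes\<close>

definition upper_half :: "complex set" where
  "upper_half = {z. Im z > 0 \<or> Im z = 0 \<and> Re z < 0}"

definition slope_value :: "complex \<Rightarrow> ereal" where
  "slope_value z = (if Im z = 0 then \<infinity> else ereal (- Re z / Im z))"

lemma slope_eq_slope_value: "slope Z \<gamma> = slope_value (Z \<gamma>)"
  by (simp add: slope_def slope_value_def)

lemma half_plane_upper_half: "half_plane \<subseteq> upper_half"
proof
  fix z assume "z \<in> half_plane"
  then obtain r \<phi> where z: "z = complex_of_real r * exp (\<i> * complex_of_real (pi * \<phi>))"
    and r: "0 < r" "0 < \<phi>" "\<phi> \<le> 1" unfolding half_plane_def by blast
  have ri: "Re z = r * cos (pi * \<phi>)" "Im z = r * sin (pi * \<phi>)"
    unfolding z by (simp_all add: exp_Euler[symmetric] Re_exp Im_exp)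
  show "z \<in> upper_half"
  proof (cases "\<phi> = 1")
    case True
    then show ?thesis using ri r by (simp add: upper_half_def)
  next
    case False
    then have "sin (pi * \<phi>) > 0" using r by (intro sin_gt_zero) auto
    then show ?thesis using ri r by (simp add: upper_half_def)
  qed
qed

lemma upper_half_add: "z \<in> upper_half \<Longrightarrow> w \<in> upper_half \<Longrightarrow> z + w \<in> upper_half"
  by (auto simp: upper_half_def)

text \<open>Comparison of slopes is the sign of a determinant, also when a slope is \<infinity>. Its
  bilinearity in \<open>z\<close> and \<open>w\<close> turns statements about sums into
  algebra.\<close>

lemma slope_value_le:
  assumes "z \<in> upper_half" "w \<in> upper_half"
  shows "slope_value z \<le> slope_value w \<longleftrightarrow> Im z * Re w \<le> Re z * Im w"
proof -
  consider "Im w = 0" "Re w < 0" "Im z \<ge> 0" | "Im w > 0" "Im z = 0" "Re z < 0" | "Im w > 0"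
    "Im z > 0"
    using assms by (auto simp: upper_half_def)
  then show ?thesis
  proof cases
    case 1
    then show ?thesis by (simp add: slope_value_def mult_nonneg_nonpos)
  next
    case 2
    then have "Re z * Im w < 0" by (simp add: mult_neg_pos)
    then show ?thesis using 2 by (simp add: slope_value_def)
  next
    case 3
    then show ?thesis by (simp add: slope_value_def field_simps)
  qed
qed

lemma slope_value_eq:
  assumes "z \<in> upper_half" "w \<in> upper_half"
  shows "slope_value z = slope_value w \<longleftrightarrow> Im z * Re w = Re z * Im w"
  using slope_value_le[OF assms] slope_value_le[OF assms(2,1)]
  by (metis antisym mult.commute order.refl)

text \<open>The determinant of \<open>\<zeta> A\<close> and \<open>\<zeta> A + \<zeta> B\<close>
  equals that of \<open>\<zeta> A\<close> and \<open>\<zeta> B\<close>.\<close>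

lemma seesaw_slope_value:
  assumes add: "\<And>A B. A \<subseteq> W \<Longrightarrow> B \<subseteq> W \<Longrightarrow> A \<inter> B = {} \<Longrightarrow> \<zeta> (A \<union> B) = \<zeta> A + \<zeta> B"
    and H: "\<And>A. A \<subseteq> W \<Longrightarrow> A \<noteq> {} \<Longrightarrow> \<zeta> A \<in> upper_half"
  shows "seesaw W (\<lambda>A. slope_value (\<zeta> A))"
  unfolding seesaw_def
proof (intro allI impI)
  fix A B assume AB: "A \<subseteq> W" "B \<subseteq> W" "A \<noteq> {}" "B \<noteq> {}" "A \<inter> B = {}"
  have m: "\<zeta> A \<in> upper_half" "\<zeta> B \<in> upper_half" "\<zeta> (A \<union> B) \<in> upper_half" using H AB by auto
  show "(slope_value (\<zeta> A) \<le> slope_value (\<zeta> (A \<union> B)) \<longleftrightarrow> slope_value (\<zeta> A) \<le> slope_value (\<zeta> B)) \<and>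
     (slope_value (\<zeta> (A \<union> B)) \<le> slope_value (\<zeta> B) \<longleftrightarrow> slope_value (\<zeta> A) \<le> slope_value (\<zeta> B))"
    unfolding slope_value_le[OF m(1,3)] slope_value_le[OF m(1,2)] slope_value_le[OF m(3,2)]
    unfolding add[OF AB(1,2,5)] by (simp add: algebra_simps)
qed

text \<open>Rays are the level sets of the slope on the half-plane. Hence membership in
  \<open>l\<close> can be replaced by an equation between slopes of vertex sets.\<close>

lemma ray_slope_value:
  assumes l: "ray l" and w: "w \<in> l" and z: "z \<in> upper_half"
  shows "z \<in> l \<longleftrightarrow> slope_value z = slope_value w"
proof -
  obtain v where v: "v \<in> half_plane" "l = {complex_of_real t * v | t. t > 0}"
    using l unfolding ray_def by blast
  have vH: "v \<in> upper_half" using v(1) half_plane_upper_half by blast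
  have scale: "complex_of_real t * v \<in> upper_half" if "t > 0" for t
    using vH that by (auto simp: upper_half_def mult_pos_neg)
  obtain t where t: "t > 0" "w = complex_of_real t * v" using w v(2) by blast
  have "slope_value z = slope_value w \<longleftrightarrow> Im z * Re v = Re z * Im v"
    unfolding slope_value_eq[OF z scale[OF t(1), folded t(2)]] using t by auto
  also have "\<dots> \<longleftrightarrow> z \<in> l"
  proof
    assume eq: "Im z * Re v = Re z * Im v"
    show "z \<in> l"
    proof (cases "Im v = 0")
      case True
      then have "Re v < 0" "Im z = 0" using vH eq by (auto simp: upper_half_def)
      then have "Re z < 0" using z by (auto simp: upper_half_def)
      have "z = complex_of_real (Re z / Re v) * v"
        using True \<open>Re v < 0\<close> \<open>Im z = 0\<close> by (simp add: complex_eq_iff)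
      moreover have "Re z / Re v > 0" using \<open>Re v < 0\<close> \<open>Re z < 0\<close> by (simp add: divide_neg_neg)
      ultimately show ?thesis unfolding v(2) by blast
    next
      case False
      then have "Im v > 0" using vH by (auto simp: upper_half_def)
      moreover have "Im z \<noteq> 0" using eq False z by (auto simp: upper_half_def)
      then have "Im z > 0" using z by (auto simp: upper_half_def)
      moreover have "z = complex_of_real (Im z / Im v) * v"
        using False eq by (simp add: complex_eq_iff field_simps)
      ultimately show ?thesis unfolding v(2)
        by (metis (mono_tags, lifting) divide_pos_pos mem_Collect_eq)
    qed
  next
    assume "z \<in> l"
    then obtain r where "z = complex_of_real r * v" unfolding v(2) by blast
    then show "Im z * Re v = Re z * Im v" by simp
  qed
  finally show ?thesis by simp
qed

lemma lookup_indicator_vec: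
  "finite I \<Longrightarrow> Poly_Mapping.lookup (indicator_vec I) v = (if v \<in> I then 1 else 0)"
  by (induction I rule: finite_induct)
    (auto simp: indicator_vec_def lookup_add lookup_single when_def)

lemma keys_indicator_vec: "finite I \<Longrightarrow> Poly_Mapping.keys (indicator_vec I) = I"
  by (auto simp: in_keys_iff lookup_indicator_vec split: if_splits)

text \<open>The map \<open>c\<close> allows two uses: \<open>fst\<close> for \<open>Z\<close>, which
  is evaluated on vertices of \<open>Q\<close>, and the identity for a stability function on the
  blow-up quiver.\<close>

lemma stability_function_finite_sum:
  assumes Z: "stability_function Q Z" and I: "finite I" "I \<noteq> {}" "c ` I \<subseteq> verts Q"
  shows "Z (\<Sum>w\<in>I. Poly_Mapping.single (c w) 1) \<in> upper_half"
  using I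
proof (induction I rule: finite_ne_induct)
  case (singleton w)
  then show ?case
    using Z half_plane_upper_half by (auto simp: stability_function_def)
next
  case (insert w I)
  have "Poly_Mapping.keys (\<Sum>w\<in>I. Poly_Mapping.single (c w) (1::int)) \<subseteq> verts Q"
    using insert(1,5) keys_sum[of "\<lambda>w. Poly_Mapping.single (c w) (1::int)" I] by auto
  then have "(\<Sum>w\<in>I. Poly_Mapping.single (c w) 1) \<in> Gamma_group Q"
    "Poly_Mapping.single (c w) 1 \<in> Gamma_group Q"
    using insert(5) by (auto simp: Gamma_group_def)
  then have "Z (\<Sum>w\<in>insert w I. Poly_Mapping.single (c w) 1) =
      Z (Poly_Mapping.single (c w) 1) + Z (\<Sum>w\<in>I. Poly_Mapping.single (c w) 1)"
    using Z insert(1,3) by (simp add: stability_function_def)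
  moreover have "Z (Poly_Mapping.single (c w) 1) \<in> upper_half"
    using Z half_plane_upper_half insert(5) by (auto simp: stability_function_def)
  ultimately show ?case using upper_half_add insert by auto
qed

lemma stability_function_Un:
  assumes Z: "stability_function Q Z" and I: "finite I" "finite J" "I \<inter> J = {}"
    "c ` (I \<union> J) \<subseteq> verts Q"
  shows "Z (\<Sum>w\<in>I \<union> J. Poly_Mapping.single (c w) 1) =
    Z (\<Sum>w\<in>I. Poly_Mapping.single (c w) 1) + Z (\<Sum>w\<in>J. Poly_Mapping.single (c w) 1)"
proof -
  have *: "(\<Sum>w\<in>K. Poly_Mapping.single (c w) 1) \<in> Gamma_group Q" if K: "K \<subseteq> I \<union> J" for K
  proof -
    have "Poly_Mapping.keys (\<Sum>w\<in>K. Poly_Mapping.single (c w) (1::int)) \<subseteq> (\<Union>w\<in>K. {c w})"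
      using keys_sum[of "\<lambda>w. Poly_Mapping.single (c w) (1::int)" K] by simp
    also have "\<dots> \<subseteq> verts Q" using K I(4) by blast
    finally show ?thesis by (simp add: Gamma_group_def)
  qed
  show ?thesis
    using Z I(1-3) *[of I] *[of J] by (simp add: stability_function_def sum.union_disjoint)
qed

lemma int_vec_dim_of: "finite I \<Longrightarrow> int_vec (dim_of c I) = (\<Sum>w\<in>I. Poly_Mapping.single (c w) 1)"
proof (induction I rule: finite_induct)
  case (insert w I)
  have "int_vec (Poly_Mapping.single (c w) 1 + dim_of c I) = Poly_Mapping.single (c w) 1 + int_vec (dim_of c I)"
    by (rule poly_mapping_eqI) (simp add: lookup_add map.rep_eq lookup_single when_def)
  then show ?case using insert by (simp add: dim_of_insert)
qed (auto intro!: poly_mapping_eqI simp: map.rep_eq)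

lemma induced_stability_indicator:
  assumes "finite I"
  shows "induced_stability Z (indicator_vec I) = Z (\<Sum>w\<in>I. Poly_Mapping.single (fst w) 1)"
  unfolding induced_stability_def keys_indicator_vec[OF assms]
  by (rule arg_cong[where f = Z], rule sum.cong) (simp_all add: lookup_indicator_vec assms)

section \<open>Semistable abelian representations\<close>

lemma subspace_complex:
  assumes "module.subspace (*) (N :: complex set)"
  shows "N = {0} \<or> N = UNIV"
proof -
  have "N = UNIV" if N: "N \<noteq> {0}"
  proof -
    have "0 \<in> N" by (rule vector_space_over_itself.subspace_0[OF assms])
    then obtain z where z: "z \<in> N" "z \<noteq> 0" using N by blast
    have "w \<in> N" for w
      using vector_space_over_itself.subspace_scale[OF assms z(1), of "w / z"] z(2) by simp
    then show ?thesis by blast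
  qed
  then show ?thesis by blast
qed

lemma dim_complex: "vector_space.dim (*) (UNIV :: complex set) = 1"
  "vector_space.dim (*) {0 :: complex} = 0"
proof -
  have "w \<in> module.span (*) {1}" for w :: complex
    using vector_space_over_itself.span_scale[OF vector_space_over_itself.span_base[of 1 "{1}"], of w] by simp
  then show "vector_space.dim (*) (UNIV :: complex set) = 1"
    by (intro vector_space_over_itself.dim_unique[of "{1}"]) auto
  show "vector_space.dim (*) {0 :: complex} = 0"
    by (rule vector_space_over_itself.dim_unique[of "{}"])
      (simp_all add: vector_space_over_itself.independent_empty)
qed

lemma subspace_complex_trivial: "module.subspace (*) {0 :: complex}"
  "module.subspace (*) (UNIV :: complex set)"
  by (auto intro: vector_space_over_itself.subspaceI)

lemma q_var_minus_one_power_sum_nonzero: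
  assumes "finite A" "A \<noteq> {}"
  shows "(\<Sum>x\<in>A. (q_var - 1) ^ n x) \<noteq> 0"
proof -
  let ?p = "[:-1, 0, 1:] :: rat poly"
  have t: "q_var - 1 = Fract ?p 1"
    by (simp add: q_half_def One_fract_def power2_eq_square one_pCons)
  have pow: "(q_var - 1) ^ k = Fract (?p ^ k) 1" for k
    by (induction k) (simp_all only: power_0 power_Suc t mult_fract mult_1 One_fract_def[symmetric])
  have "(\<Sum>x\<in>A. (q_var - 1) ^ n x) = Fract (\<Sum>x\<in>A. ?p ^ n x) 1"
    using assms(1) by (induction A rule: finite_induct) (simp_all add: pow Zero_fract_def)
  \<comment> \<open>At \<open>q_half = 2\<close> the base \<open>q - 1\<close> is 3, so all terms
    are positive.\<close>
  moreover have "poly (\<Sum>x\<in>A. ?p ^ n x) 2 = (\<Sum>x\<in>A. 3 ^ n x)" by (simp add: poly_sum)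
  moreover have "(\<Sum>x\<in>A. 3 ^ n x :: rat) > 0" using assms by (intro sum_pos) auto
  ultimately show ?thesis by (auto simp: Zero_fract_def eq_fract)
qed

lemma q_var_minus_one_nonzero: "q_var - 1 \<noteq> 0"
  using q_var_minus_one_power_sum_nonzero[of "{()}" "\<lambda>_. 1"] by simp

context fin_digraph
begin

lemma arcs_between_verts: "arcs_between (verts G) (verts G) = arcs G"
  by (auto simp: arcs_between_def)

text \<open>Subspaces of \<complex> are 0 or everything, so a family of subspaces is a vertex set,
  and it is a subrepresentation exactly when the set is closed under the arrows of the
  support.\<close>

lemma semistable_iff_support:
  "semistable G Z x \<longleftrightarrow>
     {a \<in> arcs G. x a \<noteq> 0} \<in> semistable_supports (\<lambda>I. slope Z (indicator_vec I)) (verts G)"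
proof -
  let ?S = "{a \<in> arcs G. x a \<noteq> 0}"
  have dim: "dim_vec G N = indicator_vec {v \<in> verts G. N v = UNIV}"
    if N: "\<forall>v\<in>verts G. N v = {0} \<or> N v = UNIV" for N
    unfolding dim_vec_def indicator_vec_def
  proof (rule sum.mono_neutral_cong_right[OF finite_verts])
    show "\<forall>v\<in>verts G - {v \<in> verts G. N v = UNIV}.
        Poly_Mapping.single v (int (vector_space.dim (*) (N v))) = 0"
    proof
      fix v assume "v \<in> verts G - {v \<in> verts G. N v = UNIV}"
      then have "N v = {0}" using N by blast
      then show "Poly_Mapping.single v (int (vector_space.dim (*) (N v))) = 0"
        by (simp add: dim_complex)
    qed
  qed (auto simp: dim_complex)
  have top: "dim_vec G (\<lambda>_. UNIV) = indicator_vec (verts G)" using dim[of "\<lambda>_. UNIV"] by simp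
  have ne: "{0 :: complex} \<noteq> UNIV" by (metis UNIV_I singletonD zero_neq_one)
  show ?thesis
  proof
    assume ss: "semistable G Z x"
    show "?S \<in> semistable_supports (\<lambda>I. slope Z (indicator_vec I)) (verts G)"
      unfolding semistable_supports_def
    proof (intro CollectI conjI allI impI)
      show "?S \<subseteq> arcs_between (verts G) (verts G)" unfolding arcs_between_verts by blast
      fix J assume J: "J \<subseteq> verts G" "J \<noteq> {}" and c: "closed_under G ?S J"
      show "slope Z (indicator_vec J) \<le> slope Z (indicator_vec (verts G))"
      proof (cases "J = verts G")
        case False
        define N where "N = (\<lambda>v. if v \<in> J then UNIV else {0 :: complex})"
        have "subrepresentation G x N"
          unfolding subrepresentation_def
        proof (intro conjI ballI)
          show "module.subspace (*) (N v)" for v by (simp add: N_def subspace_complex_trivial)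
          fix a z assume a: "a \<in> arcs G" and z: "z \<in> N (tail G a)"
          show "x a * z \<in> N (head G a)"
            using c a z unfolding closed_under_def N_def
              by (cases "x a = 0") (auto split: if_splits)
        qed
        moreover obtain v where "v \<in> verts G" "v \<notin> J" using J False by blast
        moreover obtain u where "u \<in> J" using J by blast
        ultimately have "proper_nonzero_subrep G x N"
          unfolding proper_nonzero_subrep_def N_def using ne J by auto
        then have "slope Z (dim_vec G N) \<le> slope Z (dim_vec G (\<lambda>_. UNIV))"
          using ss unfolding semistable_def by blast
        moreover have "{v \<in> verts G. N v = UNIV} = J" using J ne by (auto simp: N_def)
        moreover have "\<forall>v\<in>verts G. N v = {0} \<or> N v = UNIV" by (simp add: N_def)
        ultimately show ?thesis using dim[of N] top by simp
      qed simp
    qed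
  next
    assume S: "?S \<in> semistable_supports (\<lambda>I. slope Z (indicator_vec I)) (verts G)"
    show "semistable G Z x"
      unfolding semistable_def
    proof (intro allI impI)
      fix N assume N: "proper_nonzero_subrep G x N"
      then have sub: "subrepresentation G x N" and nz: "\<exists>v\<in>verts G. N v \<noteq> {0}"
        by (auto simp: proper_nonzero_subrep_def)
      have two: "\<forall>v\<in>verts G. N v = {0} \<or> N v = UNIV"
        using sub subspace_complex unfolding subrepresentation_def by blast
      let ?J = "{v \<in> verts G. N v = UNIV}"
      have "closed_under G ?S ?J"
        unfolding closed_under_def
      proof (intro ballI impI)
        fix a assume a: "a \<in> ?S" "tail G a \<in> ?J"
        then have "x a * 1 \<in> N (head G a)" using sub unfolding subrepresentation_def by blast
        then have "N (head G a) \<noteq> {0}" using a by auto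
        then show "head G a \<in> ?J" using two a by auto
      qed
      moreover have "?J \<subseteq> verts G" "?J \<noteq> {}" using nz two by auto
      ultimately have "slope Z (indicator_vec ?J) \<le> slope Z (indicator_vec (verts G))"
        using S unfolding semistable_supports_def by blast
      then show "slope Z (dim_vec G N) \<le> slope Z (dim_vec G (\<lambda>_. UNIV))"
        using dim[OF two] top by simp
    qed
  qed
qed

lemma semistable_locus_eq:
  "semistable_locus G Z = subspace_on (affine_space (arcs G)) (support_locus (arcs G)
     (semistable_supports (\<lambda>I. slope Z (indicator_vec I)) (verts G)))"
  unfolding semistable_locus_def support_locus_def semistable_iff_support ..

lemma moduli_space_eq:
  "moduli_space G Z = orbit_space G (semistable_supports (\<lambda>I. slope Z (indicator_vec I)) (verts G))"
  by (simp add: moduli_space_def orbit_space_def semistable_locus_eq)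

lemma upset_semistable_supports: "upset (arcs G) (semistable_supports s (verts G))"
  unfolding upset_def semistable_supports_def arcs_between_verts
proof (intro conjI ballI allI impI)
  fix S S' assume S: "S \<in> {S. S \<subseteq> arcs G \<and> (\<forall>J\<subseteq>verts G. J \<noteq> {} \<longrightarrow> closed_under G S J \<longrightarrow> s J \<le> s (verts G))}"
    and SS: "S \<subseteq> S'" "S' \<subseteq> arcs G"
  have "closed_under G S J" if "closed_under G S' J" for J using that SS
    by (auto simp: closed_under_def)
  then show "S' \<in> {S. S \<subseteq> arcs G \<and> (\<forall>J\<subseteq>verts G. J \<noteq> {} \<longrightarrow> closed_under G S J \<longrightarrow> s J \<le> s (verts G))}"
    using S SS by blast
qed auto

text \<open>If \<open>I\<close> were closed under \<open>B\<close> and its complement under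
  \<open>A\<close>, neither slope would exceed that of the whole. By the see-saw property they would
  be equal, against the distinctness of slopes.\<close>

lemma unsplittable_semistable_supports:
  assumes s: "seesaw (verts G) s"
    and inj: "\<And>I J. I \<subseteq> verts G \<Longrightarrow> J \<subseteq> verts G \<Longrightarrow> I \<noteq> {} \<Longrightarrow> J \<noteq> {} \<Longrightarrow> s I = s J \<Longrightarrow> I = J"
  shows "unsplittable G (semistable_supports s (verts G))"
  unfolding unsplittable_def
proof (intro ballI allI impI notI)
  fix A B I assume A: "A \<in> semistable_supports s (verts G)"
    and B: "B \<in> semistable_supports s (verts G)"
    and I: "I \<subseteq> verts G" "I \<noteq> {}" "I \<noteq> verts G"
    and c: "closed_under G B I \<and> closed_under G A (verts G - I)"
  have J: "verts G - I \<subseteq> verts G" "verts G - I \<noteq> {}" using I by auto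
  have U: "I \<union> (verts G - I) = verts G" using I by auto
  note d = seesawD[OF s I(1) J(1) I(2) J(2) Diff_disjoint, unfolded U]
  have "s I \<le> s (verts G)" "s (verts G - I) \<le> s (verts G)"
    using A B c I J unfolding semistable_supports_def by blast+
  then have "s I = s (verts G - I)" using d by (simp add: antisym)
  then have "I = verts G - I" by (rule inj[OF I(1) J(1) I(2) J(2)])
  then show False using I by blast
qed

lemma points_orbit_space_empty_iff:
  assumes "upset (arcs G) F"
  shows "points (orbit_space G F) = {} \<longleftrightarrow> F = {}"
proof -
  have "support_locus (arcs G) F \<noteq> {}" if "S \<in> F" for S
  proof -
    have "S \<subseteq> arcs G" by (rule upset_subset[OF assms that])
    then have "{a \<in> arcs G. (\<lambda>a\<in>arcs G. if a \<in> S then 1 else 0 :: complex) a \<noteq> 0} = S" by auto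
    then have "(\<lambda>a\<in>arcs G. if a \<in> S then 1 else 0) \<in> support_locus (arcs G) F"
      using that by (simp add: support_locus_def)
    then show ?thesis by blast
  qed
  then show ?thesis by (auto simp: support_locus_def)
qed

text \<open>In the quotient each support loses \<open>card (verts G) - 1\<close> factors
  \<open>q - 1\<close>, which leaves one \<open>q - 1\<close> in front; the summand 1 in the
  dimension contributes \<open>1 / q_half\<close>. Together they are
  \<open>q_half - 1 / q_half\<close>.\<close>

theorem virtual_motive_orbit_space:
  assumes F: "upset (arcs G) F" and u: "unsplittable G F" and ne: "verts G \<noteq> {}"
  shows "virtual_motive (orbit_space G F) =
    scalar ((q_half - 1 / q_half) *
      (q_half powi (int (card (verts G)) - int (card (arcs G))) *
        (\<Sum>S\<in>F. (q_var - 1) ^ card S) / (q_var - 1) ^ card (verts G)))"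
proof (cases "F = {}")
  case True
  then show ?thesis
    using points_orbit_space_empty_iff[OF F] by (simp add: virtual_motive_def scalar_zero)
next
  case False
  let ?n = "card (verts G)"
  \<comment> \<open>A support contains a spanning tree, so the truncated exponents are true
    differences.\<close>
  have n: "?n \<le> Suc (card S)" if S: "S \<in> F" for S
  proof -
    obtain T \<gamma> r where T: "T \<subseteq> S" "tree_gauge T (verts G) \<gamma> r"
      using unsplittable_tree[OF F u ne S] .
    have "finite S" using upset_subset[OF F S] finite_arcs finite_subset by blast
    then show ?thesis using tree_gaugeD(4)[OF T(2)] card_mono[of S T] T(1) by simp
  qed
  obtain S0 where "S0 \<in> F" using False by blast
  then have nE: "?n \<le> Suc (card (arcs G))"
    using n[of S0] card_mono[OF finite_arcs upset_subset[OF F]] by fastforce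
  have dim: "variety_dim (orbit_space G F) = Suc (card (arcs G)) - ?n"
    by (rule variety_dim_orbit_space[OF F u ne False])
  have "virtual_motive (orbit_space G F) =
      motivic_class (orbit_space G F) \<otimes>\<^sub>V (q_half powi (- int (Suc (card (arcs G)) - ?n)))"
    using points_orbit_space_empty_iff[OF F] False by (simp add: virtual_motive_def dim)
  also have "\<dots> = scalar ((\<Sum>S\<in>F. (q_var - 1) ^ (Suc (card S) - ?n)) *
      q_half powi (- int (Suc (card (arcs G)) - ?n)))"
    unfolding motivic_class_orbit_space[OF F u ne] tensor_sum_Lefschetz_minus_one ..
  also have "(\<Sum>S\<in>F. (q_var - 1) ^ (Suc (card S) - ?n)) =
      (q_var - 1) * (\<Sum>S\<in>F. (q_var - 1) ^ card S) / (q_var - 1) ^ ?n"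
    unfolding sum_distrib_left sum_divide_distrib
  proof (rule sum.cong[OF refl])
    fix S assume "S \<in> F"
    then show "(q_var - 1) ^ (Suc (card S) - ?n) = (q_var - 1) * (q_var - 1) ^ card S / (q_var - 1) ^ ?n"
      using n[of S] q_var_minus_one_nonzero by (simp add: power_diff)
  qed
  also have "- int (Suc (card (arcs G)) - ?n) = (int ?n - int (card (arcs G))) - 1"
    using nE by simp
  also have "q_half powi ((int ?n - int (card (arcs G))) - 1) =
      q_half powi (int ?n - int (card (arcs G))) / q_half"
    using q_half_nonzero by (simp add: power_int_diff)
  also have "(q_var - 1) * (\<Sum>S\<in>F. (q_var - 1) ^ card S) / (q_var - 1) ^ ?n *
        (q_half powi (int ?n - int (card (arcs G))) / q_half) =
      ((q_var - 1) / q_half) * (q_half powi (int ?n - int (card (arcs G))) *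
        (\<Sum>S\<in>F. (q_var - 1) ^ card S) / (q_var - 1) ^ ?n)" by (simp add: ac_simps)
  also have "(q_var - 1) / q_half = q_half - 1 / q_half"
    using q_half_nonzero by (simp add: diff_divide_distrib power2_eq_square)
  finally show ?thesis .
qed

end

section \<open>Blow-up quivers\<close>

lemma blowup_quiver_sel:
  assumes "quiver Q"
  shows "(i, k) \<in> verts (blowup_quiver Q \<alpha>) \<longleftrightarrow> i \<in> verts Q \<and> 1 \<le> k \<and> k \<le> Poly_Mapping.lookup \<alpha> i"
    "(a, k, k') \<in> arcs (blowup_quiver Q \<alpha>) \<longleftrightarrow> a \<in> arcs Q \<and>
       (tail Q a, k) \<in> verts (blowup_quiver Q \<alpha>) \<and> (head Q a, k') \<in> verts (blowup_quiver Q \<alpha>)"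
    "tail (blowup_quiver Q \<alpha>) (a, k, k') = (tail Q a, k)"
    "head (blowup_quiver Q \<alpha>) (a, k, k') = (head Q a, k')"
  using assms by (auto simp: quiver_def blowup_quiver_def wf_digraph_def)

text \<open>\<open>Q\<close> may be infinite, but only its finitely many arrows between vertices in
  the support of \<open>\<alpha>\<close> have copies.\<close>

lemma fin_digraph_blowup_quiver:
  assumes Q: "quiver Q" and \<alpha>: "\<alpha> \<in> Gamma_plus Q"
  shows "fin_digraph (blowup_quiver Q \<alpha>)"
proof
  let ?G = "blowup_quiver Q \<alpha>" and ?K = "Poly_Mapping.keys \<alpha>"
  show "finite (verts ?G)"
    by (rule finite_subset[of _ "SIGMA i:?K. {1..Poly_Mapping.lookup \<alpha> i}"])
      (auto simp: blowup_quiver_def in_keys_iff)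
  have "finite {a \<in> arcs Q. tail Q a = i \<and> head Q a = j}" for i j using Q by (simp add: quiver_def)
  then have "finite (\<Union>i\<in>?K. \<Union>j\<in>?K. {a \<in> arcs Q. tail Q a = i \<and> head Q a = j})" by simp
  then have "finite (SIGMA a:(\<Union>i\<in>?K. \<Union>j\<in>?K. {a \<in> arcs Q. tail Q a = i \<and> head Q a = j}).
      {1..Poly_Mapping.lookup \<alpha> (tail Q a)} \<times> {1..Poly_Mapping.lookup \<alpha> (head Q a)})"
    by (rule finite_SigmaI) simp
  then show "finite (arcs ?G)"
    by (rule rev_finite_subset) (auto simp: blowup_quiver_def in_keys_iff)
  fix e assume "e \<in> arcs ?G"
  then show "tail ?G e \<in> verts ?G" "head ?G e \<in> verts ?G"
    by (cases e, simp add: blowup_quiver_sel[OF Q])+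
qed

lemma dim_of_verts_blowup_quiver:
  assumes Q: "quiver Q" and \<alpha>: "\<alpha> \<in> Gamma_plus Q"
  shows "dim_of fst (verts (blowup_quiver Q \<alpha>)) = \<alpha>"
proof (rule poly_mapping_eqI)
  fix i
  interpret fin_digraph "blowup_quiver Q \<alpha>" by (rule fin_digraph_blowup_quiver[OF Q \<alpha>])
  have "{w \<in> verts (blowup_quiver Q \<alpha>). fst w = i} =
      (if i \<in> verts Q then Pair i ` {1..Poly_Mapping.lookup \<alpha> i} else {})"
    by (auto simp: blowup_quiver_sel[OF Q])
  moreover have "Poly_Mapping.lookup \<alpha> i = 0" if "i \<notin> verts Q"
    using that \<alpha> by (auto simp: Gamma_plus_def in_keys_iff)
  ultimately show "Poly_Mapping.lookup (dim_of fst (verts (blowup_quiver Q \<alpha>))) i = Poly_Mapping.lookup \<alpha> i"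
    by (simp add: lookup_dim_of card_image inj_on_def)
qed

lemma keys_dim_of: "finite I \<Longrightarrow> Poly_Mapping.keys (dim_of c I) = c ` I"
  by (auto simp: in_keys_iff lookup_dim_of card_eq_0_iff)

lemma dim_of_Gamma_plus:
  assumes Q: "quiver Q" and \<alpha>: "\<alpha> \<in> Gamma_plus Q" and I: "I \<subseteq> verts (blowup_quiver Q \<alpha>)"
  shows "dim_of fst I \<in> Gamma_plus Q"
proof -
  interpret fin_digraph "blowup_quiver Q \<alpha>" by (rule fin_digraph_blowup_quiver[OF Q \<alpha>])
  have "finite I" using finite_subset[OF I finite_verts] .
  then show ?thesis using I by (auto simp: Gamma_plus_def keys_dim_of blowup_quiver_def)
qed

lemma card_fibre: "card {w \<in> I. fst w = i} = card {k. (i, k) \<in> I}"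
proof -
  have "{w \<in> I. fst w = i} = Pair i ` {k. (i, k) \<in> I}" by force
  then show ?thesis by (simp add: card_image inj_on_def)
qed

text \<open>Over an arrow of \<open>Q\<close> lie the pairs of a vertex of \<open>I\<close> above
  its tail and a vertex of \<open>J\<close> above its head.\<close>

lemma card_arcs_between_blowup_quiver:
  assumes Q: "quiver Q" and \<alpha>: "\<alpha> \<in> Gamma_plus Q"
    and I: "I \<subseteq> verts (blowup_quiver Q \<alpha>)" and J: "J \<subseteq> verts (blowup_quiver Q \<alpha>)"
  shows "card (fin_digraph.arcs_between (blowup_quiver Q \<alpha>) I J) = r_form Q (dim_of fst I) (dim_of fst J)"
proof -
  interpret fin_digraph "blowup_quiver Q \<alpha>" by (rule fin_digraph_blowup_quiver[OF Q \<alpha>])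
  have fin: "finite I" "finite J"
    using finite_subset[OF I finite_verts] finite_subset[OF J finite_verts] .
  let ?A = "{a. a \<in> arcs Q \<and> tail Q a \<in> Poly_Mapping.keys (dim_of fst I) \<and> head Q a \<in> Poly_Mapping.keys (dim_of fst J)}"
  let ?F = "\<lambda>i. {k. (i, k) \<in> I}" and ?F' = "\<lambda>i. {k. (i, k) \<in> J}"
  have eq: "arcs_between I J = (SIGMA a:?A. ?F (tail Q a) \<times> ?F' (head Q a))"
  proof (rule set_eqI)
    fix e :: "'b \<times> nat \<times> nat"
    obtain a k k' where e: "e = (a, k, k')" by (cases e)
    show "e \<in> arcs_between I J \<longleftrightarrow> e \<in> (SIGMA a:?A. ?F (tail Q a) \<times> ?F' (head Q a))"
      using I J unfolding e by (force simp: arcs_between_def keys_dim_of[OF fin(1)] keys_dim_of[OF fin(2)] blowup_quiver_sel[OF Q])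
  qed
  have ff: "finite (?F i)" "finite (?F' i)" for i
    using finite_vimageI[OF fin(1), of "Pair i"] finite_vimageI[OF fin(2), of "Pair i"]
    by (simp_all add: inj_on_def vimage_def)
  have finA: "finite ?A"
  proof -
    have "?A \<subseteq> fst ` arcs_between I J"
    proof
      fix a assume "a \<in> ?A"
      then obtain k k' where "a \<in> arcs Q" "(tail Q a, k) \<in> I" "(head Q a, k') \<in> J"
        unfolding keys_dim_of[OF fin(1)] keys_dim_of[OF fin(2)] by force
      then have "(a, k, k') \<in> arcs_between I J" using I J
        by (auto simp: arcs_between_def blowup_quiver_sel[OF Q])
      then show "a \<in> fst ` arcs_between I J" by force
    qed
    then show ?thesis using finite_surj[OF finite_arcs_between] by blast
  qed
  show ?thesis
    unfolding eq r_form_def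
    by (subst card_SigmaI[OF finA]) (simp_all add: ff card_cartesian_product lookup_dim_of fin card_fibre)
qed

section \<open>Relabelling\<close>

lemma sum_semistable_supports_relabel:
  assumes G: "fin_digraph G" and H: "fin_digraph H"
    and \<sigma>: "bij_betw \<sigma> (verts H) I" and \<tau>: "bij_betw \<tau> (arcs H) (fin_digraph.arcs_between G I I)"
    and th: "\<And>a. a \<in> arcs H \<Longrightarrow> tail G (\<tau> a) = \<sigma> (tail H a) \<and> head G (\<tau> a) = \<sigma> (head H a)"
    and s: "\<And>J. J \<subseteq> verts H \<Longrightarrow> r J = s (\<sigma> ` J)"
  shows "(\<Sum>S\<in>fin_digraph.semistable_supports G s I. t ^ card S) =
    (\<Sum>S\<in>fin_digraph.semistable_supports H r (verts H). t ^ card S)"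
proof -
  interpret G: fin_digraph G by (rule G)
  interpret H: fin_digraph H by (rule H)
  have I: "I = \<sigma> ` verts H" and inj: "inj_on \<sigma> (verts H)" using \<sigma> by (auto simp: bij_betw_def)
  have A: "G.arcs_between I I = \<tau> ` arcs H" and inj': "inj_on \<tau> (arcs H)" using \<tau>
    by (auto simp: bij_betw_def)
  have closed: "closed_under G (\<tau> ` S) (\<sigma> ` J) \<longleftrightarrow> closed_under H S J"
    if S: "S \<subseteq> arcs H" and J: "J \<subseteq> verts H" for S J
  proof -
    have "tail G (\<tau> a) \<in> \<sigma> ` J \<longleftrightarrow> tail H a \<in> J" "head G (\<tau> a) \<in> \<sigma> ` J \<longleftrightarrow> head H a \<in> J"
      if "a \<in> S" for a
    proof -
      have a: "a \<in> arcs H" using that S by blast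
      show "tail G (\<tau> a) \<in> \<sigma> ` J \<longleftrightarrow> tail H a \<in> J" "head G (\<tau> a) \<in> \<sigma> ` J \<longleftrightarrow> head H a \<in> J"
        using th[OF a] inj_on_image_mem_iff[OF inj _ J] H.tail_in_verts[OF a] H.head_in_verts[OF a]
          by auto
    qed
    then show ?thesis by (simp add: closed_under_def)
  qed
  have iff: "\<tau> ` S \<in> G.semistable_supports s I \<longleftrightarrow> S \<in> H.semistable_supports r (verts H)"
    if S: "S \<subseteq> arcs H" for S
  proof -
    have "\<tau> ` S \<subseteq> G.arcs_between I I" using S A by blast
    moreover have "(\<forall>J\<subseteq>I. J \<noteq> {} \<longrightarrow> closed_under G (\<tau> ` S) J \<longrightarrow> s J \<le> s I) \<longleftrightarrow>
        (\<forall>J\<subseteq>verts H. J \<noteq> {} \<longrightarrow> closed_under H S J \<longrightarrow> r J \<le> r (verts H))"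
      unfolding I all_subset_image by (simp add: closed[OF S] s cong: imp_cong)
    ultimately show ?thesis
      using S by (simp add: G.semistable_supports_def H.semistable_supports_def H.arcs_between_verts)
  qed
  have sub: "S \<subseteq> arcs H" if "S \<in> H.semistable_supports r (verts H)" for S
    using that by (simp add: H.semistable_supports_def H.arcs_between_verts)
  have "G.semistable_supports s I = image \<tau> ` H.semistable_supports r (verts H)"
  proof
    show "image \<tau> ` H.semistable_supports r (verts H) \<subseteq> G.semistable_supports s I"
      using iff sub by blast
    show "G.semistable_supports s I \<subseteq> image \<tau> ` H.semistable_supports r (verts H)"
    proof
      fix S assume S: "S \<in> G.semistable_supports s I"
      then have "S \<subseteq> \<tau> ` arcs H" unfolding A[symmetric] by (simp add: G.semistable_supports_def)
      then obtain T where "T \<subseteq> arcs H" "S = \<tau> ` T" by (rule subset_imageE)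
      then show "S \<in> image \<tau> ` H.semistable_supports r (verts H)" using iff[of T] S by blast
    qed
  qed
  moreover have "inj_on (image \<tau>) (H.semistable_supports r (verts H))"
    using inj_on_image_eq_iff[OF inj'] sub by (intro inj_onI) blast
  moreover have "card (\<tau> ` S) = card S" if "S \<in> H.semistable_supports r (verts H)" for S
    using card_image inj_on_subset[OF inj' sub[OF that]] by blast
  ultimately show ?thesis by (simp add: sum.reindex)
qed

text \<open>The full subquiver on \<open>I\<close> is a copy of the blow-up quiver of its dimension
  vector: over each vertex of \<open>Q\<close> the members of \<open>I\<close> are numbered afresh.
  This is needed since \<open>f_inv\<close> is defined by the standard quiver, while blocks are
  arbitrary subsets.\<close>

lemma blowup_quiver_relabel:
  assumes Q: "quiver Q" and \<alpha>: "\<alpha> \<in> Gamma_plus Q" and I: "I \<subseteq> verts (blowup_quiver Q \<alpha>)"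
  obtains \<sigma> \<tau> where
    "bij_betw \<sigma> (verts (blowup_quiver Q (dim_of fst I))) I"
    "\<forall>w\<in>verts (blowup_quiver Q (dim_of fst I)). fst (\<sigma> w) = fst w"
    "bij_betw \<tau> (arcs (blowup_quiver Q (dim_of fst I))) (fin_digraph.arcs_between (blowup_quiver Q \<alpha>) I I)"
    "\<forall>e\<in>arcs (blowup_quiver Q (dim_of fst I)).
       tail (blowup_quiver Q \<alpha>) (\<tau> e) = \<sigma> (tail (blowup_quiver Q (dim_of fst I)) e) \<and>
       head (blowup_quiver Q \<alpha>) (\<tau> e) = \<sigma> (head (blowup_quiver Q (dim_of fst I)) e)"
proof -
  interpret fin_digraph "blowup_quiver Q \<alpha>" by (rule fin_digraph_blowup_quiver[OF Q \<alpha>])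
  let ?\<beta> = "dim_of fst I"
  let ?H = "blowup_quiver Q ?\<beta>"
  note sel = blowup_quiver_sel[OF Q]
  have fin: "finite I" using finite_subset[OF I finite_verts] .
  have "\<forall>i. \<exists>h. bij_betw h {1..card {w \<in> I. fst w = i}} {w \<in> I. fst w = i}"
    using fin by (intro allI ex_bij_betw_nat_finite_1) simp
  then obtain h where h: "\<forall>i. bij_betw (h i) {1..card {w \<in> I. fst w = i}} {w \<in> I. fst w = i}"
    by (rule choice[THEN exE])
  define \<sigma> where "\<sigma> = (\<lambda>(i, k). h i k)"
  have H: "(i, k) \<in> verts ?H \<longleftrightarrow> k \<in> {1..card {w \<in> I. fst w = i}}" for i k
  proof -
    have "i \<in> verts Q" if "card {w \<in> I. fst w = i} > 0"
    proof -
      have "{w \<in> I. fst w = i} \<noteq> {}" using that by (metis card.empty less_irrefl)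
      then show ?thesis using I by (auto simp: blowup_quiver_def)
    qed
    then show ?thesis by (auto simp: sel lookup_dim_of[OF fin])
  qed
  have hI: "h i k \<in> I \<and> fst (h i k) = i" if "(i, k) \<in> verts ?H" for i k
    using bij_betwE[OF h[rule_format, of i]] that H by blast
  have fst: "fst (\<sigma> w) = fst w" if "w \<in> verts ?H" for w
    using hI that by (cases w) (simp add: \<sigma>_def)
  have inj: "inj_on \<sigma> (verts ?H)"
  proof (rule inj_onI)
    fix w w' assume w: "w \<in> verts ?H" "w' \<in> verts ?H" and eq: "\<sigma> w = \<sigma> w'"
    obtain i k i' k' where [simp]: "w = (i, k)" "w' = (i', k')" by (cases w, cases w')
    have "i = i'" using fst[OF w(1)] fst[OF w(2)] eq by simp
    moreover have "h i k = h i k'" using eq \<open>i = i'\<close> by (simp add: \<sigma>_def)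
    then have "k = k'"
      using inj_onD[OF bij_betw_imp_inj_on[OF h[rule_format, of i]]] w \<open>i = i'\<close> H by simp
    ultimately show "w = w'" by simp
  qed
  have im: "\<sigma> ` verts ?H = I"
  proof
    show "\<sigma> ` verts ?H \<subseteq> I" using hI by (simp add: \<sigma>_def image_subset_iff split_paired_all)
    show "I \<subseteq> \<sigma> ` verts ?H"
    proof
      fix w assume "w \<in> I"
      then have "w \<in> h (fst w) ` {1..card {x \<in> I. fst x = fst w}}"
        by (subst bij_betw_imp_surj_on[OF h[rule_format, of "fst w"]]) simp
      then obtain k where "w = h (fst w) k" "k \<in> {1..card {x \<in> I. fst x = fst w}}" by (rule imageE)
      then have "(fst w, k) \<in> verts ?H" "\<sigma> (fst w, k) = w" using H by (auto simp: \<sigma>_def)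
      then show "w \<in> \<sigma> ` verts ?H" by (metis imageI)
    qed
  qed
  \<comment> \<open>An arrow keeps its underlying arrow of \<open>Q\<close>; only the numbers of its
    ends change.\<close>
  define \<tau> where "\<tau> = (\<lambda>(a, k, k'). (a, snd (\<sigma> (tail Q a, k)), snd (\<sigma> (head Q a, k'))))"
  have th: "tail (blowup_quiver Q \<alpha>) (\<tau> e) = \<sigma> (tail ?H e) \<and> head (blowup_quiver Q \<alpha>) (\<tau> e) = \<sigma> (head ?H e)"
    if e: "e \<in> arcs ?H" for e
  proof -
    obtain a k k' where [simp]: "e = (a, k, k')" by (cases e)
    have "(tail Q a, k) \<in> verts ?H" "(head Q a, k') \<in> verts ?H" using e by (simp_all add: sel)
    from fst[OF this(1)] fst[OF this(2)] show ?thesis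
      by (simp add: \<tau>_def sel prod_eq_iff)
  qed
  have "inj_on \<tau> (arcs ?H)"
  proof (rule inj_onI)
    fix e e' assume e: "e \<in> arcs ?H" "e' \<in> arcs ?H" and eq: "\<tau> e = \<tau> e'"
    obtain a k k' b j j' where [simp]: "e = (a, k, k')" "e' = (b, j, j')" by (cases e, cases e')
    have ab: "a = b" using eq by (simp add: \<tau>_def)
    have v: "(tail Q a, k) \<in> verts ?H" "(head Q a, k') \<in> verts ?H" "(tail Q a, j) \<in> verts ?H"
      "(head Q a, j') \<in> verts ?H"
      using e ab by (simp_all add: sel(2))
    have "\<sigma> (tail Q a, k) = \<sigma> (tail Q a, j)" "\<sigma> (head Q a, k') = \<sigma> (head Q a, j')"
      using th[OF e(1)] th[OF e(2)] eq ab by (simp_all add: sel(3,4))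
    then show "e = e'" using inj_onD[OF inj _ v(1,3)] inj_onD[OF inj _ v(2,4)] ab by simp
  qed
  moreover have "\<tau> ` arcs ?H = arcs_between I I"
  proof
    show "\<tau> ` arcs ?H \<subseteq> arcs_between I I"
    proof (rule image_subsetI)
      fix e assume e: "e \<in> arcs ?H"
      obtain a k k' where [simp]: "e = (a, k, k')" by (cases e)
      have "(tail Q a, k) \<in> verts ?H" "(head Q a, k') \<in> verts ?H" and a: "a \<in> arcs Q" using e
        by (simp_all add: sel(2))
      then have "\<sigma> (tail ?H e) \<in> I" "\<sigma> (head ?H e) \<in> I" using im by (auto simp: sel(3,4))
      then have *: "tail (blowup_quiver Q \<alpha>) (\<tau> e) \<in> I" "head (blowup_quiver Q \<alpha>) (\<tau> e) \<in> I"
        using th[OF e] by simp_all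
      moreover have "\<tau> e \<in> arcs (blowup_quiver Q \<alpha>)"
        using * I a by (auto simp: \<tau>_def sel(2,3,4))
      ultimately show "\<tau> e \<in> arcs_between I I" by (simp add: arcs_between_def)
    qed
    show "arcs_between I I \<subseteq> \<tau> ` arcs ?H"
    proof
      fix e assume e: "e \<in> arcs_between I I"
      obtain a k k' where [simp]: "e = (a, k, k')" by (cases e)
      have a: "a \<in> arcs Q" "(tail Q a, k) \<in> I" "(head Q a, k') \<in> I"
        using e by (simp_all add: arcs_between_def sel(2,3,4))
      have "(tail Q a, k) \<in> \<sigma> ` verts ?H" "(head Q a, k') \<in> \<sigma> ` verts ?H" using a(2,3) im
        by simp_all
      then obtain w w' where w: "w \<in> verts ?H" "\<sigma> w = (tail Q a, k)" "w' \<in> verts ?H"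
        "\<sigma> w' = (head Q a, k')"
        by (elim imageE) simp
      obtain j j' where j: "w = (tail Q a, j)" "w' = (head Q a, j')"
        using fst[OF w(1)] fst[OF w(3)] w(2,4) by (metis fst_conv prod.collapse)
      have "(a, j, j') \<in> arcs ?H" using a(1) w j by (simp add: sel(2))
      moreover have "\<tau> (a, j, j') = e" using w j by (simp add: \<tau>_def)
      ultimately show "e \<in> \<tau> ` arcs ?H" by (metis imageI)
    qed
  qed
  ultimately have \<tau>: "bij_betw \<tau> (arcs ?H) (arcs_between I I)" by (simp add: bij_betw_def)
  have \<sigma>: "bij_betw \<sigma> (verts ?H) I" using inj im by (simp add: bij_betw_def)
  show thesis by (rule that[OF \<sigma> ballI[OF fst] \<tau> ballI[OF th]])
qed

section \<open>The invariants as sums over supports\<close>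

lemma scalar_nonzero:
  assumes "(1 :: motivic_ring) \<noteq> 0" "c \<noteq> 0"
  shows "scalar c \<noteq> 0"
proof
  assume "scalar c = 0"
  then have "scalar (c * inverse c) = 0" by (simp only: scalar_mult mult_zero_left)
  then show False using assms by (simp add: tensor_one)
qed

text \<open>Converts the existence of a semistable support into nonvanishing of \<open>f\<close>,
  the form in which the hypothesis on the skew form is stated.\<close>

lemma weight_semistable_supports_nonzero:
  assumes "fin_digraph G" "fin_digraph.semistable_supports G s I \<noteq> {}"
  shows "fin_digraph.weight G q_half (q_var - 1) I (fin_digraph.semistable_supports G s I) \<noteq> 0"
proof -
  interpret fin_digraph G by fact
  show ?thesis
    using q_var_minus_one_power_sum_nonzero[OF finite_semistable_supports assms(2)]
      q_half_nonzero q_var_minus_one_nonzero by (simp add: weight_def)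
qed

text \<open>Places the values of \<open>f\<close> on subsets of one fixed quiver: the class of the
  locus is a sum over supports, relabelling carries these to \<open>I\<close>, and
  \<open>r_form\<close> becomes a count of arrows.\<close>

lemma semistable_weight_eq_f_inv:
  assumes Q: "quiver Q" and \<alpha>: "\<alpha> \<in> Gamma_plus Q" and I: "I \<subseteq> verts (blowup_quiver Q \<alpha>)"
    and s: "s = (\<lambda>I. slope (induced_stability Z) (indicator_vec I))"
  shows "f_inv Q Z (dim_of fst I) = scalar (fin_digraph.weight (blowup_quiver Q \<alpha>) q_half (q_var - 1) I
    (fin_digraph.semistable_supports (blowup_quiver Q \<alpha>) s I))"
proof -
  let ?G = "blowup_quiver Q \<alpha>" and ?\<beta> = "dim_of fst I"
  let ?H = "blowup_quiver Q ?\<beta>"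
  have fG: "fin_digraph ?G" by (rule fin_digraph_blowup_quiver[OF Q \<alpha>])
  interpret G: fin_digraph ?G by (rule fG)
  have fH: "fin_digraph ?H" by (rule fin_digraph_blowup_quiver[OF Q dim_of_Gamma_plus[OF Q \<alpha> I]])
  interpret H: fin_digraph ?H by (rule fH)
  have fin: "finite I" using finite_subset[OF I G.finite_verts] .
  obtain \<sigma> \<tau> where \<sigma>: "bij_betw \<sigma> (verts ?H) I" "\<forall>w\<in>verts ?H. fst (\<sigma> w) = fst w"
    and \<tau>: "bij_betw \<tau> (arcs ?H) (G.arcs_between I I)"
    and th: "\<forall>e\<in>arcs ?H. tail ?G (\<tau> e) = \<sigma> (tail ?H e) \<and> head ?G (\<tau> e) = \<sigma> (head ?H e)"
    by (rule blowup_quiver_relabel[OF Q \<alpha> I])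
  have slope: "s J = s (\<sigma> ` J)" if J: "J \<subseteq> verts ?H" for J
  proof -
    have fJ: "finite J" using finite_subset[OF J H.finite_verts] .
    have "inj_on \<sigma> J" using \<sigma>(1) J by (auto simp: bij_betw_def intro: inj_on_subset)
    then have "(\<Sum>w\<in>\<sigma> ` J. Poly_Mapping.single (fst w) (1::int)) = (\<Sum>w\<in>J. Poly_Mapping.single (fst w) 1)"
      using \<sigma>(2) J by (subst sum.reindex) (auto intro!: sum.cong)
    then show ?thesis
      by (simp add: s slope_def induced_stability_indicator fJ)
  qed
  have "f_inv Q Z ?\<beta> = scalar ((\<Sum>S\<in>H.semistable_supports s (verts ?H). (q_var - 1) ^ card S) *
      (q_half powi (int (card I) - int (r_form Q ?\<beta> ?\<beta>)) / (q_var - 1) ^ card I))"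
    unfolding f_inv_def H.semistable_locus_eq s[symmetric]
      motivic_class_support_locus[OF H.finite_arcs H.upset_semistable_supports]
      tensor_sum_Lefschetz_minus_one size_vec_dim_of[OF fin] ..
  also have "(\<Sum>S\<in>H.semistable_supports s (verts ?H). (q_var - 1) ^ card S) =
      (\<Sum>S\<in>G.semistable_supports s I. (q_var - 1) ^ card S)"
    by (rule sum_semistable_supports_relabel[where r = s
      and s = s, OF fG fH \<sigma>(1) \<tau> th[rule_format] slope, symmetric])
  finally show ?thesis
    by (simp add: G.weight_def card_arcs_between_blowup_quiver[OF Q \<alpha> I I] mult.commute)
qed

text \<open>Read contrapositively: a set off the ray has a block off the ray in each of its
  partitions.\<close>

lemma seesaw_partition:
  assumes s: "seesaw W s" and "finite P" "P \<noteq> {}" "disjoint P" "{} \<notin> P" "\<Union>P \<subseteq> W" "\<forall>I\<in>P. s I = m"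
  shows "s (\<Union>P) = m"
  using assms(2-)
proof (induction P rule: finite_ne_induct)
  case (insert I P)
  have "s (\<Union>P) = m" using insert by (simp add: pairwise_insert disjoint_def)
  moreover have "I \<inter> \<Union>P = {}" using insert(3,5) by (auto simp: disjoint_def)
  moreover have "\<Union>P \<noteq> {}" "I \<noteq> {}" "I \<subseteq> W" "\<Union>P \<subseteq> W" using insert(2,6,7) by auto
  ultimately show ?case using seesawD(1,4)[OF s, of I "\<Union>P"] insert(8) by simp
qed simp

theorem theorem1p4:
  fixes Q :: "('v, 'a) pre_digraph"
    and Z :: "('v \<Rightarrow>\<^sub>0 int) \<Rightarrow> complex"
    and l :: "complex set"
    and \<alpha> :: "'v \<Rightarrow>\<^sub>0 nat"
    and Z\<^sub>d\<^sub>e\<^sub>f :: "('v \<times> nat \<Rightarrow>\<^sub>0 int) \<Rightarrow> complex"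
  assumes "quiver Q"
    and "stability_function Q Z"
    and "ray l"
    and "\<And>\<beta> \<beta>'. \<lbrakk>\<beta> \<in> Gamma_plus Q - {0}; \<beta>' \<in> Gamma_plus Q - {0};
            Z (int_vec \<beta>) \<in> l; Z (int_vec \<beta>') \<in> l;
            f_inv Q Z \<beta> \<noteq> 0; f_inv Q Z \<beta>' \<noteq> 0\<rbrakk> \<Longrightarrow> skew_form Q \<beta> \<beta>' = 0"
    and "\<alpha> \<in> Gamma_plus Q - {0}"
    and "Z (int_vec \<alpha>) \<in> l"
    and "deformation Q Z \<alpha> Z\<^sub>d\<^sub>e\<^sub>f"
  shows "g_inv Q Z l \<alpha> = virtual_motive (moduli_space (blowup_quiver Q \<alpha>) Z\<^sub>d\<^sub>e\<^sub>f)"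
proof (cases "(1 :: motivic_ring) = 0") \<comment> \<open>only \<open>1 \<noteq> 0\<close> makes \<open>f\<^sub>Z\<close> nonzero where semistable supports exist\<close>
  case True
  then have "x = 0" for x :: motivic_ring using mult_1[of x] by simp
  then show ?thesis by metis
next
  case one: False
  note Q = assms(1) and Z = assms(2) and l = assms(3) and comm = assms(4)
  have \<alpha>: "\<alpha> \<in> Gamma_plus Q" "\<alpha> \<noteq> 0" using assms(5) by auto
  let ?h = "q_half" and ?t = "q_var - 1"
  let ?G = "blowup_quiver Q \<alpha>"
  let ?V = "verts ?G"
  let ?S = "ray_support Q Z l"
  let ?d = "dim_of fst :: ('v \<times> nat) set \<Rightarrow> _"
  define s where "s = (\<lambda>I :: ('v \<times> nat) set. slope (induced_stability Z) (indicator_vec I))"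
  define s' where "s' = (\<lambda>I. slope Z\<^sub>d\<^sub>e\<^sub>f (indicator_vec I))"
  interpret G: fin_digraph ?G by (rule fin_digraph_blowup_quiver[OF Q \<alpha>(1)])
  have def: "stability_function ?G Z\<^sub>d\<^sub>e\<^sub>f"
    "\<And>I J. I \<subseteq> ?V \<Longrightarrow> J \<subseteq> ?V \<Longrightarrow> I \<noteq> {} \<Longrightarrow> J \<noteq> {} \<Longrightarrow> s' I = s' J \<Longrightarrow> I = J"
    "\<And>I J. I \<subseteq> ?V \<Longrightarrow> J \<subseteq> ?V \<Longrightarrow> I \<noteq> {} \<Longrightarrow> J \<noteq> {} \<Longrightarrow> s I < s J \<Longrightarrow> s' I < s' J"
  proof -
    note d = assms(7)[unfolded deformation_def Let_def, folded s_def s'_def]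
    show "stability_function ?G Z\<^sub>d\<^sub>e\<^sub>f" using d by (rule conjunct1)
    show "I = J" if "I \<subseteq> ?V" "J \<subseteq> ?V" "I \<noteq> {}" "J \<noteq> {}" "s' I = s' J" for I J
      using d[THEN conjunct2, THEN conjunct1] that unfolding s'_def by blast
    show "s' I < s' J" if "I \<subseteq> ?V" "J \<subseteq> ?V" "I \<noteq> {}" "J \<noteq> {}" "s I < s J" for I J
      using d[THEN conjunct2, THEN conjunct2, THEN conjunct1] that unfolding s_def s'_def by blast
  qed
  have fin: "finite I" if "I \<subseteq> ?V" for I using finite_subset[OF that G.finite_verts] .
  have fstV: "fst ` I \<subseteq> verts Q" if "I \<subseteq> ?V" for I
    using that by (auto simp: blowup_quiver_def)
  define \<zeta> where "\<zeta> = (\<lambda>I :: ('v \<times> nat) set. Z (\<Sum>w\<in>I. Poly_Mapping.single (fst w) 1))"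
  have s_\<zeta>: "s I = slope_value (\<zeta> I)" if "I \<subseteq> ?V" for I
    by (simp add: s_def \<zeta>_def slope_eq_slope_value induced_stability_indicator[OF fin[OF that]])
  have \<zeta>: "\<zeta> I \<in> upper_half" if "I \<subseteq> ?V" "I \<noteq> {}" for I
    unfolding \<zeta>_def by (rule stability_function_finite_sum[OF Z fin[OF that(1)] that(2) fstV[OF that(1)]])
  have \<zeta>_dim: "\<zeta> I = Z (int_vec (?d I))" if "I \<subseteq> ?V" for I
    by (simp add: \<zeta>_def int_vec_dim_of[OF fin[OF that]])
  have "seesaw ?V (\<lambda>I. slope_value (\<zeta> I))"
  proof (rule seesaw_slope_value[OF _ \<zeta>])
    fix A B assume "A \<subseteq> ?V" "B \<subseteq> ?V" "A \<inter> B = {}"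
    then show "\<zeta> (A \<union> B) = \<zeta> A + \<zeta> B"
      unfolding \<zeta>_def using fin fstV[of "A \<union> B"] by (intro stability_function_Un[OF Z]) simp_all
  qed
  then have seesaw_s: "seesaw ?V s" by (simp add: seesaw_def s_\<zeta>)
  have seesaw_s': "seesaw ?V s'"
    unfolding s'_def slope_eq_slope_value
  proof (rule seesaw_slope_value)
    fix A B assume "A \<subseteq> ?V" "B \<subseteq> ?V" "A \<inter> B = {}"
    then show "Z\<^sub>d\<^sub>e\<^sub>f (indicator_vec (A \<union> B)) = Z\<^sub>d\<^sub>e\<^sub>f (indicator_vec A) + Z\<^sub>d\<^sub>e\<^sub>f (indicator_vec B)"
      unfolding indicator_vec_def
      by (intro stability_function_Un[OF def(1), where c = "\<lambda>w. w"]) (auto intro: fin)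
  next
    fix A assume "A \<subseteq> ?V" "A \<noteq> {}"
    then show "Z\<^sub>d\<^sub>e\<^sub>f (indicator_vec A) \<in> upper_half"
      unfolding indicator_vec_def
      by (intro stability_function_finite_sum[OF def(1), where c = "\<lambda>w. w"]) (auto intro: fin)
  qed
  interpret D: deformed_slopes ?G s s' "s ?V"
    by unfold_locales (use seesaw_s seesaw_s' def(2,3) in auto)
  have dV: "?d ?V = \<alpha>" by (rule dim_of_verts_blowup_quiver[OF Q \<alpha>(1)])
  have Vne: "?V \<noteq> {}" using dV \<alpha>(2) by (metis dim_of_empty)
  have dI: "?d I \<in> Gamma_plus Q - {0}" if "I \<subseteq> ?V" "I \<noteq> {}" for I
    using dim_of_Gamma_plus[OF Q \<alpha>(1) that(1)] dim_of_eq_0_iff[OF fin[OF that(1)]] that(2) by simp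
  \<comment> \<open>The whole vertex set has dimension vector \<open>\<alpha>\<close>, so its slope
    is that of \<open>l\<close>.\<close>
  have ray: "s I = s ?V \<longleftrightarrow> Z (int_vec (?d I)) \<in> l" if I: "I \<subseteq> ?V" "I \<noteq> {}" for I
    using ray_slope_value[OF l assms(6) \<zeta>[OF I]] \<zeta>_dim[of ?V] dV
    by (simp add: s_\<zeta> I \<zeta>_dim)
  have supp: "?d I \<in> ?S \<longleftrightarrow> s I = s ?V" if I: "I \<subseteq> ?V" "I \<noteq> {}" for I
    using dI[OF I] by (simp add: ray_support_def ray[OF I])
  have f: "f_inv Q Z (?d I) = scalar (G.weight ?h ?t I (G.semistable_supports s I))"
    if "I \<subseteq> ?V" for I
    by (rule semistable_weight_eq_f_inv[OF Q \<alpha>(1) that s_def])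
  \<comment> \<open>The hypothesis concerns pairs with both values of \<open>f\<close> nonzero,
    which the existence of semistable supports ensures.\<close>
  have commuting: "D.commuting"
    unfolding D.commuting_def
  proof (intro allI impI)
    fix I J assume I: "I \<subseteq> ?V" and J: "J \<subseteq> ?V" and ne: "I \<noteq> {}" "J \<noteq> {}"
      and m: "s I = s ?V" "s J = s ?V"
      and F: "G.semistable_supports s I \<noteq> {}" "G.semistable_supports s J \<noteq> {}"
    have "f_inv Q Z (?d I) \<noteq> 0" "f_inv Q Z (?d J) \<noteq> 0"
      unfolding f[OF I] f[OF J]
      using scalar_nonzero[OF one] weight_semistable_supports_nonzero[OF G.fin_digraph_axioms] F
        by blast+
    then have "skew_form Q (?d I) (?d J) = 0"
      using comm[OF dI[OF I ne(1)] dI[OF J ne(2)]] ray[OF I ne(1)] ray[OF J ne(2)] m by blast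
    then show "card (G.arcs_between I J) = card (G.arcs_between J I)"
      by (simp add: skew_form_def card_arcs_between_blowup_quiver[OF Q \<alpha>(1)] I J)
  qed
  have ht: "?h \<noteq> 0" "?t \<noteq> 0" "?h ^ 2 = 1 + ?t"
    using q_half_nonzero q_var_minus_one_nonzero by simp_all

  \<comment> \<open>The argument of the exponential that defines the invariants.\<close>
  define \<Gamma> where "\<Gamma> = (\<lambda>\<beta>. scalar (1 / (?h - 1 / ?h)) * exp_series_on ?S (g_inv Q Z l) \<beta>)"
  \<comment> \<open>The value 0 off the ray mirrors the absence of such terms in
    \<open>\<Gamma>\<close>.\<close>
  define w where "w = (\<lambda>I. if s I = s ?V then scalar (G.weight ?h ?t I (G.semistable_supports s' I)) else 0)"
  \<comment> \<open>The two set functions are compared through their partition sums on all nonempty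
    subsets: both give \<open>f\<close>, for \<open>\<Gamma>\<close> by the exponential formula and
    for \<open>w\<close> by the Harder--Narasimhan recursion.\<close>
  have "labelled fst \<Gamma> ?V = w ?V"
  proof (rule partition_sum_inj[OF G.finite_verts _ order.refl Vne])
    fix I assume I: "I \<subseteq> ?V" "I \<noteq> {}"
    have part: "finite P" "P \<noteq> {}" if "partition_on I P" for P
      using finite_elements[OF fin[OF I(1)] that] that I(2) by (auto simp: partition_on_def)
    have "(\<Sum>P | partition_on I P. \<Prod>J\<in>P. labelled fst \<Gamma> J) = labelled fst (series_exp \<Gamma>) I"
      by (rule labelled_series_exp[symmetric, OF _ fin[OF I(1)]])
        (simp add: \<Gamma>_def exp_series_on_def ray_support_def)
    also have "series_exp \<Gamma> = (\<lambda>\<beta>. series_one \<beta> + exp_series_on ?S (f_inv Q Z) \<beta>)"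
      using g_inv[OF Z l] unfolding abelian_quiver_invariants_def \<Gamma>_def by simp
    \<comment> \<open>The constant term is invisible as \<open>I\<close> is nonempty, and the
      factorial of the labelling cancels that of the series.\<close>
    also have "labelled fst \<dots> I = (if s I = s ?V then f_inv Q Z (?d I) else 0)"
      using dI[OF I] supp[OF I] fact_vec_nonzero[of "?d I"]
      by (simp add: labelled_def series_one_def exp_series_on_def scalar_mult_scalar tensor_one)
    also have "\<dots> = (\<Sum>P | partition_on I P. \<Prod>J\<in>P. w J)"
    proof (cases "s I = s ?V")
      case True
      have "f_inv Q Z (?d I) = scalar (\<Sum>P | partition_on I P \<and> (\<forall>J\<in>P. s J = s ?V).
          \<Prod>J\<in>P. G.weight ?h ?t J (G.semistable_supports s' J))"
        unfolding f[OF I(1)] D.weight_semistable_partitions[OF ht commuting I(1) True] ..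
      also have "\<dots> = (\<Sum>P | partition_on I P \<and> (\<forall>J\<in>P. s J = s ?V). \<Prod>J\<in>P. w J)"
        unfolding scalar_sum scalar_prod by (intro sum.cong prod.cong) (auto simp: w_def)
      also have "\<dots> = (\<Sum>P | partition_on I P. \<Prod>J\<in>P. w J)"
      proof (rule sum.mono_neutral_left)
        show "\<forall>P\<in>{P. partition_on I P} - {P. partition_on I P \<and> (\<forall>J\<in>P. s J = s ?V)}. (\<Prod>J\<in>P. w J) = 0"
        proof
          fix P assume P: "P \<in> {P. partition_on I P} - {P. partition_on I P \<and> (\<forall>J\<in>P. s J = s ?V)}"
          then obtain J where J: "J \<in> P" "w J = 0" by (auto simp: w_def)
          have "finite P" using part(1) P by simp
          from prod.remove[OF this J(1), of w] show "(\<Prod>J\<in>P. w J) = 0" using J(2) by simp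
        qed
      qed (auto simp: finitely_many_partition_on fin I)
      finally show ?thesis using True by simp
    next
      \<comment> \<open>Off the ray every partition of \<open>I\<close> contains a block on which
        \<open>w\<close> is zero.\<close>
      case False
      have "(\<Prod>J\<in>P. w J) = 0" if P: "partition_on I P" for P
      proof -
        have "\<not> (\<forall>J\<in>P. s J = s ?V)"
          using seesaw_partition[OF seesaw_s part[OF P], of "s ?V"] P I(1) False
          by (auto simp: partition_on_def)
        then obtain J where J: "J \<in> P" "w J = 0" by (auto simp: w_def)
        from prod.remove[OF part(1)[OF P] J(1), of w] show ?thesis using J(2) by simp
      qed
      then show ?thesis using False by simp
    qed
    finally show "(\<Sum>P | partition_on I P. \<Prod>J\<in>P. labelled fst \<Gamma> J) = (\<Sum>P | partition_on I P. \<Prod>J\<in>P. w J)" .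
  qed
  then have g: "scalar (1 / (?h - 1 / ?h)) * g_inv Q Z l \<alpha> = scalar (G.weight ?h ?t ?V (G.semistable_supports s' ?V))"
    using supp[OF order.refl Vne] fact_vec_nonzero[of \<alpha>]
    by (simp add: labelled_def dV \<Gamma>_def exp_series_on_def w_def scalar_mult_scalar mult.left_commute)
  have "g_inv Q Z l \<alpha> = scalar (?h - 1 / ?h) * (scalar (1 / (?h - 1 / ?h)) * g_inv Q Z l \<alpha>)"
    using q_half_diff_nonzero by (simp add: scalar_mult_scalar tensor_one)
  also have "\<dots> = scalar ((?h - 1 / ?h) * G.weight ?h ?t ?V (G.semistable_supports s' ?V))"
    by (simp only: g scalar_mult)
  also have "\<dots> = virtual_motive (moduli_space ?G Z\<^sub>d\<^sub>e\<^sub>f)"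
    unfolding G.moduli_space_eq s'_def[symmetric] G.weight_def G.arcs_between_verts
    by (rule G.virtual_motive_orbit_space[symmetric, OF G.upset_semistable_supports
      G.unsplittable_semistable_supports[OF seesaw_s' def(2)] Vne])
  finally show ?thesis .
qed

end
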